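(* Consider the regression model $Y_i=m(X_i)+\varepsilon_i$, $i=1,\dots,n$, with the kernel, bandwidth and smoothness conventions of the context. Suppose that $X_i=\sum_{k=0}^\infty a_k\zeta_{i-k}$ with $a_0=1$, $a_k=A_0k^{-(\alpha_X+1)/2}$ ($k\ge1$) for some constant $A_0$ and $\alpha_X\in(0,1)$, where $(\zeta_i)_{-\infty<i<\infty}$ are i.i.d. centered Gaussian and $\mathrm{Var}(X_1)=1$. Suppose that $\varepsilon_i=G(\eta_i,\eta_{i-1},\dots)$, where $(\eta_i)_{-\infty<i<\infty}$ is an i.i.d. sequence independent of $(X_i)_{i\ge1}$, $\mathrm{E}[\varepsilon_1]=0$, $\mathrm{E}[\varepsilon_1^2]=1$. Let $\mathcal H_i=\sigma(\eta_i,\eta_{i-1},\dots)$. Assume that $$\frac{\sqrt{nh}}{n}\sum_{i=1}^n\big(\mathrm{E}[\varepsilon_i|\mathcal H_{i-1}]-\varepsilon_i\big)=o_P(1),\qquad \frac{\sqrt{nh}\,h^2}{n}\sum_{i=1}^n\mathrm{E}[\varepsilon_i|\mathcal H_{i-1}]=o_P(1),\qquad hn^{1-\alpha_X}\to0.$$ Then, for each fixed $x$, as $n\to\infty$, $$\sqrt{\frac{nh}{\kappa_1}}\sqrt{\hat f_h(x)}\,\big(\widehat{m^*}(x)-m_n^*(x)\big)\stackrel{d}{\to}N(0,1).$$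
   Context: The sequences $(X_i)$ and $(\varepsilon_i)$ are independent of each other. The kernel $K$ is nonnegative and bounded with $\int K(u)\,du=1$, $\int uK(u)\,du=0$, $\kappa_2:=\int u^2K(u)\,du$ (finite), $\kappa_1:=\int K^2(u)\,du\neq0$. The bandwidth $h=h_n$ satisfies $h\to0$ and $nh\to\infty$. The density $f$ of $X_1$ and the function $m$ are twice differentiable with bounded derivatives, and $f(x)>0$ for each $x$ (here $f$ is the standard normal density). Density estimator: $\hat f_h(x)=\frac1{nh}\sum_{i=1}^nK\left(\frac{x-X_i}{h}\right)$. Nadaraya–Watson estimator: $\hat m_h(x)=\frac{1}{nh\,\hat f_h(x)}\sum_{i=1}^nY_iK\left(\frac{x-X_i}{h}\right)$. Shape function: $m^*=m-\int mf$, estimated by $\widehat{m^*}(x)=\hat m_h(x)-\frac1n\sum_{i=1}^nY_i$. Centering: $m_n(x)=\mathrm{E}[K((x-X_1)/h)\,m(X_1)]/\mathrm{E}[K((x-X_1)/h)]$ and $m_n^*(x)=m_n(x)-\int mf$. $\stackrel{d}{\to}$ denotes convergence in distribution. *)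

theory Defs
  imports "HOL-Probability.Probability"
begin

definition smoothing_kernel :: "(real \<Rightarrow> real) \<Rightarrow> bool" where
  "smoothing_kernel K \<longleftrightarrow>
     (\<forall>u. 0 \<le> K u) \<and> bounded (range K) \<and>
     integrable lborel K \<and> (LINT u|lborel. K u) = 1 \<and>
     integrable lborel (\<lambda>u. u * K u) \<and> (LINT u|lborel. u * K u) = 0 \<and>
     integrable lborel (\<lambda>u. u\<^sup>2 * K u) \<and>
     (LINT u|lborel. (K u)\<^sup>2) \<noteq> 0"

definition kappa1 :: "(real \<Rightarrow> real) \<Rightarrow> real" where
  "kappa1 K = (LINT u|lborel. (K u)\<^sup>2)"

definition bandwidth :: "(nat \<Rightarrow> real) \<Rightarrow> bool" where
  "bandwidth h \<longleftrightarrow>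
     (\<forall>n\<ge>1. 0 < h n) \<and> h \<longlonglongrightarrow> 0 \<and> filterlim (\<lambda>n. real n * h n) at_top sequentially"

text \<open>Only the two derivatives are required to be bounded, not the function itself.\<close>

definition twice_diff_bounded_derivs :: "(real \<Rightarrow> real) \<Rightarrow> bool" where
  "twice_diff_bounded_derivs g \<longleftrightarrow>
     (\<exists>g' g''. (\<forall>x. (g has_real_derivative g' x) (at x)) \<and>
               (\<forall>x. (g' has_real_derivative g'' x) (at x)) \<and>
               bounded (range g') \<and> bounded (range g''))"

text \<open>The estimators act on one realisation \<open>xs 1, xs 2, \<dots>\<close> of the predictors and
  \<open>ys 1, ys 2, \<dots>\<close> of the responses; \<open>b\<close> is the numerical value of the bandwidth.\<close>

definition density_est :: "(real \<Rightarrow> real) \<Rightarrow> real \<Rightarrow> nat \<Rightarrow> (nat \<Rightarrow> real) \<Rightarrow> real \<Rightarrow> real" where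
  "density_est K b n xs x = 1 / (real n * b) * (\<Sum>i=1..n. K ((x - xs i) / b))"

text \<open>Where the density estimate vanishes, this estimator takes the junk value 0.\<close>

definition nadaraya_watson ::
    "(real \<Rightarrow> real) \<Rightarrow> real \<Rightarrow> nat \<Rightarrow> (nat \<Rightarrow> real) \<Rightarrow> (nat \<Rightarrow> real) \<Rightarrow> real \<Rightarrow> real" where
  "nadaraya_watson K b n xs ys x =
     1 / (real n * b * density_est K b n xs x) * (\<Sum>i=1..n. ys i * K ((x - xs i) / b))"

definition shape_est ::
    "(real \<Rightarrow> real) \<Rightarrow> real \<Rightarrow> nat \<Rightarrow> (nat \<Rightarrow> real) \<Rightarrow> (nat \<Rightarrow> real) \<Rightarrow> real \<Rightarrow> real" where
  "shape_est K b n xs ys x = nadaraya_watson K b n xs ys x - 1 / real n * (\<Sum>i=1..n. ys i)"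

definition regression_centering ::
    "'a measure \<Rightarrow> (real \<Rightarrow> real) \<Rightarrow> real \<Rightarrow> (real \<Rightarrow> real) \<Rightarrow> ('a \<Rightarrow> real) \<Rightarrow> real \<Rightarrow> real" where
  "regression_centering M K b m X1 x =
     (LINT \<omega>|M. K ((x - X1 \<omega>) / b) * m (X1 \<omega>)) / (LINT \<omega>|M. K ((x - X1 \<omega>) / b))"

definition shape_centering ::
    "'a measure \<Rightarrow> (real \<Rightarrow> real) \<Rightarrow> real \<Rightarrow> (real \<Rightarrow> real) \<Rightarrow> (real \<Rightarrow> real) \<Rightarrow> ('a \<Rightarrow> real) \<Rightarrow> real \<Rightarrow> real"
  where
  "shape_centering M K b m f X1 x =
     regression_centering M K b m X1 x - (LINT u|lborel. m u * f u)"

definition gen_sigma :: "'a measure \<Rightarrow> ('i \<Rightarrow> 'a \<Rightarrow> real) \<Rightarrow> 'i set \<Rightarrow> 'a measure" where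
  "gen_sigma M U I =
     sigma (space M) (\<Union>i\<in>I. {U i -` B \<inter> space M | B. B \<in> sets borel})"

definition past_sigma :: "'a measure \<Rightarrow> (int \<Rightarrow> 'a \<Rightarrow> real) \<Rightarrow> int \<Rightarrow> 'a measure" where
  "past_sigma M \<eta> i = gen_sigma M \<eta> {..i}"

definition little_o_P_one :: "'a measure \<Rightarrow> (nat \<Rightarrow> 'a \<Rightarrow> real) \<Rightarrow> bool" where
  "little_o_P_one M Z \<longleftrightarrow>
     (\<forall>\<delta>>0. (\<lambda>n. measure M {\<omega> \<in> space M. \<delta> < \<bar>Z n \<omega>\<bar>}) \<longlonglongrightarrow> 0)"

definition conv_in_distr :: "'a measure \<Rightarrow> (nat \<Rightarrow> 'a \<Rightarrow> real) \<Rightarrow> real measure \<Rightarrow> bool" where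
  "conv_in_distr M Z \<mu> \<longleftrightarrow> weak_conv_m (\<lambda>n. distr M borel (Z n)) \<mu>"

text \<open>Independence of the two sequences as wholes. The library's \<open>indep_var\<close> would force both
  index types to coincide, hence the formulation by generated \<open>\<sigma>\<close>-algebras.\<close>

definition indep_sequences ::
    "'a measure \<Rightarrow> ('i \<Rightarrow> 'a \<Rightarrow> real) \<Rightarrow> 'i set \<Rightarrow> ('j \<Rightarrow> 'a \<Rightarrow> real) \<Rightarrow> 'j set \<Rightarrow> bool" where
  "indep_sequences M U I V J \<longleftrightarrow>
     prob_space.indep_set M (sets (gen_sigma M U I)) (sets (gen_sigma M V J))"

definition iid :: "'a measure \<Rightarrow> (int \<Rightarrow> 'a \<Rightarrow> real) \<Rightarrow> bool" where
  "iid M U \<longleftrightarrow>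
     prob_space.indep_vars M (\<lambda>_. borel) U UNIV \<and>
     (\<forall>i j. distr M borel (U i) = distr M borel (U j))"

end

theory Submission
  imports Defs
begin

text \<open>
Write \<open>K\<^sub>i = K ((x - X\<^sub>i) / h)\<close>. Because the mean response is subtracted, the errors enter the
statistic only through \<open>(nh)\<^sup>-\<^sup>1\<^sup>/\<^sup>2 \<Sum> (\<epsilon>\<^sub>i - \<epsilon>\<^sub>a\<^sub>v\<^sub>g) (K\<^sub>i - E K\<^sub>i)\<close> with \<open>\<epsilon>\<^sub>a\<^sub>v\<^sub>g\<close> the average error: the centering
of the kernel weights is exact.

The \<open>\<chi>\<^sup>2\<close>-distance of a bivariate normal law of correlation \<open>\<rho>\<close> from the product of its marginals is
\<open>\<rho>\<^sup>2 / (1 - \<rho>\<^sup>2)\<close>, so covariances of functions of the Gaussian predictors are at most a multiple of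
\<open>\<bar>\<rho>\<bar>\<close> times the variance. Hence the long memory contributes to second moments only through
\<open>h n\<^sup>1\<^sup>-\<^sup>\<alpha> \<longlonglongrightarrow> 0\<close>. Splitting \<open>X\<^sub>i\<close> into \<open>\<zeta>\<^sub>i\<close> and its one-step prediction, \<open>K\<^sub>i\<close> minus its conditional mean is a
martingale difference; for frozen bounded weights \<open>e\<^sub>i\<close> its compensated characteristic function gives the
normal limit with variance proportional to the average of \<open>e\<^sub>i\<^sup>2\<close>, uniformly in the weights. As the
errors are independent of the predictors, they may be frozen, and truncation together with the mean
ergodic theorem for functions of an i.i.d. sequence replaces that average by \<open>E \<epsilon>\<^sup>2 = 1\<close>, and shows
that the contribution of \<open>\<epsilon>\<^sub>a\<^sub>v\<^sub>g\<close> is negligible.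
\<close>

subsection \<open>Square integrability and convergence in probability\<close>

text \<open>The obstacle is the size of the kernel weights. A centred weight has variance of order
  h, and the lag correlations of the predictors sum to order n^(1-\<alpha>) over lags below n.
  Applied directly to the weights, the covariance inequality therefore bounds the second moment of
  the normalised sum only by a multiple of n^(1-\<alpha>). The split removes this: the predictable
  part is the kernel smoothed by the bounded density of one innovation, so it is uniformly of order
  h, its variance is of order h^2, and the bound improves to h n^(1-\<alpha>). The martingale part
  has orthogonal terms and carries no memory factor at all. The terms that involve \<open>m\<close>
  need no split, because the average of \<open>m (X i)\<close> gets a factor h from the
  normalisation and the local bias has a second moment of order h^3. Exactness of the centering
  comes from the deviations of the errors from their average summing to zero, so any constant may be
  subtracted from the weights; \<open>EK\<close> is the one that makes them centred. Freezing works
  because every constant and error rate is chosen before the weights, so it survives the final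
  integration over the errors.\<close>

lemma integrable_mult_square:
  fixes f g :: "'a \<Rightarrow> real"
  assumes "f \<in> borel_measurable M" "g \<in> borel_measurable M"
    and "integrable M (\<lambda>x. (f x)\<^sup>2)" "integrable M (\<lambda>x. (g x)\<^sup>2)"
  shows "integrable M (\<lambda>x. f x * g x)"
proof (rule Bochner_Integration.integrable_bound)
  show "integrable M (\<lambda>x. (f x)\<^sup>2 + (g x)\<^sup>2)" using assms by auto
  show "AE x in M. norm (f x * g x) \<le> norm ((f x)\<^sup>2 + (g x)\<^sup>2)"
  proof (rule AE_I2)
    fix x
    have "2 * (\<bar>f x\<bar> * \<bar>g x\<bar>) \<le> (f x)\<^sup>2 + (g x)\<^sup>2"
      using sum_squares_bound[of "\<bar>f x\<bar>" "\<bar>g x\<bar>"] by (simp add: mult.assoc)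
    moreover have "0 \<le> \<bar>f x\<bar> * \<bar>g x\<bar>" by simp
    ultimately have "\<bar>f x\<bar> * \<bar>g x\<bar> \<le> (f x)\<^sup>2 + (g x)\<^sup>2" by linarith
    then show "norm (f x * g x) \<le> norm ((f x)\<^sup>2 + (g x)\<^sup>2)"
      by (simp add: abs_mult)
  qed
qed (use assms in auto)

lemma integrable_add_square:
  fixes f g :: "'a \<Rightarrow> real"
  assumes "f \<in> borel_measurable M" "g \<in> borel_measurable M"
    and "integrable M (\<lambda>x. (f x)\<^sup>2)" "integrable M (\<lambda>x. (g x)\<^sup>2)"
  shows "integrable M (\<lambda>x. (f x + g x)\<^sup>2)"
proof -
  have "integrable M (\<lambda>x. (f x)\<^sup>2 + (g x)\<^sup>2 + 2 * (f x * g x))"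
    using assms integrable_mult_square[OF assms] by auto
  then show ?thesis by (simp add: power2_sum mult.assoc)
qed

lemma integrable_diff_square:
  fixes f g :: "'a \<Rightarrow> real"
  assumes "f \<in> borel_measurable M" "g \<in> borel_measurable M"
    and "integrable M (\<lambda>x. (f x)\<^sup>2)" "integrable M (\<lambda>x. (g x)\<^sup>2)"
  shows "integrable M (\<lambda>x. (f x - g x)\<^sup>2)"
  using integrable_add_square[of f M "\<lambda>x. - g x"] assms by simp

lemma integrable_sum_square:
  fixes f :: "'i \<Rightarrow> 'a \<Rightarrow> real"
  assumes "\<And>i. i \<in> I \<Longrightarrow> f i \<in> borel_measurable M"
    and "\<And>i. i \<in> I \<Longrightarrow> integrable M (\<lambda>x. (f i x)\<^sup>2)"
  shows "integrable M (\<lambda>x. (\<Sum>i\<in>I. f i x)\<^sup>2)"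
proof -
  have "integrable M (\<lambda>x. (\<Sum>i\<in>I. \<Sum>j\<in>I. f i x * f j x))"
    using assms by (intro Bochner_Integration.integrable_sum integrable_mult_square) auto
  then show ?thesis by (simp add: power2_eq_square sum_product)
qed

lemma integral_sum_square:
  fixes f :: "'i \<Rightarrow> 'a \<Rightarrow> real"
  assumes "\<And>i. i \<in> I \<Longrightarrow> f i \<in> borel_measurable M"
    and "\<And>i. i \<in> I \<Longrightarrow> integrable M (\<lambda>x. (f i x)\<^sup>2)"
  shows "(\<integral>x. (\<Sum>i\<in>I. f i x)\<^sup>2 \<partial>M) = (\<Sum>i\<in>I. \<Sum>j\<in>I. \<integral>x. f i x * f j x \<partial>M)"
proof -
  have i: "integrable M (\<lambda>x. f i x * f j x)" if "i \<in> I" "j \<in> I" for i j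
    using assms that by (intro integrable_mult_square) auto
  have "(\<integral>x. (\<Sum>i\<in>I. f i x)\<^sup>2 \<partial>M) = (\<integral>x. (\<Sum>i\<in>I. \<Sum>j\<in>I. f i x * f j x) \<partial>M)"
    by (simp add: power2_eq_square sum_product)
  also have "\<dots> = (\<Sum>i\<in>I. \<integral>x. (\<Sum>j\<in>I. f i x * f j x) \<partial>M)"
    using i by (intro Bochner_Integration.integral_sum) (auto intro!: Bochner_Integration.integrable_sum)
  also have "\<dots> = (\<Sum>i\<in>I. \<Sum>j\<in>I. \<integral>x. f i x * f j x \<partial>M)"
    using i by (intro sum.cong refl Bochner_Integration.integral_sum) auto
  finally show ?thesis .
qed

lemma integral_add_square_le:
  fixes f g :: "'a \<Rightarrow> real"
  assumes "f \<in> borel_measurable M" "g \<in> borel_measurable M"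
    and "integrable M (\<lambda>x. (f x)\<^sup>2)" "integrable M (\<lambda>x. (g x)\<^sup>2)"
  shows "(\<integral>x. (f x + g x)\<^sup>2 \<partial>M) \<le> 2 * (\<integral>x. (f x)\<^sup>2 \<partial>M) + 2 * (\<integral>x. (g x)\<^sup>2 \<partial>M)"
proof -
  have "(\<integral>x. (f x + g x)\<^sup>2 \<partial>M) \<le> (\<integral>x. 2 * (f x)\<^sup>2 + 2 * (g x)\<^sup>2 \<partial>M)"
    using assms integrable_add_square[OF assms]
    by (intro integral_mono) (auto simp: power2_sum intro: order_trans[OF sum_squares_bound])
  also have "\<dots> = 2 * (\<integral>x. (f x)\<^sup>2 \<partial>M) + 2 * (\<integral>x. (g x)\<^sup>2 \<partial>M)"
    using assms by (subst Bochner_Integration.integral_add) auto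
  finally show ?thesis .
qed

lemma Cauchy_Schwarz_integral:
  fixes f g :: "'a \<Rightarrow> real"
  assumes m: "f \<in> borel_measurable M" "g \<in> borel_measurable M"
    and f: "integrable M (\<lambda>x. (f x)\<^sup>2)" and g: "integrable M (\<lambda>x. (g x)\<^sup>2)"
  shows "(\<integral>x. f x * g x \<partial>M)\<^sup>2 \<le> (\<integral>x. (f x)\<^sup>2 \<partial>M) * (\<integral>x. (g x)\<^sup>2 \<partial>M)"
proof -
  let ?A = "\<integral>x. (f x)\<^sup>2 \<partial>M" and ?B = "\<integral>x. f x * g x \<partial>M" and ?C = "\<integral>x. (g x)\<^sup>2 \<partial>M"
  note fg = integrable_mult_square[OF m f g]
  have quad: "0 \<le> ?A + l * (2 * ?B) + l\<^sup>2 * ?C" for l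
  proof -
    have "0 \<le> (\<integral>x. (f x + l * g x)\<^sup>2 \<partial>M)" by simp
    also have "\<dots> = (\<integral>x. (f x)\<^sup>2 + (l * (2 * (f x * g x)) + l\<^sup>2 * (g x)\<^sup>2) \<partial>M)"
      by (intro Bochner_Integration.integral_cong) (auto simp: power2_sum power_mult_distrib)
    also have "\<dots> = ?A + l * (2 * ?B) + l\<^sup>2 * ?C"
      using f g fg by simp
    finally show ?thesis .
  qed
  show ?thesis
  proof (cases "?C = 0")
    case True
    have "?B = 0"
    proof (rule ccontr)
      assume "?B \<noteq> 0"
      \<comment> \<open>With \<open>?C = 0\<close> the quadratic is affine in \<open>l\<close>; at
        this value of \<open>l\<close> it equals -1.\<close>
      with True quad[of "- (?A + 1) / (2 * ?B)"] show False by simp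
    qed
    with True show ?thesis by simp
  next
    case False
    then have C: "?C > 0" by (simp add: order_less_le)
    have "0 \<le> ?A - ?B\<^sup>2 / ?C"
      using quad[of "- ?B / ?C"] C by (simp add: power2_eq_square field_simps)
    then show ?thesis using C by (simp add: field_simps)
  qed
qed

lemma (in prob_space) expectation_abs_le_sqrt:
  assumes "f \<in> borel_measurable M" "integrable M (\<lambda>x. (f x)\<^sup>2)"
  shows "integrable M f" "expectation (\<lambda>x. \<bar>f x\<bar>) \<le> sqrt (expectation (\<lambda>x. (f x :: real)\<^sup>2))"
proof -
  show "integrable M f" using integrable_mult_square[of f M "\<lambda>_. 1"] assms by simp
  have "(expectation (\<lambda>x. \<bar>f x\<bar>))\<^sup>2 \<le> expectation (\<lambda>x. (f x)\<^sup>2)"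
    using Cauchy_Schwarz_integral[of "\<lambda>x. \<bar>f x\<bar>" M "\<lambda>_. 1"] assms prob_space by simp
  then show "expectation (\<lambda>x. \<bar>f x\<bar>) \<le> sqrt (expectation (\<lambda>x. (f x)\<^sup>2))"
    by (intro real_le_rsqrt)
qed

section \<open>Calculus of convergence in probability\<close>

context prob_space
begin

text \<open>Chebyshev's inequality. Integrability is asked only eventually, since the second-moment
  bounds to which this is applied hold only from some index on.\<close>

lemma little_o_P_of_square:
  assumes Z: "\<And>n. Z n \<in> borel_measurable M"
    and b: "eventually (\<lambda>n. integrable M (\<lambda>\<omega>. (Z n \<omega>)\<^sup>2) \<and> expectation (\<lambda>\<omega>. (Z n \<omega>)\<^sup>2) \<le> b n) sequentially"
    and b0: "b \<longlonglongrightarrow> 0"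
  shows "little_o_P_one M Z"
  unfolding little_o_P_one_def
proof (intro allI impI)
  fix \<delta> :: real assume \<delta>: "0 < \<delta>"
  have "eventually (\<lambda>n. prob {\<omega> \<in> space M. \<delta> < \<bar>Z n \<omega>\<bar>} \<le> b n / \<delta>\<^sup>2) sequentially"
    using b
  proof eventually_elim
    case (elim n)
    have "prob {\<omega> \<in> space M. \<delta> < \<bar>Z n \<omega>\<bar>} \<le> prob {\<omega> \<in> space M. \<delta>\<^sup>2 \<le> (Z n \<omega>)\<^sup>2}"
    proof (rule finite_measure_mono)
      show "{\<omega> \<in> space M. \<delta> < \<bar>Z n \<omega>\<bar>} \<subseteq> {\<omega> \<in> space M. \<delta>\<^sup>2 \<le> (Z n \<omega>)\<^sup>2}"
        using \<delta> by (auto simp: abs_le_square_iff[symmetric])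
      show "{\<omega> \<in> space M. \<delta>\<^sup>2 \<le> (Z n \<omega>)\<^sup>2} \<in> events" using Z[of n] by measurable
    qed
    also have "\<dots> \<le> expectation (\<lambda>\<omega>. (Z n \<omega>)\<^sup>2) / \<delta>\<^sup>2"
      using elim \<delta> by (intro integral_Markov_inequality_measure[where A="{}"]) auto
    also have "\<dots> \<le> b n / \<delta>\<^sup>2" using elim by (intro divide_right_mono) auto
    finally show ?case .
  qed
  then have ev: "eventually (\<lambda>n. norm (prob {\<omega> \<in> space M. \<delta> < \<bar>Z n \<omega>\<bar>}) \<le> b n / \<delta>\<^sup>2) sequentially" by simp
  show "(\<lambda>n. prob {\<omega> \<in> space M. \<delta> < \<bar>Z n \<omega>\<bar>}) \<longlonglongrightarrow> 0"
    by (rule Lim_null_comparison[OF ev]) (rule tendsto_divide_zero[OF b0])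
qed

lemma little_o_P_add:
  assumes Z: "\<And>n. Z n \<in> borel_measurable M" and W: "\<And>n. W n \<in> borel_measurable M"
    and "little_o_P_one M Z" "little_o_P_one M W"
  shows "little_o_P_one M (\<lambda>n \<omega>. Z n \<omega> + W n \<omega>)"
  unfolding little_o_P_one_def
proof (intro allI impI)
  fix \<delta> :: real assume \<delta>: "0 < \<delta>"
  let ?P = "\<lambda>Z n. prob {\<omega> \<in> space M. \<delta> / 2 < \<bar>Z n \<omega>\<bar>}"
  have lim: "(\<lambda>n. ?P Z n + ?P W n) \<longlonglongrightarrow> 0"
    using assms(3,4)[unfolded little_o_P_one_def, rule_format, OF half_gt_zero[OF \<delta>]] by (rule tendsto_add_zero)
  have "prob {\<omega> \<in> space M. \<delta> < \<bar>Z n \<omega> + W n \<omega>\<bar>} \<le> ?P Z n + ?P W n" for n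
  proof -
    note [measurable] = Z[of n] W[of n]
    have "prob {\<omega> \<in> space M. \<delta> < \<bar>Z n \<omega> + W n \<omega>\<bar>}
      \<le> prob ({\<omega> \<in> space M. \<delta> / 2 < \<bar>Z n \<omega>\<bar>} \<union> {\<omega> \<in> space M. \<delta> / 2 < \<bar>W n \<omega>\<bar>})"
      by (intro finite_measure_mono) auto
    also have "\<dots> \<le> ?P Z n + ?P W n" by (intro measure_Un_le) measurable
    finally show ?thesis .
  qed
  then have "eventually (\<lambda>n. norm (prob {\<omega> \<in> space M. \<delta> < \<bar>Z n \<omega> + W n \<omega>\<bar>}) \<le> ?P Z n + ?P W n) sequentially" by simp
  then show "(\<lambda>n. prob {\<omega> \<in> space M. \<delta> < \<bar>Z n \<omega> + W n \<omega>\<bar>}) \<longlonglongrightarrow> 0"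
    using lim by (rule Lim_null_comparison)
qed

text \<open>Bounded second moments make \<open>W\<close> tight, and a product of a vanishing and a
  tight sequence vanishes in probability.\<close>

lemma little_o_P_mult_square_bounded:
  assumes Z: "\<And>n. Z n \<in> borel_measurable M" and W: "\<And>n. W n \<in> borel_measurable M"
    and Z0: "little_o_P_one M Z"
    and b: "eventually (\<lambda>n. integrable M (\<lambda>\<omega>. (W n \<omega>)\<^sup>2) \<and> expectation (\<lambda>\<omega>. (W n \<omega>)\<^sup>2) \<le> C) sequentially"
  shows "little_o_P_one M (\<lambda>n \<omega>. Z n \<omega> * W n \<omega>)"
  unfolding little_o_P_one_def
proof (intro allI impI)
  fix \<delta> :: real assume \<delta>: "0 < \<delta>"
  have *: "eventually (\<lambda>n. prob {\<omega> \<in> space M. \<delta> < \<bar>Z n \<omega> * W n \<omega>\<bar>} < \<eta>) sequentially"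
    if \<eta>: "0 < \<eta>" for \<eta>
  proof -
    \<comment> \<open>If \<open>Z\<close> is at most \<open>r\<close> in absolute value, a product
      above \<open>\<delta>\<close> forces \<open>W\<close> to be at least
      \<open>\<delta> / r\<close>. Markov's inequality bounds the probability of that by
      \<open>C * r\<^sup>2 / \<delta>\<^sup>2\<close>, and \<open>r\<close> is the radius that makes
      this at most \<open>\<eta> / 2\<close>. Adding 1 to the absolute value of \<open>C\<close>
      avoids division by zero.\<close>
    define r where "r = sqrt (\<delta>\<^sup>2 * \<eta> / (2 * (\<bar>C\<bar> + 1)))"
    have r: "0 < r" using \<delta> \<eta> by (simp add: r_def)
    have "r\<^sup>2 = \<delta>\<^sup>2 * \<eta> / (2 * (\<bar>C\<bar> + 1))" using \<eta> by (simp add: r_def)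
    then have "C * r\<^sup>2 / \<delta>\<^sup>2 = (C / (\<bar>C\<bar> + 1)) * (\<eta> / 2)" using \<delta> by (simp add: field_simps)
    also have "\<dots> \<le> 1 * (\<eta> / 2)" using \<eta> by (intro mult_right_mono) (auto simp: field_simps)
    finally have r2: "C * r\<^sup>2 / \<delta>\<^sup>2 \<le> \<eta> / 2" by simp
    have "eventually (\<lambda>n. prob {\<omega> \<in> space M. r < \<bar>Z n \<omega>\<bar>} < \<eta> / 2) sequentially"
      using Z0 r \<eta> unfolding little_o_P_one_def by (auto dest!: order_tendstoD(2)[where a="\<eta>/2"])
    with b show ?thesis
    proof eventually_elim
      case (elim n)
      note [measurable] = Z[of n] W[of n]
      have sub: "{\<omega> \<in> space M. \<delta> < \<bar>Z n \<omega> * W n \<omega>\<bar>} \<subseteq>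
        {\<omega> \<in> space M. r < \<bar>Z n \<omega>\<bar>} \<union> {\<omega> \<in> space M. (\<delta> / r)\<^sup>2 \<le> (W n \<omega>)\<^sup>2}"
      proof -
        have "(\<delta> / r)\<^sup>2 \<le> (W n \<omega>)\<^sup>2" if a: "\<delta> < \<bar>Z n \<omega> * W n \<omega>\<bar>" "\<not> r < \<bar>Z n \<omega>\<bar>" for \<omega>
        proof -
        have "\<delta> < \<bar>Z n \<omega>\<bar> * \<bar>W n \<omega>\<bar>" using a by (simp add: abs_mult)
        also have "\<dots> \<le> r * \<bar>W n \<omega>\<bar>" using a by (intro mult_right_mono) auto
        finally have "\<delta> / r \<le> \<bar>W n \<omega>\<bar>" using r by (simp add: field_simps)
        then show ?thesis using \<delta> r by (simp add: abs_le_square_iff[symmetric])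
        qed
        then show ?thesis by blast
      qed
      have "prob {\<omega> \<in> space M. \<delta> < \<bar>Z n \<omega> * W n \<omega>\<bar>}
        \<le> prob ({\<omega> \<in> space M. r < \<bar>Z n \<omega>\<bar>} \<union> {\<omega> \<in> space M. (\<delta> / r)\<^sup>2 \<le> (W n \<omega>)\<^sup>2})"
        by (intro finite_measure_mono sub) measurable
      also have "\<dots> \<le> prob {\<omega> \<in> space M. r < \<bar>Z n \<omega>\<bar>} + prob {\<omega> \<in> space M. (\<delta> / r)\<^sup>2 \<le> (W n \<omega>)\<^sup>2}"
        by (intro measure_Un_le) measurable
      also have "prob {\<omega> \<in> space M. (\<delta> / r)\<^sup>2 \<le> (W n \<omega>)\<^sup>2} \<le> expectation (\<lambda>\<omega>. (W n \<omega>)\<^sup>2) / (\<delta> / r)\<^sup>2"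
        using elim \<delta> r by (intro integral_Markov_inequality_measure[where A="{}"]) auto
      also have "\<dots> \<le> C / (\<delta> / r)\<^sup>2" using elim by (intro divide_right_mono) auto
      also have "\<dots> = C * r\<^sup>2 / \<delta>\<^sup>2" by (simp add: power_divide)
      finally show ?case using r2 elim by linarith
    qed
  qed
  show "(\<lambda>n. prob {\<omega> \<in> space M. \<delta> < \<bar>Z n \<omega> * W n \<omega>\<bar>}) \<longlonglongrightarrow> 0"
    unfolding tendsto_iff dist_real_def using * by simp
qed

lemma little_o_P_cmult:
  assumes "\<And>n. Z n \<in> borel_measurable M" "little_o_P_one M Z"
  shows "little_o_P_one M (\<lambda>n \<omega>. c * Z n \<omega>)"
  using little_o_P_mult_square_bounded[OF assms(1) _ assms(2), of "\<lambda>_ _. c" "c\<^sup>2"] prob_space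
  by (simp add: mult.commute)

text \<open>Continuity at the limit point turns a deviation of \<open>g\<close> into a deviation of
  its argument. The event for \<open>g\<close> may fail to be measurable; monotonicity of the
  measure asks measurability only of the larger event.\<close>

lemma little_o_P_continuous:
  assumes Z: "\<And>n. Z n \<in> borel_measurable M" and Z0: "little_o_P_one M (\<lambda>n \<omega>. Z n \<omega> - c)"
    and g: "isCont g c"
  shows "little_o_P_one M (\<lambda>n \<omega>. g (Z n \<omega>) - (g c :: real))"
  unfolding little_o_P_one_def
proof (intro allI impI)
  fix \<delta> :: real assume \<delta>: "0 < \<delta>"
  from g \<delta> obtain \<eta> where \<eta>: "0 < \<eta>" "\<And>z. \<bar>z - c\<bar> < \<eta> \<Longrightarrow> \<bar>g z - g c\<bar> < \<delta>"
    unfolding continuous_at_eps_delta dist_real_def by metis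
  have "prob {\<omega> \<in> space M. \<delta> < \<bar>g (Z n \<omega>) - g c\<bar>} \<le> prob {\<omega> \<in> space M. \<eta> / 2 < \<bar>Z n \<omega> - c\<bar>}" for n
  proof (rule finite_measure_mono)
    have "\<eta> / 2 < \<bar>Z n \<omega> - c\<bar>" if "\<delta> < \<bar>g (Z n \<omega>) - g c\<bar>" for \<omega>
    proof (rule ccontr)
      assume "\<not> \<eta> / 2 < \<bar>Z n \<omega> - c\<bar>"
      with \<eta>(1) have "\<bar>Z n \<omega> - c\<bar> < \<eta>" by linarith
      from \<eta>(2)[OF this] that show False by linarith
    qed
    then show "{\<omega> \<in> space M. \<delta> < \<bar>g (Z n \<omega>) - g c\<bar>} \<subseteq> {\<omega> \<in> space M. \<eta> / 2 < \<bar>Z n \<omega> - c\<bar>}" by auto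
    show "{\<omega> \<in> space M. \<eta> / 2 < \<bar>Z n \<omega> - c\<bar>} \<in> events" using Z[of n] by measurable
  qed
  then have ev: "eventually (\<lambda>n. norm (prob {\<omega> \<in> space M. \<delta> < \<bar>g (Z n \<omega>) - g c\<bar>}) \<le> prob {\<omega> \<in> space M. \<eta> / 2 < \<bar>Z n \<omega> - c\<bar>}) sequentially" by simp
  have "(\<lambda>n. prob {\<omega> \<in> space M. \<eta> / 2 < \<bar>Z n \<omega> - c\<bar>}) \<longlonglongrightarrow> 0"
    using Z0 half_gt_zero[OF \<eta>(1)] unfolding little_o_P_one_def by blast
  with ev show "(\<lambda>n. prob {\<omega> \<in> space M. \<delta> < \<bar>g (Z n \<omega>) - g c\<bar>}) \<longlonglongrightarrow> 0"
    by (rule Lim_null_comparison)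
qed

end

lemma norm_iexp_diff_le: "cmod (iexp x - iexp y) \<le> \<bar>x - y\<bar>"
proof -
  have "iexp x - iexp y = iexp y * (iexp (x - y) - 1)"
    by (simp add: right_diff_distrib mult_exp_exp flip: distrib_left)
  then have "cmod (iexp x - iexp y) = cmod (iexp (x - y) - 1)"
    by (simp add: norm_mult)
  then show ?thesis using iexp_approx1[of "x - y" 0] by simp
qed

context prob_space
begin

text \<open>Slutsky's theorem at the level of characteristic functions: the two exponentials differ
  by at most \<open>\<bar>t\<bar> * \<delta>\<close> where \<open>S\<close> and \<open>A\<close> are
  close, and by at most 2 on an event whose probability vanishes.\<close>

lemma char_tendsto_little_o_P:
  assumes S[measurable]: "\<And>n. S n \<in> borel_measurable M" and A[measurable]: "\<And>n. A n \<in> borel_measurable M"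
    and D: "little_o_P_one M (\<lambda>n \<omega>. S n \<omega> - A n \<omega>)"
    and lim: "(\<lambda>n. char (distr M borel (A n)) t) \<longlonglongrightarrow> \<phi>"
  shows "(\<lambda>n. char (distr M borel (S n)) t) \<longlonglongrightarrow> \<phi>"
proof -
  have int: "integrable M (\<lambda>\<omega>. iexp (t * f \<omega>))" if "f \<in> borel_measurable M" for f
    using that by (intro integrable_const_bound[where B=1]) auto
  have "(\<lambda>n. char (distr M borel (S n)) t - char (distr M borel (A n)) t) \<longlonglongrightarrow> 0"
    unfolding tendsto_iff dist_norm diff_zero
  proof (intro allI impI)
    fix \<eta> :: real assume \<eta>: "0 < \<eta>"
    \<comment> \<open>Half of \<open>\<eta>\<close> pays for the event of closeness and half for its
      complement; the summand 1 covers \<open>t = 0\<close>.\<close>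
    define \<delta> where "\<delta> = \<eta> / (2 * (\<bar>t\<bar> + 1))"
    have \<delta>: "0 < \<delta>" using \<eta> by (simp add: \<delta>_def)
    have "\<bar>t\<bar> * \<delta> = (\<bar>t\<bar> / (\<bar>t\<bar> + 1)) * (\<eta> / 2)" by (simp add: \<delta>_def)
    also have "\<dots> \<le> 1 * (\<eta> / 2)" using \<eta> by (intro mult_right_mono) auto
    finally have t\<delta>: "\<bar>t\<bar> * \<delta> \<le> \<eta> / 2" by simp
    have "eventually (\<lambda>n. prob {\<omega> \<in> space M. \<delta> < \<bar>S n \<omega> - A n \<omega>\<bar>} < \<eta> / 4) sequentially"
      using D \<delta> \<eta> unfolding little_o_P_one_def by (auto dest!: order_tendstoD(2)[where a="\<eta>/4"])
    then show "eventually (\<lambda>n. cmod (char (distr M borel (S n)) t - char (distr M borel (A n)) t) < \<eta>) sequentially"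
    proof eventually_elim
      case (elim n)
      let ?E = "{\<omega> \<in> space M. \<delta> < \<bar>S n \<omega> - A n \<omega>\<bar>}"
      have "char (distr M borel (S n)) t - char (distr M borel (A n)) t
        = (\<integral>\<omega>. iexp (t * S n \<omega>) - iexp (t * A n \<omega>) \<partial>M)"
        by (subst Bochner_Integration.integral_diff[OF int[OF S] int[OF A]]) (simp add: char_def integral_distr)
      also have "cmod \<dots> \<le> (\<integral>\<omega>. cmod (iexp (t * S n \<omega>) - iexp (t * A n \<omega>)) \<partial>M)"
        by (rule integral_norm_bound)
      also have "\<dots> \<le> (\<integral>\<omega>. \<bar>t\<bar> * \<delta> + 2 * indicator ?E \<omega> \<partial>M)"
      proof (rule integral_mono)
        show "integrable M (\<lambda>\<omega>. cmod (iexp (t * S n \<omega>) - iexp (t * A n \<omega>)))"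
          by (intro integrable_norm Bochner_Integration.integrable_diff int S A)
        show "integrable M (\<lambda>\<omega>. \<bar>t\<bar> * \<delta> + 2 * indicator ?E \<omega>)"
          by (intro integrable_const_bound[where B="\<bar>t\<bar> * \<delta> + 2"]) (auto simp: indicator_def \<delta> less_imp_le)
        fix \<omega> assume \<omega>: "\<omega> \<in> space M"
        show "cmod (iexp (t * S n \<omega>) - iexp (t * A n \<omega>)) \<le> \<bar>t\<bar> * \<delta> + 2 * indicator ?E \<omega>"
        proof (cases "\<omega> \<in> ?E")
          case True
          have "cmod (iexp (t * S n \<omega>) - iexp (t * A n \<omega>)) \<le> 1 + 1"
            by (rule order_trans[OF norm_triangle_ineq4]) simp
          with True \<delta> show ?thesis by (simp add: add_increasing)
        next
          case False
          have "cmod (iexp (t * S n \<omega>) - iexp (t * A n \<omega>)) \<le> \<bar>t * S n \<omega> - t * A n \<omega>\<bar>"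
            by (rule norm_iexp_diff_le)
          also have "\<dots> = \<bar>t\<bar> * \<bar>S n \<omega> - A n \<omega>\<bar>" by (simp add: right_diff_distrib[symmetric] abs_mult)
          also have "\<dots> \<le> \<bar>t\<bar> * \<delta>" using False \<omega> by (intro mult_left_mono) auto
          finally show ?thesis using False by simp
        qed
      qed
      also have "\<dots> = \<bar>t\<bar> * \<delta> + 2 * prob ?E"
        using prob_space by (subst Bochner_Integration.integral_add) (auto simp: emeasure_eq_measure)
      finally show ?case using elim t\<delta> by linarith
    qed
  qed
  from tendsto_add[OF this lim] show ?thesis by simp
qed

end

subsection \<open>Gaussian pairs\<close>

context prob_space
begin

lemma integrable_bounded_mult_iexp:
  assumes [measurable]: "w \<in> borel_measurable M" "U \<in> borel_measurable M"
    and "\<And>\<omega>. \<bar>w \<omega> :: real\<bar> \<le> B"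
  shows "integrable M (\<lambda>\<omega>. complex_of_real (w \<omega>) * iexp (U \<omega>))"
  using assms by (intro integrable_const_bound[where B=B]) (auto simp: norm_mult)

text \<open>Reweight the probability by \<open>w\<close> divided by its mean. The factorisation says
  that \<open>U\<close> keeps its characteristic function under the new probability, so by Levy
  uniqueness it keeps its law. A weight of mean zero vanishes almost surely and is treated
  apart.\<close>

lemma char_weighted_nonneg:
  assumes w[measurable]: "w \<in> borel_measurable M" and U[measurable]: "U \<in> borel_measurable M"
    and w_bd: "\<And>\<omega>. 0 \<le> w \<omega>" "\<And>\<omega>. w \<omega> \<le> (B::real)"
    and fac: "\<And>s. expectation (\<lambda>\<omega>. complex_of_real (w \<omega>) * iexp (s * U \<omega>))
      = complex_of_real (expectation w) * expectation (\<lambda>\<omega>. iexp (s * U \<omega>))"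
    and A[measurable]: "A \<in> sets borel"
  shows "expectation (\<lambda>\<omega>. w \<omega> * indicator A (U \<omega>)) = expectation w * prob (U -` A \<inter> space M)"
proof -
  have int: "integrable M w"
    using w_bd by (intro integrable_const_bound[where B=B]) auto
  show ?thesis
  proof (cases "expectation w = 0")
    case True
    then have "AE \<omega> in M. w \<omega> = 0"
      using integral_nonneg_eq_0_iff_AE[OF int] w_bd by simp
    then have "expectation (\<lambda>\<omega>. w \<omega> * indicator A (U \<omega>)) = expectation (\<lambda>_. 0)"
      by (intro integral_cong_AE) auto
    with True show ?thesis by simp
  next
    case False
    define c where "c = expectation w"
    have c: "0 < c" using False w_bd by (simp add: c_def order_less_le)
    define D where "D = density M (\<lambda>\<omega>. ennreal (w \<omega> / c))"
    have "emeasure D (space D) = 1"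
    proof -
      have "emeasure D (space D) = (\<integral>\<^sup>+\<omega>. ennreal (w \<omega> / c) \<partial>M)"
        by (simp add: D_def emeasure_density)
      also have "\<dots> = ennreal (\<integral>\<omega>. w \<omega> / c \<partial>M)"
        using int w_bd c by (intro nn_integral_eq_integral) auto
      also have "\<dots> = 1" using c by (simp add: c_def)
      finally show ?thesis .
    qed
    then interpret D: prob_space D by (rule prob_spaceI)
    have [measurable]: "U \<in> borel_measurable D" by (simp add: D_def)
    have rd: "real_distribution (distr D borel U)" by (rule D.real_distribution_distr) simp
    have "char (distr D borel U) = char (distr M borel U)"
    proof
      fix s
      have "char (distr D borel U) s = (\<integral>\<omega>. iexp (s * U \<omega>) \<partial>D)"
        by (simp add: char_def integral_distr)
      also have "\<dots> = (\<integral>\<omega>. (w \<omega> / c) *\<^sub>R iexp (s * U \<omega>) \<partial>M)"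
        unfolding D_def using w_bd c by (intro integral_density) auto
      also have "\<dots> = (\<integral>\<omega>. complex_of_real (w \<omega>) * iexp (s * U \<omega>) / c \<partial>M)"
        by (simp add: scaleR_conv_of_real)
      also have "\<dots> = expectation (\<lambda>\<omega>. iexp (s * U \<omega>))"
        using c fac[of s] by (simp add: c_def)
      also have "\<dots> = char (distr M borel U) s"
        by (simp add: char_def integral_distr)
      finally show "char (distr D borel U) s = char (distr M borel U) s" .
    qed
    then have eq: "distr D borel U = distr M borel U"
      by (intro Levy_uniqueness rd real_distribution_distr) simp_all
    have "prob (U -` A \<inter> space M) = measure (distr D borel U) A"
      by (simp add: eq measure_distr)
    also have "\<dots> = (\<integral>\<omega>. indicator A (U \<omega>) \<partial>D)"
      by (subst measure_distr) (auto simp: D_def[symmetric] simp flip: Bochner_Integration.integral_indicator intro!: Bochner_Integration.integral_cong simp: indicator_def)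
    also have "\<dots> = (\<integral>\<omega>. (w \<omega> / c) *\<^sub>R indicator A (U \<omega>) \<partial>M)"
      unfolding D_def using w_bd c by (intro integral_density) auto
    also have "\<dots> = expectation (\<lambda>\<omega>. w \<omega> * indicator A (U \<omega>)) / c" by simp
    finally show ?thesis using c by (simp add: c_def field_simps)
  qed
qed

text \<open>Adding \<open>B\<close> makes the weight nonnegative, and both the hypothesis and the
  conclusion are additive in the weight and hold for constants.\<close>

lemma char_weighted:
  assumes w[measurable]: "w \<in> borel_measurable M" and U[measurable]: "U \<in> borel_measurable M"
    and w_bd: "\<And>\<omega>. \<bar>w \<omega> :: real\<bar> \<le> B"
    and fac: "\<And>s. expectation (\<lambda>\<omega>. complex_of_real (w \<omega>) * iexp (s * U \<omega>))
      = complex_of_real (expectation w) * expectation (\<lambda>\<omega>. iexp (s * U \<omega>))"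
    and A[measurable]: "A \<in> sets borel"
  shows "expectation (\<lambda>\<omega>. w \<omega> * indicator A (U \<omega>)) = expectation w * prob (U -` A \<inter> space M)"
proof -
  have int: "integrable M w"
    using w_bd by (intro integrable_const_bound[where B=B]) auto
  have intA: "integrable M (\<lambda>\<omega>. indicator A (U \<omega>) :: real)"
    by (intro integrable_const_bound[where B=1]) (auto simp: indicator_def)
  have intwA: "integrable M (\<lambda>\<omega>. w \<omega> * indicator A (U \<omega>))"
    using w_bd by (intro integrable_const_bound[where B=B]) (auto simp: indicator_def intro: order_trans[OF abs_ge_zero])
  have PA: "expectation (\<lambda>\<omega>. indicator A (U \<omega>)) = prob (U -` A \<inter> space M)"
    by (auto simp flip: Bochner_Integration.integral_indicator intro!: Bochner_Integration.integral_cong simp: indicator_def)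
  have int_iexp: "integrable M (\<lambda>\<omega>. iexp (s * U \<omega>))" for s
    using integrable_bounded_mult_iexp[of "\<lambda>_. 1" "\<lambda>\<omega>. s * U \<omega>" 1] by simp
  have "expectation (\<lambda>\<omega>. (w \<omega> + B) * indicator A (U \<omega>)) = expectation (\<lambda>\<omega>. w \<omega> + B) * prob (U -` A \<inter> space M)"
  proof (rule char_weighted_nonneg[where B="2*B"])
    show "0 \<le> w \<omega> + B" "w \<omega> + B \<le> 2 * B" for \<omega> using w_bd[of \<omega>] by auto
    show "expectation (\<lambda>\<omega>. complex_of_real (w \<omega> + B) * iexp (s * U \<omega>))
      = complex_of_real (expectation (\<lambda>\<omega>. w \<omega> + B)) * expectation (\<lambda>\<omega>. iexp (s * U \<omega>))" for s
    proof -
      have "expectation (\<lambda>\<omega>. complex_of_real (w \<omega> + B) * iexp (s * U \<omega>))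
        = expectation (\<lambda>\<omega>. complex_of_real (w \<omega>) * iexp (s * U \<omega>) + complex_of_real B * iexp (s * U \<omega>))"
        by (simp only: of_real_add distrib_right)
      also have "\<dots> = expectation (\<lambda>\<omega>. complex_of_real (w \<omega>) * iexp (s * U \<omega>)) + complex_of_real B * expectation (\<lambda>\<omega>. iexp (s * U \<omega>))"
        by (subst Bochner_Integration.integral_add[OF integrable_bounded_mult_iexp[OF w _ w_bd]])
          (use integrable_bounded_mult_iexp[of "\<lambda>_. B" "\<lambda>\<omega>. s * U \<omega>" "\<bar>B\<bar>"] in auto)
      also have "\<dots> = complex_of_real (expectation (\<lambda>\<omega>. w \<omega> + B)) * expectation (\<lambda>\<omega>. iexp (s * U \<omega>))"
        using prob_space by (subst fac) (simp add: int distrib_right)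
      finally show ?thesis .
    qed
  qed auto
  moreover have "expectation (\<lambda>\<omega>. (w \<omega> + B) * indicator A (U \<omega>))
    = expectation (\<lambda>\<omega>. w \<omega> * indicator A (U \<omega>)) + B * prob (U -` A \<inter> space M)"
    using intA intwA by (simp add: distrib_right PA)
  ultimately show ?thesis using prob_space by (simp add: int distrib_right)
qed

text \<open>Two applications of the one-dimensional uniqueness theorem: first the law of \<open>U\<close> weighted by
  \<open>cos (t V)\<close> and \<open>sin (t V)\<close>, then the law of \<open>V\<close> on the event that \<open>U\<close> lies in a fixed set.\<close>

lemma indep_var_of_char:
  assumes U[measurable]: "U \<in> borel_measurable M" and V[measurable]: "V \<in> borel_measurable M"
    and fac: "\<And>s t. expectation (\<lambda>\<omega>. iexp (s * U \<omega> + t * V \<omega>))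
      = expectation (\<lambda>\<omega>. iexp (s * U \<omega>)) * expectation (\<lambda>\<omega>. iexp (t * V \<omega>))"
  shows "indep_var borel U borel V"
proof -
  have ie: "iexp x = complex_of_real (cos x) + \<i> * complex_of_real (sin x)" for x
    by (simp add: cis_conv_exp[symmetric] complex_eq_iff)
  have cos_ie: "complex_of_real (cos x) = 1 / 2 * iexp x + 1 / 2 * iexp (- x)"
    and sin_ie: "complex_of_real (sin x) = 1 / (2 * \<i>) * iexp x + - 1 / (2 * \<i>) * iexp (- x)" for x
    by (simp_all only: cos_of_real[symmetric] sin_of_real[symmetric] cos_exp_eq sin_exp_eq of_real_minus mult_minus_right)
      (simp_all add: field_simps)
  have split: "iexp (x + y) = iexp x * iexp y" for x y
    by (simp add: distrib_left exp_add)
  have int: "integrable M (\<lambda>\<omega>. iexp (f \<omega>))" if "f \<in> borel_measurable M" for f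
    using integrable_bounded_mult_iexp[of "\<lambda>_. 1" f 1] that by simp
  \<comment> \<open>Cosine and sine are both combinations of \<open>iexp x\<close> and
    \<open>iexp (- x)\<close>. With unspecified coefficients one computation serves both; it uses
    the joint characteristic function at (s, t) and at (s, -t).\<close>
  have cs: "expectation (\<lambda>\<omega>. complex_of_real (f (t * V \<omega>)) * iexp (s * U \<omega>))
      = complex_of_real (expectation (\<lambda>\<omega>. f (t * V \<omega>))) * expectation (\<lambda>\<omega>. iexp (s * U \<omega>))"
    if f: "\<And>x. complex_of_real (f x) = a * iexp x + b * iexp (- x)" for f a b s t
  proof -
    let ?E = "expectation (\<lambda>\<omega>. iexp (s * U \<omega>))"
    have "complex_of_real (f (t * V \<omega>)) * iexp (s * U \<omega>)
       = a * iexp (s * U \<omega> + t * V \<omega>) + b * iexp (s * U \<omega> + (- t) * V \<omega>)" for \<omega>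
      unfolding f split by (simp add: algebra_simps)
    moreover have i1: "integrable M (\<lambda>\<omega>. a * iexp (s * U \<omega> + t * V \<omega>))"
      and i2: "integrable M (\<lambda>\<omega>. b * iexp (s * U \<omega> + (- t) * V \<omega>))"
      by (intro integrable_mult_right int; measurable)+
    ultimately have "expectation (\<lambda>\<omega>. complex_of_real (f (t * V \<omega>)) * iexp (s * U \<omega>))
      = a * (?E * expectation (\<lambda>\<omega>. iexp (t * V \<omega>))) + b * (?E * expectation (\<lambda>\<omega>. iexp (- t * V \<omega>)))"
      unfolding fac[symmetric]
      by (simp only: Bochner_Integration.integral_add[OF i1 i2] integral_mult_right_zero)
    also have "\<dots> = ?E * expectation (\<lambda>\<omega>. a * iexp (t * V \<omega>) + b * iexp (- (t * V \<omega>)))"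
    proof -
      have "integrable M (\<lambda>\<omega>. a * iexp (t * V \<omega>))" "integrable M (\<lambda>\<omega>. b * iexp (- (t * V \<omega>)))"
        by (intro integrable_mult_right int; measurable)+
      then show ?thesis
        by (simp only: Bochner_Integration.integral_add integral_mult_right_zero mult_minus_left)
          (simp only: algebra_simps)
    qed
    also have "(\<lambda>\<omega>. a * iexp (t * V \<omega>) + b * iexp (- (t * V \<omega>))) = (\<lambda>\<omega>. complex_of_real (f (t * V \<omega>)))"
      by (simp add: f)
    finally show ?thesis by (simp add: mult.commute)
  qed
  have cos_cs: "expectation (\<lambda>\<omega>. cos (t * V \<omega>) * indicator A (U \<omega>)) = expectation (\<lambda>\<omega>. cos (t * V \<omega>)) * prob (U -` A \<inter> space M)"
    and sin_cs: "expectation (\<lambda>\<omega>. sin (t * V \<omega>) * indicator A (U \<omega>)) = expectation (\<lambda>\<omega>. sin (t * V \<omega>)) * prob (U -` A \<inter> space M)"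
    if A: "A \<in> sets borel" for A t
    by (rule char_weighted[where B=1, OF _ U _ cs[OF cos_ie] A], simp, simp)
      (rule char_weighted[where B=1, OF _ U _ cs[OF sin_ie] A], simp, simp)
  have key: "prob (U -` A \<inter> V -` B \<inter> space M) = prob (U -` A \<inter> space M) * prob (V -` B \<inter> space M)"
    if A[measurable]: "A \<in> sets borel" and B[measurable]: "B \<in> sets borel" for A B
  proof -
    have PA: "expectation (\<lambda>\<omega>. indicator A (U \<omega>)) = prob (U -` A \<inter> space M)"
      by (auto simp flip: Bochner_Integration.integral_indicator intro!: Bochner_Integration.integral_cong simp: indicator_def)
    have "expectation (\<lambda>\<omega>. indicator A (U \<omega>) * indicator B (V \<omega>)) =
      expectation (\<lambda>\<omega>. indicator A (U \<omega>)) * prob (V -` B \<inter> space M)"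
    proof (rule char_weighted[where B=1])
      fix t
      have i1: "integrable M (\<lambda>\<omega>. cos (t * V \<omega>) * indicator A (U \<omega>))" "integrable M (\<lambda>\<omega>. sin (t * V \<omega>) * indicator A (U \<omega>))"
        "integrable M (\<lambda>\<omega>. cos (t * V \<omega>))" "integrable M (\<lambda>\<omega>. sin (t * V \<omega>))"
        by (intro integrable_const_bound[where B=1]; auto simp: indicator_def abs_mult)+
      have "complex_of_real (indicator A (U \<omega>)) * iexp (t * V \<omega>)
        = complex_of_real (cos (t * V \<omega>) * indicator A (U \<omega>)) + \<i> * complex_of_real (sin (t * V \<omega>) * indicator A (U \<omega>))" for \<omega>
        unfolding ie by (simp add: algebra_simps)
      then have "expectation (\<lambda>\<omega>. complex_of_real (indicator A (U \<omega>)) * iexp (t * V \<omega>))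
        = expectation (\<lambda>\<omega>. complex_of_real (cos (t * V \<omega>) * indicator A (U \<omega>)) + \<i> * complex_of_real (sin (t * V \<omega>) * indicator A (U \<omega>)))"
        by (simp only:)
      also have "\<dots> = complex_of_real (expectation (\<lambda>\<omega>. cos (t * V \<omega>) * indicator A (U \<omega>)))
           + \<i> * complex_of_real (expectation (\<lambda>\<omega>. sin (t * V \<omega>) * indicator A (U \<omega>)))"
        using i1 by (subst Bochner_Integration.integral_add) (auto simp del: of_real_mult intro!: integrable_mult_right)
      also have "\<dots> = prob (U -` A \<inter> space M) * (complex_of_real (expectation (\<lambda>\<omega>. cos (t * V \<omega>)))
           + \<i> * complex_of_real (expectation (\<lambda>\<omega>. sin (t * V \<omega>))))"
        unfolding cos_cs[OF A] sin_cs[OF A] by (simp add: algebra_simps)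
      also have "complex_of_real (expectation (\<lambda>\<omega>. cos (t * V \<omega>))) + \<i> * complex_of_real (expectation (\<lambda>\<omega>. sin (t * V \<omega>)))
        = expectation (\<lambda>\<omega>. complex_of_real (cos (t * V \<omega>)) + \<i> * complex_of_real (sin (t * V \<omega>)))"
        using i1 by (subst Bochner_Integration.integral_add) (auto intro!: integrable_mult_right)
      finally show "expectation (\<lambda>\<omega>. complex_of_real (indicator A (U \<omega>)) * iexp (t * V \<omega>))
        = complex_of_real (expectation (\<lambda>\<omega>. indicator A (U \<omega>))) * expectation (\<lambda>\<omega>. iexp (t * V \<omega>))"
        unfolding ie PA .
    qed (auto simp: indicator_def)
    also have "expectation (\<lambda>\<omega>. indicator A (U \<omega>) * indicator B (V \<omega>)) = prob (U -` A \<inter> V -` B \<inter> space M)"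
      by (auto simp flip: Bochner_Integration.integral_indicator intro!: Bochner_Integration.integral_cong simp: indicator_def)
    finally show ?thesis by (simp add: PA)
  qed
  have "distr M borel U \<Otimes>\<^sub>M distr M borel V = distr M (borel \<Otimes>\<^sub>M borel) (\<lambda>x. (U x, V x))"
  proof (rule pair_measure_eqI)
    show "sigma_finite_measure (distr M borel U)" "sigma_finite_measure (distr M borel V)"
      by (intro prob_space_imp_sigma_finite prob_space_distr; simp)+
    show "emeasure (distr M borel U) A * emeasure (distr M borel V) B
      = emeasure (distr M (borel \<Otimes>\<^sub>M borel) (\<lambda>x. (U x, V x))) (A \<times> B)"
      if "A \<in> sets (distr M borel U)" "B \<in> sets (distr M borel V)" for A B
    proof -
      have [measurable]: "A \<in> sets borel" "B \<in> sets borel" using that by auto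
      have "(\<lambda>x. (U x, V x)) -` (A \<times> B) \<inter> space M = U -` A \<inter> V -` B \<inter> space M" by auto
      then show ?thesis
        by (simp add: emeasure_distr emeasure_eq_measure key ennreal_mult)
    qed
  qed simp
  then show ?thesis by (simp add: indep_var_distribution_eq)
qed

end

text \<open>Given that the first coordinate of a standard Gaussian pair equals \<open>x\<close>, the
  second has density \<open>normal_density (\<rho> * x) q\<close>. Its square over the marginal
  density is the integrand of the \<chi>-square distance. Completing the square in \<open>w\<close>
  exhibits a normal density, which integrates to 1 and leaves only the prefactor.\<close>

lemma normal_density_square_quotient:
  assumes \<rho>: "\<bar>\<rho>\<bar> < 1" and q: "q = sqrt (1 - \<rho>\<^sup>2)"
  shows "(normal_density (\<rho> * x) q w)\<^sup>2 / std_normal_density w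
    = exp (\<rho>\<^sup>2 * x\<^sup>2 / (1 + \<rho>\<^sup>2)) / (q * sqrt (1 + \<rho>\<^sup>2))
      * normal_density (2 * \<rho> * x / (1 + \<rho>\<^sup>2)) (q / sqrt (1 + \<rho>\<^sup>2)) w"
proof -
  have r2: "\<rho>\<^sup>2 < 1" using \<rho> by (simp add: abs_square_less_1)
  then have q0: "0 < q" and qq: "q\<^sup>2 = 1 - \<rho>\<^sup>2" by (simp_all add: q)
  define p where "p = sqrt (1 + \<rho>\<^sup>2)"
  have p0: "0 < p" and pp: "p\<^sup>2 = 1 + \<rho>\<^sup>2" by (simp_all add: p_def add_pos_nonneg)
  have P: "1 + \<rho>\<^sup>2 \<noteq> 0" and Q: "1 - \<rho>\<^sup>2 \<noteq> 0" using r2 p0 pp by auto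
  have ex: "- (w - \<rho> * x)\<^sup>2 / q\<^sup>2 + w\<^sup>2 / 2
     = \<rho>\<^sup>2 * x\<^sup>2 / (1 + \<rho>\<^sup>2) + - (w - 2 * \<rho> * x / (1 + \<rho>\<^sup>2))\<^sup>2 / (2 * (q / p)\<^sup>2)"
    using P Q unfolding power_divide qq pp
    by (simp add: divide_simps) algebra
  have "(normal_density (\<rho> * x) q w)\<^sup>2 / std_normal_density w
    = (sqrt (2 * pi) / (2 * pi * q\<^sup>2)) * exp (- (w - \<rho> * x)\<^sup>2 / q\<^sup>2 + w\<^sup>2 / 2)"
  proof -
    have e: "(exp (- (w - \<rho> * x)\<^sup>2 / (2 * q\<^sup>2)))\<^sup>2 / exp (- w\<^sup>2 / 2) = exp (- (w - \<rho> * x)\<^sup>2 / q\<^sup>2 + w\<^sup>2 / 2)"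
      by (simp only: exp_double[symmetric] exp_diff[symmetric]) simp
    have "(normal_density (\<rho> * x) q w)\<^sup>2 / std_normal_density w
      = (1 / sqrt (2 * pi * q\<^sup>2))\<^sup>2 / (1 / sqrt (2 * pi)) * ((exp (- (w - \<rho> * x)\<^sup>2 / (2 * q\<^sup>2)))\<^sup>2 / exp (- w\<^sup>2 / 2))"
      unfolding normal_density_def std_normal_density_def power_mult_distrib by simp
    also have "(1 / sqrt (2 * pi * q\<^sup>2))\<^sup>2 / (1 / sqrt (2 * pi)) = sqrt (2 * pi) / (2 * pi * q\<^sup>2)"
      using q0 by (simp add: power_divide)
    finally show ?thesis unfolding e .
  qed
  also have "sqrt (2 * pi) / (2 * pi * q\<^sup>2) = 1 / (q * p) * (1 / sqrt (2 * pi * (q / p)\<^sup>2))"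
  proof -
    have S: "sqrt (2 * pi * (q / p)\<^sup>2) = sqrt (2 * pi) * (q / p)" using q0 p0 by (simp add: real_sqrt_mult)
    have "2 * pi = sqrt (2 * pi) * sqrt (2 * pi)" "sqrt (2 * pi) > 0" by simp_all
    then obtain c where c: "sqrt (2 * pi) = c" "2 * pi = c * c" "c > 0" by blast
    show ?thesis
      unfolding S unfolding c(1) unfolding c(2) using q0 p0 c(3) by (simp add: power2_eq_square)
  qed
  finally show ?thesis
    unfolding ex exp_add normal_density_def p_def[symmetric] by (simp add: field_simps)
qed

text \<open>The outer integration for the \<chi>-square distance: the exponential prefactor left by
  the inner one only widens the Gaussian in \<open>x\<close>, to variance
  \<open>(1 + \<rho>\<^sup>2) / (1 - \<rho>\<^sup>2)\<close>.\<close>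

lemma std_normal_density_mult_exp:
  assumes \<rho>: "\<bar>\<rho>\<bar> < 1" and q: "q = sqrt (1 - \<rho>\<^sup>2)"
  shows "std_normal_density x * exp (\<rho>\<^sup>2 * x\<^sup>2 / (1 + \<rho>\<^sup>2))
    = sqrt (1 + \<rho>\<^sup>2) / q * normal_density 0 (sqrt (1 + \<rho>\<^sup>2) / q) x"
proof -
  have r2: "\<rho>\<^sup>2 < 1" using \<rho> by (simp add: abs_square_less_1)
  then have q0: "0 < q" and qq: "q\<^sup>2 = 1 - \<rho>\<^sup>2" by (simp_all add: q)
  define p where "p = sqrt (1 + \<rho>\<^sup>2)"
  have p0: "0 < p" and pp: "p\<^sup>2 = 1 + \<rho>\<^sup>2" by (simp_all add: p_def add_pos_nonneg)
  have P: "1 + \<rho>\<^sup>2 \<noteq> 0" and Q: "1 - \<rho>\<^sup>2 \<noteq> 0" using r2 p0 pp by auto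
  have ex: "- x\<^sup>2 / 2 + \<rho>\<^sup>2 * x\<^sup>2 / (1 + \<rho>\<^sup>2) = - (x - 0)\<^sup>2 / (2 * (p / q)\<^sup>2)"
    using P Q unfolding power_divide qq pp by (simp add: divide_simps) algebra
  have "sqrt (2 * pi * (p / q)\<^sup>2) = sqrt (2 * pi) * (p / q)" using q0 p0 by (simp add: real_sqrt_mult)
  then show ?thesis
    unfolding normal_density_def p_def[symmetric] ex[symmetric] exp_add using q0 p0 by simp
qed

lemma normal_affine:
  assumes q: "0 < q"
  shows "distr std_normal_distribution borel (\<lambda>z. \<mu> + q * z) = density lborel (normal_density \<mu> q)"
proof -
  interpret prob_space std_normal_distribution by (rule prob_space_normal_density) simp
  have "distributed std_normal_distribution lborel (\<lambda>z. z) std_normal_density"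
    by (simp add: distributed_def distr_id2)
  from normal_density_affine[OF this, of q \<mu>] q have "distributed std_normal_distribution lborel (\<lambda>z. \<mu> + q * z) (normal_density \<mu> q)"
    by simp
  then show ?thesis unfolding distributed_def by (simp cong: distr_cong)
qed

text \<open>With \<open>L\<close> the likelihood ratio of the pair against the product of its
  marginals, the expectation is the integral of g(x) g(w) (L - 1) under the product law.
  Cauchy-Schwarz then separates the second moment of \<open>g\<close> from the squared distance
  \<open>\<rho>\<^sup>2 / (1 - \<rho>\<^sup>2)\<close>.\<close>

lemma (in prob_space) gaussian_expectation_mult_std:
  assumes U[measurable]: "U \<in> borel_measurable M" and V[measurable]: "V \<in> borel_measurable M"
    and char: "\<And>s t. expectation (\<lambda>\<omega>. iexp (s * U \<omega> + t * V \<omega>)) = complex_of_real (exp (- (s\<^sup>2 + t\<^sup>2 + 2 * \<rho> * s * t) / 2))"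
    and \<rho>: "\<bar>\<rho>\<bar> < 1"
    and g[measurable]: "g \<in> borel_measurable borel"
    and g2: "integrable M (\<lambda>\<omega>. (g (U \<omega>))\<^sup>2)" and g0: "expectation (\<lambda>\<omega>. g (U \<omega>)) = 0"
  shows "(expectation (\<lambda>\<omega>. g (U \<omega>) * g (V \<omega>)))\<^sup>2 \<le> \<rho>\<^sup>2 / (1 - \<rho>\<^sup>2) * (expectation (\<lambda>\<omega>. (g (U \<omega>))\<^sup>2 :: real))\<^sup>2"
proof -
  let ?N = "std_normal_distribution"
  interpret N: real_distribution ?N by (rule real_dist_normal_dist)
  interpret NN: pair_prob_space ?N ?N ..
  define q where "q = sqrt (1 - \<rho>\<^sup>2)"
  have r2: "\<rho>\<^sup>2 < 1" using \<rho> by (simp add: abs_square_less_1)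
  then have q0: "0 < q" and qq: "q\<^sup>2 = 1 - \<rho>\<^sup>2" by (simp_all add: q_def)
  define p where "p = sqrt (1 + \<rho>\<^sup>2)"
  have p0: "0 < p" and pp: "p\<^sup>2 = 1 + \<rho>\<^sup>2" by (simp_all add: p_def add_pos_nonneg)
  \<comment> \<open>Gram-Schmidt: the normalised residual of \<open>V\<close> after regression on
    \<open>U\<close>. Its joint characteristic function with \<open>U\<close> factorises, so the two
    are independent standard normals.\<close>
  define Z where "Z = (\<lambda>\<omega>. (V \<omega> - \<rho> * U \<omega>) / q)"
  have Z[measurable]: "Z \<in> borel_measurable M" by (simp add: Z_def)
  have charUZ: "expectation (\<lambda>\<omega>. iexp (s * U \<omega> + t * Z \<omega>)) = complex_of_real (exp (- (s\<^sup>2 + t\<^sup>2) / 2))" for s t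
  proof -
    have "s * U \<omega> + t * Z \<omega> = (s - \<rho> * t / q) * U \<omega> + (t / q) * V \<omega>" for \<omega>
      using q0 by (simp add: Z_def field_simps)
    then have "expectation (\<lambda>\<omega>. iexp (s * U \<omega> + t * Z \<omega>))
      = complex_of_real (exp (- ((s - \<rho> * t / q)\<^sup>2 + (t / q)\<^sup>2 + 2 * \<rho> * (s - \<rho> * t / q) * (t / q)) / 2))"
      by (simp only: char)
    also have "(s - \<rho> * t / q)\<^sup>2 + (t / q)\<^sup>2 + 2 * \<rho> * (s - \<rho> * t / q) * (t / q) = s\<^sup>2 + (t\<^sup>2 / q\<^sup>2) * (1 - \<rho>\<^sup>2)"
      using q0 by (simp add: power2_eq_square field_simps)
    also have "(t\<^sup>2 / q\<^sup>2) * (1 - \<rho>\<^sup>2) = t\<^sup>2" using q0 by (simp add: qq[symmetric])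
    finally show ?thesis .
  qed
  have charU: "expectation (\<lambda>\<omega>. iexp (s * U \<omega>)) = complex_of_real (exp (- s\<^sup>2 / 2))" for s
    using charUZ[of s 0] by simp
  have charZ: "expectation (\<lambda>\<omega>. iexp (s * Z \<omega>)) = complex_of_real (exp (- s\<^sup>2 / 2))" for s
    using charUZ[of 0 s] by simp
  have dU: "distr M borel U = ?N"
    by (intro Levy_uniqueness real_distribution_distr U real_dist_normal_dist ext)
      (simp add: char_def[of "distr M borel U"] integral_distr charU[simplified] char_std_normal_distribution)
  have dZ: "distr M borel Z = ?N"
    by (intro Levy_uniqueness real_distribution_distr Z real_dist_normal_dist ext)
      (simp add: char_def[of "distr M borel Z"] integral_distr charZ[simplified] char_std_normal_distribution)
  have "indep_var borel U borel Z"
  proof (rule indep_var_of_char[OF U Z])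
    show "expectation (\<lambda>\<omega>. iexp (s * U \<omega> + t * Z \<omega>)) = expectation (\<lambda>\<omega>. iexp (s * U \<omega>)) * expectation (\<lambda>\<omega>. iexp (t * Z \<omega>))" for s t
      unfolding charUZ charU charZ by (simp add: exp_add[symmetric] add_divide_distrib flip: of_real_mult)
  qed
  then have dUZ: "distr M (borel \<Otimes>\<^sub>M borel) (\<lambda>x. (U x, Z x)) = ?N \<Otimes>\<^sub>M ?N"
    unfolding indep_var_distribution_eq dU dZ by simp
  have intg: "integrable ?N (\<lambda>x. (g x)\<^sup>2)" and Eg2: "(\<integral>x. (g x)\<^sup>2 \<partial>?N) = expectation (\<lambda>\<omega>. (g (U \<omega>))\<^sup>2)"
    using g2 unfolding dU[symmetric] by (simp_all add: integrable_distr_eq integral_distr)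
  have Eg: "(\<integral>x. g x \<partial>?N) = 0"
    using g0 unfolding dU[symmetric] by (simp add: integral_distr)
  have intg1: "integrable ?N g"
    by (rule N.expectation_abs_le_sqrt(1)) (use intg in auto)
  \<comment> \<open>Conditional density of \<open>V\<close> given \<open>U = x\<close> over the
    marginal density of \<open>V\<close>, that is, the joint density relative to the product
    law.\<close>
  define L where "L = (\<lambda>(x, w). normal_density (\<rho> * x) q w / std_normal_density w)"
  have [measurable]: "(\<lambda>x. normal_density (\<rho> * fst x) q (snd x)) \<in> borel_measurable (?N \<Otimes>\<^sub>M ?N)"
    unfolding normal_density_def by measurable
  have L[measurable]: "L \<in> borel_measurable (?N \<Otimes>\<^sub>M ?N)"
    unfolding L_def by (simp add: split_beta')
  have L0: "0 \<le> L z" for z by (simp add: L_def split_beta)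
  have [measurable]: "(\<lambda>w. L (x, w)) \<in> borel_measurable borel" for x
    unfolding L_def by simp
  have inner: "(\<integral>w. f w * L (x, w) \<partial>?N) = (\<integral>z. f (\<rho> * x + q * z) \<partial>?N)"
    if [measurable]: "f \<in> borel_measurable borel" for f :: "real \<Rightarrow> real" and x
  proof -
    have "(\<integral>z. f (\<rho> * x + q * z) \<partial>?N) = (\<integral>w. f w \<partial>distr ?N borel (\<lambda>z. \<rho> * x + q * z))"
      by (simp add: integral_distr)
    also have "\<dots> = (\<integral>w. normal_density (\<rho> * x) q w *\<^sub>R f w \<partial>lborel)"
      unfolding normal_affine[OF q0] by (intro integral_density) auto
    also have "\<dots> = (\<integral>w. std_normal_density w *\<^sub>R (f w * L (x, w)) \<partial>lborel)"
    proof (intro Bochner_Integration.integral_cong refl)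
      fix w
      show "normal_density (\<rho> * x) q w *\<^sub>R f w = std_normal_density w *\<^sub>R (f w * L (x, w))"
        using normal_density_pos[of 1 0 w] by (simp add: L_def)
    qed
    also have "\<dots> = (\<integral>w. f w * L (x, w) \<partial>?N)"
      by (intro integral_density[symmetric]) (auto simp: L_def)
    finally show ?thesis by simp
  qed
  have inner2: "integrable ?N (\<lambda>w. (L (x, w))\<^sup>2)" "(\<integral>w. (L (x, w))\<^sup>2 \<partial>?N) = exp (\<rho>\<^sup>2 * x\<^sup>2 / (1 + \<rho>\<^sup>2)) / (q * p)" for x
  proof -
    let ?c = "exp (\<rho>\<^sup>2 * x\<^sup>2 / (1 + \<rho>\<^sup>2)) / (q * p)"
    let ?n = "normal_density (2 * \<rho> * x / (1 + \<rho>\<^sup>2)) (q / p)"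
    have eq: "std_normal_density w *\<^sub>R (L (x, w))\<^sup>2 = ?c * ?n w" for w
      using normal_density_square_quotient[OF \<rho> q_def, of x w] normal_density_pos[of 1 0 w]
      by (simp add: L_def power_divide power2_eq_square p_def)
    have qp: "0 < q / p" using q0 p0 by simp
    note [simp] = integrable_normal_density[OF qp] integral_normal_density[OF qp]
    show "integrable ?N (\<lambda>w. (L (x, w))\<^sup>2)"
      by (subst integrable_density) (simp_all only: eq, auto)
    have "(\<integral>w. (L (x, w))\<^sup>2 \<partial>?N) = (\<integral>w. std_normal_density w *\<^sub>R (L (x, w))\<^sup>2 \<partial>lborel)"
      by (intro integral_density) (auto simp: L_def)
    also have "\<dots> = ?c" unfolding eq by simp
    finally show "(\<integral>w. (L (x, w))\<^sup>2 \<partial>?N) = ?c" .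
  qed
  have outer: "integrable ?N (\<lambda>x. exp (\<rho>\<^sup>2 * x\<^sup>2 / (1 + \<rho>\<^sup>2)) / (q * p))"
    "(\<integral>x. exp (\<rho>\<^sup>2 * x\<^sup>2 / (1 + \<rho>\<^sup>2)) / (q * p) \<partial>?N) = 1 / (1 - \<rho>\<^sup>2)"
  proof -
    let ?n = "normal_density 0 (p / q)"
    have eq: "std_normal_density x *\<^sub>R (exp (\<rho>\<^sup>2 * x\<^sup>2 / (1 + \<rho>\<^sup>2)) / (q * p)) = 1 / (1 - \<rho>\<^sup>2) * ?n x" for x
    proof -
      have "std_normal_density x *\<^sub>R (exp (\<rho>\<^sup>2 * x\<^sup>2 / (1 + \<rho>\<^sup>2)) / (q * p)) = (p / q * ?n x) / (q * p)"
        using std_normal_density_mult_exp[OF \<rho> q_def, of x] by (simp add: p_def)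
      also have "\<dots> = 1 / q\<^sup>2 * ?n x" using p0 by (simp add: power2_eq_square)
      finally show ?thesis by (simp add: qq)
    qed
    have pq: "0 < p / q" using q0 p0 by simp
    note [simp] = integrable_normal_density[OF pq] integral_normal_density[OF pq]
    show "integrable ?N (\<lambda>x. exp (\<rho>\<^sup>2 * x\<^sup>2 / (1 + \<rho>\<^sup>2)) / (q * p))"
      by (subst integrable_density) (simp_all only: eq, auto)
    have "(\<integral>x. exp (\<rho>\<^sup>2 * x\<^sup>2 / (1 + \<rho>\<^sup>2)) / (q * p) \<partial>?N) = (\<integral>x. std_normal_density x *\<^sub>R (exp (\<rho>\<^sup>2 * x\<^sup>2 / (1 + \<rho>\<^sup>2)) / (q * p)) \<partial>lborel)"
      by (intro integral_density) auto
    also have "\<dots> = 1 / (1 - \<rho>\<^sup>2)" unfolding eq by simp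
    finally show "(\<integral>x. exp (\<rho>\<^sup>2 * x\<^sup>2 / (1 + \<rho>\<^sup>2)) / (q * p) \<partial>?N) = 1 / (1 - \<rho>\<^sup>2)" .
  qed
  have intL2: "integrable (?N \<Otimes>\<^sub>M ?N) (\<lambda>z. (L z)\<^sup>2)"
  proof (rule NN.Fubini_integrable)
    show "integrable ?N (\<lambda>x. \<integral>w. norm ((L (x, w))\<^sup>2) \<partial>?N)" using outer(1) by (simp add: inner2)
  qed (use inner2 in auto)
  have L2: "(\<integral>z. (L z)\<^sup>2 \<partial>(?N \<Otimes>\<^sub>M ?N)) = 1 / (1 - \<rho>\<^sup>2)"
    by (simp only: NN.integral_fst'[OF intL2, symmetric] inner2 outer)
  have L1: "integrable (?N \<Otimes>\<^sub>M ?N) L" by (rule NN.expectation_abs_le_sqrt(1)[OF L intL2])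
  have EL: "(\<integral>z. L z \<partial>(?N \<Otimes>\<^sub>M ?N)) = 1"
    using NN.integral_fst'[OF L1] inner[of "\<lambda>_. 1"] N.prob_space by simp
  define gg where "gg = (\<lambda>(x, w). g x * g w)"
  have [measurable]: "gg \<in> borel_measurable (?N \<Otimes>\<^sub>M ?N)" unfolding gg_def by measurable
  have gg1: "integrable (?N \<Otimes>\<^sub>M ?N) (\<lambda>z. (gg z)\<^sup>2)" "(\<integral>z. (gg z)\<^sup>2 \<partial>(?N \<Otimes>\<^sub>M ?N)) = (\<integral>x. (g x)\<^sup>2 \<partial>?N)\<^sup>2"
  proof -
    have i: "integrable ?N (\<lambda>x. (gg (z, x))\<^sup>2)" for z
      using intg by (simp add: gg_def power_mult_distrib)
    show *: "integrable (?N \<Otimes>\<^sub>M ?N) (\<lambda>z. (gg z)\<^sup>2)"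
    proof (rule NN.Fubini_integrable)
      show "integrable ?N (\<lambda>x. \<integral>w. norm ((gg (x, w))\<^sup>2) \<partial>?N)" using intg by (simp add: gg_def power_mult_distrib)
    qed (use i in auto)
    show "(\<integral>z. (gg z)\<^sup>2 \<partial>(?N \<Otimes>\<^sub>M ?N)) = (\<integral>x. (g x)\<^sup>2 \<partial>?N)\<^sup>2"
      using NN.integral_fst'[OF *] intg by (simp add: gg_def power_mult_distrib power2_eq_square[of "\<integral>x. _ x \<partial>_"])
  qed
  have gg0: "integrable (?N \<Otimes>\<^sub>M ?N) gg" by (rule NN.expectation_abs_le_sqrt(1)[OF _ gg1(1)]) measurable
  have Egg: "(\<integral>z. gg z \<partial>(?N \<Otimes>\<^sub>M ?N)) = 0"
    using NN.integral_fst'[OF gg0] by (simp add: gg_def Eg)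
  have ggL: "integrable (?N \<Otimes>\<^sub>M ?N) (\<lambda>z. gg z * L z)"
    by (rule integrable_mult_square) (use gg1 intL2 in auto)
  have gV: "integrable M (\<lambda>\<omega>. g (U \<omega>) * g (V \<omega>))"
  proof -
    have Veq: "expectation (\<lambda>\<omega>. iexp (s * V \<omega>)) = complex_of_real (exp (- s\<^sup>2 / 2))" for s
      using char[of 0 s] by simp
    have dV: "distr M borel V = ?N"
      by (intro Levy_uniqueness real_distribution_distr V real_dist_normal_dist ext)
        (simp add: char_def[of "distr M borel V"] integral_distr Veq[simplified] char_std_normal_distribution)
    have "integrable M (\<lambda>\<omega>. (g (V \<omega>))\<^sup>2)"
      using intg unfolding dV[symmetric] by (simp add: integrable_distr_eq)
    then show ?thesis by (intro integrable_mult_square g2) auto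
  qed
  have VUZ: "V \<omega> = \<rho> * U \<omega> + q * Z \<omega>" for \<omega> using q0 by (simp add: Z_def)
  have int1: "integrable (?N \<Otimes>\<^sub>M ?N) (\<lambda>(x, z). g x * g (\<rho> * x + q * z))"
    using gV unfolding dUZ[symmetric] by (subst integrable_distr_eq) (auto simp: VUZ)
  have "expectation (\<lambda>\<omega>. g (U \<omega>) * g (V \<omega>)) = (\<integral>(x, z). g x * g (\<rho> * x + q * z) \<partial>(?N \<Otimes>\<^sub>M ?N))"
    unfolding dUZ[symmetric] by (subst integral_distr) (auto simp: VUZ)
  also have "\<dots> = (\<integral>x. (\<integral>z. g x * g (\<rho> * x + q * z) \<partial>?N) \<partial>?N)"
    using NN.integral_fst'[OF int1] by simp
  also have "\<dots> = (\<integral>x. (\<integral>w. gg (x, w) * L (x, w) \<partial>?N) \<partial>?N)"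
    by (simp add: gg_def mult.assoc inner[OF g])
  also have "\<dots> = (\<integral>z. gg z * L z \<partial>(?N \<Otimes>\<^sub>M ?N))"
    using NN.integral_fst'[OF ggL] by simp
  \<comment> \<open>Subtracting 1 from \<open>L\<close> is free because \<open>g\<close> is centred,
    so its product over independent coordinates integrates to zero.\<close>
  also have "\<dots> = (\<integral>z. gg z * (L z - 1) \<partial>(?N \<Otimes>\<^sub>M ?N))"
    using ggL gg0 by (simp add: right_diff_distrib Egg)
  finally have E: "expectation (\<lambda>\<omega>. g (U \<omega>) * g (V \<omega>)) = (\<integral>z. gg z * (L z - 1) \<partial>(?N \<Otimes>\<^sub>M ?N))" .
  have intLm: "integrable (?N \<Otimes>\<^sub>M ?N) (\<lambda>z. (L z - 1)\<^sup>2)"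
    by (intro integrable_diff_square intL2) auto
  have "(\<integral>z. (L z - 1)\<^sup>2 \<partial>(?N \<Otimes>\<^sub>M ?N)) = 1 / (1 - \<rho>\<^sup>2) - 1"
    using intL2 L1 NN.prob_space by (simp add: power2_diff L2 EL)
  also have "\<dots> = \<rho>\<^sup>2 / (1 - \<rho>\<^sup>2)" using r2 by (simp add: field_simps)
  finally have Lm: "(\<integral>z. (L z - 1)\<^sup>2 \<partial>(?N \<Otimes>\<^sub>M ?N)) = \<rho>\<^sup>2 / (1 - \<rho>\<^sup>2)" .
  have "(\<integral>z. gg z * (L z - 1) \<partial>(?N \<Otimes>\<^sub>M ?N))\<^sup>2 \<le> (\<integral>z. (gg z)\<^sup>2 \<partial>(?N \<Otimes>\<^sub>M ?N)) * (\<integral>z. (L z - 1)\<^sup>2 \<partial>(?N \<Otimes>\<^sub>M ?N))"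
    by (intro Cauchy_Schwarz_integral gg1 intLm) auto
  then show ?thesis unfolding E Lm gg1(2) Eg2 by (simp add: mult.commute)
qed

text \<open>With \<rho> = r / v there are three regimes. Below 1/2 in absolute value, \<rho>^2 / (1
  - \<rho>^2) is at most (2 \<rho>)^2. From 1/2 on, Cauchy-Schwarz alone suffices since 1 is at most
  twice the absolute value of \<rho>. For \<open>v = 0\<close> the quotient is 0, and the left side
  vanishes too because the law is a point mass at which \<open>g\<close> is zero. The degenerate
  case does occur: it is that of the one-step prediction when all past coefficients vanish.\<close>

lemma (in prob_space) gaussian_expectation_mult:
  assumes U[measurable]: "U \<in> borel_measurable M" and V[measurable]: "V \<in> borel_measurable M"
    and v: "0 \<le> v"
    and char: "\<And>s t. expectation (\<lambda>\<omega>. iexp (s * U \<omega> + t * V \<omega>)) = complex_of_real (exp (- (v * s\<^sup>2 + v * t\<^sup>2 + 2 * r * s * t) / 2))"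
    and g[measurable]: "g \<in> borel_measurable borel"
    and g2: "integrable M (\<lambda>\<omega>. (g (U \<omega>))\<^sup>2)" and g0: "expectation (\<lambda>\<omega>. g (U \<omega>)) = 0"
  shows "\<bar>expectation (\<lambda>\<omega>. g (U \<omega>) * g (V \<omega>))\<bar> \<le> 2 * (\<bar>r\<bar> / v) * expectation (\<lambda>\<omega>. (g (U \<omega>))\<^sup>2 :: real)"
proof -
  have dUV: "distr M borel V = distr M borel U"
  proof (intro Levy_uniqueness real_distribution_distr U V ext)
    fix t show "char (distr M borel V) t = char (distr M borel U) t"
      using char[of 0 t] char[of t 0] by (simp add: char_def integral_distr)
  qed
  have gV2: "integrable M (\<lambda>\<omega>. (g (V \<omega>))\<^sup>2)"
    and EV2: "expectation (\<lambda>\<omega>. (g (V \<omega>))\<^sup>2) = expectation (\<lambda>\<omega>. (g (U \<omega>))\<^sup>2)"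
  proof -
    have "integrable (distr M borel U) (\<lambda>x. (g x)\<^sup>2)" using g2 by (simp add: integrable_distr_eq)
    then show "integrable M (\<lambda>\<omega>. (g (V \<omega>))\<^sup>2)" unfolding dUV[symmetric] by (simp add: integrable_distr_eq)
    have "(\<integral>x. (g x)\<^sup>2 \<partial>distr M borel V) = (\<integral>x. (g x)\<^sup>2 \<partial>distr M borel U)" by (simp add: dUV)
    then show "expectation (\<lambda>\<omega>. (g (V \<omega>))\<^sup>2) = expectation (\<lambda>\<omega>. (g (U \<omega>))\<^sup>2)" by (simp add: integral_distr)
  qed
  show ?thesis
  proof (cases "v = 0")
    case True
    have "distr M borel U = distr M borel (\<lambda>_. 0)"
    proof (intro Levy_uniqueness real_distribution_distr U ext)
      fix t show "char (distr M borel U) t = char (distr M borel (\<lambda>_. 0)) t"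
        using char[of t 0] True prob_space by (simp add: char_def integral_distr del: distr_const)
    qed simp
    then have d: "(\<integral>x. f x \<partial>distr M borel U) = f 0" if "f \<in> borel_measurable borel" for f :: "real \<Rightarrow> real"
      using that prob_space by (simp add: integral_distr del: distr_const)
    have "g 0 = 0" using d[OF g] g0 by (simp add: integral_distr)
    then have "expectation (\<lambda>\<omega>. (g (U \<omega>))\<^sup>2) = 0"
      using d[of "\<lambda>x. (g x)\<^sup>2"] by (simp add: integral_distr)
    then have "AE \<omega> in M. (g (U \<omega>))\<^sup>2 = 0"
      using integral_nonneg_eq_0_iff_AE[OF g2] by simp
    then have "expectation (\<lambda>\<omega>. g (U \<omega>) * g (V \<omega>)) = expectation (\<lambda>_. 0)"
      by (intro integral_cong_AE) auto
    then show ?thesis by (simp add: True)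
  next
    case False
    with v have v0: "0 < v" by simp
    let ?E = "expectation (\<lambda>\<omega>. (g (U \<omega>))\<^sup>2)"
    define \<rho> where "\<rho> = r / v"
    show ?thesis
    proof (cases "\<bar>\<rho>\<bar> < 1 / 2")
      case True
      have "(expectation (\<lambda>\<omega>. g (sqrt v * (U \<omega> / sqrt v)) * g (sqrt v * (V \<omega> / sqrt v))))\<^sup>2
        \<le> \<rho>\<^sup>2 / (1 - \<rho>\<^sup>2) * (expectation (\<lambda>\<omega>. (g (sqrt v * (U \<omega> / sqrt v)))\<^sup>2))\<^sup>2"
      proof (rule gaussian_expectation_mult_std[where g="\<lambda>x. g (sqrt v * x)"])
        fix s t
        have "s * (U \<omega> / sqrt v) + t * (V \<omega> / sqrt v) = (s / sqrt v) * U \<omega> + (t / sqrt v) * V \<omega>" for \<omega> by simp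
        then have "expectation (\<lambda>\<omega>. iexp (s * (U \<omega> / sqrt v) + t * (V \<omega> / sqrt v)))
          = complex_of_real (exp (- (v * (s / sqrt v)\<^sup>2 + v * (t / sqrt v)\<^sup>2 + 2 * r * (s / sqrt v) * (t / sqrt v)) / 2))"
          by (simp only: char)
        also have "v * (s / sqrt v)\<^sup>2 + v * (t / sqrt v)\<^sup>2 + 2 * r * (s / sqrt v) * (t / sqrt v) = s\<^sup>2 + t\<^sup>2 + 2 * \<rho> * s * t"
          using v0 by (simp add: power_divide \<rho>_def)
        finally show "expectation (\<lambda>\<omega>. iexp (s * (U \<omega> / sqrt v) + t * (V \<omega> / sqrt v)))
          = complex_of_real (exp (- (s\<^sup>2 + t\<^sup>2 + 2 * \<rho> * s * t) / 2))" .
      qed (use True v0 g2 g0 in auto)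
      then have "(expectation (\<lambda>\<omega>. g (U \<omega>) * g (V \<omega>)))\<^sup>2 \<le> \<rho>\<^sup>2 / (1 - \<rho>\<^sup>2) * ?E\<^sup>2"
        using v0 by simp
      also have "\<rho>\<^sup>2 / (1 - \<rho>\<^sup>2) \<le> (2 * \<bar>\<rho>\<bar>)\<^sup>2"
      proof -
        have "\<rho>\<^sup>2 \<le> (1/2)\<^sup>2" using True by (subst abs_le_square_iff[symmetric]) simp
        then have "\<rho>\<^sup>2 \<le> 1 / 4" by (simp add: power2_eq_square)
        then have "\<rho>\<^sup>2 * 1 \<le> \<rho>\<^sup>2 * (4 * (1 - \<rho>\<^sup>2))" by (intro mult_left_mono) auto
        with \<open>\<rho>\<^sup>2 \<le> 1 / 4\<close> show ?thesis by (simp add: power_mult_distrib divide_le_eq algebra_simps)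
      qed
      finally have "(expectation (\<lambda>\<omega>. g (U \<omega>) * g (V \<omega>)))\<^sup>2 \<le> (2 * \<bar>\<rho>\<bar> * ?E)\<^sup>2"
        by (simp add: power_mult_distrib mult_right_mono)
      then have "\<bar>expectation (\<lambda>\<omega>. g (U \<omega>) * g (V \<omega>))\<bar> \<le> \<bar>2 * \<bar>\<rho>\<bar> * ?E\<bar>"
        by (subst abs_le_square_iff)
      then show ?thesis using v0 by (simp add: \<rho>_def abs_mult abs_divide)
    next
      case False
      have "(expectation (\<lambda>\<omega>. g (U \<omega>) * g (V \<omega>)))\<^sup>2 \<le> ?E * expectation (\<lambda>\<omega>. (g (V \<omega>))\<^sup>2)"
        by (intro Cauchy_Schwarz_integral g2 gV2) auto
      then have "(expectation (\<lambda>\<omega>. g (U \<omega>) * g (V \<omega>)))\<^sup>2 \<le> ?E\<^sup>2"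
        by (simp add: EV2 power2_eq_square[of "expectation _"])
      then have "\<bar>expectation (\<lambda>\<omega>. g (U \<omega>) * g (V \<omega>))\<bar> \<le> \<bar>?E\<bar>"
        by (subst abs_le_square_iff)
      also have "\<dots> = 1 * ?E" by simp
      also have "\<dots> \<le> 2 * \<bar>\<rho>\<bar> * ?E" using False by (intro mult_right_mono) auto
      finally show ?thesis using v0 by (simp add: \<rho>_def abs_divide)
    qed
  qed
qed

subsection \<open>Mean ergodic theorem for functions of an i.i.d. sequence\<close>

context prob_space
begin

text \<open>Mean ergodic convergence along \<open>T\<close>, as a property of the observable; it is stable under
  square-mean approximation, so it suffices to verify it on a generating family.\<close>

definition mean_ergodic :: "(nat \<Rightarrow> 'a \<Rightarrow> 's) \<Rightarrow> ('s \<Rightarrow> real) \<Rightarrow> bool" where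
  "mean_ergodic T F \<longleftrightarrow>
     (\<lambda>n. expectation (\<lambda>\<omega>. ((\<Sum>i=1..n. F (T i \<omega>)) / real n - expectation (\<lambda>\<omega>. F (T 0 \<omega>)))\<^sup>2)) \<longlonglongrightarrow> 0"

context
  fixes T :: "nat \<Rightarrow> 'a \<Rightarrow> 's" and S :: "'s measure"
  assumes T[measurable]: "\<And>i. T i \<in> measurable M S"
    and stat: "\<And>i. distr M S (T i) = distr M S (T 0)"
begin

lemma stationary_integrable:
  assumes [measurable]: "F \<in> borel_measurable S" and "integrable M (\<lambda>\<omega>. F (T 0 \<omega>) :: real)"
  shows "integrable M (\<lambda>\<omega>. F (T i \<omega>))"
proof -
  have "integrable (distr M S (T i)) F"
    unfolding stat[of i] using assms by (simp add: integrable_distr_eq)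
  then show ?thesis by (simp add: integrable_distr_eq)
qed

lemma stationary_expectation:
  assumes [measurable]: "F \<in> borel_measurable S"
  shows "expectation (\<lambda>\<omega>. F (T i \<omega>) :: real) = expectation (\<lambda>\<omega>. F (T 0 \<omega>))"
  using arg_cong[OF stat[of i], of "\<lambda>N. integral\<^sup>L N F"] by (simp add: integral_distr)

text \<open>Cauchy-Schwarz over the \<open>n\<close> summands together with stationarity. The factor
  4 comes from splitting the square of a difference at the cost of a factor 2 and bounding the
  squared mean by the second moment.\<close>

lemma time_average_square:
  assumes F[measurable]: "F \<in> borel_measurable S" and F2: "integrable M (\<lambda>\<omega>. (F (T 0 \<omega>))\<^sup>2 :: real)"
  shows "integrable M (\<lambda>\<omega>. ((\<Sum>i=1..n. F (T i \<omega>)) / real n - c)\<^sup>2)"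
    and "expectation (\<lambda>\<omega>. ((\<Sum>i=1..n. F (T i \<omega>)) / real n)\<^sup>2) \<le> expectation (\<lambda>\<omega>. (F (T 0 \<omega>))\<^sup>2)"
    and "expectation (\<lambda>\<omega>. ((\<Sum>i=1..n. F (T i \<omega>)) / real n - expectation (\<lambda>\<omega>. F (T 0 \<omega>)))\<^sup>2) \<le> 4 * expectation (\<lambda>\<omega>. (F (T 0 \<omega>))\<^sup>2)"
proof -
  have int: "integrable M (\<lambda>\<omega>. (F (T i \<omega>))\<^sup>2)" for i
    using stationary_integrable[of "\<lambda>x. (F x)\<^sup>2" i] F2 by simp
  have intS: "integrable M (\<lambda>\<omega>. ((\<Sum>i=1..n. F (T i \<omega>)) / real n)\<^sup>2)"
    using integrable_sum_square[of "{1..n}" "\<lambda>i \<omega>. F (T i \<omega>)" M] int by (simp add: power_divide)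
  then show intc: "integrable M (\<lambda>\<omega>. ((\<Sum>i=1..n. F (T i \<omega>)) / real n - c)\<^sup>2)" for c
    by (intro integrable_diff_square) auto
  show 2: "expectation (\<lambda>\<omega>. ((\<Sum>i=1..n. F (T i \<omega>)) / real n)\<^sup>2) \<le> expectation (\<lambda>\<omega>. (F (T 0 \<omega>))\<^sup>2)"
  proof (cases "n = 0")
    case False
    have "expectation (\<lambda>\<omega>. ((\<Sum>i=1..n. F (T i \<omega>)) / real n)\<^sup>2) \<le> expectation (\<lambda>\<omega>. (\<Sum>i=1..n. (F (T i \<omega>))\<^sup>2) / real n)"
    proof (rule integral_mono)
      fix \<omega>
      have "(\<Sum>i=1..n. F (T i \<omega>))\<^sup>2 \<le> (\<Sum>i=1..n. (F (T i \<omega>))\<^sup>2) * real n"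
        using Cauchy_Schwarz_ineq_sum[of "\<lambda>i. F (T i \<omega>)" "\<lambda>_. 1" "{1..n}"] by simp
      then show "((\<Sum>i=1..n. F (T i \<omega>)) / real n)\<^sup>2 \<le> (\<Sum>i=1..n. (F (T i \<omega>))\<^sup>2) / real n"
        using False by (simp add: power_divide field_simps power2_eq_square)
    qed (use intS int in auto)
    also have "\<dots> = (\<Sum>i=1..n. expectation (\<lambda>\<omega>. (F (T i \<omega>))\<^sup>2)) / real n"
      using int by simp
    also have "(\<Sum>i=1..n. expectation (\<lambda>\<omega>. (F (T i \<omega>))\<^sup>2)) = (\<Sum>i=1..n. expectation (\<lambda>\<omega>. (F (T 0 \<omega>))\<^sup>2))"
      by (intro sum.cong refl stationary_expectation[of "\<lambda>x. (F x)\<^sup>2"]) measurable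
    also have "\<dots> / real n = expectation (\<lambda>\<omega>. (F (T 0 \<omega>))\<^sup>2)" using False by simp
    finally show ?thesis .
  qed simp
  have "(expectation (\<lambda>\<omega>. F (T 0 \<omega>)))\<^sup>2 \<le> expectation (\<lambda>\<omega>. (F (T 0 \<omega>))\<^sup>2)"
    using Cauchy_Schwarz_integral[of "\<lambda>\<omega>. F (T 0 \<omega>)" M "\<lambda>_. 1"] F2 prob_space by simp
  moreover have "expectation (\<lambda>\<omega>. ((\<Sum>i=1..n. F (T i \<omega>)) / real n + - expectation (\<lambda>\<omega>. F (T 0 \<omega>)))\<^sup>2)
    \<le> 2 * expectation (\<lambda>\<omega>. ((\<Sum>i=1..n. F (T i \<omega>)) / real n)\<^sup>2) + 2 * expectation (\<lambda>\<omega>. (- expectation (\<lambda>\<omega>. F (T 0 \<omega>)))\<^sup>2)"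
    using intS by (intro integral_add_square_le) auto
  ultimately show "expectation (\<lambda>\<omega>. ((\<Sum>i=1..n. F (T i \<omega>)) / real n - expectation (\<lambda>\<omega>. F (T 0 \<omega>)))\<^sup>2) \<le> 4 * expectation (\<lambda>\<omega>. (F (T 0 \<omega>))\<^sup>2)"
    using 2 prob_space by simp
qed

text \<open>The time average of the approximation error has second moment at most four times that of
  the error itself, uniformly in the length of the average.\<close>

lemma mean_ergodic_approx:
  assumes F[measurable]: "F \<in> borel_measurable S" and F2: "integrable M (\<lambda>\<omega>. (F (T 0 \<omega>))\<^sup>2)"
    and approx: "\<And>e. 0 < e \<Longrightarrow> \<exists>F'. F' \<in> borel_measurable S \<and> integrable M (\<lambda>\<omega>. (F' (T 0 \<omega>))\<^sup>2) \<and>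
        mean_ergodic T F' \<and> expectation (\<lambda>\<omega>. (F (T 0 \<omega>) - F' (T 0 \<omega>))\<^sup>2) < e"
  shows "mean_ergodic T F"
  unfolding mean_ergodic_def tendsto_iff dist_real_def diff_zero
proof (intro allI impI)
  fix e :: real assume e: "0 < e"
  \<comment> \<open>The final bound is twice the deviation for \<open>F'\<close>, below
    \<open>e / 8\<close>, plus eight times the squared distance, below \<open>e / 16\<close>;
    together at most 3/4 of \<open>e\<close>.\<close>
  then obtain F' where F'[measurable]: "F' \<in> borel_measurable S" and F'2: "integrable M (\<lambda>\<omega>. (F' (T 0 \<omega>))\<^sup>2)"
    and me: "mean_ergodic T F'" and close: "expectation (\<lambda>\<omega>. (F (T 0 \<omega>) - F' (T 0 \<omega>))\<^sup>2) < e / 16"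
    using approx[of "e / 16"] by auto
  define D where "D = (\<lambda>x. F x - F' x)"
  have D[measurable]: "D \<in> borel_measurable S" by (simp add: D_def)
  have D2: "integrable M (\<lambda>\<omega>. (D (T 0 \<omega>))\<^sup>2)"
    unfolding D_def by (intro integrable_diff_square F2 F'2) auto
  let ?A = "\<lambda>F n \<omega>. (\<Sum>i=1..n. F (T i \<omega>)) / real n - expectation (\<lambda>\<omega>. F (T 0 \<omega>))"
  have i1: "integrable M (\<lambda>\<omega>. F (T 0 \<omega>))" "integrable M (\<lambda>\<omega>. F' (T 0 \<omega>))"
    using F2 F'2 by (auto intro!: expectation_abs_le_sqrt(1))
  have split: "?A F n \<omega> = ?A F' n \<omega> + ?A D n \<omega>" for n \<omega>
    unfolding D_def using i1 by (simp add: sum_subtractf diff_divide_distrib)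
  have "eventually (\<lambda>n. \<bar>expectation (\<lambda>\<omega>. (?A F' n \<omega>)\<^sup>2)\<bar> < e / 8) sequentially"
    using me e unfolding mean_ergodic_def tendsto_iff dist_real_def diff_zero by (auto elim!: allE[where x="e/8"])
  then show "eventually (\<lambda>n. \<bar>expectation (\<lambda>\<omega>. (?A F n \<omega>)\<^sup>2)\<bar> < e) sequentially"
  proof eventually_elim
    case (elim n)
    have "expectation (\<lambda>\<omega>. (?A F' n \<omega> + ?A D n \<omega>)\<^sup>2) \<le> 2 * expectation (\<lambda>\<omega>. (?A F' n \<omega>)\<^sup>2) + 2 * expectation (\<lambda>\<omega>. (?A D n \<omega>)\<^sup>2)"
      by (intro integral_add_square_le time_average_square(1)) (use F'2 D2 in measurable)
    also have "expectation (\<lambda>\<omega>. (?A D n \<omega>)\<^sup>2) \<le> 4 * expectation (\<lambda>\<omega>. (D (T 0 \<omega>))\<^sup>2)"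
      by (rule time_average_square(3)[OF D D2])
    finally have "expectation (\<lambda>\<omega>. (?A F n \<omega>)\<^sup>2) \<le> 2 * expectation (\<lambda>\<omega>. (?A F' n \<omega>)\<^sup>2) + 8 * expectation (\<lambda>\<omega>. (D (T 0 \<omega>))\<^sup>2)"
      unfolding split by simp
    also have "\<dots> < e" using elim close unfolding D_def by linarith
    finally show ?case by simp
  qed
qed

lemma mean_ergodic_lincomb:
  assumes F[measurable]: "F \<in> borel_measurable S" and F2: "integrable M (\<lambda>\<omega>. (F (T 0 \<omega>))\<^sup>2)" and mF: "mean_ergodic T F"
    and G[measurable]: "G \<in> borel_measurable S" and G2: "integrable M (\<lambda>\<omega>. (G (T 0 \<omega>))\<^sup>2)" and mG: "mean_ergodic T G"
  shows "mean_ergodic T (\<lambda>x. a * F x + b * G x)"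
proof -
  let ?A = "\<lambda>F n \<omega>. (\<Sum>i=1..n. F (T i \<omega>)) / real n - expectation (\<lambda>\<omega>. F (T 0 \<omega>))"
  have i1: "integrable M (\<lambda>\<omega>. F (T 0 \<omega>))" "integrable M (\<lambda>\<omega>. G (T 0 \<omega>))"
    using F2 G2 by (auto intro!: expectation_abs_le_sqrt(1))
  have split: "?A (\<lambda>x. a * F x + b * G x) n \<omega> = a * ?A F n \<omega> + b * ?A G n \<omega>" for n \<omega>
    using i1 by (simp add: sum.distrib add_divide_distrib algebra_simps flip: sum_distrib_left)
  have "expectation (\<lambda>\<omega>. (a * ?A F n \<omega> + b * ?A G n \<omega>)\<^sup>2)
    \<le> 2 * expectation (\<lambda>\<omega>. (a * ?A F n \<omega>)\<^sup>2) + 2 * expectation (\<lambda>\<omega>. (b * ?A G n \<omega>)\<^sup>2)" for n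
    unfolding power_mult_distrib
    using time_average_square(1)[OF F F2] time_average_square(1)[OF G G2]
    by (subst power_mult_distrib[symmetric])+ (intro integral_add_square_le; simp add: power_mult_distrib)
  then have le: "norm (expectation (\<lambda>\<omega>. (?A (\<lambda>x. a * F x + b * G x) n \<omega>)\<^sup>2))
    \<le> 2 * (a\<^sup>2 * expectation (\<lambda>\<omega>. (?A F n \<omega>)\<^sup>2)) + 2 * (b\<^sup>2 * expectation (\<lambda>\<omega>. (?A G n \<omega>)\<^sup>2))" for n
    unfolding split by (simp add: power_mult_distrib)
  have "(\<lambda>n. 2 * (a\<^sup>2 * expectation (\<lambda>\<omega>. (?A F n \<omega>)\<^sup>2)) + 2 * (b\<^sup>2 * expectation (\<lambda>\<omega>. (?A G n \<omega>)\<^sup>2))) \<longlonglongrightarrow> 2 * (a\<^sup>2 * 0) + 2 * (b\<^sup>2 * 0)"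
    using mF mG unfolding mean_ergodic_def by (intro tendsto_intros)
  then have lim: "(\<lambda>n. 2 * (a\<^sup>2 * expectation (\<lambda>\<omega>. (?A F n \<omega>)\<^sup>2)) + 2 * (b\<^sup>2 * expectation (\<lambda>\<omega>. (?A G n \<omega>)\<^sup>2))) \<longlonglongrightarrow> 0" by simp
  show ?thesis unfolding mean_ergodic_def
    by (rule Lim_null_comparison[OF _ lim]) (rule always_eventually, rule allI, rule le)
qed

lemma mean_ergodic_const: "mean_ergodic T (\<lambda>_. c)"
proof -
  have "eventually (\<lambda>n. expectation (\<lambda>\<omega>. ((\<Sum>i=1..n. c) / real n - expectation (\<lambda>\<omega>. c))\<^sup>2) = 0) sequentially"
    using eventually_gt_at_top[of 0] by eventually_elim (simp add: prob_space)
  then show ?thesis unfolding mean_ergodic_def by (rule tendsto_eventually)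
qed

lemma integrable_indicator_square:
  assumes [measurable]: "A \<in> sets S"
  shows "integrable M (\<lambda>\<omega>. (indicator A (T 0 \<omega>) :: real)\<^sup>2)"
  by (intro integrable_const_bound[where B=1]) (auto simp: indicator_def)

text \<open>Dynkin's argument. Complements and finite disjoint unions are linear combinations of
  indicators; a countable disjoint union is the limit of its finite parts in mean square by
  dominated convergence.\<close>

lemma mean_ergodic_sets:
  assumes G: "Int_stable G" "G \<subseteq> Pow (space S)" "sets S = sigma_sets (space S) G"
    and basic: "\<And>A. A \<in> G \<Longrightarrow> mean_ergodic T (indicator A)"
    and A: "A \<in> sets S"
  shows "mean_ergodic T (indicator A)"
  using A unfolding G(3)
proof (induction rule: sigma_sets_induct_disjoint[OF G(1,2), consumes 1, case_names basic empty compl union])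
  case (basic A) then show ?case by (rule assms(4))
next
  case empty
  have "(indicator {} :: 's \<Rightarrow> real) = (\<lambda>_. 0)" by auto
  then show ?case using mean_ergodic_const[of 0] by (simp only:)
next
  case (compl A)
  then have A[measurable]: "A \<in> sets S" by (simp add: G(3))
  have "mean_ergodic T (\<lambda>x. 1 * (\<lambda>_. 1) x + (-1) * indicator A x)"
    by (intro mean_ergodic_lincomb mean_ergodic_const compl.IH integrable_indicator_square) auto
  moreover have "1 * (\<lambda>_. 1) (T i \<omega>) + (-1) * indicator A (T i \<omega>) = (indicator (space S - A) (T i \<omega>) :: real)"
    if "\<omega> \<in> space M" for i \<omega>
    using measurable_space[OF T that, of i] by (auto simp: indicator_def)
  ultimately show ?case unfolding mean_ergodic_def
    by (simp cong: Bochner_Integration.integral_cong)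
next
  case (union A)
  then have A[measurable]: "A i \<in> sets S" for i by (auto simp: G(3))
  have fin: "mean_ergodic T (indicator (\<Union>i<m. A i))" for m
  proof (induction m)
    case 0
    have "(indicator (\<Union>i<(0::nat). A i) :: 's \<Rightarrow> real) = (\<lambda>_. 0)" by auto
    then show ?case using mean_ergodic_const[of 0] by (simp only:)
  next
    case (Suc m)
    have "A m \<inter> A i = {}" if "i < m" for i
      using union.hyps(1) that by (auto simp: disjoint_family_on_def)
    then have "A m \<inter> (\<Union>i<m. A i) = {}" by blast
    then have "(indicator (\<Union>i<Suc m. A i) :: 's \<Rightarrow> real) = (\<lambda>x. 1 * indicator (A m) x + 1 * indicator (\<Union>i<m. A i) x)"
      by (auto simp: lessThan_Suc indicator_def fun_eq_iff)
    then show ?case using mean_ergodic_lincomb[OF _ _ union.IH[of m] _ _ Suc, of 1 1] integrable_indicator_square by simp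
  qed
  show ?case
  proof (rule mean_ergodic_approx)
    show "indicator (\<Union> (range A)) \<in> borel_measurable S" "integrable M (\<lambda>\<omega>. (indicator (\<Union> (range A)) (T 0 \<omega>))\<^sup>2 :: real)"
      by (auto intro!: integrable_indicator_square)
    fix e :: real assume e: "0 < e"
    have "(\<lambda>m. expectation (\<lambda>\<omega>. (indicator (\<Union> (range A)) (T 0 \<omega>) - indicator (\<Union>i<m. A i) (T 0 \<omega>))\<^sup>2 :: real)) \<longlonglongrightarrow> expectation (\<lambda>_. 0)"
    proof (rule integral_dominated_convergence[where w="\<lambda>_. 1"])
      show "AE \<omega> in M. (\<lambda>m. (indicator (\<Union> (range A)) (T 0 \<omega>) - indicator (\<Union>i<m. A i) (T 0 \<omega>))\<^sup>2 :: real) \<longlonglongrightarrow> 0"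
      proof (rule AE_I2, rule tendsto_eventually)
        fix \<omega>
        show "eventually (\<lambda>m. (indicator (\<Union> (range A)) (T 0 \<omega>) - indicator (\<Union>i<m. A i) (T 0 \<omega>))\<^sup>2 = (0::real)) sequentially"
        proof (cases "T 0 \<omega> \<in> \<Union> (range A)")
          case True
          then obtain k where k: "T 0 \<omega> \<in> A k" by auto
          show ?thesis using eventually_gt_at_top[of k]
          proof eventually_elim
            case (elim m)
            with k have "T 0 \<omega> \<in> (\<Union>i<m. A i)" by auto
            with True show ?case by simp
          qed
        next
          case False
          then show ?thesis by (simp add: indicator_def)
        qed
      qed
    qed (auto simp: indicator_def)
    then have "eventually (\<lambda>m. expectation (\<lambda>\<omega>. (indicator (\<Union> (range A)) (T 0 \<omega>) - indicator (\<Union>i<m. A i) (T 0 \<omega>))\<^sup>2 :: real) < e) sequentially"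
      using e by (intro order_tendstoD(2)[where a=e]) auto
    then obtain m where "expectation (\<lambda>\<omega>. (indicator (\<Union> (range A)) (T 0 \<omega>) - indicator (\<Union>i<m. A i) (T 0 \<omega>))\<^sup>2 :: real) < e"
      by (auto simp: eventually_sequentially)
    then show "\<exists>F'. F' \<in> borel_measurable S \<and> integrable M (\<lambda>\<omega>. (F' (T 0 \<omega>))\<^sup>2) \<and>
        mean_ergodic T F' \<and> expectation (\<lambda>\<omega>. (indicator (\<Union> (range A)) (T 0 \<omega>) - F' (T 0 \<omega>))\<^sup>2) < e"
      using fin by (intro exI[of _ "indicator (\<Union>i<m. A i)"]) (auto intro!: integrable_indicator_square)
  qed
qed

text \<open>The usual extension from indicators to nonnegative functions. Square integrability
  travels through the induction: each constituent is dominated by the whole because everything is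
  nonnegative.\<close>

lemma mean_ergodic_nonneg:
  assumes sets: "\<And>A. A \<in> sets S \<Longrightarrow> mean_ergodic T (indicator A)"
    and F: "F \<in> borel_measurable S" "\<And>x. 0 \<le> F x" and F2: "integrable M (\<lambda>\<omega>. (F (T 0 \<omega>))\<^sup>2)"
  shows "mean_ergodic T F"
  using F F2
proof (induction rule: borel_measurable_induct_real)
  case (set A) then show ?case by (intro sets)
next
  case (mult u c)
  show ?case
  \<comment> \<open>For \<open>c = 0\<close> the integrability of the multiple says nothing about
    \<open>u\<close>, so the induction hypothesis is out of reach; the function is then
    constant.\<close>
  proof (cases "c = 0")
    case True then show ?thesis using mean_ergodic_const[of 0] by simp
  next
    case False
    then have u2: "integrable M (\<lambda>\<omega>. (u (T 0 \<omega>))\<^sup>2)" using mult by (simp add: power_mult_distrib)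
    with mult have "mean_ergodic T u" by blast
    with mean_ergodic_lincomb[OF _ u2 this _ u2 this, of c 0] mult show ?thesis by simp
  qed
next
  case (add u v)
  have "integrable M (\<lambda>\<omega>. (u (T 0 \<omega>))\<^sup>2)"
    by (rule Bochner_Integration.integrable_bound[OF add.prems]) (use add in \<open>auto intro!: power_mono\<close>)
  moreover have "integrable M (\<lambda>\<omega>. (v (T 0 \<omega>))\<^sup>2)"
    by (rule Bochner_Integration.integrable_bound[OF add.prems]) (use add in \<open>auto intro!: power_mono\<close>)
  ultimately show ?case
    using mean_ergodic_lincomb[of v u 1 1] add by simp
next
  case (seq U)
  note U = seq.hyps and IH = seq.IH
  note [measurable] = U(1)
  have le: "U i x \<le> F x" if "x \<in> space S" for i x
    using U(3) U(4)[OF that] by (intro incseq_le) (auto simp: incseq_def le_fun_def)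
  have T0: "T 0 \<omega> \<in> space S" if "\<omega> \<in> space M" for \<omega> using measurable_space[OF T that] .
  have Fm[measurable]: "F \<in> borel_measurable S" by (rule borel_measurable_LIMSEQ_real[OF U(4) U(1)])
  have u0: "0 \<le> F x" if "x \<in> space S" for x using le[OF that, of 0] U(2)[of 0 x] by linarith
  have U2: "integrable M (\<lambda>\<omega>. (U i (T 0 \<omega>))\<^sup>2)" for i
  proof (rule Bochner_Integration.integrable_bound[OF seq.prems])
    show "AE \<omega> in M. norm ((U i (T 0 \<omega>))\<^sup>2) \<le> norm ((F (T 0 \<omega>))\<^sup>2)"
      using le[OF T0] U(2) by (intro AE_I2) (simp add: power_mono)
  qed simp
  show ?case
  proof (rule mean_ergodic_approx[OF Fm seq.prems])
    fix e :: real assume e: "0 < e"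
    have "(\<lambda>m. expectation (\<lambda>\<omega>. (F (T 0 \<omega>) - U m (T 0 \<omega>))\<^sup>2)) \<longlonglongrightarrow> expectation (\<lambda>_. 0)"
    proof (rule integral_dominated_convergence[where w="\<lambda>\<omega>. (F (T 0 \<omega>))\<^sup>2"])
      show "AE \<omega> in M. (\<lambda>m. (F (T 0 \<omega>) - U m (T 0 \<omega>))\<^sup>2) \<longlonglongrightarrow> 0"
      proof (rule AE_I2)
        fix \<omega> assume "\<omega> \<in> space M"
        from U(4)[OF T0[OF this]] have "(\<lambda>m. (F (T 0 \<omega>) - U m (T 0 \<omega>))\<^sup>2) \<longlonglongrightarrow> (F (T 0 \<omega>) - F (T 0 \<omega>))\<^sup>2"
          by (intro tendsto_intros)
        then show "(\<lambda>m. (F (T 0 \<omega>) - U m (T 0 \<omega>))\<^sup>2) \<longlonglongrightarrow> 0" by simp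
      qed
      show "AE \<omega> in M. norm ((F (T 0 \<omega>) - U m (T 0 \<omega>))\<^sup>2) \<le> (F (T 0 \<omega>))\<^sup>2" for m
      proof (rule AE_I2)
        fix \<omega> assume "\<omega> \<in> space M"
        from le[OF T0[OF this], of m] U(2)[of m "T 0 \<omega>"]
        show "norm ((F (T 0 \<omega>) - U m (T 0 \<omega>))\<^sup>2) \<le> (F (T 0 \<omega>))\<^sup>2" by (auto intro!: power_mono)
      qed
    qed (use seq.prems in simp_all)
    then have "eventually (\<lambda>m. expectation (\<lambda>\<omega>. (F (T 0 \<omega>) - U m (T 0 \<omega>))\<^sup>2) < e) sequentially"
      using e by (intro order_tendstoD(2)[where a=e]) auto
    then obtain m where "expectation (\<lambda>\<omega>. (F (T 0 \<omega>) - U m (T 0 \<omega>))\<^sup>2) < e"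
      by (auto simp: eventually_sequentially)
    then show "\<exists>F'. F' \<in> borel_measurable S \<and> integrable M (\<lambda>\<omega>. (F' (T 0 \<omega>))\<^sup>2) \<and>
        mean_ergodic T F' \<and> expectation (\<lambda>\<omega>. (F (T 0 \<omega>) - F' (T 0 \<omega>))\<^sup>2) < e"
      using U(1) IH U2 by blast
  qed
qed

text \<open>Positive and negative parts are treated at once as \<open>max (c * F x) 0\<close> with
  \<open>c\<close> equal to 1 or -1.\<close>

lemma mean_ergodic_of_sets:
  assumes sets: "\<And>A. A \<in> sets S \<Longrightarrow> mean_ergodic T (indicator A)"
    and F[measurable]: "F \<in> borel_measurable S" and F2: "integrable M (\<lambda>\<omega>. (F (T 0 \<omega>))\<^sup>2)"
  shows "mean_ergodic T F"
proof -
  have p: "mean_ergodic T (\<lambda>x. max (c * F x) 0)" "integrable M (\<lambda>\<omega>. (max (c * F (T 0 \<omega>)) 0)\<^sup>2)" if c: "\<bar>c\<bar> = 1" for c :: real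
  proof -
    show 2: "integrable M (\<lambda>\<omega>. (max (c * F (T 0 \<omega>)) 0)\<^sup>2)"
    proof (rule Bochner_Integration.integrable_bound[OF F2], measurable, rule AE_I2)
      fix \<omega>
      have "\<bar>max (c * F (T 0 \<omega>)) 0\<bar> \<le> \<bar>c * F (T 0 \<omega>)\<bar>" by auto
      also have "\<dots> = \<bar>F (T 0 \<omega>)\<bar>" using c by (simp add: abs_mult)
      finally show "norm ((max (c * F (T 0 \<omega>)) 0)\<^sup>2) \<le> norm ((F (T 0 \<omega>))\<^sup>2)"
        by (simp add: abs_le_square_iff[symmetric])
    qed
    show "mean_ergodic T (\<lambda>x. max (c * F x) 0)"
      by (rule mean_ergodic_nonneg[OF sets]) (use 2 in auto)
  qed
  have eq: "(\<lambda>x. 1 * max (1 * F x) 0 + (-1) * max ((-1) * F x) 0) = F" by auto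
  have "mean_ergodic T (\<lambda>x. 1 * max (1 * F x) 0 + (-1) * max ((-1) * F x) 0)"
    by (intro mean_ergodic_lincomb p) auto
  then show ?thesis unfolding eq .
qed

end

text \<open>The joint law of the whole sequence is a product measure. Reading it through the
  injective map sending k to i - k selects a product of marginals, and since these all coincide,
  \<open>i\<close> disappears.\<close>

lemma stationary_shift:
  fixes \<eta> :: "int \<Rightarrow> 'a \<Rightarrow> real"
  assumes ind: "indep_vars (\<lambda>_. borel) \<eta> UNIV" and id: "\<And>i j. distr M borel (\<eta> i) = distr M borel (\<eta> j)"
  shows "distr M (Pi\<^sub>M UNIV (\<lambda>_. borel)) (\<lambda>\<omega> (k::nat). \<eta> (i - int k) \<omega>) = Pi\<^sub>M UNIV (\<lambda>_. distr M borel (\<eta> 0))"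
proof -
  have [measurable]: "\<eta> j \<in> borel_measurable M" for j using ind by (auto simp: indep_vars_def)
  have P: "prob_space (distr M borel (\<eta> j))" for j by (rule prob_space_distr) simp
  have "(\<lambda>\<omega>. \<lambda>j\<in>UNIV. \<eta> j \<omega>) = (\<lambda>\<omega> j. \<eta> j \<omega>)" by (simp add: restrict_def)
  then have joint: "distr M (Pi\<^sub>M UNIV (\<lambda>_. borel)) (\<lambda>\<omega> j. \<eta> j \<omega>) = Pi\<^sub>M UNIV (\<lambda>j. distr M borel (\<eta> j))"
    using ind indep_vars_iff_distr_eq_PiM[where I=UNIV and M'="\<lambda>_. borel" and X=\<eta>] by simp
  have re: "distr (Pi\<^sub>M UNIV (\<lambda>j. distr M borel (\<eta> j))) (Pi\<^sub>M UNIV (\<lambda>k. distr M borel (\<eta> (i - int k)))) (\<lambda>p. \<lambda>k\<in>UNIV. p (i - int k))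
    = Pi\<^sub>M UNIV (\<lambda>k. distr M borel (\<eta> (i - int k)))"
    by (rule distr_PiM_reindex[where f="\<lambda>k. i - int k"]) (auto intro: P simp: inj_on_def)
  have m1: "(\<lambda>p k. p (i - int k)) \<in> measurable (Pi\<^sub>M UNIV (\<lambda>_. borel)) (Pi\<^sub>M UNIV (\<lambda>_. borel :: real measure))"
    by (intro measurable_PiM_single') auto
  have m2: "(\<lambda>\<omega> j. \<eta> j \<omega>) \<in> measurable M (Pi\<^sub>M UNIV (\<lambda>_. borel))"
    by (intro measurable_PiM_single') auto
  have s: "sets (Pi\<^sub>M (UNIV::nat set) (\<lambda>k. distr M borel (\<eta> (i - int k)))) = sets (Pi\<^sub>M UNIV (\<lambda>_. borel))"
    by (intro sets_PiM_cong) auto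
  have "distr M (Pi\<^sub>M UNIV (\<lambda>_. borel)) (\<lambda>\<omega> (k::nat). \<eta> (i - int k) \<omega>)
    = distr (distr M (Pi\<^sub>M UNIV (\<lambda>_. borel)) (\<lambda>\<omega> j. \<eta> j \<omega>)) (Pi\<^sub>M UNIV (\<lambda>_. borel)) (\<lambda>p k. p (i - int k))"
    by (subst distr_distr[OF m1 m2]) (simp add: comp_def)
  also have "\<dots> = distr (Pi\<^sub>M UNIV (\<lambda>j. distr M borel (\<eta> j))) (Pi\<^sub>M UNIV (\<lambda>k. distr M borel (\<eta> (i - int k)))) (\<lambda>p. \<lambda>k\<in>UNIV. p (i - int k))"
    unfolding joint by (intro distr_cong) (simp_all add: s restrict_def)
  also have "\<dots> = Pi\<^sub>M UNIV (\<lambda>k. distr M borel (\<eta> (i - int k)))" by (rule re)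
  also have "\<dots> = Pi\<^sub>M UNIV (\<lambda>_. distr M borel (\<eta> 0))"
    by (intro PiM_cong refl id)
  finally show ?thesis .
qed


text \<open>A cylinder looks back at finitely many coordinates, so its indicators at two times
  further apart than the longest lag are independent. The variance of their average is then of order
  1/n, and cylinders generate the product \<sigma>-algebra.\<close>

lemma mean_ergodic_shift:
  fixes \<eta> :: "int \<Rightarrow> 'a \<Rightarrow> real"
  assumes ind: "indep_vars (\<lambda>_. borel) \<eta> UNIV" and id: "\<And>i j. distr M borel (\<eta> i) = distr M borel (\<eta> j)"
    and F: "F \<in> borel_measurable (Pi\<^sub>M (UNIV :: nat set) (\<lambda>_. borel))"
    and F2: "integrable M (\<lambda>\<omega>. (F (\<lambda>k. \<eta> (int 0 - int k) \<omega>))\<^sup>2)"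
  shows "mean_ergodic (\<lambda>i \<omega> k. \<eta> (int i - int k) \<omega>) F"
proof -
  let ?S = "Pi\<^sub>M (UNIV :: nat set) (\<lambda>_. borel :: real measure)"
  define T where "T = (\<lambda>(i::nat) \<omega> (k::nat). \<eta> (int i - int k) \<omega>)"
  have \<eta>[measurable]: "\<eta> j \<in> borel_measurable M" for j using ind by (auto simp: indep_vars_def)
  have T[measurable]: "T i \<in> measurable M ?S" for i
    unfolding T_def by (intro measurable_PiM_single') auto
  have stat: "distr M ?S (T i) = distr M ?S (T 0)" for i
    unfolding T_def stationary_shift[OF ind id] ..
  have cyl: "mean_ergodic T (indicator A)" if A: "A \<in> prod_algebra UNIV (\<lambda>_::nat. borel)" for A
  proof -
    obtain J E where A_eq: "A = prod_emb UNIV (\<lambda>_. borel) J (\<Pi>\<^sub>E j\<in>J. E j)" and J: "finite J" and E: "\<And>k. k \<in> J \<Longrightarrow> E k \<in> sets borel"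
      using A by (rule prod_algebraE) auto
    have A_sets[measurable]: "A \<in> sets ?S" using A by (simp add: sets_PiM sigma_sets.Basic)
    have mem: "T i \<omega> \<in> A \<longleftrightarrow> (\<forall>k\<in>J. \<eta> (int i - int k) \<omega> \<in> E k)" for i \<omega>
      unfolding A_eq prod_emb_iff by (auto simp: T_def)
    define p where "p = expectation (\<lambda>\<omega>. indicator A (T 0 \<omega>) :: real)"
    have p: "expectation (\<lambda>\<omega>. indicator A (T i \<omega>) :: real) = p" for i
      unfolding p_def by (rule stationary_expectation[of T ?S, OF T stat]) auto
    have pr: "expectation (\<lambda>\<omega>. indicator A (T i \<omega>) :: real) = prob (T i -` A \<inter> space M)" for i
      by (auto simp flip: Bochner_Integration.integral_indicator intro!: Bochner_Integration.integral_cong simp: indicator_def)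
    have p01: "0 \<le> p" "p \<le> 1" using p[of 0] pr[of 0] by (auto simp: measure_nonneg)
    define g where "g = (\<lambda>i \<omega>. indicator A (T i \<omega>) - p)"
    have g[measurable]: "g i \<in> borel_measurable M" for i unfolding g_def by measurable
    have g_bd: "\<bar>g i \<omega>\<bar> \<le> 1" for i \<omega> using p01 by (auto simp: g_def indicator_def)
    have g_int: "integrable M (\<lambda>\<omega>. (g i \<omega>)\<^sup>2)" for i
      using g_bd by (intro integrable_const_bound[where B=1]) (auto simp: abs_square_le_1)
    \<comment> \<open>The longest lag that the cylinder inspects; inserting 0 gives a value when
      \<open>J\<close> is empty.\<close>
    define q where "q = Max (insert 0 J)"
    have q: "k \<le> q" if "k \<in> J" for k using J that by (simp add: q_def)
    have far: "expectation (\<lambda>\<omega>. g i \<omega> * g j \<omega>) = 0" if ij: "i + q < j" for i j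
    proof -
      \<comment> \<open>The coordinates of the innovations that the cylinder inspects at time
        \<open>i\<close>. The set \<open>?X i\<close> is the same cylinder indexed by them, with the
        lag recovered as \<open>int i - l\<close>. Beyond distance \<open>q\<close> these index sets
        are disjoint.\<close>
      let ?c = "\<lambda>i. (\<lambda>k. int i - int k) ` J"
      let ?X = "\<lambda>i. (\<Pi>\<^sub>E l\<in>?c i. E (nat (int i - l)))"
      have ip: "indep_var (Pi\<^sub>M (?c i) (\<lambda>_. borel)) (\<lambda>\<omega>. \<lambda>l\<in>?c i. \<eta> l \<omega>) (Pi\<^sub>M (?c j) (\<lambda>_. borel)) (\<lambda>\<omega>. \<lambda>l\<in>?c j. \<eta> l \<omega>)"
      proof (rule indep_var_restrict[OF ind])
        show "?c i \<inter> ?c j = {}" using ij q by force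
      qed auto
      have X: "?X i \<in> sets (Pi\<^sub>M (?c i) (\<lambda>_. borel))" for i
        using J E by (intro sets_PiM_I_finite) auto
      have pre: "(\<lambda>l\<in>?c i. \<eta> l \<omega>) \<in> ?X i \<longleftrightarrow> T i \<omega> \<in> A" for i \<omega>
        unfolding mem by (auto simp: PiE_iff)
      have "prob ((\<lambda>x. (\<lambda>l\<in>?c i. \<eta> l x, \<lambda>l\<in>?c j. \<eta> l x)) -` (?X i \<times> ?X j) \<inter> space M)
        = prob ((\<lambda>\<omega>. \<lambda>l\<in>?c i. \<eta> l \<omega>) -` ?X i \<inter> space M) * prob ((\<lambda>\<omega>. \<lambda>l\<in>?c j. \<eta> l \<omega>) -` ?X j \<inter> space M)"
        by (rule indep_varD[OF ip X X])
      also have "(\<lambda>x. (\<lambda>l\<in>?c i. \<eta> l x, \<lambda>l\<in>?c j. \<eta> l x)) -` (?X i \<times> ?X j) \<inter> space M = (T i -` A \<inter> T j -` A) \<inter> space M"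
        unfolding vimage_def mem_Collect_eq mem_Times_iff fst_conv snd_conv pre by auto
      also have "(\<lambda>\<omega>. \<lambda>l\<in>?c i. \<eta> l \<omega>) -` ?X i \<inter> space M = T i -` A \<inter> space M"
        unfolding vimage_def pre ..
      also have "(\<lambda>\<omega>. \<lambda>l\<in>?c j. \<eta> l \<omega>) -` ?X j \<inter> space M = T j -` A \<inter> space M"
        unfolding vimage_def pre ..
      finally have pp: "prob ((T i -` A \<inter> T j -` A) \<inter> space M) = p * p"
        using p[of i] p[of j] pr[of i] pr[of j] by simp
      have "expectation (\<lambda>\<omega>. indicator A (T i \<omega>) * indicator A (T j \<omega>) :: real) = prob ((T i -` A \<inter> T j -` A) \<inter> space M)"
        by (auto simp flip: Bochner_Integration.integral_indicator intro!: Bochner_Integration.integral_cong simp: indicator_def)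
      with pp have E2: "expectation (\<lambda>\<omega>. indicator A (T i \<omega>) * indicator A (T j \<omega>) :: real) = p * p" by simp
      have i1: "integrable M (\<lambda>\<omega>. indicator A (T i \<omega>) :: real)" for i
        by (intro integrable_const_bound[where B=1]) (auto simp: indicator_def)
      have i2: "integrable M (\<lambda>\<omega>. indicator A (T i \<omega>) * indicator A (T j \<omega>) :: real)"
        by (intro integrable_const_bound[where B=1]) (auto simp: indicator_def)
      have "expectation (\<lambda>\<omega>. g i \<omega> * g j \<omega>) = expectation (\<lambda>\<omega>. indicator A (T i \<omega>) * indicator A (T j \<omega>) - p * indicator A (T i \<omega>) - p * indicator A (T j \<omega>) + p * p)"
        by (intro Bochner_Integration.integral_cong) (auto simp: g_def algebra_simps)
      also have "\<dots> = 0" using i1 i2 prob_space by (simp add: E2 p)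
      finally show ?thesis .
    qed
    \<comment> \<open>Subtraction on naturals stops at 0, which is harmless: times are nonnegative,
      so the window still contains every time within distance \<open>q\<close> of
      \<open>i\<close>.\<close>
    have cov: "expectation (\<lambda>\<omega>. g i \<omega> * g j \<omega>) \<le> (if j \<in> {i - q..i + q} then 1 else 0)" for i j
    proof (cases "j \<in> {i - q..i + q}")
      case True
      have "expectation (\<lambda>\<omega>. g i \<omega> * g j \<omega>) \<le> expectation (\<lambda>_. 1)"
      proof (rule integral_mono)
        show "integrable M (\<lambda>\<omega>. g i \<omega> * g j \<omega>)" by (intro integrable_mult_square g_int g)
        show "g i \<omega> * g j \<omega> \<le> 1" for \<omega>
          using mult_mono[OF g_bd g_bd[of j \<omega>], of i \<omega>] abs_ge_self[of "g i \<omega> * g j \<omega>"] by (simp add: abs_mult)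
      qed simp
      then show ?thesis using True prob_space by simp
    next
      case False
      then have "i + q < j \<or> j + q < i" by auto
      then have "expectation (\<lambda>\<omega>. g i \<omega> * g j \<omega>) = 0"
        using far[of i j] far[of j i] by (auto simp: mult.commute)
      then show ?thesis using False by simp
    qed
    have bound: "norm (expectation (\<lambda>\<omega>. ((\<Sum>i=1..n. indicator A (T i \<omega>)) / real n - expectation (\<lambda>\<omega>. indicator A (T 0 \<omega>)))\<^sup>2 :: real)) \<le> (2 * real q + 1) / real n" if n: "0 < n" for n
    proof -
      have "(\<Sum>i=1..n. indicator A (T i \<omega>)) / real n - p = (\<Sum>i=1..n. g i \<omega>) / real n" for \<omega>
        using n by (simp add: g_def sum_subtractf diff_divide_distrib)
      then have "expectation (\<lambda>\<omega>. ((\<Sum>i=1..n. indicator A (T i \<omega>)) / real n - p)\<^sup>2 :: real) = expectation (\<lambda>\<omega>. (\<Sum>i=1..n. g i \<omega>)\<^sup>2) / (real n)\<^sup>2"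
        by (simp add: power_divide)
      also have "expectation (\<lambda>\<omega>. (\<Sum>i=1..n. g i \<omega>)\<^sup>2) = (\<Sum>i=1..n. \<Sum>j=1..n. expectation (\<lambda>\<omega>. g i \<omega> * g j \<omega>))"
        by (intro integral_sum_square g g_int)
      also have "\<dots> / (real n)\<^sup>2 \<le> (\<Sum>i=1..n. 2 * real q + 1) / (real n)\<^sup>2"
      proof (intro divide_right_mono sum_mono)
        fix i
        have "(\<Sum>j=1..n. expectation (\<lambda>\<omega>. g i \<omega> * g j \<omega>)) \<le> (\<Sum>j=1..n. if j \<in> {i - q..i + q} then 1 else 0)"
          by (intro sum_mono cov)
        also have "\<dots> = real (card ({1..n} \<inter> {i - q..i + q}))" by (simp add: sum.If_cases Int_def)
        also have "\<dots> \<le> real (card {i - q..i + q})" by (intro of_nat_mono card_mono) auto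
        also have "\<dots> \<le> 2 * real q + 1" by (simp add: of_nat_diff)
        finally show "(\<Sum>j=1..n. expectation (\<lambda>\<omega>. g i \<omega> * g j \<omega>)) \<le> 2 * real q + 1" .
      qed simp
      also have "\<dots> = (2 * real q + 1) / real n" using n by (simp add: power2_eq_square)
      finally show ?thesis by (simp add: p_def)
    qed
    have lim: "(\<lambda>n. (2 * real q + 1) / real n) \<longlonglongrightarrow> 0" by (rule lim_const_over_n)
    show ?thesis unfolding mean_ergodic_def
      by (rule Lim_null_comparison[OF _ lim], rule eventually_mono[OF eventually_gt_at_top[of 0]], rule bound)
  qed
  have "mean_ergodic T F"
  proof (rule mean_ergodic_of_sets[of T ?S, OF T stat _ F])
    fix A assume "A \<in> sets ?S"
    then show "mean_ergodic T (indicator A)"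
      using prod_algebra_sets_into_space[of UNIV "\<lambda>_. borel :: real measure"]
      by (intro mean_ergodic_sets[of T ?S, OF T stat Int_stable_prod_algebra _ _ cyl]) (auto simp: sets_PiM space_PiM)
  qed (use F2 in \<open>simp add: T_def\<close>)
  then show ?thesis unfolding T_def .
qed

end

subsection \<open>Characteristic functions of martingale sums\<close>

context prob_space
begin

text \<open>The library's \<open>indep_var\<close> relates only random elements of one and the same type.\<close>

definition indep_pair :: "'b measure \<Rightarrow> ('a \<Rightarrow> 'b) \<Rightarrow> 'c measure \<Rightarrow> ('a \<Rightarrow> 'c) \<Rightarrow> bool" where
  "indep_pair A P B Z \<longleftrightarrow> P \<in> measurable M A \<and> Z \<in> measurable M B \<and>
     distr M (A \<Otimes>\<^sub>M B) (\<lambda>\<omega>. (P \<omega>, Z \<omega>)) = distr M A P \<Otimes>\<^sub>M distr M B Z"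

lemma indep_pairI:
  assumes P[measurable]: "P \<in> measurable M A" and Z[measurable]: "Z \<in> measurable M B"
    and eq: "\<And>X Y. X \<in> sets A \<Longrightarrow> Y \<in> sets B \<Longrightarrow>
      prob (P -` X \<inter> Z -` Y \<inter> space M) = prob (P -` X \<inter> space M) * prob (Z -` Y \<inter> space M)"
  shows "indep_pair A P B Z"
proof -
  have "distr M A P \<Otimes>\<^sub>M distr M B Z = distr M (A \<Otimes>\<^sub>M B) (\<lambda>\<omega>. (P \<omega>, Z \<omega>))"
  proof (rule pair_measure_eqI)
    show "sigma_finite_measure (distr M A P)" "sigma_finite_measure (distr M B Z)"
      by (intro prob_space_imp_sigma_finite prob_space_distr; simp)+
    show "sets (distr M A P \<Otimes>\<^sub>M distr M B Z) = sets (distr M (A \<Otimes>\<^sub>M B) (\<lambda>\<omega>. (P \<omega>, Z \<omega>)))"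
      by (simp cong: sets_pair_measure_cong)
    fix X Y assume "X \<in> sets (distr M A P)" "Y \<in> sets (distr M B Z)"
    then have [measurable]: "X \<in> sets A" "Y \<in> sets B" by auto
    have "(\<lambda>\<omega>. (P \<omega>, Z \<omega>)) -` (X \<times> Y) \<inter> space M = P -` X \<inter> Z -` Y \<inter> space M" by auto
    then show "emeasure (distr M A P) X * emeasure (distr M B Z) Y = emeasure (distr M (A \<Otimes>\<^sub>M B) (\<lambda>\<omega>. (P \<omega>, Z \<omega>))) (X \<times> Y)"
      by (simp add: emeasure_distr emeasure_eq_measure eq ennreal_mult)
  qed
  then show ?thesis by (simp add: indep_pair_def)
qed

lemma indep_pair_past:
  fixes \<zeta> :: "int \<Rightarrow> 'a \<Rightarrow> real"
  assumes ind: "indep_vars (\<lambda>_. borel) \<zeta> UNIV"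
  shows "indep_pair (Pi\<^sub>M {..<i} (\<lambda>_. borel)) (\<lambda>\<omega>. \<lambda>j\<in>{..<i}. \<zeta> j \<omega>) borel (\<zeta> i)"
proof (rule indep_pairI)
  have [measurable]: "\<zeta> j \<in> borel_measurable M" for j using ind by (auto simp: indep_vars_def)
  show "(\<lambda>\<omega>. \<lambda>j\<in>{..<i}. \<zeta> j \<omega>) \<in> measurable M (Pi\<^sub>M {..<i} (\<lambda>_. borel))" "\<zeta> i \<in> borel_measurable M"
    by (auto intro!: measurable_restrict)
  have ip: "indep_var (Pi\<^sub>M {..<i} (\<lambda>_. borel)) (\<lambda>\<omega>. \<lambda>j\<in>{..<i}. \<zeta> j \<omega>) (Pi\<^sub>M {i} (\<lambda>_. borel)) (\<lambda>\<omega>. \<lambda>j\<in>{i}. \<zeta> j \<omega>)"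
    by (rule indep_var_restrict[OF ind]) auto
  fix X :: "(int \<Rightarrow> real) set" and Y :: "real set"
  assume X: "X \<in> sets (Pi\<^sub>M {..<i} (\<lambda>_. borel))" and Y: "Y \<in> sets borel"
  \<comment> \<open>Disjoint blocks of coordinates are independent as functions on index sets; the
    block over \<open>{i}\<close> is read as a real variable through this cylinder.\<close>
  let ?Y = "(\<lambda>p. p i) -` Y \<inter> space (Pi\<^sub>M {i} (\<lambda>_. borel :: real measure))"
  have "?Y \<in> sets (Pi\<^sub>M {i} (\<lambda>_. borel))" using Y by (intro measurable_sets[of _ _ borel]) auto
  from indep_varD[OF ip X this]
  have "prob ((\<lambda>x. (\<lambda>j\<in>{..<i}. \<zeta> j x, \<lambda>j\<in>{i}. \<zeta> j x)) -` (X \<times> ?Y) \<inter> space M)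
    = prob ((\<lambda>\<omega>. \<lambda>j\<in>{..<i}. \<zeta> j \<omega>) -` X \<inter> space M) * prob ((\<lambda>\<omega>. \<lambda>j\<in>{i}. \<zeta> j \<omega>) -` ?Y \<inter> space M)" .
  also have "(\<lambda>x. (\<lambda>j\<in>{..<i}. \<zeta> j x, \<lambda>j\<in>{i}. \<zeta> j x)) -` (X \<times> ?Y) \<inter> space M
    = (\<lambda>\<omega>. \<lambda>j\<in>{..<i}. \<zeta> j \<omega>) -` X \<inter> \<zeta> i -` Y \<inter> space M" by (auto simp: space_PiM)
  also have "(\<lambda>\<omega>. \<lambda>j\<in>{i}. \<zeta> j \<omega>) -` ?Y \<inter> space M = \<zeta> i -` Y \<inter> space M" by (auto simp: space_PiM)
  finally show "prob ((\<lambda>\<omega>. \<lambda>j\<in>{..<i}. \<zeta> j \<omega>) -` X \<inter> \<zeta> i -` Y \<inter> space M)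
    = prob ((\<lambda>\<omega>. \<lambda>j\<in>{..<i}. \<zeta> j \<omega>) -` X \<inter> space M) * prob (\<zeta> i -` Y \<inter> space M)" .
qed

lemma expectation_indep_pair:
  fixes f :: "'b \<times> 'c \<Rightarrow> 'd::{banach, second_countable_topology}"
  assumes ind: "indep_pair A P B Z"
    and f[measurable]: "f \<in> borel_measurable (A \<Otimes>\<^sub>M B)"
    and int: "integrable M (\<lambda>\<omega>. f (P \<omega>, Z \<omega>))"
  shows "expectation (\<lambda>\<omega>. f (P \<omega>, Z \<omega>)) = (\<integral>p. (\<integral>z. f (p, z) \<partial>distr M B Z) \<partial>distr M A P)"
proof -
  have [measurable]: "P \<in> measurable M A" "Z \<in> measurable M B"
    using ind by (simp_all add: indep_pair_def)
  interpret DP: prob_space "distr M A P" by (rule prob_space_distr) simp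
  interpret DZ: prob_space "distr M B Z" by (rule prob_space_distr) simp
  interpret PZ: pair_prob_space "distr M A P" "distr M B Z" ..
  have d: "distr M A P \<Otimes>\<^sub>M distr M B Z = distr M (A \<Otimes>\<^sub>M B) (\<lambda>\<omega>. (P \<omega>, Z \<omega>))"
    using ind by (simp add: indep_pair_def)
  have "integrable (distr M A P \<Otimes>\<^sub>M distr M B Z) f"
    unfolding d using int by (simp add: integrable_distr_eq)
  from PZ.integral_fst'[OF this]
  show ?thesis unfolding d by (simp add: integral_distr)
qed

text \<open>Conditioning on the past \<open>P\<close>, carried out by Fubini: with the past fixed,
  \<open>F\<close> leaves the inner integral over the fresh noise. With \<open>\<eta> = 0\<close> it
  yields orthogonality of martingale differences, with a small \<open>\<eta>\<close> one step of the
  telescoping for characteristic functions.\<close>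

lemma norm_expectation_indep_le:
  fixes F :: "'b \<Rightarrow> 'd::{banach, real_normed_algebra, second_countable_topology}"
  assumes ind: "indep_pair A P B Z"
    and F[measurable]: "F \<in> borel_measurable A" and H[measurable]: "H \<in> borel_measurable (A \<Otimes>\<^sub>M B)"
    and Fc: "\<And>p. norm (F p) \<le> c" and Hc: "\<And>p z. norm (H (p, z)) \<le> c'"
    and small: "\<And>p. norm (\<integral>z. H (p, z) \<partial>distr M B Z) \<le> \<eta>"
  shows "norm (expectation (\<lambda>\<omega>. F (P \<omega>) * H (P \<omega>, Z \<omega>))) \<le> c * \<eta>"
proof -
  have [measurable]: "P \<in> measurable M A" "Z \<in> measurable M B"
    using ind by (simp_all add: indep_pair_def)
  interpret DP: prob_space "distr M A P" by (rule prob_space_distr) simp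
  interpret DZ: prob_space "distr M B Z" by (rule prob_space_distr) simp
  have c: "0 \<le> c" by (rule order_trans[OF norm_ge_zero Fc])
  have bd: "norm (F p * H (p, z)) \<le> c * c'" for p z
    by (rule order_trans[OF norm_mult_ineq]) (intro mult_mono Fc Hc c norm_ge_zero)
  have "expectation (\<lambda>\<omega>. F (P \<omega>) * H (P \<omega>, Z \<omega>)) = (\<integral>p. (\<integral>z. F p * H (p, z) \<partial>distr M B Z) \<partial>distr M A P)"
    using bd by (subst expectation_indep_pair[OF ind, where f="\<lambda>(p, z). F p * H (p, z)", simplified])
      (auto intro!: integrable_const_bound[where B="c * c'"])
  also have "norm \<dots> \<le> (\<integral>p. norm (\<integral>z. F p * H (p, z) \<partial>distr M B Z) \<partial>distr M A P)"
    by (rule integral_norm_bound)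
  also have "\<dots> \<le> (\<integral>p. c * \<eta> \<partial>distr M A P)"
  proof (rule integral_mono')
    fix p assume p: "p \<in> space (distr M A P)"
    have "integrable (distr M B Z) (\<lambda>z. H (p, z))"
      using p Hc by (intro DZ.integrable_const_bound[where B=c']) auto
    then have "(\<integral>z. F p * H (p, z) \<partial>distr M B Z) = F p * (\<integral>z. H (p, z) \<partial>distr M B Z)"
      by simp
    also have "norm \<dots> \<le> norm (F p) * norm (\<integral>z. H (p, z) \<partial>distr M B Z)" by (rule norm_mult_ineq)
    also have "\<dots> \<le> c * \<eta>" by (intro mult_mono Fc small c norm_ge_zero)
    finally show "norm (\<integral>z. F p * H (p, z) \<partial>distr M B Z) \<le> c * \<eta>" .
  next
    fix p
    have "0 \<le> \<eta>" by (rule order_trans[OF norm_ge_zero small])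
    then show "0 \<le> c * \<eta>" using c by simp
  qed simp
  also have "\<dots> = c * \<eta>" using DP.prob_space by simp
  finally show ?thesis .
qed

end

text \<open>Compensation cancels the first-order term: 1 - u is the second-order expansion of a
  centred characteristic function, \<open>exp u\<close> its compensator, and only an error of order
  u^2 remains.\<close>

lemma exp_mult_one_minus_bound:
  fixes u :: real assumes "0 \<le> u"
  shows "\<bar>exp u * (1 - u) - 1\<bar> \<le> u\<^sup>2 * exp u"
proof -
  have "1 - u \<le> exp (- u)" using exp_ge_add_one_self[of "- u"] by simp
  then have "exp u * (1 - u) \<le> exp u * exp (- u)" by (intro mult_left_mono) auto
  then have 1: "exp u * (1 - u) \<le> 1" by (simp add: exp_minus)
  have "exp u - 1 = exp u * (1 - exp (- u))" by (simp add: right_diff_distrib exp_minus)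
  also have "\<dots> \<le> exp u * u" using \<open>1 - u \<le> exp (- u)\<close> by (intro mult_left_mono) auto
  finally have "u * (exp u - 1) \<le> u * (exp u * u)" using assms by (intro mult_left_mono) auto
  then have "u * exp u - u \<le> u\<^sup>2 * exp u" by (simp add: algebra_simps power2_eq_square)
  moreover have "1 + u \<le> exp u" by (rule exp_ge_add_one_self)
  moreover have "1 - exp u * (1 - u) = 1 - exp u + u * exp u" by (simp add: algebra_simps)
  ultimately have "1 - exp u * (1 - u) \<le> u\<^sup>2 * exp u" by linarith
  with 1 show ?thesis by simp
qed

lemma abs_exp_diff_le:
  fixes a b c :: real assumes "a \<le> c" "b \<le> c"
  shows "\<bar>exp a - exp b\<bar> \<le> exp c * \<bar>a - b\<bar>"
proof -
  have *: "exp a - exp b \<le> exp a * (a - b)" for a b :: real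
  proof -
    have "1 - (a - b) \<le> exp (- (a - b))" using exp_ge_add_one_self[of "- (a - b)"] by linarith
    then have "exp a * (1 - exp (- (a - b))) \<le> exp a * (a - b)" by (intro mult_left_mono) auto
    then show ?thesis by (simp add: right_diff_distrib flip: exp_add)
  qed
  have 1: "exp a - exp b \<le> exp c * \<bar>a - b\<bar>"
    by (rule order_trans[OF *], rule order_trans[OF mult_left_mono mult_right_mono[of "exp a"]]) (use assms in auto)
  have 2: "exp b - exp a \<le> exp c * \<bar>a - b\<bar>"
    by (rule order_trans[OF *], rule order_trans[OF mult_left_mono mult_right_mono[of "exp b"]]) (use assms in auto)
  from 1 2 show ?thesis by linarith
qed

text \<open>Taylor expansion to second order: the linear term vanishes by centering, the quadratic
  one is cancelled by the compensator up to u^2 with u = t^2 v / 2, and boundedness turns the third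
  moment into \<delta> times the variance. The answer is expressed through an upper bound
  \<open>v'\<close> because the conditional variance will depend on the past.\<close>

lemma (in prob_space) char_centered_compensated:
  assumes [measurable]: "D \<in> borel_measurable M"
    and bd: "\<And>\<omega>. \<bar>D \<omega>\<bar> \<le> \<delta>" and mean: "expectation D = 0"
    and v: "v = expectation (\<lambda>\<omega>. (D \<omega>)\<^sup>2)" and v': "v \<le> v'"
  shows "cmod (expectation (\<lambda>\<omega>. exp (\<i> * complex_of_real (t * D \<omega>) + complex_of_real (t\<^sup>2 * v / 2)) - 1))
    \<le> exp (t\<^sup>2 * v' / 2) * (t ^ 4 * v'\<^sup>2 / 4 + \<bar>t\<bar> ^ 3 * \<delta> * v')"
proof -
  have \<delta>: "0 \<le> \<delta>" by (rule order_trans[OF abs_ge_zero bd])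
  have int: "integrable M (\<lambda>\<omega>. iexp (t * D \<omega>))"
    by (intro integrable_const_bound[where B=1]) auto
  have intD: "integrable M D" using bd by (intro integrable_const_bound[where B=\<delta>]) auto
  have intD2: "integrable M (\<lambda>\<omega>. (D \<omega>)\<^sup>2)"
  proof (intro integrable_const_bound[where B="\<delta>\<^sup>2"] AE_I2)
    fix \<omega> show "norm ((D \<omega>)\<^sup>2) \<le> \<delta>\<^sup>2"
      using bd[of \<omega>] \<delta> by (simp add: abs_le_square_iff[symmetric])
  qed simp
  have v0: "0 \<le> v" unfolding v by simp
  define u where "u = t\<^sup>2 * v / 2"
  have u0: "0 \<le> u" using v0 by (simp add: u_def)
  have uu: "u \<le> t\<^sup>2 * v' / 2" unfolding u_def using v' by (intro divide_right_mono mult_left_mono) auto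
  let ?r = "\<lambda>\<omega>. iexp (t * D \<omega>) - (1 + \<i> * complex_of_real (t * D \<omega>) - complex_of_real ((t * D \<omega>)\<^sup>2 / 2))"
  have r: "cmod (?r \<omega>) \<le> \<bar>t\<bar> ^ 3 * \<delta> * (D \<omega>)\<^sup>2" for \<omega>
  proof -
    have "(\<Sum>k\<le>2. (\<i> * complex_of_real x) ^ k / fact k) = 1 + \<i> * complex_of_real x - complex_of_real (x\<^sup>2 / 2)" for x
      by (simp add: numeral_2_eq_2 complex_eq_iff)
    then have "cmod (?r \<omega>) \<le> \<bar>t * D \<omega>\<bar> ^ Suc 2 / fact (Suc 2)"
      using iexp_approx1[of "t * D \<omega>" 2] by (simp only:)
    also have "\<dots> = \<bar>t * D \<omega>\<bar> ^ 3 / fact 3" by simp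
    also have "\<dots> \<le> \<bar>t * D \<omega>\<bar> ^ 3 / 1" by (intro divide_left_mono) auto
    also have "\<dots> = \<bar>t\<bar> ^ 3 * (\<bar>D \<omega>\<bar> * (D \<omega>)\<^sup>2)"
      by (simp only: abs_mult power_mult_distrib) (simp only: power3_eq_cube[of "\<bar>D \<omega>\<bar>"] power2_eq_square mult.assoc abs_mult_self_eq)
    also have "\<dots> \<le> \<bar>t\<bar> ^ 3 * (\<delta> * (D \<omega>)\<^sup>2)"
      by (intro mult_left_mono mult_right_mono bd) auto
    finally show ?thesis by (simp add: mult.assoc)
  qed
  have ia: "integrable M (\<lambda>\<omega>. t * D \<omega>)" using intD by simp
  have ib: "integrable M (\<lambda>\<omega>. (t * D \<omega>)\<^sup>2 / 2)" using intD2 by (simp add: power_mult_distrib)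
  note ints = Bochner_Integration.integrable_add integrable_mult_right integrable_of_real ia ib integrable_const
  have intr: "integrable M (\<lambda>\<omega>. 1 + \<i> * complex_of_real (t * D \<omega>) - complex_of_real ((t * D \<omega>)\<^sup>2 / 2))"
    by (intro Bochner_Integration.integrable_diff ints)
  have eq: "expectation (\<lambda>\<omega>. 1 + \<i> * complex_of_real (t * D \<omega>) - complex_of_real ((t * D \<omega>)\<^sup>2 / 2)) = complex_of_real (1 - u)"
  proof -
    have "expectation (\<lambda>\<omega>. 1 + \<i> * complex_of_real (t * D \<omega>) - complex_of_real ((t * D \<omega>)\<^sup>2 / 2))
      = expectation (\<lambda>\<omega>. 1 + \<i> * complex_of_real (t * D \<omega>)) - expectation (\<lambda>\<omega>. complex_of_real ((t * D \<omega>)\<^sup>2 / 2))"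
      by (intro Bochner_Integration.integral_diff ints)
    also have "expectation (\<lambda>\<omega>. 1 + \<i> * complex_of_real (t * D \<omega>)) = expectation (\<lambda>_. 1) + expectation (\<lambda>\<omega>. \<i> * complex_of_real (t * D \<omega>))"
      by (intro Bochner_Integration.integral_add ints)
    also have "expectation (\<lambda>\<omega>. \<i> * complex_of_real (t * D \<omega>)) = 0"
      by (simp only: integral_mult_right_zero integral_complex_of_real) (simp add: mean)
    also have "expectation (\<lambda>\<omega>. complex_of_real ((t * D \<omega>)\<^sup>2 / 2)) = complex_of_real u"
      by (simp only: integral_complex_of_real) (simp add: power_mult_distrib u_def v)
    finally show ?thesis using prob_space by simp
  qed
  have "expectation ?r = expectation (\<lambda>\<omega>. iexp (t * D \<omega>)) - complex_of_real (1 - u)"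
    using Bochner_Integration.integral_diff[OF int intr] unfolding eq .
  then have e1: "expectation (\<lambda>\<omega>. iexp (t * D \<omega>)) = complex_of_real (1 - u) + expectation ?r" by simp
  have "cmod (expectation ?r) \<le> expectation (\<lambda>\<omega>. cmod (?r \<omega>))" by (rule integral_norm_bound)
  also have "\<dots> \<le> expectation (\<lambda>\<omega>. \<bar>t\<bar> ^ 3 * \<delta> * (D \<omega>)\<^sup>2)"
    by (rule integral_mono[OF _ _ r]) (intro integrable_norm Bochner_Integration.integrable_diff int intr, use intD2 in auto)
  also have "\<dots> = \<bar>t\<bar> ^ 3 * \<delta> * v" by (simp add: v)
  also have "\<dots> \<le> \<bar>t\<bar> ^ 3 * \<delta> * v'" using \<delta> v' by (intro mult_left_mono) auto
  finally have r': "cmod (expectation ?r) \<le> \<bar>t\<bar> ^ 3 * \<delta> * v'" .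
  have "expectation (\<lambda>\<omega>. exp (\<i> * complex_of_real (t * D \<omega>) + complex_of_real (t\<^sup>2 * v / 2)) - 1)
    = expectation (\<lambda>\<omega>. iexp (t * D \<omega>) * complex_of_real (exp u) - 1)"
    by (simp only: exp_add u_def exp_of_real)
  also have "\<dots> = expectation (\<lambda>\<omega>. iexp (t * D \<omega>)) * complex_of_real (exp u) - 1"
    using int prob_space by (subst Bochner_Integration.integral_diff) auto
  also have "\<dots> = complex_of_real (exp u * (1 - u) - 1) + complex_of_real (exp u) * expectation ?r"
    unfolding e1 by (simp add: algebra_simps)
  also have "cmod \<dots> \<le> \<bar>exp u * (1 - u) - 1\<bar> + exp u * (\<bar>t\<bar> ^ 3 * \<delta> * v')"
    by (rule order_trans[OF norm_triangle_ineq], rule add_mono)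
      (simp_all only: norm_of_real norm_mult, use r' in \<open>auto intro!: mult_left_mono\<close>)
  also have "\<dots> \<le> u\<^sup>2 * exp u + exp u * (\<bar>t\<bar> ^ 3 * \<delta> * v')"
    by (intro add_right_mono exp_mult_one_minus_bound u0)
  also have "\<dots> = exp u * (u\<^sup>2 + \<bar>t\<bar> ^ 3 * \<delta> * v')" by (simp add: algebra_simps)
  also have "\<dots> \<le> exp (t\<^sup>2 * v' / 2) * ((t\<^sup>2 * v' / 2)\<^sup>2 + \<bar>t\<bar> ^ 3 * \<delta> * v')"
    using u0 uu \<delta> v0 v' by (intro mult_mono add_mono power_mono) (auto intro!: add_nonneg_nonneg mult_nonneg_nonneg)
  also have "(t\<^sup>2 * v' / 2)\<^sup>2 = t ^ 4 * v'\<^sup>2 / 4" by (simp add: power_mult_distrib power_divide)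
  finally show ?thesis .
qed


text \<open>Multiplying by the exponential of the accumulated conditional variance makes the
  expectation nearly constant from step to step, so it stays near 1. Afterwards the random
  accumulated variance is exchanged for the constant \<open>V\<close> at the price of their mean
  distance. The deterministic bound \<open>c\<close> keeps all compensators bounded.\<close>

lemma (in prob_space) martingale_char_bound:
  fixes \<zeta> :: "int \<Rightarrow> 'a \<Rightarrow> real" and \<rho> :: "nat \<Rightarrow> (int \<Rightarrow> real) \<Rightarrow> real" and n :: nat
  assumes ind: "indep_vars (\<lambda>_. borel) \<zeta> UNIV"
    and \<rho>[measurable]: "\<And>i. \<rho> i \<in> borel_measurable (Pi\<^sub>M {..<int i} (\<lambda>_. borel))"
    and R: "\<And>i \<omega>. R i \<omega> = \<rho> i (\<lambda>j\<in>{..<int i}. \<zeta> j \<omega>)"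
    and d[measurable]: "\<And>i. (\<lambda>(y, z). d i y z) \<in> borel_measurable (borel \<Otimes>\<^sub>M borel)"
    and d_bd: "\<And>i y z. \<bar>d i y z\<bar> \<le> \<delta>"
    and d_mean: "\<And>i y. (\<integral>z. d i y z \<partial>distr M borel (\<zeta> (int i))) = 0"
    and v: "\<And>i y. v i y = (\<integral>z. (d i y z)\<^sup>2 \<partial>distr M borel (\<zeta> (int i)))"
    and v_bd: "\<And>i y. v i y \<le> c / n"
    and n: "1 \<le> n" and V: "0 \<le> V" "V \<le> c"
  shows "cmod (expectation (\<lambda>\<omega>. iexp (t * (\<Sum>i=1..n. d i (R i \<omega>) (\<zeta> (int i) \<omega>)))) - complex_of_real (exp (- (t\<^sup>2 * V / 2))))
    \<le> exp (t\<^sup>2 * c) * (t ^ 4 * c\<^sup>2 / (4 * n) + \<bar>t\<bar> ^ 3 * \<delta> * c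
        + t\<^sup>2 / 2 * expectation (\<lambda>\<omega>. \<bar>V - (\<Sum>i=1..n. v i (R i \<omega>))\<bar>))"
proof -
  have \<zeta>[measurable]: "\<zeta> j \<in> borel_measurable M" for j using ind by (auto simp: indep_vars_def)
  let ?\<mu> = "\<lambda>i. distr M borel (\<zeta> (int i))"
  have \<mu>: "prob_space (?\<mu> i)" for i by (rule prob_space_distr) simp
  have past[measurable]: "(\<lambda>\<omega>. \<lambda>j\<in>{..<i}. \<zeta> j \<omega>) \<in> measurable M (Pi\<^sub>M {..<i} (\<lambda>_. borel))" for i
    by (auto intro!: measurable_restrict)
  have [measurable]: "R i \<in> borel_measurable M" for i unfolding R by measurable
  have [measurable]: "v i \<in> borel_measurable borel" for i
  proof -
    interpret \<mu>: prob_space "?\<mu> i" by (rule \<mu>)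
    show ?thesis unfolding v by measurable
  qed
  have d'[measurable]: "(\<lambda>x. d i (f x) (g x)) \<in> borel_measurable M"
    if "f \<in> borel_measurable M" "g \<in> borel_measurable M" for i f g
    using measurable_compose[OF measurable_Pair[OF that] d[of i]] by simp
  have v0: "0 \<le> v i y" for i y unfolding v by simp
  have c0: "0 \<le> c" using order_trans[OF v0 v_bd] n by (simp add: zero_le_divide_iff)
  have cn: "c / n \<le> c" using c0 n mult_left_mono[of 1 "real n" c] by (simp add: divide_le_eq)
  have \<delta>: "0 \<le> \<delta>" by (rule order_trans[OF abs_ge_zero d_bd])
  have sum_v: "(\<Sum>i=1..k. v i (y i)) \<le> c" if "k \<le> n" for k y
  proof -
    have "(\<Sum>i=1..k. v i (y i)) \<le> (\<Sum>i=1..k. c / n)" by (intro sum_mono v_bd)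
    also have "\<dots> = (k / n) * c" by simp
    also have "\<dots> \<le> 1 * c" using that n c0 by (intro mult_right_mono) auto
    finally show ?thesis by simp
  qed
  define S where "S = (\<lambda>k \<omega>. \<Sum>i=1..k. d i (R i \<omega>) (\<zeta> (int i) \<omega>))"
  define W where "W = (\<lambda>k \<omega>. \<Sum>i=1..k. v i (R i \<omega>))"
  \<comment> \<open>The compensated exponential of the partial sum: \<open>W\<close> adds up the
    conditional variances.\<close>
  define Z where "Z = (\<lambda>k \<omega>. exp (\<i> * complex_of_real (t * S k \<omega>) + complex_of_real (t\<^sup>2 * W k \<omega> / 2)))"
  have [measurable]: "S k \<in> borel_measurable M" "W k \<in> borel_measurable M" for k
    unfolding S_def W_def by measurable
  have [measurable]: "Z k \<in> borel_measurable M" for k unfolding Z_def by measurable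
  have exp_le: "exp (t\<^sup>2 * w / 2) \<le> exp (t\<^sup>2 * c / 2)" if "w \<le> c" for w
    using that by (simp add: mult_left_mono)
  have Z_bd: "cmod (Z k \<omega>) \<le> exp (t\<^sup>2 * c / 2)" if "k \<le> n" for k \<omega>
    using exp_le[OF sum_v[OF that]] by (simp add: Z_def W_def)
  have Z_int: "integrable M (Z k)" if "k \<le> n" for k
    using Z_bd[OF that] by (intro integrable_const_bound[where B="exp (t\<^sup>2 * c / 2)"]) auto
  \<comment> \<open>Error of one step, from \<open>char_centered_compensated\<close> with variance
    bound \<open>c / n\<close>. It is of order 1/n^2 plus \<delta>/n, so \<open>n\<close> steps cost
    1/n plus \<delta>.\<close>
  define \<eta> where "\<eta> = exp (t\<^sup>2 * (c / n) / 2) * (t ^ 4 * (c / n)\<^sup>2 / 4 + \<bar>t\<bar> ^ 3 * \<delta> * (c / n))"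
  have step: "cmod (expectation (Z (Suc k)) - expectation (Z k)) \<le> exp (t\<^sup>2 * c / 2) * \<eta>" if k: "Suc k \<le> n" for k
  proof -
    let ?A = "Pi\<^sub>M {..<int (Suc k)} (\<lambda>_. borel :: real measure)"
    let ?P = "\<lambda>\<omega>. \<lambda>j\<in>{..<int (Suc k)}. \<zeta> j \<omega>"
    \<comment> \<open>The increment of \<open>Z\<close> factorises: \<open>F\<close> is the current
      value as a function of the noise before time k + 1, \<open>H\<close> the compensated factor of
      the next step minus 1, whose integral over the new noise is small for every past.\<close>
    define F where "F = (\<lambda>p. exp (\<i> * complex_of_real (t * (\<Sum>i=1..k. d i (\<rho> i (restrict p {..<int i})) (p (int i))))
      + complex_of_real (t\<^sup>2 * (\<Sum>i=1..k. v i (\<rho> i (restrict p {..<int i}))) / 2)))"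
    define H where "H = (\<lambda>(p, z). exp (\<i> * complex_of_real (t * d (Suc k) (\<rho> (Suc k) p) z) + complex_of_real (t\<^sup>2 * v (Suc k) (\<rho> (Suc k) p) / 2)) - 1)"
    have restr: "(\<lambda>p. \<rho> i (restrict p {..<int i})) \<in> borel_measurable ?A" if "i \<in> {1..k}" for i
      using that by (intro measurable_compose[OF measurable_restrict_subset \<rho>]) auto
    have coord: "(\<lambda>p. p (int i)) \<in> borel_measurable ?A" if "i \<in> {1..k}" for i
      using that by (intro measurable_component_singleton) auto
    have F[measurable]: "F \<in> borel_measurable ?A"
    proof -
      have "(\<lambda>p. \<Sum>i=1..k. d i (\<rho> i (restrict p {..<int i})) (p (int i))) \<in> borel_measurable ?A"
        using measurable_compose[OF measurable_Pair[OF restr coord] d] by (intro borel_measurable_sum) auto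
      moreover have "(\<lambda>p. \<Sum>i=1..k. v i (\<rho> i (restrict p {..<int i}))) \<in> borel_measurable ?A"
        by (intro borel_measurable_sum measurable_compose[OF restr]) auto
      ultimately show ?thesis unfolding F_def by measurable
    qed
    have H[measurable]: "H \<in> borel_measurable (?A \<Otimes>\<^sub>M borel)"
    proof -
      have \<rho>1: "(\<lambda>x. \<rho> (Suc k) (fst x)) \<in> borel_measurable (?A \<Otimes>\<^sub>M borel)"
        by (rule measurable_compose[OF measurable_fst \<rho>])
      have "(\<lambda>x. d (Suc k) (\<rho> (Suc k) (fst x)) (snd x)) \<in> borel_measurable (?A \<Otimes>\<^sub>M borel)"
        using measurable_compose[OF measurable_Pair[OF \<rho>1 measurable_snd] d[of "Suc k"]] by simp
      moreover have "(\<lambda>x. v (Suc k) (\<rho> (Suc k) (fst x))) \<in> borel_measurable (?A \<Otimes>\<^sub>M borel)"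
        by (rule measurable_compose[OF \<rho>1]) simp
      ultimately show ?thesis unfolding H_def split_beta' by measurable
    qed
    have FP: "F (?P \<omega>) = Z k \<omega>" for \<omega>
    proof -
      have "restrict (?P \<omega>) {..<int i} = (\<lambda>j\<in>{..<int i}. \<zeta> j \<omega>)" if "i \<in> {1..k}" for i
        using that by (auto simp: restrict_def fun_eq_iff)
      moreover have "?P \<omega> (int i) = \<zeta> (int i) \<omega>" if "i \<in> {1..k}" for i
        using that by auto
      ultimately have "(\<Sum>i=1..k. d i (\<rho> i (restrict (?P \<omega>) {..<int i})) (?P \<omega> (int i))) = S k \<omega>"
        "(\<Sum>i=1..k. v i (\<rho> i (restrict (?P \<omega>) {..<int i}))) = W k \<omega>"
        unfolding S_def W_def R by (auto intro!: sum.cong simp only:)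
      then show ?thesis unfolding F_def Z_def by (simp only:)
    qed
    have HP: "H (?P \<omega>, \<zeta> (int (Suc k)) \<omega>) = exp (\<i> * complex_of_real (t * d (Suc k) (R (Suc k) \<omega>) (\<zeta> (int (Suc k)) \<omega>)) + complex_of_real (t\<^sup>2 * v (Suc k) (R (Suc k) \<omega>) / 2)) - 1" for \<omega>
      by (simp add: H_def R)
    have "Z (Suc k) \<omega> - Z k \<omega> = F (?P \<omega>) * H (?P \<omega>, \<zeta> (int (Suc k)) \<omega>)" for \<omega>
    proof -
      have "Z (Suc k) \<omega> = Z k \<omega> * exp (\<i> * complex_of_real (t * d (Suc k) (R (Suc k) \<omega>) (\<zeta> (int (Suc k)) \<omega>)) + complex_of_real (t\<^sup>2 * v (Suc k) (R (Suc k) \<omega>) / 2))"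
        unfolding Z_def exp_add[symmetric] by (simp add: S_def W_def algebra_simps add_divide_distrib)
      then show ?thesis unfolding FP HP by (simp add: algebra_simps)
    qed
    then have "expectation (Z (Suc k)) - expectation (Z k) = expectation (\<lambda>\<omega>. F (?P \<omega>) * H (?P \<omega>, \<zeta> (int (Suc k)) \<omega>))"
      using Z_int[OF k] Z_int[of k] k by (simp flip: Bochner_Integration.integral_diff)
    also have "cmod \<dots> \<le> exp (t\<^sup>2 * c / 2) * \<eta>"
    proof (rule norm_expectation_indep_le[OF indep_pair_past[OF ind] F H])
      show "cmod (F p) \<le> exp (t\<^sup>2 * c / 2)" for p
        using exp_le[OF sum_v[of k]] k by (simp add: F_def)
      show "cmod (H (p, z)) \<le> exp (t\<^sup>2 * c / 2) + 1" for p z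
        unfolding H_def prod.case
        using exp_le[OF order_trans[OF v_bd cn]] by (intro order_trans[OF norm_triangle_ineq4]) simp
      show "cmod (\<integral>z. H (p, z) \<partial>distr M borel (\<zeta> (int (Suc k)))) \<le> \<eta>" for p
        unfolding H_def prod.case \<eta>_def
      proof (rule prob_space.char_centered_compensated[OF \<mu>])
        show "d (Suc k) (\<rho> (Suc k) p) \<in> borel_measurable (?\<mu> (Suc k))"
          using measurable_Pair2[OF d[of "Suc k"], of "\<rho> (Suc k) p"] by simp
      qed (rule d_bd d_mean v v_bd)+
    qed
    finally show ?thesis .
  qed
  have tel: "cmod (expectation (Z k) - 1) \<le> real k * (exp (t\<^sup>2 * c / 2) * \<eta>)" if "k \<le> n" for k
    using that
  proof (induction k)
    case 0
    show ?case using prob_space by (simp add: Z_def S_def W_def)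
  next
    case (Suc k)
    have "expectation (Z (Suc k)) - 1 = (expectation (Z (Suc k)) - expectation (Z k)) + (expectation (Z k) - 1)" by simp
    also have "cmod \<dots> \<le> exp (t\<^sup>2 * c / 2) * \<eta> + real k * (exp (t\<^sup>2 * c / 2) * \<eta>)"
      using Suc step by (intro order_trans[OF norm_triangle_ineq] add_mono) auto
    finally show ?case by (simp add: algebra_simps)
  qed
  have "real n * (exp (t\<^sup>2 * c / 2) * \<eta>) \<le> exp (t\<^sup>2 * c) * (t ^ 4 * c\<^sup>2 / (4 * n) + \<bar>t\<bar> ^ 3 * \<delta> * c)"
  proof -
    have "real n * (exp (t\<^sup>2 * c / 2) * \<eta>)
      = (exp (t\<^sup>2 * c / 2) * exp (t\<^sup>2 * (c / n) / 2)) * (t ^ 4 * c\<^sup>2 / (4 * n) + \<bar>t\<bar> ^ 3 * \<delta> * c)"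
    proof -
      have "real n * (t ^ 4 * (c / n)\<^sup>2 / 4 + \<bar>t\<bar> ^ 3 * \<delta> * (c / n)) = t ^ 4 * c\<^sup>2 / (4 * n) + \<bar>t\<bar> ^ 3 * \<delta> * c"
        using n by (simp add: distrib_left power_divide power2_eq_square)
      then show ?thesis unfolding \<eta>_def by (simp only: mult.left_commute[of "real n"] mult.assoc)
    qed
    also have "\<dots> \<le> (exp (t\<^sup>2 * c / 2) * exp (t\<^sup>2 * c / 2)) * (t ^ 4 * c\<^sup>2 / (4 * n) + \<bar>t\<bar> ^ 3 * \<delta> * c)"
      using c0 \<delta> exp_le[OF cn] by (intro mult_right_mono mult_left_mono) auto
    also have "exp (t\<^sup>2 * c / 2) * exp (t\<^sup>2 * c / 2) = exp (t\<^sup>2 * c)" by (simp flip: exp_add)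
    finally show ?thesis .
  qed
  with tel[of n] have A: "cmod (expectation (Z n) - 1) \<le> exp (t\<^sup>2 * c) * (t ^ 4 * c\<^sup>2 / (4 * n) + \<bar>t\<bar> ^ 3 * \<delta> * c)"
    by simp
  let ?E = "expectation (\<lambda>\<omega>. \<bar>V - W n \<omega>\<bar>)"
  have intS: "integrable M (\<lambda>\<omega>. iexp (t * S n \<omega>))"
    by (intro integrable_const_bound[where B=1]) auto
  have W0: "0 \<le> W n \<omega>" "W n \<omega> \<le> c" for \<omega>
    unfolding W_def using sum_v[of n] by (auto intro!: sum_nonneg v0)
  have intW: "integrable M (\<lambda>\<omega>. \<bar>V - W n \<omega>\<bar>)"
    using W0 by (intro integrable_const_bound[where B="\<bar>V\<bar> + c"]) (auto intro!: AE_I2 order_trans[OF abs_triangle_ineq4])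
  let ?e = "complex_of_real (exp (t\<^sup>2 * V / 2))"
  have "cmod (expectation (\<lambda>\<omega>. iexp (t * S n \<omega>) * ?e - Z n \<omega>)) \<le> expectation (\<lambda>\<omega>. cmod (iexp (t * S n \<omega>) * ?e - Z n \<omega>))"
    by (rule integral_norm_bound)
  also have "\<dots> \<le> expectation (\<lambda>\<omega>. exp (t\<^sup>2 * c / 2) * (t\<^sup>2 / 2) * \<bar>V - W n \<omega>\<bar>)"
  proof (rule integral_mono)
    fix \<omega>
    have "iexp (t * S n \<omega>) * ?e - Z n \<omega> = iexp (t * S n \<omega>) * complex_of_real (exp (t\<^sup>2 * V / 2) - exp (t\<^sup>2 * W n \<omega> / 2))"
      by (simp only: Z_def exp_add exp_of_real of_real_diff right_diff_distrib)
    then have "cmod (iexp (t * S n \<omega>) * ?e - Z n \<omega>) = \<bar>exp (t\<^sup>2 * V / 2) - exp (t\<^sup>2 * W n \<omega> / 2)\<bar>"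
      by (simp only: norm_mult norm_of_real) simp
    also have "\<dots> \<le> exp (t\<^sup>2 * c / 2) * \<bar>t\<^sup>2 * V / 2 - t\<^sup>2 * W n \<omega> / 2\<bar>"
      using V W0 by (intro abs_exp_diff_le) (auto intro!: mult_left_mono)
    also have "t\<^sup>2 * V / 2 - t\<^sup>2 * W n \<omega> / 2 = t\<^sup>2 / 2 * (V - W n \<omega>)" by (simp add: algebra_simps)
    also have "\<bar>t\<^sup>2 / 2 * (V - W n \<omega>)\<bar> = t\<^sup>2 / 2 * \<bar>V - W n \<omega>\<bar>" by (simp add: abs_mult)
    finally show "cmod (iexp (t * S n \<omega>) * ?e - Z n \<omega>) \<le> exp (t\<^sup>2 * c / 2) * (t\<^sup>2 / 2) * \<bar>V - W n \<omega>\<bar>"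
      by (simp only: mult.assoc)
  qed (intro integrable_norm Bochner_Integration.integrable_diff integrable_mult_left integrable_mult_right intS Z_int intW order_refl)+
  also have "\<dots> = exp (t\<^sup>2 * c / 2) * (t\<^sup>2 / 2) * ?E" by simp
  also have "\<dots> \<le> exp (t\<^sup>2 * c) * (t\<^sup>2 / 2 * ?E)"
    unfolding mult.assoc using c0 by (intro mult_right_mono) auto
  finally have B: "cmod (expectation (\<lambda>\<omega>. iexp (t * S n \<omega>) * ?e - Z n \<omega>)) \<le> exp (t\<^sup>2 * c) * (t\<^sup>2 / 2 * ?E)" .
  have AB: "cmod (expectation (\<lambda>\<omega>. iexp (t * S n \<omega>)) * ?e - 1)
    \<le> exp (t\<^sup>2 * c) * (t ^ 4 * c\<^sup>2 / (4 * n) + \<bar>t\<bar> ^ 3 * \<delta> * c + t\<^sup>2 / 2 * ?E)"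
  proof -
    have "expectation (\<lambda>\<omega>. iexp (t * S n \<omega>) * ?e - Z n \<omega>) = expectation (\<lambda>\<omega>. iexp (t * S n \<omega>)) * ?e - expectation (Z n)"
      by (subst Bochner_Integration.integral_diff) (intro integrable_mult_left intS Z_int order_refl | simp)+
    then have "expectation (\<lambda>\<omega>. iexp (t * S n \<omega>)) * ?e - 1 = expectation (\<lambda>\<omega>. iexp (t * S n \<omega>) * ?e - Z n \<omega>) + (expectation (Z n) - 1)"
      by simp
    also have "cmod \<dots> \<le> exp (t\<^sup>2 * c) * (t\<^sup>2 / 2 * ?E) + exp (t\<^sup>2 * c) * (t ^ 4 * c\<^sup>2 / (4 * n) + \<bar>t\<bar> ^ 3 * \<delta> * c)"
      by (intro order_trans[OF norm_triangle_ineq] add_mono A B)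
    finally show ?thesis by (simp only: distrib_left add_ac)
  qed
    \<comment> \<open>Undo the deterministic compensator; its inverse is at most 1 because
      \<open>V\<close> is nonnegative.\<close>
    let ?X = "expectation (\<lambda>\<omega>. iexp (t * S n \<omega>))"
    have "?X - complex_of_real (exp (- (t\<^sup>2 * V / 2))) = complex_of_real (exp (- (t\<^sup>2 * V / 2))) * (?X * ?e - 1)"
      by (simp add: right_diff_distrib exp_minus mult.left_commute)
    then have "cmod (?X - complex_of_real (exp (- (t\<^sup>2 * V / 2)))) = exp (- (t\<^sup>2 * V / 2)) * cmod (?X * ?e - 1)"
      by (simp only: norm_mult norm_of_real) simp
    also have "\<dots> \<le> 1 * cmod (?X * ?e - 1)" using V by (intro mult_right_mono) auto
    finally show ?thesis using AB unfolding S_def W_def by simp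
qed

subsection \<open>Gaussian linear processes\<close>

lemma powr_diff_mvt:
  fixes a s :: real assumes "0 < a"
  obtains z where "a < z" "z < a + 1" "(a + 1) powr s - a powr s = s * z powr (s - 1)"
proof -
  have "\<exists>z. a < z \<and> z < a + 1 \<and> (a + 1) powr s - a powr s = (a + 1 - a) * (s * z powr (s - 1))"
  proof (rule MVT2)
    fix x assume "a \<le> x"
    with assms show "((\<lambda>x. x powr s) has_real_derivative s * x powr (s - 1)) (at x)"
      by (intro has_real_derivative_powr) auto
  qed simp
  then show ?thesis using that by auto
qed

text \<open>Comparison of sum and integral: by the mean value theorem each term is dominated by an
  increment of the primitive, and the increments telescope.\<close>

lemma sum_powr_le:
  fixes \<beta> :: real assumes "0 < \<beta>" "\<beta> < 1"
  shows "(\<Sum>k=1..n. real k powr (- \<beta>)) \<le> real n powr (1 - \<beta>) / (1 - \<beta>)"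
proof (induction n)
  case (Suc n)
  have "(1 - \<beta>) * real (Suc n) powr (- \<beta>) \<le> real (Suc n) powr (1 - \<beta>) - real n powr (1 - \<beta>)"
  proof (cases "n = 0")
    case True then show ?thesis using assms by simp
  next
    case False
    then obtain z where z: "real n < z" "z < real n + 1" "(real n + 1) powr (1 - \<beta>) - real n powr (1 - \<beta>) = (1 - \<beta>) * z powr (1 - \<beta> - 1)"
      using powr_diff_mvt[of "real n" "1 - \<beta>"] by auto
    have "(real n + 1) powr (- \<beta>) \<le> z powr (- \<beta>)"
      using z assms by (intro powr_mono2') auto
    then show ?thesis using z assms by (simp add: add.commute mult_left_mono)
  qed
  then have "real (Suc n) powr (- \<beta>) \<le> (real (Suc n) powr (1 - \<beta>) - real n powr (1 - \<beta>)) / (1 - \<beta>)"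
    using assms by (simp add: pos_le_divide_eq mult.commute)
  with Suc show ?case by (simp add: diff_divide_distrib)
qed simp

lemma sum_powr_tail_le:
  fixes \<alpha> :: real assumes "0 < \<alpha>" "1 \<le> n"
  shows "(\<Sum>k<N. real (k + n) powr (- 1 - \<alpha>)) \<le> (1 + 1 / \<alpha>) * real n powr (- \<alpha>)"
proof (cases N)
  case (Suc N')
  \<comment> \<open>The induction needs the added tail
    \<open>real (N + n) powr (- \<alpha>) / \<alpha>\<close>, from which each new term is paid. The
    first term accounts for the 1 in the constant, the tail for \<open>1 / \<alpha>\<close>.\<close>
  have "(\<Sum>k<Suc N. real (k + n) powr (- 1 - \<alpha>)) + real (N + n) powr (- \<alpha>) / \<alpha> \<le> (1 + 1 / \<alpha>) * real n powr (- \<alpha>)" for N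
  proof (induction N)
    case 0
    have "real n powr (- 1 - \<alpha>) \<le> real n powr (- \<alpha>)" using assms by (intro powr_mono) auto
    then show ?case by (simp add: algebra_simps)
  next
    case (Suc N)
    have "real (Suc N + n) powr (- 1 - \<alpha>) \<le> (real (N + n) powr (- \<alpha>) - real (Suc N + n) powr (- \<alpha>)) / \<alpha>"
    proof -
      from assms obtain z where z: "real (N + n) < z" "z < real (N + n) + 1"
        "(real (N + n) + 1) powr (- \<alpha>) - real (N + n) powr (- \<alpha>) = - \<alpha> * z powr (- \<alpha> - 1)"
        using powr_diff_mvt[of "real (N + n)" "- \<alpha>"] by auto
      have "(real (N + n) + 1) powr (- \<alpha> - 1) \<le> z powr (- \<alpha> - 1)"
        using z assms by (intro powr_mono2') auto
      then have "\<alpha> * real (Suc N + n) powr (- 1 - \<alpha>) \<le> \<alpha> * z powr (- \<alpha> - 1)"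
        using assms by (intro mult_left_mono) (simp_all add: add.commute minus_diff_commute[of \<alpha> 1])
      also have "\<dots> = real (N + n) powr (- \<alpha>) - real (Suc N + n) powr (- \<alpha>)"
        using z(3) by (simp add: algebra_simps)
      finally show ?thesis using assms by (simp add: pos_le_divide_eq mult.commute)
    qed
    with Suc show ?case by (simp add: diff_divide_distrib add_ac)
  qed
  from this[of N'] show ?thesis using Suc assms by (smt (verit) powr_ge_zero divide_nonneg_pos)
next
  case 0
  have "0 \<le> (1 + 1 / \<alpha>) * real n powr (- \<alpha>)" using assms by (intro mult_nonneg_nonneg) auto
  with 0 show ?thesis by simp
qed

text \<open>The sum over lags is estimated without an asymptotic formula for single covariances. For
  a decreasing envelope \<open>u\<close>, the products with k < n contribute at most S(n) u(d) and
  the rest at most the tail T(n) of the squares. Summing over d < n gives S(n)^2 + n T(n), and both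
  are of order n^(1-\<alpha>).\<close>

lemma lagged_products:
  fixes b :: "nat \<Rightarrow> real"
  assumes \<alpha>: "0 < \<alpha>" "\<alpha> < 1"
    and b: "\<And>k. 1 \<le> k \<Longrightarrow> \<bar>b k\<bar> \<le> A * real k powr (- (\<alpha> + 1) / 2)"
  shows "summable (\<lambda>k. (b k)\<^sup>2)" and "\<And>d. summable (\<lambda>k. b k * b (k + d))"
    and "\<exists>C\<ge>0. \<forall>n\<ge>1. (\<Sum>d<n. \<bar>\<Sum>k. b k * b (k + d)\<bar>) \<le> C * real n powr (1 - \<alpha>)"
proof -
  \<comment> \<open>One constant for index 0 and for the power bound, so that the envelope
    \<open>u\<close> decreases from index 0 on.\<close>
  define B where "B = max A \<bar>b 0\<bar>"
  have B: "0 \<le> B" "A \<le> B" "\<bar>b 0\<bar> \<le> B" by (auto simp: B_def)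
  define u where "u = (\<lambda>k. if k = 0 then B else B * real k powr (- (\<alpha> + 1) / 2))"
  have u0: "0 \<le> u k" for k using B by (simp add: u_def)
  have bu: "\<bar>b k\<bar> \<le> u k" for k
  proof (cases "k = 0")
    case False
    then have "\<bar>b k\<bar> \<le> A * real k powr (- (\<alpha> + 1) / 2)" by (intro b) simp
    also have "\<dots> \<le> B * real k powr (- (\<alpha> + 1) / 2)" using B by (intro mult_right_mono) auto
    finally show ?thesis using False by (simp add: u_def)
  qed (use B in \<open>simp add: u_def\<close>)
  have u_dec: "u k \<le> u j" if "j \<le> k" for j k
  proof (cases "j = 0")
    case True
    have "real k powr (- (\<alpha> + 1) / 2) \<le> 1" if "0 < k"
      using \<alpha> that powr_mono2'[of "- (\<alpha> + 1) / 2" 1 "real k"] by simp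
    then show ?thesis using True B mult_left_mono[of _ 1 B] by (auto simp: u_def)
  next
    case False
    then have "real k powr (- (\<alpha> + 1) / 2) \<le> real j powr (- (\<alpha> + 1) / 2)"
      using that \<alpha> by (intro powr_mono2') auto
    then show ?thesis using False that B by (simp add: u_def mult_left_mono)
  qed
  have usq: "(u k)\<^sup>2 = B\<^sup>2 * real k powr (- 1 - \<alpha>)" if "1 \<le> k" for k
  proof -
    have "(real k powr (- (\<alpha> + 1) / 2))\<^sup>2 = real k powr (- 1 - \<alpha>)"
      using that by (simp add: power2_eq_square minus_diff_commute[of \<alpha> 1] flip: powr_add)
    then show ?thesis using that by (simp add: u_def power_mult_distrib)
  qed
  have u2: "summable (\<lambda>k. (u k)\<^sup>2)"
  proof (rule summable_comparison_test')
    show "summable (\<lambda>k. B\<^sup>2 * real k powr (- 1 - \<alpha>))"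
      using \<alpha> by (intro summable_mult) (simp add: summable_real_powr_iff)
    show "norm ((u k)\<^sup>2) \<le> B\<^sup>2 * real k powr (- 1 - \<alpha>)" if "1 \<le> k" for k using usq[OF that] by simp
  qed
  have b2: "(b k)\<^sup>2 \<le> (u k)\<^sup>2" for k using bu[of k] u0[of k] by (simp add: abs_le_square_iff[symmetric])
  show "summable (\<lambda>k. (b k)\<^sup>2)"
    by (rule summable_comparison_test'[OF u2, of 0]) (simp add: b2)
  have ud: "u k * u (k + d) \<le> (u k)\<^sup>2" for k d
    using u_dec[of k "k + d"] u0[of k] by (simp add: power2_eq_square mult_left_mono)
  have sud: "summable (\<lambda>k. u k * u (k + d))" for d
    by (rule summable_comparison_test'[OF u2, of 0]) (use u0 ud in \<open>simp add: abs_mult\<close>)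
  have bd: "\<bar>b k * b (k + d)\<bar> \<le> u k * u (k + d)" for k d
    unfolding abs_mult by (intro mult_mono bu u0) auto
  show sbd: "summable (\<lambda>k. b k * b (k + d))" for d
    by (rule summable_comparison_test'[OF sud[of d], of 0]) (simp add: bd)
  have bdu: "\<bar>\<Sum>k. b k * b (k + d)\<bar> \<le> (\<Sum>k. u k * u (k + d))" for d
  proof -
    have s: "summable (\<lambda>k. \<bar>b k * b (k + d)\<bar>)"
      by (rule summable_comparison_test'[OF sud[of d], of 0]) (simp add: bd)
    show ?thesis by (rule order_trans[OF summable_rabs[OF s] suminf_le[OF bd s sud]])
  qed
  define S where "S = (\<lambda>n. \<Sum>k<n. u k)"
  define Ta where "Ta = (\<lambda>n. \<Sum>k. (u (k + n))\<^sup>2)"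
  have u2n: "summable (\<lambda>k. (u (k + n))\<^sup>2)" for n using summable_ignore_initial_segment[OF u2] .
  \<comment> \<open>The cut at \<open>n\<close> does not depend on the lag: before it the shifted
    factor is at most \<open>u d\<close>, after it monotonicity leaves squares.\<close>
  have lag: "(\<Sum>k. u k * u (k + d)) \<le> S n * u d + Ta n" for n d
  proof -
    have "(\<Sum>k. u k * u (k + d)) = (\<Sum>k. u (k + n) * u (k + n + d)) + (\<Sum>k<n. u k * u (k + d))"
      by (rule suminf_split_initial_segment[OF sud])
    also have "(\<Sum>k. u (k + n) * u (k + n + d)) \<le> Ta n"
      unfolding Ta_def using summable_ignore_initial_segment[OF sud[of d], of n] u2n
      by (intro suminf_le ud)
    also have "(\<Sum>k<n. u k * u (k + d)) \<le> (\<Sum>k<n. u k * u d)"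
      by (intro sum_mono mult_left_mono u_dec u0) simp
    finally show ?thesis by (simp add: S_def sum_distrib_right)
  qed
  define \<beta> where "\<beta> = (\<alpha> + 1) / 2"
  have e\<beta>: "- (\<alpha> + 1) / 2 = - \<beta>" by (simp only: \<beta>_def minus_divide_left)
  have \<beta>: "0 < \<beta>" "\<beta> < 1" using \<alpha> by (auto simp: \<beta>_def)
  have Sn: "S n \<le> (B + B / (1 - \<beta>)) * real n powr (1 - \<beta>)" if n: "1 \<le> n" for n
  proof -
    have "S n \<le> (\<Sum>k\<le>n. u k)" unfolding S_def by (intro sum_mono2 u0) auto
    also have "\<dots> = u 0 + (\<Sum>k=1..n. u k)" by (simp add: sum.atMost_shift atLeast0_atMost_Suc_eq_insert_0 sum.atLeast1_atMost_eq)
    also have "\<dots> = B + B * (\<Sum>k=1..n. real k powr (- \<beta>))"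
      unfolding sum_distrib_left u_def e\<beta> by (auto intro!: sum.cong)
    also have "\<dots> \<le> B * real n powr (1 - \<beta>) + B * (real n powr (1 - \<beta>) / (1 - \<beta>))"
      using n \<beta> B powr_mono2[of "1 - \<beta>" 1 "real n"] mult_left_mono[of 1 "real n powr (1 - \<beta>)" B]
      by (intro add_mono mult_left_mono sum_powr_le) auto
    finally show ?thesis by (simp add: algebra_simps)
  qed
  have Tn: "Ta n \<le> B\<^sup>2 * (1 + 1 / \<alpha>) * real n powr (- \<alpha>)" if n: "1 \<le> n" for n
    unfolding Ta_def
  proof (rule suminf_le_const[OF u2n])
    fix N
    have "(\<Sum>k<N. (u (k + n))\<^sup>2) = B\<^sup>2 * (\<Sum>k<N. real (k + n) powr (- 1 - \<alpha>))"
      unfolding sum_distrib_left using n by (intro sum.cong refl usq) simp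
    also have "\<dots> \<le> B\<^sup>2 * ((1 + 1 / \<alpha>) * real n powr (- \<alpha>))"
      using \<alpha> n by (intro mult_left_mono sum_powr_tail_le) auto
    finally show "(\<Sum>k<N. (u (k + n))\<^sup>2) \<le> B\<^sup>2 * (1 + 1 / \<alpha>) * real n powr (- \<alpha>)" by (simp add: mult.assoc)
  qed
  define D where "D = B + B / (1 - \<beta>)"
  have D: "0 \<le> D" using B \<beta> by (simp add: D_def)
  show "\<exists>C\<ge>0. \<forall>n\<ge>1. (\<Sum>d<n. \<bar>\<Sum>k. b k * b (k + d)\<bar>) \<le> C * real n powr (1 - \<alpha>)"
  proof (intro exI[of _ "D\<^sup>2 + B\<^sup>2 * (1 + 1 / \<alpha>)"] conjI allI impI)
    show "0 \<le> D\<^sup>2 + B\<^sup>2 * (1 + 1 / \<alpha>)" using \<alpha> by simp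
    fix n :: nat assume n: "1 \<le> n"
    have S0: "0 \<le> S n" unfolding S_def by (intro sum_nonneg u0)
    have "(\<Sum>d<n. \<bar>\<Sum>k. b k * b (k + d)\<bar>) \<le> (\<Sum>d<n. S n * u d + Ta n)"
      by (intro sum_mono order_trans[OF bdu lag])
    also have "\<dots> = (S n)\<^sup>2 + real n * Ta n"
      by (simp add: sum.distrib S_def power2_eq_square flip: sum_distrib_left)
    also have "\<dots> \<le> (D * real n powr (1 - \<beta>))\<^sup>2 + real n * (B\<^sup>2 * (1 + 1 / \<alpha>) * real n powr (- \<alpha>))"
      using Sn[OF n] Tn[OF n] S0 by (intro add_mono power_mono mult_left_mono) (auto simp: D_def)
    also have "(D * real n powr (1 - \<beta>))\<^sup>2 = D\<^sup>2 * real n powr (1 - \<alpha>)"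
    proof -
      have "1 - \<beta> + (1 - \<beta>) = 1 - \<alpha>" by (simp add: \<beta>_def field_simps)
      then have "(real n powr (1 - \<beta>))\<^sup>2 = real n powr (1 - \<alpha>)"
        by (simp only: power2_eq_square powr_add[symmetric])
      then show ?thesis by (simp add: power_mult_distrib)
    qed
    also have "real n * (B\<^sup>2 * (1 + 1 / \<alpha>) * real n powr (- \<alpha>)) = B\<^sup>2 * (1 + 1 / \<alpha>) * real n powr (1 - \<alpha>)"
    proof -
      have "real n powr (1 - \<alpha>) = real n * real n powr (- \<alpha>)"
        using n powr_add[of "real n" 1 "- \<alpha>"] by simp
      then show ?thesis by (simp only: mult_ac)
    qed
    finally show "(\<Sum>d<n. \<bar>\<Sum>k. b k * b (k + d)\<bar>) \<le> (D\<^sup>2 + B\<^sup>2 * (1 + 1 / \<alpha>)) * real n powr (1 - \<alpha>)"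
      by (simp add: distrib_right)
  qed
qed

section \<open>Characteristic functions of linear processes\<close>

lemma (in prob_space) char_normal:
  assumes D: "distributed M lborel Z (normal_density 0 \<sigma>)" and \<sigma>: "0 < \<sigma>"
  shows "expectation (\<lambda>\<omega>. iexp (t * Z \<omega>)) = complex_of_real (exp (- (t\<^sup>2 * \<sigma>\<^sup>2 / 2)))"
proof -
  have [measurable]: "Z \<in> borel_measurable M" using D by (simp add: distributed_def)
  have "distributed M lborel (\<lambda>\<omega>. Z \<omega> / \<sigma>) std_normal_density"
    using D \<sigma> normal_standard_normal_convert[of \<sigma> Z 0] by simp
  then have d: "distr M borel (\<lambda>\<omega>. Z \<omega> / \<sigma>) = std_normal_distribution"
    unfolding distributed_def by (simp cong: distr_cong)
  have "expectation (\<lambda>\<omega>. iexp (t * Z \<omega>)) = expectation (\<lambda>\<omega>. iexp ((t * \<sigma>) * (Z \<omega> / \<sigma>)))"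
    using \<sigma> by simp
  also have "\<dots> = char (distr M borel (\<lambda>\<omega>. Z \<omega> / \<sigma>)) (t * \<sigma>)"
    by (simp only: char_def) (subst integral_distr, auto)
  also have "\<dots> = complex_of_real (exp (- (t\<^sup>2 * \<sigma>\<^sup>2 / 2)))"
    unfolding d char_std_normal_distribution by (simp add: power_mult_distrib)
  finally show ?thesis .
qed

locale gaussian_noise = prob_space M for M :: "'a measure" +
  fixes \<zeta> :: "int \<Rightarrow> 'a \<Rightarrow> real" and \<sigma> :: real
  assumes noise_indep: "indep_vars (\<lambda>_. borel) \<zeta> UNIV"
    and noise_normal: "\<And>i. distributed M lborel (\<zeta> i) (normal_density 0 \<sigma>)"
    and noise_pos: "0 < \<sigma>"
begin

lemma noise_measurable[measurable]: "\<zeta> i \<in> borel_measurable M"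
  using noise_indep by (auto simp: indep_vars_def)

text \<open>Finite partial sums have product characteristic functions by independence; almost sure
  convergence of the series and dominated convergence carry the formula to the limit.\<close>

lemma char_linear_process:
  assumes b: "summable (\<lambda>k. (b k)\<^sup>2)" and Z[measurable]: "Z \<in> borel_measurable M"
    and sums: "AE \<omega> in M. (\<lambda>k. b k * \<zeta> (j - int k) \<omega>) sums Z \<omega>"
  shows "expectation (\<lambda>\<omega>. iexp (t * Z \<omega>)) = complex_of_real (exp (- (t\<^sup>2 * (\<sigma>\<^sup>2 * (\<Sum>k. (b k)\<^sup>2)) / 2)))"
proof -
  define S where "S = (\<lambda>N \<omega>. \<Sum>k<N. b k * \<zeta> (j - int k) \<omega>)"
  have [measurable]: "S N \<in> borel_measurable M" for N unfolding S_def by measurable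
  have fin: "expectation (\<lambda>\<omega>. iexp (t * S N \<omega>)) = complex_of_real (exp (- (t\<^sup>2 * (\<sigma>\<^sup>2 * (\<Sum>k<N. (b k)\<^sup>2)) / 2)))" for N
  proof -
    let ?I = "(\<lambda>k. j - int k) ` {..<N}"
    let ?Y = "\<lambda>l \<omega>. b (nat (j - l)) * \<zeta> l \<omega>"
    have inj: "inj_on (\<lambda>k. j - int k) {..<N}" by (auto simp: inj_on_def)
    have ind: "indep_vars (\<lambda>_. borel) ?Y ?I"
      by (rule indep_vars_compose2[OF indep_vars_subset[OF noise_indep]]) auto
    have S_eq: "S N \<omega> = (\<Sum>l\<in>?I. ?Y l \<omega>)" for \<omega>
      unfolding S_def by (subst sum.reindex[OF inj]) simp
    have "expectation (\<lambda>\<omega>. iexp (t * S N \<omega>)) = char (distr M borel (\<lambda>\<omega>. \<Sum>l\<in>?I. ?Y l \<omega>)) t"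
      unfolding char_def S_eq by (subst integral_distr) auto
    also have "\<dots> = (\<Prod>l\<in>?I. char (distr M borel (?Y l)) t)" by (rule char_distr_sum[OF ind])
    also have "\<dots> = (\<Prod>k<N. char (distr M borel (\<lambda>\<omega>. b k * \<zeta> (j - int k) \<omega>)) t)"
      by (subst prod.reindex[OF inj]) simp
    also have "\<dots> = (\<Prod>k<N. complex_of_real (exp (- ((t * b k)\<^sup>2 * \<sigma>\<^sup>2 / 2))))"
    proof (rule prod.cong[OF refl])
      fix k
      have "char (distr M borel (\<lambda>\<omega>. b k * \<zeta> (j - int k) \<omega>)) t = expectation (\<lambda>\<omega>. iexp ((t * b k) * \<zeta> (j - int k) \<omega>))"
        unfolding char_def by (subst integral_distr) (auto simp: mult.assoc)
      also have "\<dots> = complex_of_real (exp (- ((t * b k)\<^sup>2 * \<sigma>\<^sup>2 / 2)))"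
        by (rule char_normal[OF noise_normal noise_pos])
      finally show "char (distr M borel (\<lambda>\<omega>. b k * \<zeta> (j - int k) \<omega>)) t = complex_of_real (exp (- ((t * b k)\<^sup>2 * \<sigma>\<^sup>2 / 2)))" .
    qed
    also have "\<dots> = complex_of_real (exp (\<Sum>k<N. - ((t * b k)\<^sup>2 * \<sigma>\<^sup>2 / 2)))"
      by (simp only: exp_sum[OF finite_lessThan] of_real_prod)
    also have "(\<Sum>k<N. - ((t * b k)\<^sup>2 * \<sigma>\<^sup>2 / 2)) = - (t\<^sup>2 * (\<sigma>\<^sup>2 * (\<Sum>k<N. (b k)\<^sup>2)) / 2)"
      by (simp add: sum_negf sum_distrib_left sum_divide_distrib power_mult_distrib mult_ac)
    finally show ?thesis .
  qed
  have "(\<lambda>N. expectation (\<lambda>\<omega>. iexp (t * S N \<omega>))) \<longlonglongrightarrow> expectation (\<lambda>\<omega>. iexp (t * Z \<omega>))"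
  proof (rule integral_dominated_convergence[where w="\<lambda>_. 1"])
    show "AE \<omega> in M. (\<lambda>N. iexp (t * S N \<omega>)) \<longlonglongrightarrow> iexp (t * Z \<omega>)"
      using sums
    proof eventually_elim
      case (elim \<omega>)
      then have "(\<lambda>N. S N \<omega>) \<longlonglongrightarrow> Z \<omega>" by (simp add: sums_def S_def)
      then show ?case by (intro tendsto_intros)
    qed
  qed auto
  moreover have "(\<lambda>N. \<Sum>k<N. (b k)\<^sup>2) \<longlonglongrightarrow> (\<Sum>k. (b k)\<^sup>2)" using b by (rule summable_LIMSEQ)
  then have "(\<lambda>N. complex_of_real (exp (- (t\<^sup>2 * (\<sigma>\<^sup>2 * (\<Sum>k<N. (b k)\<^sup>2)) / 2)))) \<longlonglongrightarrow> complex_of_real (exp (- (t\<^sup>2 * (\<sigma>\<^sup>2 * (\<Sum>k. (b k)\<^sup>2)) / 2)))"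
    by (intro tendsto_intros) auto
  ultimately show ?thesis unfolding fin by (rule LIMSEQ_unique)
qed

text \<open>A linear combination of the process at two times is again a one-sided linear process
  seen from the later time, so the formula for a single variable gives the joint law.\<close>

lemma char_linear_process_pair:
  assumes b2: "summable (\<lambda>k. (b k)\<^sup>2)" and bd: "summable (\<lambda>k. b k * b (k + d))"
    and U[measurable]: "U \<in> borel_measurable M" and V[measurable]: "V \<in> borel_measurable M"
    and sU: "AE \<omega> in M. (\<lambda>k. b k * \<zeta> (i - int k) \<omega>) sums U \<omega>"
    and sV: "AE \<omega> in M. (\<lambda>k. b k * \<zeta> (i + int d - int k) \<omega>) sums V \<omega>"
  defines "v \<equiv> \<sigma>\<^sup>2 * (\<Sum>k. (b k)\<^sup>2)" and "r \<equiv> \<sigma>\<^sup>2 * (\<Sum>k. b k * b (k + d))"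
  shows "expectation (\<lambda>\<omega>. iexp (s * U \<omega> + t * V \<omega>))
    = complex_of_real (exp (- (v * s\<^sup>2 + v * t\<^sup>2 + 2 * r * s * t) / 2))"
proof -
  \<comment> \<open>The coefficients of \<open>U\<close> as seen from time i + d: \<open>U\<close>
    is blind to the last \<open>d\<close> innovations.\<close>
  define c where "c = (\<lambda>k. if k < d then 0 else b (k - d))"
  define e where "e = (\<lambda>k. s * c k + t * b k)"
  have sh: "(\<lambda>k. f k) sums y" if "\<And>k. k < d \<Longrightarrow> f k = 0" "(\<lambda>k. f (k + d)) sums y" for f :: "nat \<Rightarrow> real" and y
    using that sums_iff_shift[of f d y] by simp
  have c2: "(\<lambda>k. (c k)\<^sup>2) sums (\<Sum>k. (b k)\<^sup>2)"
    by (rule sh) (use summable_sums[OF b2] in \<open>simp_all add: c_def\<close>)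
  have cb: "(\<lambda>k. c k * b k) sums (\<Sum>k. b k * b (k + d))"
    by (rule sh) (use summable_sums[OF bd] in \<open>simp_all add: c_def\<close>)
  have "(\<lambda>k. s\<^sup>2 * (c k)\<^sup>2 + t\<^sup>2 * (b k)\<^sup>2 + 2 * s * t * (c k * b k)) sums
      (s\<^sup>2 * (\<Sum>k. (b k)\<^sup>2) + t\<^sup>2 * (\<Sum>k. (b k)\<^sup>2) + 2 * s * t * (\<Sum>k. b k * b (k + d)))"
    by (intro sums_add sums_mult c2 cb summable_sums[OF b2])
  moreover have "(e k)\<^sup>2 = s\<^sup>2 * (c k)\<^sup>2 + t\<^sup>2 * (b k)\<^sup>2 + 2 * s * t * (c k * b k)" for k
    by (simp add: e_def power2_sum power_mult_distrib mult_ac)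
  ultimately have e2: "(\<lambda>k. (e k)\<^sup>2) sums (s\<^sup>2 * (\<Sum>k. (b k)\<^sup>2) + t\<^sup>2 * (\<Sum>k. (b k)\<^sup>2) + 2 * s * t * (\<Sum>k. b k * b (k + d)))"
    by simp
  have "AE \<omega> in M. (\<lambda>k. e k * \<zeta> (i + int d - int k) \<omega>) sums (s * U \<omega> + t * V \<omega>)"
    using sU sV
  proof eventually_elim
    case (elim \<omega>)
    have "(\<lambda>k. c k * \<zeta> (i + int d - int k) \<omega>) sums U \<omega>"
      by (rule sh) (use elim(1) in \<open>simp_all add: c_def\<close>)
    then have "(\<lambda>k. s * (c k * \<zeta> (i + int d - int k) \<omega>) + t * (b k * \<zeta> (i + int d - int k) \<omega>)) sums (s * U \<omega> + t * V \<omega>)"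
      by (intro sums_add sums_mult elim(2))
    then show ?case by (simp add: e_def distrib_right mult.assoc)
  qed
  from char_linear_process[OF sums_summable[OF e2] _ this, of 1]
  have "expectation (\<lambda>\<omega>. iexp (s * U \<omega> + t * V \<omega>)) = complex_of_real (exp (- (\<sigma>\<^sup>2 * (\<Sum>k. (e k)\<^sup>2) / 2)))" by simp
  also have "\<sigma>\<^sup>2 * (\<Sum>k. (e k)\<^sup>2) = v * s\<^sup>2 + v * t\<^sup>2 + 2 * r * s * t"
    unfolding sums_unique[OF e2, symmetric] v_def r_def by (simp add: algebra_simps)
  finally show ?thesis by (simp only: minus_divide_left)
qed

end

text \<open>With truncated subtraction, \<open>(i - j) + (j - i)\<close> is the distance of
  \<open>i\<close> and \<open>j\<close>. Each distance is attained at most once on either side of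
  \<open>i\<close>, hence the factor 2.\<close>

lemma sum_lag_le:
  fixes c :: "nat \<Rightarrow> real"
  assumes c: "\<And>d. 0 \<le> c d" and i: "i \<in> {1..n}"
  shows "(\<Sum>j=1..n. c ((i - j) + (j - i))) \<le> 2 * (\<Sum>d<n. c d)"
proof -
  have "(\<Sum>j=1..n. c ((i - j) + (j - i))) = (\<Sum>j\<in>{1..i} \<union> {i<..n}. c ((i - j) + (j - i)))"
    using i by (intro sum.cong) auto
  also have "\<dots> = (\<Sum>j\<in>{1..i}. c ((i - j) + (j - i))) + (\<Sum>j\<in>{i<..n}. c ((i - j) + (j - i)))"
    by (intro sum.union_disjoint) auto
  also have "(\<Sum>j\<in>{1..i}. c ((i - j) + (j - i))) = (\<Sum>j\<in>{1..i}. c (i - j))" by (intro sum.cong) auto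
  also have "\<dots> = sum c ((\<lambda>j. i - j) ` {1..i})" by (subst sum.reindex) (auto simp: inj_on_def)
  also have "\<dots> \<le> (\<Sum>d<n. c d)" using i c by (intro sum_mono2) auto
  also have "(\<Sum>j\<in>{i<..n}. c ((i - j) + (j - i))) = (\<Sum>j\<in>{i<..n}. c (j - i))" by (intro sum.cong) auto
  also have "\<dots> = sum c ((\<lambda>j. j - i) ` {i<..n})" by (subst sum.reindex) (auto simp: inj_on_def)
  also have "\<dots> \<le> (\<Sum>d<n. c d)" using i c by (intro sum_mono2) auto
  finally show ?thesis by simp
qed

text \<open>Schur's test: after bounding the product of two weights by half the sum of their
  squares, only row sums remain, and these are controlled by \<open>sum_lag_le\<close>.\<close>

lemma toeplitz_form_le:
  fixes e c :: "nat \<Rightarrow> real"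
  assumes c: "\<And>d. 0 \<le> c d"
  shows "(\<Sum>i=1..n. \<Sum>j=1..n. \<bar>e i\<bar> * \<bar>e j\<bar> * c ((i - j) + (j - i))) \<le> 2 * (\<Sum>d<n. c d) * (\<Sum>i=1..n. (e i)\<^sup>2)"
proof -
  let ?c = "\<lambda>i j. c ((i - j) + (j - i))"
  have "\<bar>e i\<bar> * \<bar>e j\<bar> * ?c i j \<le> (e i)\<^sup>2 / 2 * ?c i j + (e j)\<^sup>2 / 2 * ?c i j" for i j
  proof -
    have "\<bar>e i\<bar> * \<bar>e j\<bar> \<le> (e i)\<^sup>2 / 2 + (e j)\<^sup>2 / 2"
      using sum_squares_bound[of "\<bar>e i\<bar>" "\<bar>e j\<bar>"] by (simp add: mult.assoc)
    from mult_right_mono[OF this c[of "(i - j) + (j - i)"]] show ?thesis by (simp add: distrib_right)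
  qed
  then have "(\<Sum>i=1..n. \<Sum>j=1..n. \<bar>e i\<bar> * \<bar>e j\<bar> * ?c i j) \<le> (\<Sum>i=1..n. \<Sum>j=1..n. (e i)\<^sup>2 / 2 * ?c i j + (e j)\<^sup>2 / 2 * ?c i j)"
    by (intro sum_mono)
  also have "\<dots> = (\<Sum>i=1..n. \<Sum>j=1..n. (e i)\<^sup>2 / 2 * ?c i j) + (\<Sum>i=1..n. \<Sum>j=1..n. (e j)\<^sup>2 / 2 * ?c i j)"
    by (simp add: sum.distrib)
  also have "(\<Sum>i=1..n. \<Sum>j=1..n. (e j)\<^sup>2 / 2 * ?c i j) = (\<Sum>i=1..n. \<Sum>j=1..n. (e i)\<^sup>2 / 2 * ?c i j)"
    by (subst sum.swap) (simp add: add.commute)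
  also have "(\<Sum>i=1..n. \<Sum>j=1..n. (e i)\<^sup>2 / 2 * ?c i j) + (\<Sum>i=1..n. \<Sum>j=1..n. (e i)\<^sup>2 / 2 * ?c i j)
    = (\<Sum>i=1..n. (e i)\<^sup>2 * (\<Sum>j=1..n. ?c i j))"
    by (simp add: sum_distrib_left flip: sum.distrib)
  also have "\<dots> \<le> (\<Sum>i=1..n. (e i)\<^sup>2 * (2 * (\<Sum>d<n. c d)))"
    by (intro sum_mono mult_left_mono sum_lag_le c) auto
  finally show ?thesis by (simp add: sum_distrib_left sum_distrib_right mult_ac)
qed

section \<open>Second moments of weighted sums over a linear process\<close>

context gaussian_noise
begin

lemma linear_process_stationary:
  assumes b: "summable (\<lambda>k. (b k)\<^sup>2)"
    and X: "X \<in> borel_measurable M" "AE \<omega> in M. (\<lambda>k. b k * \<zeta> (i - int k) \<omega>) sums X \<omega>"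
    and X': "X' \<in> borel_measurable M" "AE \<omega> in M. (\<lambda>k. b k * \<zeta> (j - int k) \<omega>) sums X' \<omega>"
  shows "distr M borel X = distr M borel X'"
proof (intro Levy_uniqueness real_distribution_distr X(1) X'(1) ext)
  fix t show "char (distr M borel X) t = char (distr M borel X') t"
    using char_linear_process[OF b X, of t] char_linear_process[OF b X', of t] X(1) X'(1)
    by (simp add: char_def integral_distr)
qed

text \<open>Covariances decay at least like the correlations, which are summed by
  \<open>lagged_products\<close>. The constant is chosen before \<open>n\<close>, the weights and
  \<open>g\<close>: later \<open>g\<close> varies with the bandwidth and the weights are frozen
  errors.\<close>

lemma linear_process_weighted_sum:
  fixes X :: "nat \<Rightarrow> 'a \<Rightarrow> real"
  assumes \<alpha>: "0 < \<alpha>" "\<alpha> < 1"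
    and b: "\<And>k. 1 \<le> k \<Longrightarrow> \<bar>b k\<bar> \<le> A * real k powr (- (\<alpha> + 1) / 2)"
    and X: "\<And>i. 1 \<le> i \<Longrightarrow> X i \<in> borel_measurable M"
    and lin: "\<And>i. 1 \<le> i \<Longrightarrow> AE \<omega> in M. (\<lambda>k. b k * \<zeta> (int i - int k) \<omega>) sums X i \<omega>"
  shows "\<exists>C\<ge>0. \<forall>n\<ge>1. \<forall>e g. g \<in> borel_measurable borel \<longrightarrow> integrable M (\<lambda>\<omega>. (g (X 1 \<omega>))\<^sup>2) \<longrightarrow>
      expectation (\<lambda>\<omega>. g (X 1 \<omega>)) = 0 \<longrightarrow>
      expectation (\<lambda>\<omega>. (\<Sum>i=1..n. e i * g (X i \<omega>))\<^sup>2)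
        \<le> C * real n powr (1 - \<alpha>) * (\<Sum>i=1..n. (e i)\<^sup>2) * expectation (\<lambda>\<omega>. (g (X 1 \<omega>))\<^sup>2 :: real)"
proof -
  note b2 = lagged_products(1)[OF \<alpha> b] and bd = lagged_products(2)[OF \<alpha> b]
  obtain C where C: "0 \<le> C" "\<And>n. 1 \<le> n \<Longrightarrow> (\<Sum>d<n. \<bar>\<Sum>k. b k * b (k + d)\<bar>) \<le> C * real n powr (1 - \<alpha>)"
    using lagged_products(3)[OF \<alpha> b] by auto
  define v where "v = \<sigma>\<^sup>2 * (\<Sum>k. (b k)\<^sup>2)"
  define r where "r = (\<lambda>d. \<sigma>\<^sup>2 * (\<Sum>k. b k * b (k + d)))"
  have v0: "0 \<le> v" unfolding v_def using b2 by (intro mult_nonneg_nonneg suminf_nonneg) auto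
  have law: "distr M borel (X i) = distr M borel (X 1)" if "1 \<le> i" for i
    by (rule linear_process_stationary[OF b2]) (use X lin that in auto)
  \<comment> \<open>One factor 2 comes from the Gaussian covariance bound, the other from the two
    sides of the diagonal. For \<open>v = 0\<close> this is 0, in agreement with the covariance
    bound in that case.\<close>
  define D where "D = 4 * (\<sigma>\<^sup>2 * C / v)"
  have D0: "0 \<le> D" using C v0 by (simp add: D_def)
  show ?thesis
  proof (intro exI[of _ D] conjI allI impI D0)
    fix n :: nat and e :: "nat \<Rightarrow> real" and g :: "real \<Rightarrow> real"
    assume n: "1 \<le> n" and g[measurable]: "g \<in> borel_measurable borel"
      and g2: "integrable M (\<lambda>\<omega>. (g (X 1 \<omega>))\<^sup>2)" and g0: "expectation (\<lambda>\<omega>. g (X 1 \<omega>)) = 0"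
    have X'[measurable]: "X i \<in> borel_measurable M" if "i \<in> {1..n}" for i using X that by auto
    let ?E = "expectation (\<lambda>\<omega>. (g (X 1 \<omega>))\<^sup>2)"
    have g2': "integrable M (\<lambda>\<omega>. (g (X i \<omega>))\<^sup>2)" and E2': "expectation (\<lambda>\<omega>. (g (X i \<omega>))\<^sup>2) = ?E"
      and E0': "expectation (\<lambda>\<omega>. g (X i \<omega>)) = 0" if i: "1 \<le> i" for i
    proof -
      have [measurable]: "X i \<in> borel_measurable M" "X 1 \<in> borel_measurable M" using X i by auto
      have "integrable (distr M borel (X i)) (\<lambda>x. (g x)\<^sup>2)" unfolding law[OF i] using g2 by (subst integrable_distr_eq) (auto simp del: One_nat_def)
      then show "integrable M (\<lambda>\<omega>. (g (X i \<omega>))\<^sup>2)" by (simp add: integrable_distr_eq)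
      show "expectation (\<lambda>\<omega>. (g (X i \<omega>))\<^sup>2) = ?E"
        using arg_cong[OF law[OF i], of "\<lambda>N. integral\<^sup>L N (\<lambda>x. (g x)\<^sup>2)"] by (simp add: integral_distr del: One_nat_def)
      show "expectation (\<lambda>\<omega>. g (X i \<omega>)) = 0"
        using arg_cong[OF law[OF i], of "\<lambda>N. integral\<^sup>L N g"] g0 by (simp add: integral_distr del: One_nat_def)
    qed
    have cov: "\<bar>expectation (\<lambda>\<omega>. g (X i \<omega>) * g (X (i + d) \<omega>))\<bar> \<le> 2 * (\<bar>r d\<bar> / v) * ?E" if i: "1 \<le> i" for i d
    proof -
      have "\<bar>expectation (\<lambda>\<omega>. g (X i \<omega>) * g (X (i + d) \<omega>))\<bar> \<le> 2 * (\<bar>r d\<bar> / v) * expectation (\<lambda>\<omega>. (g (X i \<omega>))\<^sup>2)"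
      proof (rule gaussian_expectation_mult[OF _ _ v0 _ g g2'[OF i] E0'[OF i]])
        show "X i \<in> borel_measurable M" "X (i + d) \<in> borel_measurable M" using X i by auto
        show "expectation (\<lambda>\<omega>. iexp (s * X i \<omega> + t * X (i + d) \<omega>)) = complex_of_real (exp (- (v * s\<^sup>2 + v * t\<^sup>2 + 2 * r d * s * t) / 2))" for s t
          unfolding v_def r_def
          by (rule char_linear_process_pair[OF b2 bd, where i="int i"])
            (use X[of i] X[of "i + d"] lin[of i] lin[of "i + d"] i in \<open>auto\<close>)
      qed
      then show ?thesis by (simp add: E2'[OF i])
    qed
    define c where "c = (\<lambda>d. 2 * (\<bar>r d\<bar> / v) * ?E)"
    have c0: "0 \<le> c d" for d using v0 by (simp add: c_def)
    have cov2: "\<bar>expectation (\<lambda>\<omega>. g (X i \<omega>) * g (X j \<omega>))\<bar> \<le> c ((i - j) + (j - i))" if "1 \<le> i" "1 \<le> j" for i j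
    proof (cases "i \<le> j")
      case True
      then show ?thesis using cov[OF that(1), of "j - i"] by (simp add: c_def)
    next
      case False
      then show ?thesis using cov[OF that(2), of "i - j"] by (simp add: c_def mult.commute[of "g (X i _)"])
    qed
    have "expectation (\<lambda>\<omega>. (\<Sum>i=1..n. e i * g (X i \<omega>))\<^sup>2) = (\<Sum>i=1..n. \<Sum>j=1..n. expectation (\<lambda>\<omega>. (e i * g (X i \<omega>)) * (e j * g (X j \<omega>))))"
      by (rule integral_sum_square) (use g2' in \<open>auto simp: power_mult_distrib\<close>)
    also have "\<dots> = (\<Sum>i=1..n. \<Sum>j=1..n. e i * e j * expectation (\<lambda>\<omega>. g (X i \<omega>) * g (X j \<omega>)))"
    proof (intro sum.cong refl)
      fix i j
      have "(\<lambda>\<omega>. (e i * g (X i \<omega>)) * (e j * g (X j \<omega>))) = (\<lambda>\<omega>. (e i * e j) * (g (X i \<omega>) * g (X j \<omega>)))" by (auto simp: mult_ac)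
      then show "expectation (\<lambda>\<omega>. (e i * g (X i \<omega>)) * (e j * g (X j \<omega>))) = e i * e j * expectation (\<lambda>\<omega>. g (X i \<omega>) * g (X j \<omega>))"
        by (simp only: integral_mult_right_zero)
    qed
    also have "\<dots> \<le> (\<Sum>i=1..n. \<Sum>j=1..n. \<bar>e i\<bar> * \<bar>e j\<bar> * c ((i - j) + (j - i)))"
    proof (intro sum_mono)
      fix i j assume "i \<in> {1..n}" "j \<in> {1..n}"
      then have "\<bar>e i * e j\<bar> * \<bar>expectation (\<lambda>\<omega>. g (X i \<omega>) * g (X j \<omega>))\<bar> \<le> \<bar>e i * e j\<bar> * c ((i - j) + (j - i))"
        by (intro mult_left_mono cov2) auto
      then show "e i * e j * expectation (\<lambda>\<omega>. g (X i \<omega>) * g (X j \<omega>)) \<le> \<bar>e i\<bar> * \<bar>e j\<bar> * c ((i - j) + (j - i))"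
        unfolding abs_mult[symmetric] by linarith
    qed
    also have "\<dots> \<le> 2 * (\<Sum>d<n. c d) * (\<Sum>i=1..n. (e i)\<^sup>2)" by (rule toeplitz_form_le[OF c0])
    also have "(\<Sum>d<n. c d) = 2 * (\<sigma>\<^sup>2 * (\<Sum>d<n. \<bar>\<Sum>k. b k * b (k + d)\<bar>) / v) * ?E"
      by (simp add: c_def r_def abs_mult sum_distrib_left sum_distrib_right sum_divide_distrib)
    also have "2 * (2 * (\<sigma>\<^sup>2 * (\<Sum>d<n. \<bar>\<Sum>k. b k * b (k + d)\<bar>) / v) * ?E) * (\<Sum>i=1..n. (e i)\<^sup>2)
      \<le> 2 * (2 * (\<sigma>\<^sup>2 * (C * real n powr (1 - \<alpha>)) / v) * ?E) * (\<Sum>i=1..n. (e i)\<^sup>2)"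
      using v0 C(2)[OF n] by (intro mult_left_mono mult_right_mono divide_right_mono sum_nonneg) auto
    also have "\<dots> = D * real n powr (1 - \<alpha>) * (\<Sum>i=1..n. (e i)\<^sup>2) * ?E"
      by (simp add: D_def)
    finally show "expectation (\<lambda>\<omega>. (\<Sum>i=1..n. e i * g (X i \<omega>))\<^sup>2) \<le> D * real n powr (1 - \<alpha>) * (\<Sum>i=1..n. (e i)\<^sup>2) * ?E" .
  qed
qed

end

section \<open>The predictors and their one-step predictions\<close>

locale gaussian_predictor = gaussian_noise M \<zeta> \<sigma> for M :: "'a measure" and \<zeta> \<sigma> +
  fixes a :: "nat \<Rightarrow> real" and \<alpha> A :: real and X :: "nat \<Rightarrow> 'a \<Rightarrow> real"
  assumes memory: "0 < \<alpha>" "\<alpha> < 1"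
    and a_0: "a 0 = 1"
    and a_le: "\<And>k. 1 \<le> k \<Longrightarrow> \<bar>a k\<bar> \<le> A * real k powr (- (\<alpha> + 1) / 2)"
    and X_measurable: "\<And>i. 1 \<le> i \<Longrightarrow> X i \<in> borel_measurable M"
    and X_linear: "\<And>i. 1 \<le> i \<Longrightarrow> AE \<omega> in M. (\<lambda>k. a k * \<zeta> (int i - int k) \<omega>) sums X i \<omega>"
    and X_variance: "variance (X 1) = 1"
begin

text \<open>Lag 0 is kept with coefficient zero instead of shifting indices: the prediction is then
  a linear process at the same time \<open>i\<close> with the same decay, and the second-moment
  bound applies to it as it stands.\<close>

definition past_weights :: "nat \<Rightarrow> real" where
  "past_weights k = (if k = 0 then 0 else a k)"

text \<open>A function on noise paths that reads only indices below \<open>i\<close>, which makes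
  the prediction visibly a function of the past. Paths with a divergent series receive an arbitrary
  value; they have probability zero for \<open>i\<close> at least 1.\<close>

definition prediction :: "nat \<Rightarrow> (int \<Rightarrow> real) \<Rightarrow> real" where
  "prediction i p = (\<Sum>k. a (Suc k) * p (int i - int (Suc k)))"

definition R :: "nat \<Rightarrow> 'a \<Rightarrow> real" where
  "R i \<omega> = prediction i (\<lambda>j\<in>{..<int i}. \<zeta> j \<omega>)"

abbreviation noise_law :: "real measure" where
  "noise_law \<equiv> density lborel (normal_density 0 \<sigma>)"

lemma distr_noise: "distr M borel (\<zeta> i) = noise_law"
  using noise_normal[of i] unfolding distributed_def by (simp cong: distr_cong)

lemma prob_space_noise_law: "prob_space noise_law"
  by (rule prob_space_normal_density) (rule noise_pos)

lemma prediction_measurable[measurable]: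
  "prediction i \<in> borel_measurable (Pi\<^sub>M {..<int i} (\<lambda>_. borel))"
  unfolding prediction_def[abs_def]
  by (intro borel_measurable_suminf borel_measurable_times borel_measurable_const measurable_component_singleton) auto

lemma past_measurable[measurable]:
  "(\<lambda>\<omega>. \<lambda>j\<in>{..<i}. \<zeta> j \<omega>) \<in> measurable M (Pi\<^sub>M {..<i} (\<lambda>_. borel))"
  by (intro measurable_restrict) auto

lemma R_measurable[measurable]: "R i \<in> borel_measurable M"
  unfolding R_def[abs_def] by measurable

lemma R_eq: "R i \<omega> = (\<Sum>k. a (Suc k) * \<zeta> (int i - int (Suc k)) \<omega>)"
  unfolding R_def prediction_def by (intro suminf_cong) simp

lemma X_sums_past:
  assumes "1 \<le> i"
  shows "AE \<omega> in M. X i \<omega> = R i \<omega> + \<zeta> (int i) \<omega> \<and> (\<lambda>k. past_weights k * \<zeta> (int i - int k) \<omega>) sums R i \<omega>"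
  using X_linear[OF assms]
proof eventually_elim
  case (elim \<omega>)
  then have s: "(\<lambda>k. a (Suc k) * \<zeta> (int i - int (Suc k)) \<omega>) sums (X i \<omega> - \<zeta> (int i) \<omega>)"
    using sums_Suc_iff[of "\<lambda>k. a k * \<zeta> (int i - int k) \<omega>" "X i \<omega> - \<zeta> (int i) \<omega>"] by (simp add: a_0)
  then have R: "R i \<omega> = X i \<omega> - \<zeta> (int i) \<omega>" unfolding R_eq by (rule sums_unique[symmetric])
  have "(\<lambda>k. past_weights k * \<zeta> (int i - int k) \<omega>) sums R i \<omega>"
    using s sums_Suc_iff[of "\<lambda>k. past_weights k * \<zeta> (int i - int k) \<omega>" "R i \<omega>"]
    by (simp add: R past_weights_def)
  with R show ?case by simp
qed

lemma past_weights_le: "1 \<le> k \<Longrightarrow> \<bar>past_weights k\<bar> \<le> A * real k powr (- (\<alpha> + 1) / 2)"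
  using a_le by (simp add: past_weights_def)

lemma R_sums: "1 \<le> i \<Longrightarrow> AE \<omega> in M. (\<lambda>k. past_weights k * \<zeta> (int i - int k) \<omega>) sums R i \<omega>"
  using X_sums_past by (auto elim: eventually_mono)

lemma X_split: "1 \<le> i \<Longrightarrow> AE \<omega> in M. X i \<omega> = R i \<omega> + \<zeta> (int i) \<omega>"
  using X_sums_past by (auto elim: eventually_mono)

lemmas X_weighted_sum = linear_process_weighted_sum[OF memory a_le X_measurable X_linear]

lemmas R_weighted_sum = linear_process_weighted_sum[OF memory past_weights_le R_measurable R_sums]

text \<open>The characteristic function is that of a centred normal law of variance
  \<open>v\<close>, positive because \<open>a 0 = 1\<close>. Rescaling to a standard normal variable
  identifies \<open>v\<close> with the variance, which is 1.\<close>

lemma distr_X: assumes "1 \<le> i" shows "distr M borel (X i) = std_normal_distribution"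
proof -
  note One_nat_def[simp del]
  have X1[measurable]: "X 1 \<in> borel_measurable M" by (rule X_measurable) simp
  have a2: "summable (\<lambda>k. (a k)\<^sup>2)" by (rule lagged_products(1)[OF memory a_le])
  define v where "v = \<sigma>\<^sup>2 * (\<Sum>k. (a k)\<^sup>2)"
  have "(\<Sum>k<1. (a k)\<^sup>2) \<le> (\<Sum>k. (a k)\<^sup>2)" by (rule sum_le_suminf[OF a2]) auto
  then have v0: "0 < v" unfolding v_def using noise_pos by (intro mult_pos_pos) (auto simp: a_0)
  have c: "expectation (\<lambda>\<omega>. iexp (t * X 1 \<omega>)) = complex_of_real (exp (- (t\<^sup>2 * v / 2)))" for t
    using char_linear_process[OF a2 X1 X_linear[OF order_refl], of t] by (simp add: v_def)
  define Y where "Y = (\<lambda>\<omega>. X 1 \<omega> / sqrt v)"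
  have Y[measurable]: "Y \<in> borel_measurable M" by (simp add: Y_def)
  have "distr M borel Y = std_normal_distribution"
  proof (intro Levy_uniqueness real_distribution_distr Y real_dist_normal_dist ext)
    fix t
    have "char (distr M borel Y) t = expectation (\<lambda>\<omega>. iexp (t * Y \<omega>))"
      unfolding char_def by (subst integral_distr) auto
    also have "\<dots> = expectation (\<lambda>\<omega>. iexp ((t / sqrt v) * X 1 \<omega>))" by (simp add: Y_def)
    also have "\<dots> = complex_of_real (exp (- t\<^sup>2 / 2))"
      unfolding c using v0 by (simp add: power_divide)
    finally show "char (distr M borel Y) t = char std_normal_distribution t"
      by (simp add: char_std_normal_distribution)
  qed
  then have "distr M lborel Y = std_normal_distribution" by (simp cong: distr_cong)
  then have dY: "distributed M lborel Y std_normal_density"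
    unfolding distributed_def by simp
  have XY: "X 1 \<omega> = sqrt v * Y \<omega>" for \<omega> using v0 by (simp add: Y_def)
  have "variance (X 1) = v * variance Y"
  proof -
    have "(X 1 \<omega> - expectation (X 1))\<^sup>2 = v * (Y \<omega> - expectation Y)\<^sup>2" for \<omega>
      unfolding XY[abs_def] using v0 by (simp add: right_diff_distrib[symmetric] power_mult_distrib)
    then show ?thesis by (simp only: integral_mult_right_zero)
  qed
  then have v1: "v = 1" using X_variance standard_normal_distributed_variance[OF dY] by simp
  have "distr M borel (X i) = distr M borel (X 1)"
    by (rule linear_process_stationary[OF a2]) (use X_measurable X_linear assms in auto)
  also have "\<dots> = std_normal_distribution"
  proof (intro Levy_uniqueness real_distribution_distr X1 real_dist_normal_dist ext)
    fix t
    have "char (distr M borel (X 1)) t = expectation (\<lambda>\<omega>. iexp (t * X 1 \<omega>))"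
      unfolding char_def by (subst integral_distr) auto
    then show "char (distr M borel (X 1)) t = char std_normal_distribution t"
      unfolding c v1 by (simp add: char_std_normal_distribution)
  qed
  finally show ?thesis .
qed

lemma indep_pair_noise:
  "indep_pair (Pi\<^sub>M {..<int i} (\<lambda>_. borel)) (\<lambda>\<omega>. \<lambda>j\<in>{..<int i}. \<zeta> j \<omega>) borel (\<zeta> (int i))"
  by (rule indep_pair_past[OF noise_indep])

text \<open>The tower property: the newest innovation is independent of the past and may be
  integrated out for a fixed value of the prediction.\<close>

lemma expectation_prediction:
  assumes f[measurable]: "f \<in> borel_measurable (borel \<Otimes>\<^sub>M borel)"
    and int: "integrable M (\<lambda>\<omega>. f (R i \<omega>, \<zeta> (int i) \<omega>) :: real)"
  shows "expectation (\<lambda>\<omega>. f (R i \<omega>, \<zeta> (int i) \<omega>)) = expectation (\<lambda>\<omega>. \<integral>z. f (R i \<omega>, z) \<partial>noise_law)"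
proof -
  let ?A = "Pi\<^sub>M {..<int i} (\<lambda>_. borel :: real measure)" and ?P = "\<lambda>\<omega>. \<lambda>j\<in>{..<int i}. \<zeta> j \<omega>"
  interpret N: prob_space noise_law by (rule prob_space_noise_law)
  have \<rho>1: "(\<lambda>x. prediction i (fst x)) \<in> borel_measurable (?A \<Otimes>\<^sub>M borel)"
    by (rule measurable_compose[OF measurable_fst prediction_measurable])
  have g: "(\<lambda>x. f (prediction i (fst x), snd x)) \<in> borel_measurable (?A \<Otimes>\<^sub>M borel)"
    by (rule measurable_compose[OF measurable_Pair[OF \<rho>1 measurable_snd] f])
  have "expectation (\<lambda>\<omega>. f (R i \<omega>, \<zeta> (int i) \<omega>)) = (\<integral>p. (\<integral>z. f (prediction i p, z) \<partial>noise_law) \<partial>distr M ?A ?P)"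
    using expectation_indep_pair[OF indep_pair_noise g] int by (simp add: R_def distr_noise)
  also have "\<dots> = expectation (\<lambda>\<omega>. \<integral>z. f (R i \<omega>, z) \<partial>noise_law)"
    unfolding R_def
  proof (rule integral_distr)
    have "(\<lambda>y. \<integral>z. f (y, z) \<partial>noise_law) \<in> borel_measurable borel" by measurable
    from measurable_compose[OF prediction_measurable this]
    show "(\<lambda>p. \<integral>z. f (prediction i p, z) \<partial>noise_law) \<in> borel_measurable ?A" .
  qed measurable
  finally show ?thesis .
qed

text \<open>The earlier factor is a function of the noise before time \<open>j\<close>, and the
  later one has integral zero over the noise at time \<open>j\<close> for every past; this is
  \<open>norm_expectation_indep_le\<close> with \<open>\<eta> = 0\<close>.\<close>

lemma prediction_orthogonal:
  fixes d :: "nat \<Rightarrow> real \<Rightarrow> real \<Rightarrow> real"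
  assumes d: "\<And>i. (\<lambda>(y, z). d i y z) \<in> borel_measurable (borel \<Otimes>\<^sub>M borel)"
    and bd: "\<And>i y z. \<bar>d i y z\<bar> \<le> B"
    and mean: "\<And>i y. (\<integral>z. d i y z \<partial>noise_law) = 0"
    and ij: "i < j"
  shows "expectation (\<lambda>\<omega>. d i (R i \<omega>) (\<zeta> (int i) \<omega>) * d j (R j \<omega>) (\<zeta> (int j) \<omega>)) = 0"
proof -
  let ?A = "Pi\<^sub>M {..<int j} (\<lambda>_. borel :: real measure)" and ?P = "\<lambda>\<omega>. \<lambda>l\<in>{..<int j}. \<zeta> l \<omega>"
  let ?F = "\<lambda>p. d i (prediction i (restrict p {..<int i})) (p (int i))"
  let ?H = "\<lambda>x. d j (prediction j (fst x)) (snd x)"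
  have "(\<lambda>p. prediction i (restrict p {..<int i})) \<in> borel_measurable ?A"
    using ij by (intro measurable_compose[OF measurable_restrict_subset prediction_measurable]) auto
  moreover have "(\<lambda>p. p (int i)) \<in> borel_measurable ?A"
    using ij by (intro measurable_component_singleton) auto
  ultimately have F: "?F \<in> borel_measurable ?A"
    using measurable_compose[OF measurable_Pair d[of i]] by auto
  have "(\<lambda>x. prediction j (fst x)) \<in> borel_measurable (?A \<Otimes>\<^sub>M borel)"
    by (rule measurable_compose[OF measurable_fst prediction_measurable])
  from measurable_compose[OF measurable_Pair[OF this measurable_snd] d[of j]]
  have H: "?H \<in> borel_measurable (?A \<Otimes>\<^sub>M borel)" by simp
  have "restrict (?P \<omega>) {..<int i} = (\<lambda>l\<in>{..<int i}. \<zeta> l \<omega>)" for \<omega>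
    using ij by (auto simp: restrict_def fun_eq_iff)
  then have FP: "?F (?P \<omega>) = d i (R i \<omega>) (\<zeta> (int i) \<omega>)" for \<omega> using ij by (simp only: R_def) simp
  have "norm (expectation (\<lambda>\<omega>. ?F (?P \<omega>) * ?H (?P \<omega>, \<zeta> (int j) \<omega>))) \<le> B * 0"
    by (rule norm_expectation_indep_le[OF indep_pair_noise F H, where c'=B]) (use bd mean in \<open>simp_all add: distr_noise\<close>)
  then show ?thesis unfolding FP by (simp add: R_def)
qed

end

subsection \<open>Kernel sums along the predictors\<close>

lemma normal_density_le: "normal_density \<mu> \<sigma> z \<le> 1 / sqrt (2 * pi * \<sigma>\<^sup>2)"
proof -
  have "exp (- (z - \<mu>)\<^sup>2 / (2 * \<sigma>\<^sup>2)) \<le> exp 0" by (subst exp_le_cancel_iff) simp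
  then have "1 / sqrt (2 * pi * \<sigma>\<^sup>2) * exp (- (z - \<mu>)\<^sup>2 / (2 * \<sigma>\<^sup>2)) \<le> 1 / sqrt (2 * pi * \<sigma>\<^sup>2) * 1"
    by (intro mult_left_mono) auto
  then show ?thesis unfolding normal_density_def by simp
qed

lemma integral_rescale:
  fixes f :: "real \<Rightarrow> real"
  assumes h: "0 < h"
  shows "(\<integral>u. f ((x - u) / h) * w u \<partial>lborel) = h * (\<integral>s. f s * w (x - h * s) \<partial>lborel)"
proof -
  have "(\<integral>u. f ((x - u) / h) * w u \<partial>lborel) = \<bar>- h\<bar> *\<^sub>R (\<integral>s. f ((x - (x + (- h) * s)) / h) * w (x + (- h) * s) \<partial>lborel)"
    by (rule lborel_integral_real_affine) (use h in simp)
  then show ?thesis using h by simp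
qed

lemma integrable_rescale:
  fixes f :: "real \<Rightarrow> real"
  assumes f: "integrable lborel f" and h: "0 < h"
  shows "integrable lborel (\<lambda>u. f ((x - u) / h))"
proof -
  have "integrable lborel (\<lambda>u. f (x / h + (- 1 / h) * u))"
    by (rule lborel_integrable_real_affine[OF f]) (use h in simp)
  then show ?thesis by (simp add: diff_divide_distrib)
qed

text \<open>After rescaling, dominated convergence with the bounded weight \<open>w\<close>. The
  total mass of \<open>f\<close> is left free so that both \<open>K\<close> and its square are
  covered.\<close>

lemma approximate_identity:
  fixes f w :: "real \<Rightarrow> real"
  assumes f: "integrable lborel f" and w: "w \<in> borel_measurable borel" "\<And>u. \<bar>w u\<bar> \<le> c" "isCont w x"
    and h: "\<And>n. 1 \<le> n \<Longrightarrow> 0 < h n" "h \<longlonglongrightarrow> 0"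
  shows "(\<lambda>n. (\<integral>u. f ((x - u) / h n) * w u \<partial>lborel) / h n) \<longlonglongrightarrow> (\<integral>u. f u \<partial>lborel) * w x"
proof -
  have [measurable]: "f \<in> borel_measurable borel" "w \<in> borel_measurable borel" using f w by auto
  have "(\<lambda>n. \<integral>s. f s * w (x - h n * s) \<partial>lborel) \<longlonglongrightarrow> (\<integral>s. f s * w x \<partial>lborel)"
  proof (rule integral_dominated_convergence[where w="\<lambda>s. \<bar>f s\<bar> * c"])
    show "AE s in lborel. (\<lambda>n. f s * w (x - h n * s)) \<longlonglongrightarrow> f s * w x"
    proof (rule AE_I2)
      fix s
      have "(\<lambda>n. x - h n * s) \<longlonglongrightarrow> x - 0 * s" by (intro tendsto_intros h)
      then have "(\<lambda>n. w (x - h n * s)) \<longlonglongrightarrow> w x" using isCont_tendsto_compose[OF w(3)] by simp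
      then show "(\<lambda>n. f s * w (x - h n * s)) \<longlonglongrightarrow> f s * w x" by (intro tendsto_intros)
    qed
    show "AE s in lborel. norm (f s * w (x - h n * s)) \<le> \<bar>f s\<bar> * c" for n
      using w(2) by (intro AE_I2) (auto simp: abs_mult intro!: mult_left_mono)
  qed (use f in auto)
  moreover have "eventually (\<lambda>n. (\<integral>s. f s * w (x - h n * s) \<partial>lborel) = (\<integral>u. f ((x - u) / h n) * w u \<partial>lborel) / h n) sequentially"
    using eventually_ge_at_top[of 1]
  proof eventually_elim
    case (elim n)
    then show ?case using h(1)[OF elim] integral_rescale[of "h n" f x w] by simp
  qed
  ultimately show ?thesis using f by (simp add: Lim_transform_eventually)
qed

text \<open>A bounded density turns an integrable bump of width \<open>h\<close> into mass of order
  \<open>h\<close>. It is applied to \<open>K\<close> for means and to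
  \<open>\<lambda>s. s\<^sup>2 * K s\<close> for the local bias.\<close>

lemma integral_kernel_density_le:
  fixes f w :: "real \<Rightarrow> real"
  assumes f: "integrable lborel f" "\<And>u. 0 \<le> f u" and w[measurable]: "w \<in> borel_measurable borel"
    and w0: "\<And>u. 0 \<le> w u" "\<And>u. w u \<le> c" and h: "0 < h"
  shows "integrable lborel (\<lambda>u. f ((x - u) / h) * w u)"
    and "(\<integral>u. f ((x - u) / h) * w u \<partial>lborel) \<le> c * (\<integral>u. f u \<partial>lborel) * h"
proof -
  have [measurable]: "f \<in> borel_measurable borel" using f by auto
  note i = integrable_rescale[OF f(1) h, of x]
  have "norm (f ((x - u) / h) * w u) \<le> norm (c * f ((x - u) / h))" for u
    using mult_right_mono[OF w0(2)[of u] f(2)[of "(x - u) / h"]] w0(1)[of u] f(2)[of "(x - u) / h"]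
    by (simp add: mult.commute)
  then show int: "integrable lborel (\<lambda>u. f ((x - u) / h) * w u)"
    using i by (intro Bochner_Integration.integrable_bound[OF integrable_mult_right[OF i, of c]]) auto
  have "(\<integral>u. f ((x - u) / h) * w u \<partial>lborel) \<le> (\<integral>u. f ((x - u) / h) * c \<partial>lborel)"
    using int i w0 f by (intro integral_mono) (auto intro!: mult_left_mono)
  also have "\<dots> = c * (\<integral>u. f u \<partial>lborel) * h"
    using integral_rescale[OF h, of f x "\<lambda>_. c"] by (simp only: integral_mult_left_zero) (simp add: mult_ac)
  finally show "(\<integral>u. f ((x - u) / h) * w u \<partial>lborel) \<le> c * (\<integral>u. f u \<partial>lborel) * h" .
qed

section \<open>Conditional moments of the kernel weights\<close>

locale kernel_predictor = gaussian_predictor M \<zeta> \<sigma> a \<alpha> A X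
  for M :: "'a measure" and \<zeta> \<sigma> a \<alpha> A X +
  fixes K :: "real \<Rightarrow> real" and x :: real
  assumes kernel: "smoothing_kernel K"
begin

definition K_sup :: real where "K_sup = (SUP u. K u)"

text \<open>The value of the noise density at 0, hence its maximum.\<close>

definition noise_sup :: real where "noise_sup = 1 / sqrt (2 * pi * \<sigma>\<^sup>2)"

definition kern :: "real \<Rightarrow> real \<Rightarrow> real" where "kern h z = K ((x - z) / h)"

text \<open>At \<open>y = R i \<omega>\<close> this is the conditional expectation of
  \<open>kern h (X i \<omega>)\<close> given the noise before time \<open>i\<close>;
  \<open>kvar\<close> is the matching conditional variance.\<close>

definition kmean :: "real \<Rightarrow> real \<Rightarrow> real" where "kmean h y = (\<integral>z. kern h (y + z) \<partial>noise_law)"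

definition kvar :: "real \<Rightarrow> real \<Rightarrow> real" where "kvar h y = (\<integral>z. (kern h (y + z) - kmean h y)\<^sup>2 \<partial>noise_law)"

definition EK :: "real \<Rightarrow> real" where "EK h = expectation (\<lambda>\<omega>. kern h (X 1 \<omega>))"

lemma K_integrable: "integrable lborel K" and K_nonneg: "0 \<le> K u" and K_integral: "(\<integral>u. K u \<partial>lborel) = 1"
  using kernel by (auto simp: smoothing_kernel_def)

lemma K_measurable[measurable]: "K \<in> borel_measurable borel"
  using K_integrable by auto

lemma K_le: "K u \<le> K_sup"
  unfolding K_sup_def using kernel
  by (intro cSUP_upper bounded_imp_bdd_above) (auto simp: smoothing_kernel_def)

lemma K_sup_nonneg: "0 \<le> K_sup" using K_nonneg[of 0] K_le[of 0] by linarith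

lemma noise_sup_pos: "0 < noise_sup" using noise_pos by (simp add: noise_sup_def)

lemma K_square_integrable: "integrable lborel (\<lambda>u. (K u)\<^sup>2)"
proof (rule Bochner_Integration.integrable_bound[OF integrable_mult_right[OF K_integrable, of K_sup]])
  show "AE u in lborel. norm ((K u)\<^sup>2) \<le> norm (K_sup * K u)"
    using K_nonneg K_le K_sup_nonneg by (intro AE_I2) (simp add: power2_eq_square mult_right_mono)
qed simp

lemma kern_measurable[measurable]: "kern h \<in> borel_measurable borel" unfolding kern_def[abs_def] by measurable

lemma kern_nonneg: "0 \<le> kern h z" and kern_le: "kern h z \<le> K_sup"
  using K_nonneg K_le by (auto simp: kern_def)

lemma kern_integrable_noise: "integrable noise_law (\<lambda>z. kern h (y + z))" "integrable noise_law (\<lambda>z. (kern h (y + z))\<^sup>2)"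
proof -
  interpret N: prob_space noise_law by (rule prob_space_noise_law)
  show "integrable noise_law (\<lambda>z. kern h (y + z))"
    by (intro N.integrable_const_bound[where B=K_sup]) (auto simp: kern_nonneg kern_le)
  show "integrable noise_law (\<lambda>z. (kern h (y + z))\<^sup>2)"
    by (intro N.integrable_const_bound[where B="K_sup\<^sup>2"]) (auto simp: kern_nonneg kern_le power_mono)
qed

lemma kmean_measurable[measurable]: "kmean h \<in> borel_measurable borel"
proof -
  interpret N: prob_space noise_law by (rule prob_space_noise_law)
  show ?thesis unfolding kmean_def[abs_def] by measurable
qed

lemma kvar_measurable[measurable]: "kvar h \<in> borel_measurable borel"
proof -
  interpret N: prob_space noise_law by (rule prob_space_noise_law)
  show ?thesis unfolding kvar_def[abs_def] by measurable
qed

lemma kmean_nonneg: "0 \<le> kmean h y"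
  unfolding kmean_def by (intro integral_nonneg_AE AE_I2 kern_nonneg)

text \<open>One fresh innovation with bounded density smooths the kernel, so the conditional mean is
  of order h uniformly in the past, although the weight itself is only bounded. This gain is what
  tames the long memory.\<close>

lemma kmean_le: assumes "0 < h" shows "kmean h y \<le> noise_sup * h"
proof -
  have "kmean h y = (\<integral>z. normal_density 0 \<sigma> z *\<^sub>R kern h (y + z) \<partial>lborel)"
    unfolding kmean_def by (intro integral_density) auto
  also have "\<dots> = (\<integral>z. K (((x - y) - z) / h) * normal_density 0 \<sigma> z \<partial>lborel)"
    by (intro Bochner_Integration.integral_cong refl) (simp add: kern_def diff_diff_eq)
  also have "\<dots> \<le> noise_sup * (\<integral>u. K u \<partial>lborel) * h"
    unfolding noise_sup_def
    by (intro integral_kernel_density_le K_integrable K_nonneg normal_density_le assms) auto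
  finally show ?thesis by (simp add: K_integral)
qed

lemma kvar_nonneg: "0 \<le> kvar h y" unfolding kvar_def by simp

lemma kvar_eq: "kvar h y = (\<integral>z. (kern h (y + z))\<^sup>2 \<partial>noise_law) - (kmean h y)\<^sup>2"
proof -
  interpret N: prob_space noise_law by (rule prob_space_noise_law)
  have "kvar h y = (\<integral>z. (kern h (y + z))\<^sup>2 - 2 * kmean h y * kern h (y + z) + (kmean h y)\<^sup>2 \<partial>noise_law)"
    unfolding kvar_def by (intro Bochner_Integration.integral_cong) (auto simp: power2_diff)
  also have "\<dots> = (\<integral>z. (kern h (y + z))\<^sup>2 \<partial>noise_law) - 2 * kmean h y * kmean h y + (kmean h y)\<^sup>2"
    using kern_integrable_noise[of h y] N.prob_space by (simp add: kmean_def)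
  finally show ?thesis by (simp add: power2_eq_square)
qed

text \<open>The squared kernel is at most its supremum times the kernel, which reduces the bound to
  \<open>kmean_le\<close>.\<close>

lemma kvar_le: assumes "0 < h" shows "kvar h y \<le> K_sup * noise_sup * h"
proof -
  have "(\<integral>z. (kern h (y + z))\<^sup>2 \<partial>noise_law) \<le> (\<integral>z. K_sup * kern h (y + z) \<partial>noise_law)"
    using kern_integrable_noise by (intro integral_mono)
      (auto simp: power2_eq_square kern_nonneg kern_le mult_right_mono)
  also have "\<dots> = K_sup * kmean h y" by (simp add: kmean_def)
  also have "\<dots> \<le> K_sup * (noise_sup * h)" by (intro mult_left_mono kmean_le assms K_sup_nonneg)
  finally show ?thesis unfolding kvar_eq mult.assoc using zero_le_power2[of "kmean h y"] by linarith
qed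

lemma kmean_centered: "(\<integral>z. kern h (y + z) - kmean h y \<partial>noise_law) = 0"
proof -
  interpret N: prob_space noise_law by (rule prob_space_noise_law)
  show ?thesis using kern_integrable_noise N.prob_space by (simp add: kmean_def)
qed

lemma X_measurable'[measurable]: "X (Suc i) \<in> borel_measurable M"
  by (rule X_measurable) simp

lemma X_split_all: "AE \<omega> in M. \<forall>i\<ge>1. X i \<omega> = R i \<omega> + \<zeta> (int i) \<omega>"
  unfolding AE_all_countable
proof
  fix i show "AE \<omega> in M. 1 \<le> i \<longrightarrow> X i \<omega> = R i \<omega> + \<zeta> (int i) \<omega>"
    using X_split[of i] by (cases "1 \<le> i") auto
qed

lemma expectation_X:
  assumes i: "1 \<le> i" and g[measurable]: "g \<in> borel_measurable borel"
  shows "expectation (\<lambda>\<omega>. g (X i \<omega>) :: real) = (\<integral>u. g u * std_normal_density u \<partial>lborel)"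
    and "integrable M (\<lambda>\<omega>. g (X i \<omega>)) \<longleftrightarrow> integrable lborel (\<lambda>u. g u * std_normal_density u)"
proof -
  have X[measurable]: "X i \<in> borel_measurable M" using X_measurable[OF i] .
  have "expectation (\<lambda>\<omega>. g (X i \<omega>)) = (\<integral>u. g u \<partial>distr M borel (X i))" by (simp add: integral_distr)
  also have "\<dots> = (\<integral>u. std_normal_density u *\<^sub>R g u \<partial>lborel)"
    unfolding distr_X[OF i] by (intro integral_density) auto
  finally show "expectation (\<lambda>\<omega>. g (X i \<omega>)) = (\<integral>u. g u * std_normal_density u \<partial>lborel)" by (simp add: mult.commute)
  have "integrable M (\<lambda>\<omega>. g (X i \<omega>)) \<longleftrightarrow> integrable (distr M borel (X i)) g" by (simp add: integrable_distr_eq)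
  also have "\<dots> \<longleftrightarrow> integrable lborel (\<lambda>u. std_normal_density u *\<^sub>R g u)"
    unfolding distr_X[OF i] by (intro integrable_density) auto
  finally show "integrable M (\<lambda>\<omega>. g (X i \<omega>)) \<longleftrightarrow> integrable lborel (\<lambda>u. g u * std_normal_density u)" by (simp add: mult.commute)
qed

lemma kern_X_integrable: "1 \<le> i \<Longrightarrow> integrable M (\<lambda>\<omega>. kern h (X i \<omega>))"
  by (intro integrable_const_bound[where B=K_sup] measurable_compose[OF X_measurable]) (auto simp: kern_nonneg kern_le)

lemma EK_eq: "1 \<le> i \<Longrightarrow> expectation (\<lambda>\<omega>. kern h (X i \<omega>)) = EK h"
  unfolding EK_def by (simp only: expectation_X(1)[OF _ kern_measurable] order_refl)

lemma EK_kmean: assumes i: "1 \<le> i" shows "expectation (\<lambda>\<omega>. kmean h (R i \<omega>)) = EK h"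
proof -
  have "EK h = expectation (\<lambda>\<omega>. kern h (R i \<omega> + \<zeta> (int i) \<omega>))"
    unfolding EK_eq[OF i, symmetric] using X_split[OF i] X_measurable[OF i] by (intro integral_cong_AE) auto
  also have "\<dots> = expectation (\<lambda>\<omega>. \<integral>z. kern h (R i \<omega> + z) \<partial>noise_law)"
    using expectation_prediction[of "\<lambda>(y, z). kern h (y + z)" i]
    by (simp add: integrable_const_bound[where B=K_sup] kern_nonneg kern_le)
  finally show ?thesis by (simp add: kmean_def)
qed

lemma kmean_R_integrable: "0 < h \<Longrightarrow> integrable M (\<lambda>\<omega>. kmean h (R i \<omega>))"
  using kmean_le[of h] kmean_nonneg[of h] by (intro integrable_const_bound[where B="noise_sup * h"]) auto

lemma kmean_R_square_integrable: "0 < h \<Longrightarrow> integrable M (\<lambda>\<omega>. (kmean h (R i \<omega>))\<^sup>2)"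
  using kmean_le[of h] kmean_nonneg[of h]
  by (intro integrable_const_bound[where B="(noise_sup * h)\<^sup>2"]) (auto simp: power_mono)

lemma kvar_R_integrable: "0 < h \<Longrightarrow> integrable M (\<lambda>\<omega>. kvar h (R i \<omega>))"
  using kvar_le[of h] kvar_nonneg[of h] by (intro integrable_const_bound[where B="K_sup * noise_sup * h"]) auto

lemma EK_le: assumes "0 < h" shows "0 \<le> EK h" "EK h \<le> noise_sup * h"
proof -
  show "0 \<le> EK h" unfolding EK_def by (intro integral_nonneg_AE AE_I2 kern_nonneg)
  have "EK h = expectation (\<lambda>\<omega>. kmean h (R 1 \<omega>))" by (simp add: EK_kmean)
  also have "\<dots> \<le> expectation (\<lambda>_. noise_sup * h)"
    using kmean_R_integrable[OF assms] kmean_le[OF assms] by (intro integral_mono) auto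
  finally show "EK h \<le> noise_sup * h" using prob_space by simp
qed

lemma kmean_EK_abs_le: assumes "0 < h" shows "\<bar>kmean h y - EK h\<bar> \<le> noise_sup * h"
  using EK_le[OF assms] kmean_nonneg[of h y] kmean_le[OF assms, of y] by linarith

lemma expectation_kvar_R:
  assumes h: "0 < h"
  shows "expectation (\<lambda>\<omega>. kvar h (R 1 \<omega>)) = expectation (\<lambda>\<omega>. (kern h (X 1 \<omega>))\<^sup>2) - expectation (\<lambda>\<omega>. (kmean h (R 1 \<omega>))\<^sup>2)"
proof -
  interpret N: prob_space noise_law by (rule prob_space_noise_law)
  have bd: "\<bar>\<integral>z. (kern h (y + z))\<^sup>2 \<partial>noise_law\<bar> \<le> K_sup\<^sup>2" for y
  proof -
    have "(\<integral>z. (kern h (y + z))\<^sup>2 \<partial>noise_law) \<le> (\<integral>z. K_sup\<^sup>2 \<partial>noise_law)"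
      using kern_integrable_noise by (intro integral_mono) (auto simp: kern_nonneg kern_le power_mono)
    moreover have "0 \<le> (\<integral>z. (kern h (y + z))\<^sup>2 \<partial>noise_law)" by simp
    ultimately show ?thesis using N.prob_space by simp
  qed
  have i1: "integrable M (\<lambda>\<omega>. \<integral>z. (kern h (R 1 \<omega> + z))\<^sup>2 \<partial>noise_law)"
    using bd by (intro integrable_const_bound[where B="K_sup\<^sup>2"]) auto
  have "expectation (\<lambda>\<omega>. (kern h (X 1 \<omega>))\<^sup>2) = expectation (\<lambda>\<omega>. (kern h (R 1 \<omega> + \<zeta> (int 1) \<omega>))\<^sup>2)"
    using X_split[of 1] X_measurable[of 1] by (intro integral_cong_AE) auto
  also have "\<dots> = expectation (\<lambda>\<omega>. \<integral>z. (kern h (R 1 \<omega> + z))\<^sup>2 \<partial>noise_law)"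
    using expectation_prediction[of "\<lambda>(y, z). (kern h (y + z))\<^sup>2" 1]
    by (simp add: integrable_const_bound[where B="K_sup\<^sup>2"] kern_nonneg kern_le power_mono)
  finally show ?thesis unfolding kvar_eq using i1 kmean_R_square_integrable[OF h]
    by (subst Bochner_Integration.integral_diff) auto
qed

lemma std_normal_density_bounded: "\<bar>std_normal_density u\<bar> \<le> 1 / sqrt (2 * pi)"
  using normal_density_le[of 0 1 u] by simp

lemma isCont_std_normal_density: "isCont std_normal_density u"
  unfolding std_normal_density_def[abs_def] by (intro continuous_intros) auto

text \<open>The normal density is positive everywhere, so a zero mean would make \<open>K\<close>
  vanish almost everywhere, against its integral being 1.\<close>

lemma EK_pos: assumes "0 < h" shows "0 < EK h"
proof -
  have i: "integrable lborel (\<lambda>u. K ((x - u) / h) * std_normal_density u)"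
    using std_normal_density_bounded
    by (intro integral_kernel_density_le(1)[OF K_integrable K_nonneg, where c="1 / sqrt (2 * pi)"] assms) auto
  have e: "EK h = (\<integral>u. K ((x - u) / h) * std_normal_density u \<partial>lborel)"
    unfolding EK_def using expectation_X(1)[of 1 "kern h"] by (simp add: kern_def)
  have "EK h \<noteq> 0"
  proof
    assume "EK h = 0"
    then have "AE u in lborel. K ((x - u) / h) * std_normal_density u = 0"
      using integral_nonneg_eq_0_iff_AE[OF i] K_nonneg e by simp
    then have "AE u in lborel. K ((x - u) / h) = 0"
    proof eventually_elim
      case (elim u) then show ?case using normal_density_pos[of 1 0 u] by auto
    qed
    then have "(\<integral>u. K ((x - u) / h) * 1 \<partial>lborel) = 0"
      by (intro integral_eq_zero_AE) simp
    then show False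
      using integral_rescale[OF assms, of K x "\<lambda>_. 1"] K_integral assms by simp
  qed
  then show ?thesis using EK_le(1)[OF assms] by simp
qed

context
  fixes h :: "nat \<Rightarrow> real"
  assumes h_pos: "\<And>n. 1 \<le> n \<Longrightarrow> 0 < h n" and h_lim: "h \<longlonglongrightarrow> 0"
begin

lemma EK_limit: "(\<lambda>n. EK (h n) / h n) \<longlonglongrightarrow> std_normal_density x"
proof -
  have "(\<lambda>n. (\<integral>u. K ((x - u) / h n) * std_normal_density u \<partial>lborel) / h n) \<longlonglongrightarrow> (\<integral>u. K u \<partial>lborel) * std_normal_density x"
    by (rule approximate_identity[OF K_integrable _ std_normal_density_bounded isCont_std_normal_density h_pos h_lim]) auto
  then show ?thesis
    unfolding EK_def using expectation_X(1)[of 1 "kern (h _)"] by (simp add: kern_def K_integral)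
qed

lemma kern_square_limit: "(\<lambda>n. expectation (\<lambda>\<omega>. (kern (h n) (X 1 \<omega>))\<^sup>2) / h n) \<longlonglongrightarrow> kappa1 K * std_normal_density x"
proof -
  have "(\<lambda>n. (\<integral>u. (K ((x - u) / h n))\<^sup>2 * std_normal_density u \<partial>lborel) / h n) \<longlonglongrightarrow> (\<integral>u. (K u)\<^sup>2 \<partial>lborel) * std_normal_density x"
    by (rule approximate_identity[OF K_square_integrable _ std_normal_density_bounded isCont_std_normal_density h_pos h_lim]) auto
  then show ?thesis
    using expectation_X(1)[of 1 "\<lambda>z. (kern (h _) z)\<^sup>2"] by (simp add: kern_def kappa1_def)
qed

text \<open>The squared conditional mean is of order h^2 and drops out after division by h, so
  conditional variance and raw second moment have the same leading term.\<close>

lemma kvar_limit: "(\<lambda>n. expectation (\<lambda>\<omega>. kvar (h n) (R 1 \<omega>)) / h n) \<longlonglongrightarrow> kappa1 K * std_normal_density x"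
proof -
  have "(\<lambda>n. expectation (\<lambda>\<omega>. (kmean (h n) (R 1 \<omega>))\<^sup>2) / h n) \<longlonglongrightarrow> 0"
  proof (rule Lim_null_comparison)
    show "eventually (\<lambda>n. norm (expectation (\<lambda>\<omega>. (kmean (h n) (R 1 \<omega>))\<^sup>2) / h n) \<le> noise_sup\<^sup>2 * h n) sequentially"
      using eventually_ge_at_top[of 1]
    proof eventually_elim
      case (elim n)
      note hp = h_pos[OF elim]
      have "expectation (\<lambda>\<omega>. (kmean (h n) (R 1 \<omega>))\<^sup>2) \<le> expectation (\<lambda>_. (noise_sup * h n)\<^sup>2)"
        using kmean_R_square_integrable[OF hp] kmean_le[OF hp] kmean_nonneg by (intro integral_mono power_mono) auto
      then show ?case using hp prob_space by (simp add: divide_le_eq power_mult_distrib power2_eq_square mult_ac)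
    qed
    show "(\<lambda>n. noise_sup\<^sup>2 * h n) \<longlonglongrightarrow> 0" using tendsto_mult_right_zero[OF h_lim] .
  qed
  from tendsto_diff[OF kern_square_limit this]
  have "(\<lambda>n. (expectation (\<lambda>\<omega>. (kern (h n) (X 1 \<omega>))\<^sup>2) - expectation (\<lambda>\<omega>. (kmean (h n) (R 1 \<omega>))\<^sup>2)) / h n) \<longlonglongrightarrow> kappa1 K * std_normal_density x"
    by (simp add: diff_divide_distrib)
  then show ?thesis
  proof (rule Lim_transform_eventually)
    show "eventually (\<lambda>n. (expectation (\<lambda>\<omega>. (kern (h n) (X 1 \<omega>))\<^sup>2) - expectation (\<lambda>\<omega>. (kmean (h n) (R 1 \<omega>))\<^sup>2)) / h n = expectation (\<lambda>\<omega>. kvar (h n) (R 1 \<omega>)) / h n) sequentially"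
      using eventually_ge_at_top[of 1] by eventually_elim (simp only: expectation_kvar_R[OF h_pos])
  qed
qed

end

text \<open>Off-diagonal terms vanish by \<open>prediction_orthogonal\<close> and each diagonal term
  is a mean conditional variance. No power of \<open>n\<close> from the memory appears.\<close>

lemma martingale_part_square:
  assumes h: "0 < h"
  shows "integrable M (\<lambda>\<omega>. (\<Sum>i=1..n. e i * (kern h (R i \<omega> + \<zeta> (int i) \<omega>) - kmean h (R i \<omega>)))\<^sup>2)"
    and "expectation (\<lambda>\<omega>. (\<Sum>i=1..n. e i * (kern h (R i \<omega> + \<zeta> (int i) \<omega>) - kmean h (R i \<omega>)))\<^sup>2)
      \<le> K_sup * noise_sup * h * (\<Sum>i=1..n. (e i)\<^sup>2)"
proof -
  define d where "d = (\<lambda>(i::nat) y z. kern h (y + z) - kmean h y)"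
  define D where "D = (\<lambda>i \<omega>. d i (R i \<omega>) (\<zeta> (int i) \<omega>))"
  have dm: "(\<lambda>(y, z). d i y z) \<in> borel_measurable (borel \<Otimes>\<^sub>M borel)" for i unfolding d_def by measurable
  have [measurable]: "D i \<in> borel_measurable M" for i unfolding D_def d_def by measurable
  have d_bd: "\<bar>d i y z\<bar> \<le> K_sup + noise_sup * h" for i y z
    unfolding d_def using kern_nonneg[of h "y + z"] kern_le[of h "y + z"] kmean_nonneg[of h y] kmean_le[OF h, of y] by linarith
  have D2: "integrable M (\<lambda>\<omega>. (D i \<omega>)\<^sup>2)" for i
  proof (intro integrable_const_bound[where B="(K_sup + noise_sup * h)\<^sup>2"] AE_I2)
    fix \<omega>
    have "0 \<le> K_sup + noise_sup * h" using order_trans[OF abs_ge_zero d_bd] .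
    then show "norm ((D i \<omega>)\<^sup>2) \<le> (K_sup + noise_sup * h)\<^sup>2"
      using d_bd[of i "R i \<omega>" "\<zeta> (int i) \<omega>"] by (simp add: D_def abs_le_square_iff[symmetric])
  qed simp
  have d_mean: "(\<integral>z. d i y z \<partial>noise_law) = 0" for i y
    unfolding d_def by (rule kmean_centered)
  have orth: "expectation (\<lambda>\<omega>. D i \<omega> * D j \<omega>) = 0" if "i \<noteq> j" for i j
    using prediction_orthogonal[OF dm d_bd d_mean, of i j] prediction_orthogonal[OF dm d_bd d_mean, of j i] that
    by (cases "i < j") (auto simp: D_def mult.commute)
  have diag: "expectation (\<lambda>\<omega>. D i \<omega> * D i \<omega>) \<le> K_sup * noise_sup * h" for i
  proof -
    have "expectation (\<lambda>\<omega>. D i \<omega> * D i \<omega>) = expectation (\<lambda>\<omega>. \<integral>z. (d i (R i \<omega>) z)\<^sup>2 \<partial>noise_law)"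
      using expectation_prediction[of "\<lambda>(y, z). (d i y z)\<^sup>2" i] D2[of i] dm[of i] by (simp add: D_def split_beta' power2_eq_square)
    also have "\<dots> = expectation (\<lambda>\<omega>. kvar h (R i \<omega>))" by (simp add: kvar_def d_def)
    also have "\<dots> \<le> expectation (\<lambda>_. K_sup * noise_sup * h)"
      using kvar_R_integrable[OF h] kvar_le[OF h] by (intro integral_mono) auto
    finally show ?thesis using prob_space by simp
  qed
  have D2e: "integrable M (\<lambda>\<omega>. (e i * D i \<omega>)\<^sup>2)" for i using D2 by (simp add: power_mult_distrib)
  show "integrable M (\<lambda>\<omega>. (\<Sum>i=1..n. e i * (kern h (R i \<omega> + \<zeta> (int i) \<omega>) - kmean h (R i \<omega>)))\<^sup>2)"
    using integrable_sum_square[of "{1..n}" "\<lambda>i \<omega>. e i * D i \<omega>" M] D2e by (simp add: D_def d_def)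
  have "expectation (\<lambda>\<omega>. (\<Sum>i=1..n. e i * D i \<omega>)\<^sup>2) = (\<Sum>i=1..n. \<Sum>j=1..n. expectation (\<lambda>\<omega>. (e i * D i \<omega>) * (e j * D j \<omega>)))"
    by (rule integral_sum_square) (use D2e in auto)
  also have "\<dots> = (\<Sum>i=1..n. \<Sum>j=1..n. e i * e j * expectation (\<lambda>\<omega>. D i \<omega> * D j \<omega>))"
  proof (intro sum.cong refl)
    fix i j
    have "(\<lambda>\<omega>. (e i * D i \<omega>) * (e j * D j \<omega>)) = (\<lambda>\<omega>. (e i * e j) * (D i \<omega> * D j \<omega>))" by (auto simp: mult_ac)
    then show "expectation (\<lambda>\<omega>. (e i * D i \<omega>) * (e j * D j \<omega>)) = e i * e j * expectation (\<lambda>\<omega>. D i \<omega> * D j \<omega>)"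
      by (simp only: integral_mult_right_zero)
  qed
  also have "\<dots> = (\<Sum>i=1..n. \<Sum>j=1..n. if j = i then (e i)\<^sup>2 * expectation (\<lambda>\<omega>. D i \<omega> * D i \<omega>) else 0)"
    using orth by (intro sum.cong refl) (auto simp: power2_eq_square)
  also have "\<dots> = (\<Sum>i=1..n. (e i)\<^sup>2 * expectation (\<lambda>\<omega>. D i \<omega> * D i \<omega>))" by simp
  also have "\<dots> \<le> (\<Sum>i=1..n. (e i)\<^sup>2 * (K_sup * noise_sup * h))"
    by (intro sum_mono mult_left_mono diag) auto
  also have "\<dots> = K_sup * noise_sup * h * (\<Sum>i=1..n. (e i)\<^sup>2)" by (simp add: sum_distrib_left mult.commute)
  finally show "expectation (\<lambda>\<omega>. (\<Sum>i=1..n. e i * (kern h (R i \<omega> + \<zeta> (int i) \<omega>) - kmean h (R i \<omega>)))\<^sup>2)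
      \<le> K_sup * noise_sup * h * (\<Sum>i=1..n. (e i)\<^sup>2)"
    by (simp add: D_def d_def)
qed

text \<open>A uniform bound on \<open>g\<close> replaces its second moment. For the centred
  \<open>kmean\<close> and \<open>kvar\<close> the bound is of order h, so the square supplies the
  decisive factor h^2.\<close>

lemma bounded_R_sum_square:
  "\<exists>C\<ge>0. \<forall>n\<ge>1. \<forall>e g c. g \<in> borel_measurable borel \<longrightarrow> (\<forall>y. \<bar>g y\<bar> \<le> c) \<longrightarrow> expectation (\<lambda>\<omega>. g (R 1 \<omega>)) = 0 \<longrightarrow>
    integrable M (\<lambda>\<omega>. (\<Sum>i=1..n. e i * g (R i \<omega>))\<^sup>2) \<and>
    expectation (\<lambda>\<omega>. (\<Sum>i=1..n. e i * g (R i \<omega>))\<^sup>2) \<le> C * real n powr (1 - \<alpha>) * (\<Sum>i=1..n. (e i)\<^sup>2) * c\<^sup>2"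
proof -
  obtain C where C0: "0 \<le> C" and C1: "\<forall>n\<ge>1. \<forall>e g. g \<in> borel_measurable borel \<longrightarrow> integrable M (\<lambda>\<omega>. (g (R 1 \<omega>))\<^sup>2) \<longrightarrow>
      expectation (\<lambda>\<omega>. g (R 1 \<omega>)) = 0 \<longrightarrow>
      expectation (\<lambda>\<omega>. (\<Sum>i=1..n. e i * g (R i \<omega>))\<^sup>2)
        \<le> C * real n powr (1 - \<alpha>) * (\<Sum>i=1..n. (e i)\<^sup>2) * expectation (\<lambda>\<omega>. (g (R 1 \<omega>))\<^sup>2 :: real)"
    using R_weighted_sum by blast
  show ?thesis
  proof (intro exI[of _ C] conjI allI impI C0)
    fix n :: nat and e :: "nat \<Rightarrow> real" and g :: "real \<Rightarrow> real" and c :: real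
    assume n: "1 \<le> n" and g[measurable]: "g \<in> borel_measurable borel" and bd: "\<forall>y. \<bar>g y\<bar> \<le> c"
      and E0: "expectation (\<lambda>\<omega>. g (R 1 \<omega>)) = 0"
    have sq: "(g y)\<^sup>2 \<le> c\<^sup>2" for y
      using bd[rule_format, of y] by (simp add: abs_le_square_iff[symmetric])
    have g2: "integrable M (\<lambda>\<omega>. (g (R i \<omega>))\<^sup>2)" for i
      using sq by (intro integrable_const_bound[where B="c\<^sup>2"]) auto
    show "integrable M (\<lambda>\<omega>. (\<Sum>i=1..n. e i * g (R i \<omega>))\<^sup>2)"
      using g2 by (intro integrable_sum_square) (auto simp: power_mult_distrib)
    have "expectation (\<lambda>\<omega>. (g (R 1 \<omega>))\<^sup>2) \<le> expectation (\<lambda>_. c\<^sup>2)"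
      using g2 sq by (intro integral_mono) auto
    then have "expectation (\<lambda>\<omega>. (g (R 1 \<omega>))\<^sup>2) \<le> c\<^sup>2" using prob_space by simp
    then have "C * real n powr (1 - \<alpha>) * (\<Sum>i=1..n. (e i)\<^sup>2) * expectation (\<lambda>\<omega>. (g (R 1 \<omega>))\<^sup>2)
      \<le> C * real n powr (1 - \<alpha>) * (\<Sum>i=1..n. (e i)\<^sup>2) * c\<^sup>2"
      using C0 by (intro mult_left_mono mult_nonneg_nonneg sum_nonneg) auto
    with C1[rule_format, OF n g g2 E0] show "expectation (\<lambda>\<omega>. (\<Sum>i=1..n. e i * g (R i \<omega>))\<^sup>2) \<le> C * real n powr (1 - \<alpha>) * (\<Sum>i=1..n. (e i)\<^sup>2) * c\<^sup>2"
      by (rule order_trans)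
  qed
qed

end

section \<open>Kernel sums with deterministic weights\<close>

context kernel_predictor
begin

lemma kmean_le_K_sup: "kmean h y \<le> K_sup"
proof -
  interpret N: prob_space noise_law by (rule prob_space_noise_law)
  have "kmean h y \<le> (\<integral>z. K_sup \<partial>noise_law)"
    unfolding kmean_def using kern_integrable_noise by (intro integral_mono) (auto simp: kern_le)
  then show ?thesis using N.prob_space by simp
qed

lemma kernel_sum_split:
  "AE \<omega> in M. (\<Sum>i=1..n. e i * (kern h (X i \<omega>) - EK h))
    = (\<Sum>i=1..n. e i * (kern h (R i \<omega> + \<zeta> (int i) \<omega>) - kmean h (R i \<omega>))) + (\<Sum>i=1..n. e i * (kmean h (R i \<omega>) - EK h))"
  using X_split_all
proof eventually_elim
  case (elim \<omega>)
  then have "(\<Sum>i=1..n. e i * (kern h (X i \<omega>) - EK h)) = (\<Sum>i=1..n. e i * (kern h (R i \<omega> + \<zeta> (int i) \<omega>) - EK h))"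
    by (intro sum.cong) auto
  also have "\<dots> = (\<Sum>i=1..n. e i * (kern h (R i \<omega> + \<zeta> (int i) \<omega>) - kmean h (R i \<omega>))) + (\<Sum>i=1..n. e i * (kmean h (R i \<omega>) - EK h))"
    by (simp add: algebra_simps flip: sum.distrib)
  finally show ?case .
qed

lemma kernel_sum_measurable: "(\<lambda>\<omega>. \<Sum>i=1..n. e i * (kern h (X i \<omega>) - EK h)) \<in> borel_measurable M"
  by (intro borel_measurable_sum borel_measurable_times borel_measurable_diff borel_measurable_const
      measurable_compose[OF X_measurable kern_measurable]) auto

text \<open>The term of order h comes from the martingale part, the one of order h^2 n^(1-\<alpha>)
  from the predictable part. Under the memory condition on the bandwidth the former
  dominates.\<close>

lemma kernel_sum_square:
  "\<exists>C\<ge>0. \<forall>h>0. \<forall>n\<ge>1. \<forall>e. integrable M (\<lambda>\<omega>. (\<Sum>i=1..n. e i * (kern h (X i \<omega>) - EK h))\<^sup>2) \<and>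
    expectation (\<lambda>\<omega>. (\<Sum>i=1..n. e i * (kern h (X i \<omega>) - EK h))\<^sup>2) \<le> C * h * (1 + h * real n powr (1 - \<alpha>)) * (\<Sum>i=1..n. (e i)\<^sup>2)"
proof -
  obtain C where C0: "0 \<le> C" and C: "\<forall>n\<ge>1. \<forall>e g c. g \<in> borel_measurable borel \<longrightarrow> (\<forall>y. \<bar>g y\<bar> \<le> c) \<longrightarrow> expectation (\<lambda>\<omega>. g (R 1 \<omega>)) = 0 \<longrightarrow>
    integrable M (\<lambda>\<omega>. (\<Sum>i=1..n. e i * g (R i \<omega>))\<^sup>2) \<and>
    expectation (\<lambda>\<omega>. (\<Sum>i=1..n. e i * g (R i \<omega>))\<^sup>2) \<le> C * real n powr (1 - \<alpha>) * (\<Sum>i=1..n. (e i)\<^sup>2) * c\<^sup>2"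
    using bounded_R_sum_square by blast
  define D where "D = 2 * K_sup * noise_sup + 2 * C * noise_sup\<^sup>2"
  have D0: "0 \<le> D" using C0 K_sup_nonneg noise_sup_pos by (simp add: D_def)
  show ?thesis
  proof (intro exI[of _ D] conjI allI impI D0)
    fix h :: real and n :: nat and e :: "nat \<Rightarrow> real" assume h: "0 < h" and n: "1 \<le> n"
    let ?S = "\<lambda>\<omega>. \<Sum>i=1..n. e i * (kern h (X i \<omega>) - EK h)"
    let ?U = "\<lambda>\<omega>. \<Sum>i=1..n. e i * (kern h (R i \<omega> + \<zeta> (int i) \<omega>) - kmean h (R i \<omega>))"
    let ?V = "\<lambda>\<omega>. \<Sum>i=1..n. e i * (kmean h (R i \<omega>) - EK h)"
    let ?e = "\<Sum>i=1..n. (e i)\<^sup>2"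
    have "expectation (\<lambda>\<omega>. kmean h (R 1 \<omega>) - EK h) = 0"
      using EK_kmean[of 1 h] kmean_R_integrable[OF h, of 1] prob_space by simp
    with C[rule_format, OF n, of "\<lambda>y. kmean h y - EK h" "noise_sup * h" e] kmean_EK_abs_le[OF h]
    have V: "integrable M (\<lambda>\<omega>. (?V \<omega>)\<^sup>2)"
      "expectation (\<lambda>\<omega>. (?V \<omega>)\<^sup>2) \<le> C * real n powr (1 - \<alpha>) * ?e * (noise_sup * h)\<^sup>2" by auto
    note U = martingale_part_square[OF h, where e=e and n=n]
    have m: "?S \<in> borel_measurable M" "?U \<in> borel_measurable M" "?V \<in> borel_measurable M"
      using kernel_sum_measurable by measurable
    have eq: "AE \<omega> in M. (?U \<omega> + ?V \<omega>)\<^sup>2 = (?S \<omega>)\<^sup>2"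
      using kernel_sum_split[of e h n] by eventually_elim simp
    show "integrable M (\<lambda>\<omega>. (?S \<omega>)\<^sup>2)"
      using integrable_add_square[OF m(2,3) U(1) V(1)] m eq by (subst integrable_cong_AE[symmetric, OF _ _ eq]) auto
    have "expectation (\<lambda>\<omega>. (?S \<omega>)\<^sup>2) = expectation (\<lambda>\<omega>. (?U \<omega> + ?V \<omega>)\<^sup>2)"
      by (rule integral_cong_AE) (use m eq in auto)
    also have "\<dots> \<le> 2 * expectation (\<lambda>\<omega>. (?U \<omega>)\<^sup>2) + 2 * expectation (\<lambda>\<omega>. (?V \<omega>)\<^sup>2)"
      by (rule integral_add_square_le[OF m(2,3) U(1) V(1)])
    also have "\<dots> \<le> 2 * (K_sup * noise_sup * h * ?e) + 2 * (C * real n powr (1 - \<alpha>) * ?e * (noise_sup * h)\<^sup>2)"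
      using U(2) V(2) by (intro add_mono mult_left_mono) auto
    also have "\<dots> = (2 * K_sup * noise_sup) * (h * ?e) + (2 * C * noise_sup\<^sup>2) * (h * (h * real n powr (1 - \<alpha>)) * ?e)"
      by (simp add: power2_eq_square mult_ac)
    also have "\<dots> \<le> D * (h * ?e) + D * (h * (h * real n powr (1 - \<alpha>)) * ?e)"
      using h C0 K_sup_nonneg noise_sup_pos by (intro add_mono mult_right_mono) (auto simp: D_def intro!: mult_nonneg_nonneg sum_nonneg)
    also have "\<dots> = D * h * (1 + h * real n powr (1 - \<alpha>)) * ?e" by (simp add: algebra_simps)
    finally show "expectation (\<lambda>\<omega>. (?S \<omega>)\<^sup>2) \<le> D * h * (1 + h * real n powr (1 - \<alpha>)) * ?e" .
  qed
qed

text \<open>The rate \<open>\<delta>\<close> is fixed before the weights: only their common bound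
  \<open>L\<close> enters, while the limiting exponent retains their mean square. This is what
  permits random weights afterwards.\<close>

lemma kernel_sum_char:
  fixes h :: "nat \<Rightarrow> real"
  assumes h_pos: "\<And>n. 1 \<le> n \<Longrightarrow> 0 < h n" and h_lim: "h \<longlonglongrightarrow> 0"
    and nh: "filterlim (\<lambda>n. real n * h n) at_top sequentially"
    and mem: "(\<lambda>n. h n * real n powr (1 - \<alpha>)) \<longlonglongrightarrow> 0"
    and L: "0 \<le> L"
  shows "\<exists>\<delta>. \<delta> \<longlonglongrightarrow> 0 \<and> (\<forall>n\<ge>1. \<forall>e. (\<forall>i. \<bar>e i\<bar> \<le> L) \<longrightarrow>
    cmod (expectation (\<lambda>\<omega>. iexp (t * ((\<Sum>i=1..n. e i * (kern (h n) (X i \<omega>) - EK (h n))) / sqrt (real n * h n))))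
      - complex_of_real (exp (- (t\<^sup>2 * (((\<Sum>i=1..n. (e i)\<^sup>2) / real n) * (kappa1 K * std_normal_density x)) / 2)))) \<le> \<delta> n)"
proof -
  obtain C where C0: "0 \<le> C" and C: "\<forall>n\<ge>1. \<forall>e g c. g \<in> borel_measurable borel \<longrightarrow> (\<forall>y. \<bar>g y\<bar> \<le> c) \<longrightarrow> expectation (\<lambda>\<omega>. g (R 1 \<omega>)) = 0 \<longrightarrow>
    integrable M (\<lambda>\<omega>. (\<Sum>i=1..n. e i * g (R i \<omega>))\<^sup>2) \<and>
    expectation (\<lambda>\<omega>. (\<Sum>i=1..n. e i * g (R i \<omega>))\<^sup>2) \<le> C * real n powr (1 - \<alpha>) * (\<Sum>i=1..n. (e i)\<^sup>2) * c\<^sup>2"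
    using bounded_R_sum_square by blast
  define N where "N = K_sup * noise_sup"
  have N0: "0 \<le> N" using K_sup_nonneg noise_sup_pos by (simp add: N_def)
  \<comment> \<open>A bound for \<open>n\<close> times each conditional variance of the normalised
    summands, hence also for their sum.\<close>
  define c where "c = L\<^sup>2 * N"
  have c0: "0 \<le> c" using N0 by (simp add: c_def)
  define q where "q = (\<lambda>n. expectation (\<lambda>\<omega>. kvar (h n) (R 1 \<omega>)) / h n)"
  define \<kappa> where "\<kappa> = kappa1 K * std_normal_density x"
  have q_lim: "q \<longlonglongrightarrow> \<kappa>" unfolding q_def \<kappa>_def by (rule kvar_limit[OF h_pos h_lim])
  have \<kappa>0: "0 \<le> \<kappa>" by (simp add: \<kappa>_def kappa1_def)
  \<comment> \<open>The three errors: \<open>\<delta>1\<close> is that of the martingale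
    approximation, with summands bounded by \<open>L * K_sup / sqrt (real n * h n)\<close> and the
    fluctuation of the accumulated variance; \<open>\<delta>2\<close> replaces the rescaled mean
    conditional variance by its limit; \<open>\<delta>3\<close> discards the predictable
    part.\<close>
  define \<delta>1 where "\<delta>1 = (\<lambda>n. exp (t\<^sup>2 * c) * (t ^ 4 * c\<^sup>2 / (4 * real n) + \<bar>t\<bar> ^ 3 * (L * K_sup / sqrt (real n * h n)) * c
      + t\<^sup>2 / 2 * (L\<^sup>2 * N * sqrt (C * real n powr (- \<alpha>)))))"
  define \<delta>2 where "\<delta>2 = (\<lambda>n. t\<^sup>2 / 2 * L\<^sup>2 * \<bar>q n - \<kappa>\<bar>)"
  define \<delta>3 where "\<delta>3 = (\<lambda>n. \<bar>t\<bar> * (L * noise_sup * sqrt (C * (h n * real n powr (1 - \<alpha>)))))"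
  have "\<delta>1 \<longlonglongrightarrow> exp (t\<^sup>2 * c) * (0 + \<bar>t\<bar> ^ 3 * 0 * c + t\<^sup>2 / 2 * (L\<^sup>2 * N * sqrt (C * 0)))"
    unfolding \<delta>1_def
  proof (intro tendsto_intros)
    show "(\<lambda>n. t ^ 4 * c\<^sup>2 / (4 * real n)) \<longlonglongrightarrow> 0"
      using lim_const_over_n[of "t ^ 4 * c\<^sup>2 / 4"] by (simp add: divide_divide_eq_left)
    have "filterlim (\<lambda>n. sqrt (real n * h n)) at_top sequentially"
      by (rule filterlim_compose[OF sqrt_at_top nh])
    then show "(\<lambda>n. L * K_sup / sqrt (real n * h n)) \<longlonglongrightarrow> 0"
      by (intro real_tendsto_divide_at_top[OF tendsto_const])
    have "((\<lambda>u. u powr (- \<alpha>)) \<longlongrightarrow> 0) at_top" using memory by (intro tendsto_neg_powr filterlim_ident) auto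
    from filterlim_compose[OF this filterlim_real_sequentially]
    show "(\<lambda>n. real n powr (- \<alpha>)) \<longlonglongrightarrow> 0" .
  qed
  then have l1: "\<delta>1 \<longlonglongrightarrow> 0" by simp
  have "\<delta>2 \<longlonglongrightarrow> t\<^sup>2 / 2 * L\<^sup>2 * \<bar>\<kappa> - \<kappa>\<bar>" unfolding \<delta>2_def by (intro tendsto_intros q_lim)
  then have l2: "\<delta>2 \<longlonglongrightarrow> 0" by simp
  have "\<delta>3 \<longlonglongrightarrow> \<bar>t\<bar> * (L * noise_sup * sqrt (C * 0))" unfolding \<delta>3_def by (intro tendsto_intros mem)
  then have l3: "\<delta>3 \<longlonglongrightarrow> 0" by simp
  show ?thesis
  proof (intro exI[of _ "\<lambda>n. \<delta>1 n + \<delta>2 n + \<delta>3 n"] conjI allI impI)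
    show "(\<lambda>n. \<delta>1 n + \<delta>2 n + \<delta>3 n) \<longlonglongrightarrow> 0"
      using tendsto_add[OF tendsto_add[OF l1 l2] l3] by simp
    fix n :: nat and e :: "nat \<Rightarrow> real" assume n: "1 \<le> n" and e: "\<forall>i. \<bar>e i\<bar> \<le> L"
    note hp = h_pos[OF n]
    define s where "s = sqrt (real n * h n)"
    have s0: "0 < s" and ss: "s\<^sup>2 = real n * h n" using hp n by (auto simp: s_def)
    have e2: "(e i)\<^sup>2 \<le> L\<^sup>2" for i using e L by (simp add: abs_le_square_iff[symmetric])
    have sum_e2: "(\<Sum>i=1..n. (e i)\<^sup>2) \<le> real n * L\<^sup>2"
      using sum_mono[of "{1..n}" "\<lambda>i. (e i)\<^sup>2" "\<lambda>_. L\<^sup>2"] e2 by simp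
    have avg: "0 \<le> (\<Sum>i=1..n. (e i)\<^sup>2) / real n" "(\<Sum>i=1..n. (e i)\<^sup>2) / real n \<le> L\<^sup>2"
      using sum_e2 n by (auto simp: divide_le_eq mult.commute intro!: divide_nonneg_nonneg sum_nonneg)
    \<comment> \<open>The accumulated conditional variance with each \<open>kvar\<close> replaced by
      its mean.\<close>
    define V where "V = (\<Sum>i=1..n. (e i)\<^sup>2) / real n * q n"
    define d where "d = (\<lambda>i y z. e i / s * (kern (h n) (y + z) - kmean (h n) y))"
    define v where "v = (\<lambda>i y. (e i)\<^sup>2 / (real n * h n) * kvar (h n) y)"
    let ?D = "\<lambda>\<omega>. \<Sum>i=1..n. d i (R i \<omega>) (\<zeta> (int i) \<omega>)"
    have Ekvar: "0 \<le> expectation (\<lambda>\<omega>. kvar (h n) (R 1 \<omega>))" "expectation (\<lambda>\<omega>. kvar (h n) (R 1 \<omega>)) \<le> N * h n"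
    proof -
      show "0 \<le> expectation (\<lambda>\<omega>. kvar (h n) (R 1 \<omega>))" by (intro integral_nonneg_AE AE_I2 kvar_nonneg)
      have "expectation (\<lambda>\<omega>. kvar (h n) (R 1 \<omega>)) \<le> expectation (\<lambda>_. N * h n)"
        using kvar_R_integrable[OF hp] kvar_le[OF hp] by (intro integral_mono) (auto simp: N_def)
      then show "expectation (\<lambda>\<omega>. kvar (h n) (R 1 \<omega>)) \<le> N * h n" using prob_space by simp
    qed
    have q01: "0 \<le> q n" "q n \<le> N" using Ekvar hp by (auto simp: q_def divide_le_eq)
    have V: "0 \<le> V" "V \<le> c"
      unfolding V_def c_def
      by (rule mult_nonneg_nonneg[OF avg(1) q01(1)]) (rule mult_mono[OF avg(2) q01(2)], use q01 in auto)
    have main: "cmod (expectation (\<lambda>\<omega>. iexp (t * ?D \<omega>)) - complex_of_real (exp (- (t\<^sup>2 * V / 2))))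
      \<le> exp (t\<^sup>2 * c) * (t ^ 4 * c\<^sup>2 / (4 * n) + \<bar>t\<bar> ^ 3 * (L * K_sup / s) * c
        + t\<^sup>2 / 2 * expectation (\<lambda>\<omega>. \<bar>V - (\<Sum>i=1..n. v i (R i \<omega>))\<bar>))"
    proof (rule martingale_char_bound[OF noise_indep prediction_measurable R_def])
      show "(\<lambda>(y, z). d i y z) \<in> borel_measurable (borel \<Otimes>\<^sub>M borel)" for i unfolding d_def by measurable
      show "\<bar>d i y z\<bar> \<le> L * K_sup / s" for i y z
      proof -
        have "\<bar>kern (h n) (y + z) - kmean (h n) y\<bar> \<le> K_sup"
          using kern_nonneg[of "h n" "y + z"] kern_le[of "h n" "y + z"] kmean_nonneg[of "h n" y] kmean_le_K_sup[of "h n" y] by linarith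
        then have "\<bar>e i\<bar> * \<bar>kern (h n) (y + z) - kmean (h n) y\<bar> \<le> L * K_sup"
          using e L by (intro mult_mono) auto
        then show ?thesis using s0 by (simp add: d_def abs_mult divide_right_mono)
      qed
      show "(\<integral>z. d i y z \<partial>distr M borel (\<zeta> (int i))) = 0" for i y
        unfolding d_def distr_noise by (simp only: integral_mult_right_zero kmean_centered)
      show "v i y = (\<integral>z. (d i y z)\<^sup>2 \<partial>distr M borel (\<zeta> (int i)))" for i y
        unfolding d_def distr_noise v_def kvar_def power_mult_distrib power_divide ss
        by (simp only: integral_mult_right_zero)
      show "v i y \<le> c / real n" for i y
      proof -
        have "v i y \<le> L\<^sup>2 / (real n * h n) * (N * h n)"
          unfolding v_def using hp n e2[of i] kvar_le[OF hp, of y] kvar_nonneg[of "h n" y]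
          by (intro mult_mono divide_right_mono) (auto simp: N_def)
        also have "\<dots> = c / real n" using hp by (simp add: c_def)
        finally show ?thesis .
      qed
    qed (use n V in auto)
    \<comment> \<open>The conditional variances inherit the long memory, but as centred functions of
      the prediction of size h they obey the weighted bound, now with weights
      \<open>(e i)\<^sup>2\<close>. Dividing by n h leaves a mean fluctuation of order
      n^(-\<alpha>/2), whatever the bandwidth.\<close>
    let ?k = "\<lambda>y. kvar (h n) y - expectation (\<lambda>\<omega>. kvar (h n) (R 1 \<omega>))"
    have kb: "\<bar>?k y\<bar> \<le> N * h n" for y
      using Ekvar kvar_nonneg[of "h n" y] kvar_le[OF hp, of y] unfolding N_def by linarith
    have "expectation (\<lambda>\<omega>. ?k (R 1 \<omega>)) = 0"
      using kvar_R_integrable[OF hp, of 1] prob_space by simp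
    with C[rule_format, OF n, of ?k "N * h n" "\<lambda>i. (e i)\<^sup>2"] kb
    have K1: "integrable M (\<lambda>\<omega>. (\<Sum>i=1..n. (e i)\<^sup>2 * ?k (R i \<omega>))\<^sup>2)"
      "expectation (\<lambda>\<omega>. (\<Sum>i=1..n. (e i)\<^sup>2 * ?k (R i \<omega>))\<^sup>2) \<le> C * real n powr (1 - \<alpha>) * (\<Sum>i=1..n. ((e i)\<^sup>2)\<^sup>2) * (N * h n)\<^sup>2"
      by auto
    have EV: "expectation (\<lambda>\<omega>. \<bar>V - (\<Sum>i=1..n. v i (R i \<omega>))\<bar>) \<le> L\<^sup>2 * N * sqrt (C * real n powr (- \<alpha>))"
    proof -
      have "V - (\<Sum>i=1..n. v i (R i \<omega>)) = - (\<Sum>i=1..n. (e i)\<^sup>2 * ?k (R i \<omega>)) / (real n * h n)" for \<omega>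
        using hp n by (simp add: V_def v_def q_def right_diff_distrib sum_subtractf diff_divide_distrib sum_divide_distrib sum_distrib_right)
      then have "expectation (\<lambda>\<omega>. \<bar>V - (\<Sum>i=1..n. v i (R i \<omega>))\<bar>) = expectation (\<lambda>\<omega>. \<bar>\<Sum>i=1..n. (e i)\<^sup>2 * ?k (R i \<omega>)\<bar>) / (real n * h n)"
        using hp n by (simp add: abs_mult)
      also have "\<dots> \<le> sqrt (C * real n powr (1 - \<alpha>) * (real n * (L\<^sup>2)\<^sup>2) * (N * h n)\<^sup>2) / (real n * h n)"
      proof (rule divide_right_mono)
        have "(\<Sum>i=1..n. ((e i)\<^sup>2)\<^sup>2) \<le> real n * (L\<^sup>2)\<^sup>2"
        proof -
          have "(\<Sum>i=1..n. ((e i)\<^sup>2)\<^sup>2) \<le> (\<Sum>i=1..n. (L\<^sup>2)\<^sup>2)"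
            by (intro sum_mono power_mono[OF e2]) simp
          then show ?thesis by simp
        qed
        then have "C * real n powr (1 - \<alpha>) * (\<Sum>i=1..n. ((e i)\<^sup>2)\<^sup>2) * (N * h n)\<^sup>2 \<le> C * real n powr (1 - \<alpha>) * (real n * (L\<^sup>2)\<^sup>2) * (N * h n)\<^sup>2"
          using C0 by (intro mult_right_mono mult_left_mono) auto
        then show "expectation (\<lambda>\<omega>. \<bar>\<Sum>i=1..n. (e i)\<^sup>2 * ?k (R i \<omega>)\<bar>) \<le> sqrt (C * real n powr (1 - \<alpha>) * (real n * (L\<^sup>2)\<^sup>2) * (N * h n)\<^sup>2)"
          by (intro order_trans[OF expectation_abs_le_sqrt(2)[OF _ K1(1)]] real_sqrt_le_mono order_trans[OF K1(2)]) auto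
      qed (use hp in simp)
      also have "C * real n powr (1 - \<alpha>) * (real n * (L\<^sup>2)\<^sup>2) * (N * h n)\<^sup>2 = (C * real n powr (- \<alpha>)) * (L\<^sup>2 * N * (real n * h n))\<^sup>2"
      proof -
        have "real n powr (1 - \<alpha>) = real n * real n powr (- \<alpha>)"
          using n powr_add[of "real n" 1 "- \<alpha>"] by simp
        then show ?thesis by (simp add: power2_eq_square mult_ac)
      qed
      also have "sqrt ((C * real n powr (- \<alpha>)) * (L\<^sup>2 * N * (real n * h n))\<^sup>2) / (real n * h n) = L\<^sup>2 * N * sqrt (C * real n powr (- \<alpha>))"
        using hp n N0 by (simp add: real_sqrt_mult[of _ "(_)\<^sup>2"])
      finally show ?thesis .
    qed
    have "exp (t\<^sup>2 * c) * (t ^ 4 * c\<^sup>2 / (4 * n) + \<bar>t\<bar> ^ 3 * (L * K_sup / s) * c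
        + t\<^sup>2 / 2 * expectation (\<lambda>\<omega>. \<bar>V - (\<Sum>i=1..n. v i (R i \<omega>))\<bar>)) \<le> \<delta>1 n"
      unfolding \<delta>1_def s_def using mult_left_mono[OF EV, of "t\<^sup>2 / 2"]
      by (intro mult_left_mono add_left_mono) simp_all
    with main have 1: "cmod (expectation (\<lambda>\<omega>. iexp (t * ?D \<omega>)) - complex_of_real (exp (- (t\<^sup>2 * V / 2)))) \<le> \<delta>1 n"
      by (rule order_trans)
    let ?W = "(\<Sum>i=1..n. (e i)\<^sup>2) / real n * \<kappa>"
    have 2: "cmod (complex_of_real (exp (- (t\<^sup>2 * V / 2))) - complex_of_real (exp (- (t\<^sup>2 * ?W / 2)))) \<le> \<delta>2 n"
    proof -
      have "\<bar>exp (- (t\<^sup>2 * V / 2)) - exp (- (t\<^sup>2 * ?W / 2))\<bar> \<le> exp 0 * \<bar>- (t\<^sup>2 * V / 2) - - (t\<^sup>2 * ?W / 2)\<bar>"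
      proof (rule abs_exp_diff_le)
        have *: "- (t\<^sup>2 * u / 2) \<le> 0" if "0 \<le> u" for u using that by simp
        show "- (t\<^sup>2 * V / 2) \<le> 0" "- (t\<^sup>2 * ?W / 2) \<le> 0"
          by (rule *[OF V(1)]) (rule *[OF mult_nonneg_nonneg[OF avg(1) \<kappa>0]])
      qed
      also have "- (t\<^sup>2 * V / 2) - - (t\<^sup>2 * ?W / 2) = - (t\<^sup>2 / 2 * ((\<Sum>i=1..n. (e i)\<^sup>2) / real n) * (q n - \<kappa>))"
      proof -
        have "- (T * (u * a) / 2) - - (T * (u * b) / 2) = - (T / 2 * u * (a - b))" for T u a b :: real
          by (simp add: field_simps)
        then show ?thesis unfolding V_def .
      qed
      also have "exp 0 * \<bar>- (t\<^sup>2 / 2 * ((\<Sum>i=1..n. (e i)\<^sup>2) / real n) * (q n - \<kappa>))\<bar> = t\<^sup>2 / 2 * ((\<Sum>i=1..n. (e i)\<^sup>2) / real n) * \<bar>q n - \<kappa>\<bar>"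
        by (simp only: abs_minus_cancel abs_mult abs_of_nonneg[OF avg(1)]) simp
      also have "\<dots> \<le> \<delta>2 n" unfolding \<delta>2_def using avg(2) by (intro mult_right_mono mult_left_mono) auto
      finally show ?thesis unfolding of_real_diff[symmetric] norm_of_real .
    qed
    let ?S = "\<lambda>\<omega>. (\<Sum>i=1..n. e i * (kern (h n) (X i \<omega>) - EK (h n))) / s"
    let ?P = "\<lambda>\<omega>. \<Sum>i=1..n. e i * (kmean (h n) (R i \<omega>) - EK (h n))"
    have "expectation (\<lambda>\<omega>. kmean (h n) (R 1 \<omega>) - EK (h n)) = 0"
      using EK_kmean[of 1 "h n"] kmean_R_integrable[OF hp, of 1] prob_space by simp
    with C[rule_format, OF n, of "\<lambda>y. kmean (h n) y - EK (h n)" "noise_sup * h n" e] kmean_EK_abs_le[OF hp]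
    have P: "integrable M (\<lambda>\<omega>. (?P \<omega>)\<^sup>2)"
      "expectation (\<lambda>\<omega>. (?P \<omega>)\<^sup>2) \<le> C * real n powr (1 - \<alpha>) * (\<Sum>i=1..n. (e i)\<^sup>2) * (noise_sup * h n)\<^sup>2" by auto
    have Dm[measurable]: "?D \<in> borel_measurable M" unfolding d_def by measurable
    have Sm[measurable]: "?S \<in> borel_measurable M" using kernel_sum_measurable by (rule borel_measurable_divide) simp
    have 3: "cmod (expectation (\<lambda>\<omega>. iexp (t * ?S \<omega>)) - expectation (\<lambda>\<omega>. iexp (t * ?D \<omega>))) \<le> \<delta>3 n"
    proof -
      have intc: "integrable M (\<lambda>\<omega>. iexp (t * f \<omega>))" if "f \<in> borel_measurable M" for f
        using that by (intro integrable_const_bound[where B=1]) auto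
      have "cmod (expectation (\<lambda>\<omega>. iexp (t * ?S \<omega>)) - expectation (\<lambda>\<omega>. iexp (t * ?D \<omega>))) \<le> expectation (\<lambda>\<omega>. cmod (iexp (t * ?S \<omega>) - iexp (t * ?D \<omega>)))"
        unfolding Bochner_Integration.integral_diff[symmetric, OF intc[OF Sm] intc[OF Dm]]
        by (rule integral_norm_bound)
      also have "\<dots> \<le> expectation (\<lambda>\<omega>. \<bar>t\<bar> / s * \<bar>?P \<omega>\<bar>)"
      proof (rule integral_mono_AE)
        show "integrable M (\<lambda>\<omega>. cmod (iexp (t * ?S \<omega>) - iexp (t * ?D \<omega>)))"
          by (intro integrable_norm Bochner_Integration.integrable_diff intc Sm Dm)
        show "integrable M (\<lambda>\<omega>. \<bar>t\<bar> / s * \<bar>?P \<omega>\<bar>)"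
          using expectation_abs_le_sqrt(1)[OF _ P(1)] by (intro integrable_mult_right integrable_abs) auto
        show "AE \<omega> in M. cmod (iexp (t * ?S \<omega>) - iexp (t * ?D \<omega>)) \<le> \<bar>t\<bar> / s * \<bar>?P \<omega>\<bar>"
          using kernel_sum_split[of e "h n" n]
        proof eventually_elim
          case (elim \<omega>)
          have "?D \<omega> = (\<Sum>i=1..n. e i * (kern (h n) (R i \<omega> + \<zeta> (int i) \<omega>) - kmean (h n) (R i \<omega>))) / s"
            by (simp add: d_def sum_divide_distrib)
          then have "t * ?S \<omega> - t * ?D \<omega> = t / s * ?P \<omega>"
            unfolding elim by (simp add: add_divide_distrib distrib_left)
          then have "\<bar>t * ?S \<omega> - t * ?D \<omega>\<bar> = \<bar>t\<bar> / s * \<bar>?P \<omega>\<bar>" using s0 by (simp only: abs_mult abs_divide)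
          then show ?case using norm_iexp_diff_le[of "t * ?S \<omega>" "t * ?D \<omega>"] by simp
        qed
      qed
      also have "\<dots> = \<bar>t\<bar> / s * expectation (\<lambda>\<omega>. \<bar>?P \<omega>\<bar>)" by simp
      also have "\<dots> \<le> \<bar>t\<bar> / s * sqrt (C * real n powr (1 - \<alpha>) * (real n * L\<^sup>2) * (noise_sup * h n)\<^sup>2)"
      proof (rule mult_left_mono)
        have "C * real n powr (1 - \<alpha>) * (\<Sum>i=1..n. (e i)\<^sup>2) * (noise_sup * h n)\<^sup>2 \<le> C * real n powr (1 - \<alpha>) * (real n * L\<^sup>2) * (noise_sup * h n)\<^sup>2"
          using C0 sum_e2 by (intro mult_right_mono mult_left_mono) auto
        then show "expectation (\<lambda>\<omega>. \<bar>?P \<omega>\<bar>) \<le> sqrt (C * real n powr (1 - \<alpha>) * (real n * L\<^sup>2) * (noise_sup * h n)\<^sup>2)"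
          by (intro order_trans[OF expectation_abs_le_sqrt(2)[OF _ P(1)]] real_sqrt_le_mono order_trans[OF P(2)]) auto
      qed (use s0 in simp)
      also have "C * real n powr (1 - \<alpha>) * (real n * L\<^sup>2) * (noise_sup * h n)\<^sup>2 = (C * (h n * real n powr (1 - \<alpha>))) * (L * noise_sup * s)\<^sup>2"
        unfolding power_mult_distrib ss by (simp add: power2_eq_square mult_ac)
      also have "\<bar>t\<bar> / s * sqrt ((C * (h n * real n powr (1 - \<alpha>))) * (L * noise_sup * s)\<^sup>2) = \<delta>3 n"
        using s0 L noise_sup_pos by (simp add: real_sqrt_mult[of _ "(_)\<^sup>2"] \<delta>3_def)
      finally show ?thesis .
    qed
    have "cmod (expectation (\<lambda>\<omega>. iexp (t * ?S \<omega>)) - complex_of_real (exp (- (t\<^sup>2 * ?W / 2))))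
      \<le> \<delta>3 n + (\<delta>1 n + \<delta>2 n)"
      using norm_triangle_le[OF add_mono[OF 3 norm_triangle_le[OF add_mono[OF 1 2]]]] by simp
    then show "cmod (expectation (\<lambda>\<omega>. iexp (t * ((\<Sum>i=1..n. e i * (kern (h n) (X i \<omega>) - EK (h n))) / sqrt (real n * h n))))
      - complex_of_real (exp (- (t\<^sup>2 * (((\<Sum>i=1..n. (e i)\<^sup>2) / real n) * (kappa1 K * std_normal_density x)) / 2)))) \<le> \<delta>1 n + \<delta>2 n + \<delta>3 n"
      unfolding s_def \<kappa>_def by simp
  qed
qed

end

subsection \<open>Random weights independent of the predictors\<close>

text \<open>Preimages of product-measurable sets lie in the generated \<sigma>-algebras, so their
  independence passes to the two random sequences. The second sequence is put first, so that it is
  the one held fixed in iterated integrals.\<close>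

lemma (in prob_space) indep_pair_of_sequences:
  fixes U :: "'i \<Rightarrow> 'a \<Rightarrow> real" and V :: "'j \<Rightarrow> 'a \<Rightarrow> real"
  assumes ind: "indep_sequences M U I V J"
    and U: "\<And>i. i \<in> I \<Longrightarrow> U i \<in> borel_measurable M" and V: "\<And>j. j \<in> J \<Longrightarrow> V j \<in> borel_measurable M"
  shows "indep_pair (Pi\<^sub>M J (\<lambda>_. borel)) (\<lambda>\<omega>. \<lambda>j\<in>J. V j \<omega>) (Pi\<^sub>M I (\<lambda>_. borel)) (\<lambda>\<omega>. \<lambda>i\<in>I. U i \<omega>)"
proof (rule indep_pairI)
  show "(\<lambda>\<omega>. \<lambda>j\<in>J. V j \<omega>) \<in> measurable M (Pi\<^sub>M J (\<lambda>_. borel))" "(\<lambda>\<omega>. \<lambda>i\<in>I. U i \<omega>) \<in> measurable M (Pi\<^sub>M I (\<lambda>_. borel))"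
    using U V by (auto intro!: measurable_restrict)
  have gen: "(\<lambda>\<omega>. \<lambda>i\<in>I. U i \<omega>) -` A \<inter> space M \<in> sets (gen_sigma M U I)"
    if A: "A \<in> sets (Pi\<^sub>M I (\<lambda>_. borel))" for A and U :: "'k \<Rightarrow> 'a \<Rightarrow> real" and I
  proof -
    have sub: "(\<Union>i\<in>I. {U i -` B \<inter> space M | B. B \<in> sets borel}) \<subseteq> Pow (space M)" by auto
    have sp: "space (gen_sigma M U I) = space M" unfolding gen_sigma_def by (rule space_measure_of[OF sub])
    have "U i \<in> borel_measurable (gen_sigma M U I)" if i: "i \<in> I" for i
    proof (rule measurableI)
      fix B :: "real set" assume "B \<in> sets borel"
      then show "U i -` B \<inter> space (gen_sigma M U I) \<in> sets (gen_sigma M U I)"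
        unfolding sp unfolding gen_sigma_def sets_measure_of[OF sub] using i by (intro sigma_sets.Basic) auto
    qed simp
    then have "(\<lambda>\<omega>. \<lambda>i\<in>I. U i \<omega>) \<in> measurable (gen_sigma M U I) (Pi\<^sub>M I (\<lambda>_. borel))"
      by (rule measurable_restrict)
    from measurable_sets[OF this A] show ?thesis by (simp only: sp)
  qed
  fix A B assume A: "A \<in> sets (Pi\<^sub>M J (\<lambda>_. borel :: real measure))" and B: "B \<in> sets (Pi\<^sub>M I (\<lambda>_. borel :: real measure))"
  have "prob (((\<lambda>\<omega>. \<lambda>i\<in>I. U i \<omega>) -` B \<inter> space M) \<inter> ((\<lambda>\<omega>. \<lambda>j\<in>J. V j \<omega>) -` A \<inter> space M))
    = prob ((\<lambda>\<omega>. \<lambda>i\<in>I. U i \<omega>) -` B \<inter> space M) * prob ((\<lambda>\<omega>. \<lambda>j\<in>J. V j \<omega>) -` A \<inter> space M)"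
    using ind unfolding indep_sequences_def by (rule indep_setD) (rule gen[OF B], rule gen[OF A])
  moreover have "((\<lambda>\<omega>. \<lambda>i\<in>I. U i \<omega>) -` B \<inter> space M) \<inter> ((\<lambda>\<omega>. \<lambda>j\<in>J. V j \<omega>) -` A \<inter> space M)
    = (\<lambda>\<omega>. \<lambda>j\<in>J. V j \<omega>) -` A \<inter> (\<lambda>\<omega>. \<lambda>i\<in>I. U i \<omega>) -` B \<inter> space M" by auto
  ultimately show "prob ((\<lambda>\<omega>. \<lambda>j\<in>J. V j \<omega>) -` A \<inter> (\<lambda>\<omega>. \<lambda>i\<in>I. U i \<omega>) -` B \<inter> space M)
    = prob ((\<lambda>\<omega>. \<lambda>j\<in>J. V j \<omega>) -` A \<inter> space M) * prob ((\<lambda>\<omega>. \<lambda>i\<in>I. U i \<omega>) -` B \<inter> space M)"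
    by (simp only: mult.commute)
qed

locale random_weights = kernel_predictor M \<zeta> \<sigma> a \<alpha> A X K x
  for M :: "'a measure" and \<zeta> \<sigma> a \<alpha> A X K x +
  fixes \<eta> :: "int \<Rightarrow> 'a \<Rightarrow> real"
  assumes \<eta>_measurable: "\<And>j. \<eta> j \<in> borel_measurable M"
    and indep_X_\<eta>: "indep_sequences M X {1..} \<eta> UNIV"
begin

lemma indep_pair_X: "indep_pair (Pi\<^sub>M UNIV (\<lambda>_. borel)) (\<lambda>\<omega> j. \<eta> j \<omega>) (Pi\<^sub>M {1..} (\<lambda>_. borel)) (\<lambda>\<omega>. \<lambda>i\<in>{1..}. X i \<omega>)"
  using indep_pair_of_sequences[OF indep_X_\<eta> X_measurable \<eta>_measurable] by (simp add: restrict_def)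

lemma innovations_measurable[measurable]: "(\<lambda>\<omega> j. \<eta> j \<omega>) \<in> measurable M (Pi\<^sub>M UNIV (\<lambda>_. borel))"
  by (intro measurable_PiM_single' \<eta>_measurable) simp

text \<open>Conditioning on the innovations: under the product law the predictors can be integrated out
  with the weights held fixed.\<close>

lemma expectation_weights:
  fixes f :: "(int \<Rightarrow> real) \<times> (nat \<Rightarrow> real) \<Rightarrow> 'd::{banach, second_countable_topology}"
  assumes f: "f \<in> borel_measurable (Pi\<^sub>M UNIV (\<lambda>_. borel) \<Otimes>\<^sub>M Pi\<^sub>M {1..} (\<lambda>_. borel))"
    and int: "integrable M (\<lambda>\<omega>. f (\<lambda>j. \<eta> j \<omega>, \<lambda>i\<in>{1..}. X i \<omega>))"
  shows "expectation (\<lambda>\<omega>. f (\<lambda>j. \<eta> j \<omega>, \<lambda>i\<in>{1..}. X i \<omega>))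
    = expectation (\<lambda>\<omega>'. expectation (\<lambda>\<omega>. f (\<lambda>j. \<eta> j \<omega>', \<lambda>i\<in>{1..}. X i \<omega>)))"
proof -
  let ?A = "Pi\<^sub>M UNIV (\<lambda>_. borel) :: (int \<Rightarrow> real) measure" and ?B = "Pi\<^sub>M {1..} (\<lambda>_. borel) :: (nat \<Rightarrow> real) measure"
  have Xm[measurable]: "(\<lambda>\<omega>. \<lambda>i\<in>{1..}. X i \<omega>) \<in> measurable M ?B"
    by (intro measurable_restrict X_measurable) simp
  interpret D: prob_space "distr M ?B (\<lambda>\<omega>. \<lambda>i\<in>{1..}. X i \<omega>)" by (rule prob_space_distr) (rule Xm)
  have f'[measurable]: "f \<in> borel_measurable (?A \<Otimes>\<^sub>M distr M ?B (\<lambda>\<omega>. \<lambda>i\<in>{1..}. X i \<omega>))"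
    using f by (simp cong: measurable_cong_sets sets_pair_measure_cong)
  have "expectation (\<lambda>\<omega>. f (\<lambda>j. \<eta> j \<omega>, \<lambda>i\<in>{1..}. X i \<omega>))
    = (\<integral>p. (\<integral>z. f (p, z) \<partial>distr M ?B (\<lambda>\<omega>. \<lambda>i\<in>{1..}. X i \<omega>)) \<partial>distr M ?A (\<lambda>\<omega> j. \<eta> j \<omega>))"
    by (rule expectation_indep_pair[OF indep_pair_X f int])
  also have "\<dots> = expectation (\<lambda>\<omega>'. \<integral>z. f (\<lambda>j. \<eta> j \<omega>', z) \<partial>distr M ?B (\<lambda>\<omega>. \<lambda>i\<in>{1..}. X i \<omega>))"
    by (rule integral_distr) measurable
  also have "\<dots> = expectation (\<lambda>\<omega>'. expectation (\<lambda>\<omega>. f (\<lambda>j. \<eta> j \<omega>', \<lambda>i\<in>{1..}. X i \<omega>)))"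
  proof (intro Bochner_Integration.integral_cong refl integral_distr Xm)
    fix \<omega>'
    show "(\<lambda>z. f (\<lambda>j. \<eta> j \<omega>', z)) \<in> borel_measurable ?B"
      by (rule measurable_Pair2[OF f]) (simp add: space_PiM)
  qed
  finally show ?thesis .
qed

lemma weighted_sum_measurable:
  assumes U: "\<And>i. U i \<in> borel_measurable (Pi\<^sub>M UNIV (\<lambda>_. borel))"
  shows "(\<lambda>(p, z). \<Sum>i=1..n. U i p * (kern h (z i) - EK h)) \<in> borel_measurable (Pi\<^sub>M UNIV (\<lambda>_. borel) \<Otimes>\<^sub>M Pi\<^sub>M {1..} (\<lambda>_. borel))"
  unfolding split_beta'
proof (intro borel_measurable_sum borel_measurable_times borel_measurable_diff borel_measurable_const)
  fix i assume "i \<in> {1..n}"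
  then have "(\<lambda>z. z i) \<in> borel_measurable (Pi\<^sub>M {1..} (\<lambda>_. borel :: real measure))"
    by (intro measurable_component_singleton) simp
  then show "(\<lambda>w. kern h (snd w i)) \<in> borel_measurable (Pi\<^sub>M UNIV (\<lambda>_. borel) \<Otimes>\<^sub>M Pi\<^sub>M {1..} (\<lambda>_. borel))"
    by (intro measurable_compose[OF _ kern_measurable] measurable_compose[OF measurable_snd])
qed (rule measurable_compose[OF measurable_fst U])

lemma weights_measurable:
  "U \<in> borel_measurable (Pi\<^sub>M UNIV (\<lambda>_. borel)) \<Longrightarrow> (\<lambda>\<omega>. U (\<lambda>j. \<eta> j \<omega>)) \<in> borel_measurable M"
  by (rule measurable_compose[OF innovations_measurable])

lemma random_weighted_measurable:
  assumes U: "\<And>i. U i \<in> borel_measurable (Pi\<^sub>M UNIV (\<lambda>_. borel))"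
  shows "(\<lambda>\<omega>. \<Sum>i=1..n. U i (\<lambda>j. \<eta> j \<omega>) * (kern h (X i \<omega>) - EK h)) \<in> borel_measurable M"
  by (intro borel_measurable_sum borel_measurable_times borel_measurable_diff borel_measurable_const
      weights_measurable[OF U] measurable_compose[OF X_measurable kern_measurable]) simp

lemma restrict_X_sum:
  "(\<Sum>i=1..n. u i * (kern h ((\<lambda>i\<in>{1..}. X i \<omega>) i) - EK h)) = (\<Sum>i=1..n. u i * (kern h (X i \<omega>) - EK h))"
  by (intro sum.cong) auto

text \<open>For fixed innovations the weights are numbers and \<open>kernel_sum_square\<close>
  applies with a constant independent of them; integrating that bound over the innovations gives the
  claim. Square integrability of the weights suffices because the kernel is bounded.\<close>

lemma random_weighted_square:
  "\<exists>C\<ge>0. \<forall>h>0. \<forall>n\<ge>1. \<forall>U. (\<forall>i. U i \<in> borel_measurable (Pi\<^sub>M UNIV (\<lambda>_. borel))) \<longrightarrow>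
    (\<forall>i. integrable M (\<lambda>\<omega>. (U i (\<lambda>j. \<eta> j \<omega>))\<^sup>2)) \<longrightarrow>
    integrable M (\<lambda>\<omega>. (\<Sum>i=1..n. U i (\<lambda>j. \<eta> j \<omega>) * (kern h (X i \<omega>) - EK h))\<^sup>2) \<and>
    expectation (\<lambda>\<omega>. (\<Sum>i=1..n. U i (\<lambda>j. \<eta> j \<omega>) * (kern h (X i \<omega>) - EK h))\<^sup>2)
      \<le> C * h * (1 + h * real n powr (1 - \<alpha>)) * (\<Sum>i=1..n. expectation (\<lambda>\<omega>. (U i (\<lambda>j. \<eta> j \<omega>))\<^sup>2))"
proof -
  obtain C where C0: "0 \<le> C" and C: "\<forall>h>0. \<forall>n\<ge>1. \<forall>e. integrable M (\<lambda>\<omega>. (\<Sum>i=1..n. e i * (kern h (X i \<omega>) - EK h))\<^sup>2) \<and>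
    expectation (\<lambda>\<omega>. (\<Sum>i=1..n. e i * (kern h (X i \<omega>) - EK h))\<^sup>2) \<le> C * h * (1 + h * real n powr (1 - \<alpha>)) * (\<Sum>i=1..n. (e i)\<^sup>2)"
    using kernel_sum_square by blast
  show ?thesis
  proof (intro exI[of _ C] conjI C0 allI impI)
    fix h :: real and n :: nat and U :: "nat \<Rightarrow> (int \<Rightarrow> real) \<Rightarrow> real"
    assume h: "0 < h" and n: "1 \<le> n" and "\<forall>i. U i \<in> borel_measurable (Pi\<^sub>M UNIV (\<lambda>_. borel))"
      and "\<forall>i. integrable M (\<lambda>\<omega>. (U i (\<lambda>j. \<eta> j \<omega>))\<^sup>2)"
    then have U: "\<And>i. U i \<in> borel_measurable (Pi\<^sub>M UNIV (\<lambda>_. borel))"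
      and U2: "\<And>i. integrable M (\<lambda>\<omega>. (U i (\<lambda>j. \<eta> j \<omega>))\<^sup>2)" by auto
    have Um: "(\<lambda>\<omega>. U i (\<lambda>j. \<eta> j \<omega>)) \<in> borel_measurable M" for i
      by (rule weights_measurable[OF U])
    show int: "integrable M (\<lambda>\<omega>. (\<Sum>i=1..n. U i (\<lambda>j. \<eta> j \<omega>) * (kern h (X i \<omega>) - EK h))\<^sup>2)"
    proof (rule integrable_sum_square)
      fix i assume i: "i \<in> {1..n}"
      have Xi: "(\<lambda>\<omega>. kern h (X i \<omega>)) \<in> borel_measurable M"
        using i by (intro measurable_compose[OF X_measurable kern_measurable]) simp
      show m: "(\<lambda>\<omega>. U i (\<lambda>j. \<eta> j \<omega>) * (kern h (X i \<omega>) - EK h)) \<in> borel_measurable M"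
        using Um Xi by measurable
      show "integrable M (\<lambda>\<omega>. (U i (\<lambda>j. \<eta> j \<omega>) * (kern h (X i \<omega>) - EK h))\<^sup>2)"
      proof (rule Bochner_Integration.integrable_bound[OF integrable_mult_right[OF U2[of i], of "(K_sup + EK h)\<^sup>2"]])
        show "AE \<omega> in M. norm ((U i (\<lambda>j. \<eta> j \<omega>) * (kern h (X i \<omega>) - EK h))\<^sup>2) \<le> norm ((K_sup + EK h)\<^sup>2 * (U i (\<lambda>j. \<eta> j \<omega>))\<^sup>2)"
        proof (rule AE_I2)
          fix \<omega>
          have "\<bar>kern h (X i \<omega>) - EK h\<bar> \<le> \<bar>K_sup + EK h\<bar>"
            using kern_nonneg[of h "X i \<omega>"] kern_le[of h "X i \<omega>"] EK_le(1)[OF h] by linarith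
          then have "(kern h (X i \<omega>) - EK h)\<^sup>2 \<le> (K_sup + EK h)\<^sup>2" by (simp add: abs_le_square_iff)
          then show "norm ((U i (\<lambda>j. \<eta> j \<omega>) * (kern h (X i \<omega>) - EK h))\<^sup>2) \<le> norm ((K_sup + EK h)\<^sup>2 * (U i (\<lambda>j. \<eta> j \<omega>))\<^sup>2)"
            by (simp add: power_mult_distrib mult.commute mult_left_mono)
        qed
      qed (use m in simp)
    qed
    let ?f = "\<lambda>w. (case w of (p, z) \<Rightarrow> \<Sum>i=1..n. U i p * (kern h (z i) - EK h))\<^sup>2"
    have f: "?f \<in> borel_measurable (Pi\<^sub>M UNIV (\<lambda>_. borel) \<Otimes>\<^sub>M Pi\<^sub>M {1..} (\<lambda>_. borel))"
      by (intro borel_measurable_power weighted_sum_measurable U)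
    have "expectation (\<lambda>\<omega>. (\<Sum>i=1..n. U i (\<lambda>j. \<eta> j \<omega>) * (kern h (X i \<omega>) - EK h))\<^sup>2)
      = expectation (\<lambda>\<omega>'. expectation (\<lambda>\<omega>. (\<Sum>i=1..n. U i (\<lambda>j. \<eta> j \<omega>') * (kern h (X i \<omega>) - EK h))\<^sup>2))"
      using expectation_weights[OF f] int unfolding prod.case restrict_X_sum .
    also have "\<dots> \<le> expectation (\<lambda>\<omega>'. C * h * (1 + h * real n powr (1 - \<alpha>)) * (\<Sum>i=1..n. (U i (\<lambda>j. \<eta> j \<omega>'))\<^sup>2))"
    proof (rule integral_mono')
      show "integrable M (\<lambda>\<omega>'. C * h * (1 + h * real n powr (1 - \<alpha>)) * (\<Sum>i=1..n. (U i (\<lambda>j. \<eta> j \<omega>'))\<^sup>2))"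
        by (intro integrable_mult_right Bochner_Integration.integrable_sum U2)
      fix \<omega>'
      show "expectation (\<lambda>\<omega>. (\<Sum>i=1..n. U i (\<lambda>j. \<eta> j \<omega>') * (kern h (X i \<omega>) - EK h))\<^sup>2) \<le> C * h * (1 + h * real n powr (1 - \<alpha>)) * (\<Sum>i=1..n. (U i (\<lambda>j. \<eta> j \<omega>'))\<^sup>2)"
        by (rule C[rule_format, OF h n, THEN conjunct2])
      show "0 \<le> C * h * (1 + h * real n powr (1 - \<alpha>)) * (\<Sum>i=1..n. (U i (\<lambda>j. \<eta> j \<omega>'))\<^sup>2)"
        using C0 h by (intro mult_nonneg_nonneg sum_nonneg) auto
    qed
    also have "\<dots> = C * h * (1 + h * real n powr (1 - \<alpha>)) * (\<Sum>i=1..n. expectation (\<lambda>\<omega>. (U i (\<lambda>j. \<eta> j \<omega>))\<^sup>2))"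
      by (simp only: integral_mult_right_zero Bochner_Integration.integral_sum[OF U2])
    finally show "expectation (\<lambda>\<omega>. (\<Sum>i=1..n. U i (\<lambda>j. \<eta> j \<omega>) * (kern h (X i \<omega>) - EK h))\<^sup>2)
      \<le> C * h * (1 + h * real n powr (1 - \<alpha>)) * (\<Sum>i=1..n. expectation (\<lambda>\<omega>. (U i (\<lambda>j. \<eta> j \<omega>))\<^sup>2))" .
  qed
qed

text \<open>For frozen weights the error is at most \<open>\<delta> n\<close> whatever their values,
  so the bound survives integration over the innovations. The comparison term remains a random
  Gaussian exponent in the mean square of the weights.\<close>

lemma random_weighted_char:
  fixes h :: "nat \<Rightarrow> real"
  assumes h_pos: "\<And>n. 1 \<le> n \<Longrightarrow> 0 < h n" and h_lim: "h \<longlonglongrightarrow> 0"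
    and nh: "filterlim (\<lambda>n. real n * h n) at_top sequentially"
    and mem: "(\<lambda>n. h n * real n powr (1 - \<alpha>)) \<longlonglongrightarrow> 0"
    and U: "\<And>i. U i \<in> borel_measurable (Pi\<^sub>M UNIV (\<lambda>_. borel))" and UL: "\<And>i p. \<bar>U i p\<bar> \<le> L"
  shows "(\<lambda>n. expectation (\<lambda>\<omega>. iexp (t * ((\<Sum>i=1..n. U i (\<lambda>j. \<eta> j \<omega>) * (kern (h n) (X i \<omega>) - EK (h n))) / sqrt (real n * h n))))
    - expectation (\<lambda>\<omega>. complex_of_real (exp (- (t\<^sup>2 * (((\<Sum>i=1..n. (U i (\<lambda>j. \<eta> j \<omega>))\<^sup>2) / real n) * (kappa1 K * std_normal_density x)) / 2))))) \<longlonglongrightarrow> 0"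
proof -
  have L: "0 \<le> L" using order_trans[OF abs_ge_zero UL] .
  obtain \<delta> where \<delta>: "\<delta> \<longlonglongrightarrow> 0" and bound: "\<forall>n\<ge>1. \<forall>e. (\<forall>i. \<bar>e i\<bar> \<le> L) \<longrightarrow>
    cmod (expectation (\<lambda>\<omega>. iexp (t * ((\<Sum>i=1..n. e i * (kern (h n) (X i \<omega>) - EK (h n))) / sqrt (real n * h n))))
      - complex_of_real (exp (- (t\<^sup>2 * (((\<Sum>i=1..n. (e i)\<^sup>2) / real n) * (kappa1 K * std_normal_density x)) / 2)))) \<le> \<delta> n"
    using kernel_sum_char[OF h_pos h_lim nh mem L, of t] by blast
  show ?thesis
  proof (rule Lim_null_comparison[OF eventually_mono[OF eventually_ge_at_top[of 1]] \<delta>])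
    fix n :: nat assume n: "1 \<le> n"
    let ?\<psi> = "\<lambda>p. complex_of_real (exp (- (t\<^sup>2 * (((\<Sum>i=1..n. (U i p)\<^sup>2) / real n) * (kappa1 K * std_normal_density x)) / 2)))"
    let ?f = "\<lambda>w. iexp (t * ((case w of (p, z) \<Rightarrow> \<Sum>i=1..n. U i p * (kern (h n) (z i) - EK (h n))) / sqrt (real n * h n))) - ?\<psi> (fst w)"
    have \<psi>m: "?\<psi> \<in> borel_measurable (Pi\<^sub>M UNIV (\<lambda>_. borel))" using U by measurable
    have f: "?f \<in> borel_measurable (Pi\<^sub>M UNIV (\<lambda>_. borel) \<Otimes>\<^sub>M Pi\<^sub>M {1..} (\<lambda>_. borel))"
    proof (rule borel_measurable_diff)
      show "(\<lambda>w. iexp (t * ((case w of (p, z) \<Rightarrow> \<Sum>i=1..n. U i p * (kern (h n) (z i) - EK (h n))) / sqrt (real n * h n)))) \<in> borel_measurable (Pi\<^sub>M UNIV (\<lambda>_. borel) \<Otimes>\<^sub>M Pi\<^sub>M {1..} (\<lambda>_. borel))"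
        using weighted_sum_measurable[where U=U and n=n and h="h n", OF U] by measurable
      show "(\<lambda>w. ?\<psi> (fst w)) \<in> borel_measurable (Pi\<^sub>M UNIV (\<lambda>_. borel) \<Otimes>\<^sub>M Pi\<^sub>M {1..} (\<lambda>_. borel))"
        by (rule measurable_compose[OF measurable_fst \<psi>m])
    qed
    let ?S = "\<lambda>\<omega>. (\<Sum>i=1..n. U i (\<lambda>j. \<eta> j \<omega>) * (kern (h n) (X i \<omega>) - EK (h n))) / sqrt (real n * h n)"
    have Sm: "?S \<in> borel_measurable M" by (intro borel_measurable_divide random_weighted_measurable U) simp
    have intc: "integrable M (\<lambda>\<omega>. iexp (t * f \<omega>))" if "f \<in> borel_measurable M" for f
      using that by (intro integrable_const_bound[where B=1]) auto
    note i1 = intc[OF Sm]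
    have nonneg: "0 \<le> t\<^sup>2 * (((\<Sum>i=1..n. (U i p)\<^sup>2) / real n) * (kappa1 K * std_normal_density x)) / 2" for p
      by (intro mult_nonneg_nonneg divide_nonneg_nonneg sum_nonneg) (auto simp: kappa1_def)
    have i2: "integrable M (\<lambda>\<omega>. ?\<psi> (\<lambda>j. \<eta> j \<omega>))"
      using nonneg by (intro integrable_const_bound[where B=1] measurable_compose[OF innovations_measurable \<psi>m])
        (simp_all only: norm_of_real, simp)
    have i2': "integrable M (\<lambda>\<omega>. iexp (t * ((\<Sum>i=1..n. e i * (kern (h n) (X i \<omega>) - EK (h n))) / sqrt (real n * h n))))" for e
      by (intro intc borel_measurable_divide kernel_sum_measurable borel_measurable_const)
    let ?I = "expectation (\<lambda>\<omega>. iexp (t * ?S \<omega>) - ?\<psi> (\<lambda>j. \<eta> j \<omega>))"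
    have I_eq: "expectation (\<lambda>\<omega>. iexp (t * ?S \<omega>)) - expectation (\<lambda>\<omega>. ?\<psi> (\<lambda>j. \<eta> j \<omega>)) = ?I"
      by (rule Bochner_Integration.integral_diff[OF i1 i2, symmetric])
    have I_eq2: "?I = expectation (\<lambda>\<omega>'. expectation (\<lambda>\<omega>. iexp (t * ((\<Sum>i=1..n. U i (\<lambda>j. \<eta> j \<omega>') * (kern (h n) (X i \<omega>) - EK (h n))) / sqrt (real n * h n))) - ?\<psi> (\<lambda>j. \<eta> j \<omega>')))"
      using expectation_weights[OF f] Bochner_Integration.integrable_diff[OF i1 i2]
      unfolding prod.case fst_conv restrict_X_sum .
    have "cmod ?I \<le> expectation (\<lambda>\<omega>'. cmod (expectation (\<lambda>\<omega>. iexp (t * ((\<Sum>i=1..n. U i (\<lambda>j. \<eta> j \<omega>') * (kern (h n) (X i \<omega>) - EK (h n))) / sqrt (real n * h n))) - ?\<psi> (\<lambda>j. \<eta> j \<omega>'))))"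
      unfolding I_eq2 by (rule integral_norm_bound)
    also have "\<dots> \<le> expectation (\<lambda>_. \<delta> n)"
    proof (rule integral_mono')
      fix \<omega>'
      have "expectation (\<lambda>\<omega>. iexp (t * ((\<Sum>i=1..n. U i (\<lambda>j. \<eta> j \<omega>') * (kern (h n) (X i \<omega>) - EK (h n))) / sqrt (real n * h n))) - ?\<psi> (\<lambda>j. \<eta> j \<omega>'))
        = expectation (\<lambda>\<omega>. iexp (t * ((\<Sum>i=1..n. U i (\<lambda>j. \<eta> j \<omega>') * (kern (h n) (X i \<omega>) - EK (h n))) / sqrt (real n * h n)))) - ?\<psi> (\<lambda>j. \<eta> j \<omega>')"
        by (subst Bochner_Integration.integral_diff[OF i2' integrable_const]) (simp add: prob_space)
      with bound n UL show "cmod (expectation (\<lambda>\<omega>. iexp (t * ((\<Sum>i=1..n. U i (\<lambda>j. \<eta> j \<omega>') * (kern (h n) (X i \<omega>) - EK (h n))) / sqrt (real n * h n))) - ?\<psi> (\<lambda>j. \<eta> j \<omega>'))) \<le> \<delta> n"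
        by simp
      \<comment> \<open>The zero weights are admissible and bound a norm by
        \<open>\<delta> n\<close>.\<close>
      show "0 \<le> \<delta> n"
        by (rule order_trans[OF norm_ge_zero bound[rule_format, OF n, of "\<lambda>_. 0"]]) (use L in simp)
    qed simp
    also have "\<dots> = \<delta> n" using prob_space by simp
    finally show "cmod (expectation (\<lambda>\<omega>. iexp (t * ?S \<omega>)) - expectation (\<lambda>\<omega>. ?\<psi> (\<lambda>j. \<eta> j \<omega>))) \<le> \<delta> n"
      unfolding I_eq .
  qed
qed

end

subsection \<open>Errors driven by innovations\<close>

text \<open>Pure algebra, valid for every \<open>c\<close>: in the first two terms together
  \<open>c\<close> is multiplied by the sum of the deviations of the errors from their average,
  which is zero. These terms carry the errors, the third the local bias of the regression, the last
  the fluctuation of the mean of \<open>m\<close>.\<close>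

lemma studentized_identity:
  fixes k \<mu> e :: "nat \<Rightarrow> real"
  assumes n: "1 \<le> n" and h: "0 < h" and \<kappa>: "0 < \<kappa>" and k: "\<And>i. 0 \<le> k i"
    and F: "F = 1 / (real n * h) * (\<Sum>i=1..n. k i)"
  shows "sqrt (real n * h / \<kappa>) * sqrt F *
      (1 / (real n * h * F) * (\<Sum>i=1..n. (\<mu> i + e i) * k i) - 1 / real n * (\<Sum>i=1..n. \<mu> i + e i) - (mn - Em))
    = (1 / sqrt (\<kappa> * F)) * ((\<Sum>i=1..n. e i * (k i - c)) / sqrt (real n * h))
      + - ((1 / sqrt (\<kappa> * F)) * ((\<Sum>i=1..n. (\<Sum>j=1..n. e j) / real n * (k i - c)) / sqrt (real n * h)))
      + (1 / sqrt (\<kappa> * F)) * ((\<Sum>i=1..n. k i * (\<mu> i - mn)) / sqrt (real n * h))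
      + - (sqrt (F / \<kappa>) * (sqrt (real n * h) / real n * (\<Sum>i=1..n. \<mu> i - Em)))"
proof (cases "F = 0")
  case False
  have F0: "0 < F" using False k n h unfolding F by (auto simp: sum_nonneg order_less_le)
  \<comment> \<open>Naming the square roots \<open>s\<close>, \<open>f\<close>, \<open>g\<close> of
    n h, \<open>F\<close>, \<open>\<kappa>\<close> turns the claim into a rational identity.\<close>
  define s where "s = sqrt (real n * h)"
  have s0: "0 < s" and ss: "real n * h = s * s" using n h by (auto simp: s_def)
  define r where "r = sqrt (\<kappa> * F)"
  define f where "f = sqrt F"
  define g where "g = sqrt \<kappa>"
  have f0: "0 < f" "F = f * f" and g0: "0 < g" "\<kappa> = g * g" using F0 \<kappa> by (auto simp: f_def g_def)
  define S where "S = (\<Sum>i=1..n. k i)"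
  have SF: "S = s * s * (f * f)" using F s0 unfolding S_def[symmetric] ss f0(2) by simp
  define A where "A = (\<Sum>i=1..n. \<mu> i * k i)"
  define B where "B = (\<Sum>i=1..n. e i * k i)"
  define P where "P = (\<Sum>i=1..n. \<mu> i)"
  define Q where "Q = (\<Sum>i=1..n. e i)"
  have 1: "(\<Sum>i=1..n. (\<mu> i + e i) * k i) = A + B" "(\<Sum>i=1..n. \<mu> i + e i) = P + Q"
    by (simp_all add: A_def B_def P_def Q_def sum.distrib distrib_right)
  have 2: "(\<Sum>i=1..n. e i * (k i - c)) = B - Q * c" "(\<Sum>i=1..n. q * (k i - c)) = q * (S - real n * c)"
    "(\<Sum>i=1..n. k i * (\<mu> i - mn)) = A - mn * S" "(\<Sum>i=1..n. \<mu> i - Em) = P - real n * Em" for q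
    by (simp_all add: A_def B_def P_def Q_def S_def right_diff_distrib sum_subtractf sum_distrib_left sum_distrib_right mult.commute)
  have sq: "sqrt (s * s) = s" "sqrt (f * f) = f" "sqrt (s * s / (g * g)) = s / g" "sqrt (g * g * (f * f)) = g * f" "sqrt (f * f / (g * g)) = f / g"
    using s0 f0 g0 by (simp_all add: real_sqrt_divide real_sqrt_mult)
  show ?thesis
    unfolding 1 2 Q_def[symmetric] unfolding ss f0(2) g0(2) sq SF using n s0 f0(1) g0(1)
    by (simp add: field_simps)
next
  \<comment> \<open>For \<open>F = 0\<close> every term vanishes: square roots of zero on both
    sides, and division by zero gives zero.\<close>
  case True
  then show ?thesis by simp
qed

text \<open>Split \<open>Q\<close> into its limit and a vanishing remainder; the remainder meets a
  factor with bounded second moments, the limit one that tends to zero in mean square.\<close>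

lemma (in prob_space) little_o_P_mult_convergent:
  assumes Q: "\<And>n. Q n \<in> borel_measurable M" and E: "\<And>n. E n \<in> borel_measurable M"
    and Qc: "little_o_P_one M (\<lambda>n \<omega>. Q n \<omega> - c)"
    and b: "eventually (\<lambda>n. integrable M (\<lambda>\<omega>. (E n \<omega>)\<^sup>2) \<and> expectation (\<lambda>\<omega>. (E n \<omega>)\<^sup>2) \<le> b n) sequentially" and b0: "b \<longlonglongrightarrow> 0"
  shows "little_o_P_one M (\<lambda>n \<omega>. Q n \<omega> * E n \<omega>)"
proof -
  have "eventually (\<lambda>n. b n < 1) sequentially" using b0 by (rule order_tendstoD) simp
  with b have b1: "eventually (\<lambda>n. integrable M (\<lambda>\<omega>. (E n \<omega>)\<^sup>2) \<and> expectation (\<lambda>\<omega>. (E n \<omega>)\<^sup>2) \<le> 1) sequentially"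
    by eventually_elim auto
  have Qm: "(\<lambda>\<omega>. Q n \<omega> - c) \<in> borel_measurable M" for n using Q by measurable
  have "little_o_P_one M (\<lambda>n \<omega>. (Q n \<omega> - c) * E n \<omega> + c * E n \<omega>)"
  proof (rule little_o_P_add)
    show "little_o_P_one M (\<lambda>n \<omega>. (Q n \<omega> - c) * E n \<omega>)"
      by (rule little_o_P_mult_square_bounded[OF Qm E Qc b1])
    show "little_o_P_one M (\<lambda>n \<omega>. c * E n \<omega>)"
      by (rule little_o_P_cmult[OF E little_o_P_of_square[OF E b b0]])
  qed (use Q E in measurable)
  then show ?thesis by (simp add: left_diff_distrib)
qed

text \<open>The exponential is Lipschitz, and the mean distance is at most the root of the mean
  square distance.\<close>

lemma (in prob_space) norm_char_diff_le:
  assumes A: "A \<in> borel_measurable M" and B: "B \<in> borel_measurable M"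
    and AB: "integrable M (\<lambda>\<omega>. (A \<omega> - B \<omega>)\<^sup>2)" "expectation (\<lambda>\<omega>. (A \<omega> - B \<omega>)\<^sup>2) \<le> c"
  shows "cmod (expectation (\<lambda>\<omega>. iexp (t * A \<omega>)) - expectation (\<lambda>\<omega>. iexp (t * B \<omega>))) \<le> \<bar>t\<bar> * sqrt c"
proof -
  have int: "integrable M (\<lambda>\<omega>. iexp (t * f \<omega>))" if "f \<in> borel_measurable M" for f
    using that by (intro integrable_const_bound[where B=1]) auto
  have ABm: "(\<lambda>\<omega>. A \<omega> - B \<omega>) \<in> borel_measurable M" using A B by measurable
  have "cmod (expectation (\<lambda>\<omega>. iexp (t * A \<omega>)) - expectation (\<lambda>\<omega>. iexp (t * B \<omega>))) \<le> expectation (\<lambda>\<omega>. cmod (iexp (t * A \<omega>) - iexp (t * B \<omega>)))"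
    unfolding Bochner_Integration.integral_diff[symmetric, OF int[OF A] int[OF B]] by (rule integral_norm_bound)
  also have "\<dots> \<le> expectation (\<lambda>\<omega>. \<bar>t\<bar> * \<bar>A \<omega> - B \<omega>\<bar>)"
  proof (rule integral_mono)
    show "integrable M (\<lambda>\<omega>. cmod (iexp (t * A \<omega>) - iexp (t * B \<omega>)))"
      by (intro integrable_norm Bochner_Integration.integrable_diff int A B)
    show "integrable M (\<lambda>\<omega>. \<bar>t\<bar> * \<bar>A \<omega> - B \<omega>\<bar>)"
      by (intro integrable_mult_right integrable_abs expectation_abs_le_sqrt(1)[OF ABm AB(1)])
    show "cmod (iexp (t * A \<omega>) - iexp (t * B \<omega>)) \<le> \<bar>t\<bar> * \<bar>A \<omega> - B \<omega>\<bar>" for \<omega>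
      using norm_iexp_diff_le[of "t * A \<omega>" "t * B \<omega>"] by (simp only: right_diff_distrib[symmetric] abs_mult)
  qed
  also have "\<dots> = \<bar>t\<bar> * expectation (\<lambda>\<omega>. \<bar>A \<omega> - B \<omega>\<bar>)" by simp
  also have "\<dots> \<le> \<bar>t\<bar> * sqrt c"
    by (intro mult_left_mono order_trans[OF expectation_abs_le_sqrt(2)[OF ABm AB(1)]] real_sqrt_le_mono AB(2)) simp
  finally show ?thesis .
qed

section \<open>The errors, their truncation and the leading term\<close>

locale shape_regression = random_weights M \<zeta> \<sigma> a \<alpha> A X K x \<eta>
  for M :: "'a measure" and \<zeta> \<sigma> a \<alpha> A X K x \<eta> +
  fixes G :: "(nat \<Rightarrow> real) \<Rightarrow> real" and h :: "nat \<Rightarrow> real"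
  assumes \<eta>_indep: "indep_vars (\<lambda>_. borel) \<eta> UNIV"
    and \<eta>_ident: "\<And>i j. distr M borel (\<eta> i) = distr M borel (\<eta> j)"
    and G_measurable: "G \<in> borel_measurable (Pi\<^sub>M UNIV (\<lambda>_. borel))"
    and G_mean: "expectation (\<lambda>\<omega>. G (\<lambda>k. \<eta> (1 - int k) \<omega>)) = 0"
    and G_square: "expectation (\<lambda>\<omega>. (G (\<lambda>k. \<eta> (1 - int k) \<omega>))\<^sup>2) = 1"
    and h_pos: "\<And>n. 1 \<le> n \<Longrightarrow> 0 < h n" and h_lim: "h \<longlonglongrightarrow> 0"
    and nh_lim: "filterlim (\<lambda>n. real n * h n) at_top sequentially"
    and h_memory: "(\<lambda>n. h n * real n powr (1 - \<alpha>)) \<longlonglongrightarrow> 0"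
begin

text \<open>The innovations read backwards from time \<open>i\<close>, the form in which the ergodic
  theorem for shifts applies. \<open>GP\<close> is the same error as a function of the whole
  two-sided path, the form in which weights are frozen.\<close>

definition lagged :: "nat \<Rightarrow> 'a \<Rightarrow> nat \<Rightarrow> real" where "lagged i \<omega> k = \<eta> (int i - int k) \<omega>"

definition GP :: "nat \<Rightarrow> (int \<Rightarrow> real) \<Rightarrow> real" where "GP i p = G (\<lambda>k. p (int i - int k))"

definition eps :: "nat \<Rightarrow> 'a \<Rightarrow> real" where "eps i \<omega> = G (lagged i \<omega>)"

lemma eps_GP: "eps i \<omega> = GP i (\<lambda>j. \<eta> j \<omega>)"
  by (simp add: eps_def GP_def lagged_def[abs_def])

lemma GP_measurable[measurable]: "GP i \<in> borel_measurable (Pi\<^sub>M UNIV (\<lambda>_. borel))"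
proof -
  have "(\<lambda>p k. p (int i - int k)) \<in> measurable (Pi\<^sub>M UNIV (\<lambda>_. borel)) (Pi\<^sub>M UNIV (\<lambda>_. borel :: real measure))"
    by (intro measurable_PiM_single') auto
  from measurable_compose[OF this G_measurable] show ?thesis by (simp add: GP_def[abs_def])
qed

lemma eps_measurable[measurable]: "eps i \<in> borel_measurable M"
  using weights_measurable[OF GP_measurable[of i]] by (simp add: eps_GP[abs_def])

lemma lagged_measurable: "lagged i \<in> measurable M (Pi\<^sub>M UNIV (\<lambda>_. borel))"
  unfolding lagged_def[abs_def] by (intro measurable_PiM_single' \<eta>_measurable) simp

lemma lagged_stationary: "distr M (Pi\<^sub>M UNIV (\<lambda>_. borel)) (lagged i) = distr M (Pi\<^sub>M UNIV (\<lambda>_. borel)) (lagged 0)"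
  unfolding lagged_def[abs_def] stationary_shift[OF \<eta>_indep \<eta>_ident] ..

lemma expectation_lagged:
  fixes F :: "(nat \<Rightarrow> real) \<Rightarrow> real"
  assumes F: "F \<in> borel_measurable (Pi\<^sub>M UNIV (\<lambda>_. borel))"
  shows "expectation (\<lambda>\<omega>. F (lagged i \<omega>)) = expectation (\<lambda>\<omega>. F (lagged j \<omega>))"
    and "integrable M (\<lambda>\<omega>. F (lagged i \<omega>)) \<longleftrightarrow> integrable M (\<lambda>\<omega>. F (lagged j \<omega>))"
proof -
  have d: "distr M (Pi\<^sub>M UNIV (\<lambda>_. borel)) (lagged i) = distr M (Pi\<^sub>M UNIV (\<lambda>_. borel)) (lagged j)"
    using lagged_stationary[of i] lagged_stationary[of j] by (rule trans[OF _ sym])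
  show "expectation (\<lambda>\<omega>. F (lagged i \<omega>)) = expectation (\<lambda>\<omega>. F (lagged j \<omega>))"
    unfolding integral_distr[OF lagged_measurable F, symmetric] d ..
  show "integrable M (\<lambda>\<omega>. F (lagged i \<omega>)) \<longleftrightarrow> integrable M (\<lambda>\<omega>. F (lagged j \<omega>))"
    unfolding integrable_distr_eq[OF lagged_measurable F, symmetric] d ..
qed

lemma eps_square_integrable: "integrable M (\<lambda>\<omega>. (eps i \<omega>)\<^sup>2)"
  and eps_square: "expectation (\<lambda>\<omega>. (eps i \<omega>)\<^sup>2) = 1" and eps_mean: "expectation (eps i) = 0"
proof -
  note [measurable] = G_measurable
  have 1: "expectation (\<lambda>\<omega>. (eps 1 \<omega>)\<^sup>2) = 1" "expectation (\<lambda>\<omega>. eps 1 \<omega>) = 0"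
    using G_square G_mean by (simp_all add: eps_def lagged_def[abs_def])
  \<comment> \<open>A function that is not integrable has integral 0 by convention, so the value 1
    forces integrability.\<close>
  have "integrable M (\<lambda>\<omega>. (eps 1 \<omega>)\<^sup>2)"
    using 1(1) by (metis not_integrable_integral_eq zero_neq_one)
  then show "integrable M (\<lambda>\<omega>. (eps i \<omega>)\<^sup>2)"
    using expectation_lagged(2)[of "\<lambda>y. (G y)\<^sup>2" i 1] by (simp add: eps_def)
  show "expectation (\<lambda>\<omega>. (eps i \<omega>)\<^sup>2) = 1"
    using expectation_lagged(1)[of "\<lambda>y. (G y)\<^sup>2" i 1] 1 by (simp add: eps_def)
  show "expectation (eps i) = 0"
    using expectation_lagged(1)[of G i 1] 1 by (simp add: eps_def[abs_def])
qed

lemma time_average_lagged: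
  assumes F: "F \<in> borel_measurable (Pi\<^sub>M UNIV (\<lambda>_. borel))" and F2: "integrable M (\<lambda>\<omega>. (F (lagged 0 \<omega>))\<^sup>2)"
  shows "(\<lambda>n. expectation (\<lambda>\<omega>. ((\<Sum>i=1..n. F (lagged i \<omega>)) / real n - expectation (\<lambda>\<omega>. F (lagged 0 \<omega>)))\<^sup>2)) \<longlonglongrightarrow> 0"
  using mean_ergodic_shift[OF \<eta>_indep \<eta>_ident F] F2
  unfolding mean_ergodic_def lagged_def[abs_def] by simp

lemma eps_average: "(\<lambda>n. expectation (\<lambda>\<omega>. ((\<Sum>i=1..n. eps i \<omega>) / real n)\<^sup>2)) \<longlonglongrightarrow> 0"
  using time_average_lagged[OF G_measurable] eps_square_integrable[of 0] eps_mean[of 0]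
  by (simp add: eps_def[abs_def])

text \<open>Large values are set to zero and not clipped, so that the square of
  \<open>y - trunc L y\<close> is exactly the square of \<open>y\<close> minus that of
  \<open>trunc L y\<close>. The truncation error then has mean square
  \<open>1 - vtrunc L\<close>.\<close>

definition trunc :: "real \<Rightarrow> real \<Rightarrow> real" where "trunc L y = (if \<bar>y\<bar> \<le> L then y else 0)"

lemma trunc_measurable[measurable]: "trunc L \<in> borel_measurable borel"
  unfolding trunc_def[abs_def] by measurable

lemma trunc_bound: "0 \<le> L \<Longrightarrow> \<bar>trunc L y\<bar> \<le> L" by (simp add: trunc_def)

definition vtrunc :: "real \<Rightarrow> real" where "vtrunc L = expectation (\<lambda>\<omega>. (trunc L (eps 0 \<omega>))\<^sup>2)"

lemma trunc_square_integrable: "integrable M (\<lambda>\<omega>. (trunc L (eps i \<omega>))\<^sup>2)"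
  by (rule Bochner_Integration.integrable_bound[OF eps_square_integrable[of i]]) (auto simp: trunc_def)

lemma expectation_trunc: "expectation (\<lambda>\<omega>. (trunc L (eps i \<omega>))\<^sup>2) = vtrunc L"
proof -
  note [measurable] = G_measurable
  show ?thesis unfolding vtrunc_def eps_def
    by (rule expectation_lagged(1)[of "\<lambda>y. (trunc L (G y))\<^sup>2"]) measurable
qed

lemma expectation_trunc_error:
  "integrable M (\<lambda>\<omega>. (eps i \<omega> - trunc L (eps i \<omega>))\<^sup>2)"
  "expectation (\<lambda>\<omega>. (eps i \<omega> - trunc L (eps i \<omega>))\<^sup>2) = 1 - vtrunc L"
proof -
  have eq: "(eps i \<omega> - trunc L (eps i \<omega>))\<^sup>2 = (eps i \<omega>)\<^sup>2 - (trunc L (eps i \<omega>))\<^sup>2" for \<omega>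
    by (simp add: trunc_def)
  show "integrable M (\<lambda>\<omega>. (eps i \<omega> - trunc L (eps i \<omega>))\<^sup>2)"
    unfolding eq by (intro Bochner_Integration.integrable_diff eps_square_integrable trunc_square_integrable)
  show "expectation (\<lambda>\<omega>. (eps i \<omega> - trunc L (eps i \<omega>))\<^sup>2) = 1 - vtrunc L"
    unfolding eq Bochner_Integration.integral_diff[OF eps_square_integrable trunc_square_integrable] eps_square expectation_trunc ..
qed

lemma vtrunc_limit: "(\<lambda>L. vtrunc (real L)) \<longlonglongrightarrow> 1"
proof -
  have "(\<lambda>L. expectation (\<lambda>\<omega>. (trunc (real L) (eps 0 \<omega>))\<^sup>2)) \<longlonglongrightarrow> expectation (\<lambda>\<omega>. (eps 0 \<omega>)\<^sup>2)"
  proof (rule integral_dominated_convergence[where w="\<lambda>\<omega>. (eps 0 \<omega>)\<^sup>2"])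
    show "AE \<omega> in M. (\<lambda>L. (trunc (real L) (eps 0 \<omega>))\<^sup>2) \<longlonglongrightarrow> (eps 0 \<omega>)\<^sup>2"
    proof (rule AE_I2, rule tendsto_eventually)
      fix \<omega>
      obtain N :: nat where "\<bar>eps 0 \<omega>\<bar> \<le> real N" using real_arch_simple by blast
      then show "eventually (\<lambda>L. (trunc (real L) (eps 0 \<omega>))\<^sup>2 = (eps 0 \<omega>)\<^sup>2) sequentially"
        by (intro eventually_sequentiallyI[of N]) (simp add: trunc_def)
    qed
  qed (auto simp: trunc_def eps_square_integrable)
  then show ?thesis by (simp add: vtrunc_def eps_square)
qed

lemma vtrunc_bounds: "0 \<le> vtrunc L" "vtrunc L \<le> 1"
proof -
  show "0 \<le> vtrunc L" by (simp add: vtrunc_def)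
  have "0 \<le> expectation (\<lambda>\<omega>. (eps 0 \<omega> - trunc L (eps 0 \<omega>))\<^sup>2)" by simp
  then show "vtrunc L \<le> 1" unfolding expectation_trunc_error by simp
qed

lemma trunc_average:
  "(\<lambda>n. expectation (\<lambda>\<omega>. ((\<Sum>i=1..n. (trunc (real L) (eps i \<omega>))\<^sup>2) / real n - vtrunc (real L))\<^sup>2)) \<longlonglongrightarrow> 0"
proof -
  note [measurable] = G_measurable lagged_measurable
  have "integrable M (\<lambda>\<omega>. ((trunc (real L) (G (lagged 0 \<omega>)))\<^sup>2)\<^sup>2)"
  proof (intro integrable_const_bound[where B="((real L)\<^sup>2)\<^sup>2"] AE_I2)
    fix \<omega>
    have "(trunc (real L) (G (lagged 0 \<omega>)))\<^sup>2 \<le> (real L)\<^sup>2"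
      using trunc_bound[of "real L" "G (lagged 0 \<omega>)"] by (simp add: abs_le_square_iff[symmetric])
    then show "norm (((trunc (real L) (G (lagged 0 \<omega>)))\<^sup>2)\<^sup>2) \<le> ((real L)\<^sup>2)\<^sup>2"
      using power_mono[of "(trunc (real L) (G (lagged 0 \<omega>)))\<^sup>2" "(real L)\<^sup>2" 2] by simp
  qed measurable
  from time_average_lagged[OF _ this] show ?thesis by (simp add: eps_def vtrunc_def)
qed

definition W :: "(nat \<Rightarrow> 'a \<Rightarrow> real) \<Rightarrow> nat \<Rightarrow> 'a \<Rightarrow> real" where
  "W u n \<omega> = (\<Sum>i=1..n. u i \<omega> * (kern (h n) (X i \<omega>) - EK (h n))) / sqrt (real n * h n)"

lemma W_measurable: "(\<And>i. u i \<in> borel_measurable M) \<Longrightarrow> W u n \<in> borel_measurable M"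
  unfolding W_def[abs_def]
  by (intro borel_measurable_divide borel_measurable_sum borel_measurable_times borel_measurable_diff borel_measurable_const
      measurable_compose[OF X_measurable kern_measurable]) simp_all

text \<open>Once h n^(1-\<alpha>) is below 1 the memory factor in
  \<open>random_weighted_square\<close> is below 2, and the normalisation leaves the average second
  moment of the weights.\<close>

lemma W_square:
  "\<exists>C\<ge>0. eventually (\<lambda>n. \<forall>U. (\<forall>i. U i \<in> borel_measurable (Pi\<^sub>M UNIV (\<lambda>_. borel))) \<longrightarrow>
    (\<forall>i. integrable M (\<lambda>\<omega>. (U i (\<lambda>j. \<eta> j \<omega>))\<^sup>2)) \<longrightarrow>
    integrable M (\<lambda>\<omega>. (W (\<lambda>i \<omega>. U i (\<lambda>j. \<eta> j \<omega>)) n \<omega>)\<^sup>2) \<and>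
    expectation (\<lambda>\<omega>. (W (\<lambda>i \<omega>. U i (\<lambda>j. \<eta> j \<omega>)) n \<omega>)\<^sup>2) \<le> C * ((\<Sum>i=1..n. expectation (\<lambda>\<omega>. (U i (\<lambda>j. \<eta> j \<omega>))\<^sup>2)) / real n)) sequentially"
proof -
  obtain C where C0: "0 \<le> C" and C: "\<forall>h>0. \<forall>n\<ge>1. \<forall>U. (\<forall>i. U i \<in> borel_measurable (Pi\<^sub>M UNIV (\<lambda>_. borel))) \<longrightarrow>
    (\<forall>i. integrable M (\<lambda>\<omega>. (U i (\<lambda>j. \<eta> j \<omega>))\<^sup>2)) \<longrightarrow>
    integrable M (\<lambda>\<omega>. (\<Sum>i=1..n. U i (\<lambda>j. \<eta> j \<omega>) * (kern h (X i \<omega>) - EK h))\<^sup>2) \<and>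
    expectation (\<lambda>\<omega>. (\<Sum>i=1..n. U i (\<lambda>j. \<eta> j \<omega>) * (kern h (X i \<omega>) - EK h))\<^sup>2)
      \<le> C * h * (1 + h * real n powr (1 - \<alpha>)) * (\<Sum>i=1..n. expectation (\<lambda>\<omega>. (U i (\<lambda>j. \<eta> j \<omega>))\<^sup>2))"
    using random_weighted_square by blast
  have "eventually (\<lambda>n. h n * real n powr (1 - \<alpha>) < 1) sequentially"
    using h_memory by (rule order_tendstoD) simp
  then have "eventually (\<lambda>n. 1 \<le> n \<and> h n * real n powr (1 - \<alpha>) < 1) sequentially"
    using eventually_ge_at_top[of 1] by eventually_elim simp
  then show ?thesis
  proof (intro exI[of _ "2 * C"] conjI, use C0 in simp, elim eventually_mono, intro allI impI)
    fix n :: nat and U :: "nat \<Rightarrow> (int \<Rightarrow> real) \<Rightarrow> real"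
    assume n: "1 \<le> n \<and> h n * real n powr (1 - \<alpha>) < 1" and U: "\<forall>i. U i \<in> borel_measurable (Pi\<^sub>M UNIV (\<lambda>_. borel))"
      and U2: "\<forall>i. integrable M (\<lambda>\<omega>. (U i (\<lambda>j. \<eta> j \<omega>))\<^sup>2)"
    let ?S = "\<lambda>\<omega>. \<Sum>i=1..n. U i (\<lambda>j. \<eta> j \<omega>) * (kern (h n) (X i \<omega>) - EK (h n))"
    let ?e = "\<Sum>i=1..n. expectation (\<lambda>\<omega>. (U i (\<lambda>j. \<eta> j \<omega>))\<^sup>2)"
    have hp: "0 < h n" using h_pos n by simp
    have nh: "0 < real n * h n" using hp n by simp
    have S: "integrable M (\<lambda>\<omega>. (?S \<omega>)\<^sup>2)" "expectation (\<lambda>\<omega>. (?S \<omega>)\<^sup>2) \<le> C * h n * (1 + h n * real n powr (1 - \<alpha>)) * ?e"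
      using C[rule_format, OF hp, of n U] n U U2 by auto
    have W: "(W (\<lambda>i \<omega>. U i (\<lambda>j. \<eta> j \<omega>)) n \<omega>)\<^sup>2 = (?S \<omega>)\<^sup>2 / (real n * h n)" for \<omega>
      using nh by (simp add: W_def power_divide)
    show "integrable M (\<lambda>\<omega>. (W (\<lambda>i \<omega>. U i (\<lambda>j. \<eta> j \<omega>)) n \<omega>)\<^sup>2)
      \<and> expectation (\<lambda>\<omega>. (W (\<lambda>i \<omega>. U i (\<lambda>j. \<eta> j \<omega>)) n \<omega>)\<^sup>2) \<le> 2 * C * (?e / real n)"
    proof
      show "integrable M (\<lambda>\<omega>. (W (\<lambda>i \<omega>. U i (\<lambda>j. \<eta> j \<omega>)) n \<omega>)\<^sup>2)" unfolding W using S(1) by simp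
      have e0: "0 \<le> ?e" by (intro sum_nonneg) simp
      have "expectation (\<lambda>\<omega>. (W (\<lambda>i \<omega>. U i (\<lambda>j. \<eta> j \<omega>)) n \<omega>)\<^sup>2) = expectation (\<lambda>\<omega>. (?S \<omega>)\<^sup>2) / (real n * h n)"
        unfolding W by simp
      also have "\<dots> \<le> (C * h n * (1 + h n * real n powr (1 - \<alpha>)) * ?e) / (real n * h n)"
        using S(2) nh by (intro divide_right_mono) auto
      also have "\<dots> \<le> (C * h n * 2 * ?e) / (real n * h n)"
        using n C0 hp e0 nh by (intro divide_right_mono mult_right_mono mult_left_mono) auto
      also have "\<dots> = 2 * C * (?e / real n)" using hp by simp
      finally show "expectation (\<lambda>\<omega>. (W (\<lambda>i \<omega>. U i (\<lambda>j. \<eta> j \<omega>)) n \<omega>)\<^sup>2) \<le> 2 * C * (?e / real n)" .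
    qed
  qed
qed

lemma W_eps_bounded:
  "\<exists>C. eventually (\<lambda>n. integrable M (\<lambda>\<omega>. (W eps n \<omega>)\<^sup>2) \<and> expectation (\<lambda>\<omega>. (W eps n \<omega>)\<^sup>2) \<le> C) sequentially"
proof -
  obtain C where C: "eventually (\<lambda>n. \<forall>U. (\<forall>i. U i \<in> borel_measurable (Pi\<^sub>M UNIV (\<lambda>_. borel))) \<longrightarrow>
    (\<forall>i. integrable M (\<lambda>\<omega>. (U i (\<lambda>j. \<eta> j \<omega>))\<^sup>2)) \<longrightarrow>
    integrable M (\<lambda>\<omega>. (W (\<lambda>i \<omega>. U i (\<lambda>j. \<eta> j \<omega>)) n \<omega>)\<^sup>2) \<and>
    expectation (\<lambda>\<omega>. (W (\<lambda>i \<omega>. U i (\<lambda>j. \<eta> j \<omega>)) n \<omega>)\<^sup>2) \<le> C * ((\<Sum>i=1..n. expectation (\<lambda>\<omega>. (U i (\<lambda>j. \<eta> j \<omega>))\<^sup>2)) / real n)) sequentially"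
    using W_square by blast
  show ?thesis
  proof (rule exI[of _ C], use C eventually_ge_at_top[of 1] in eventually_elim)
    case (elim n)
    from elim(1)[rule_format, of GP] eps_square_integrable eps_square elim(2)
    show ?case by (simp add: eps_GP[symmetric] eps_GP[abs_def, symmetric] GP_measurable)
  qed
qed

text \<open>The average error is an admissible weight, constant in the summation index. Its second
  moment tends to zero by the mean ergodic theorem, which needs no rate.\<close>

lemma W_average:
  "\<exists>b. b \<longlonglongrightarrow> 0 \<and> eventually (\<lambda>n. integrable M (\<lambda>\<omega>. (W (\<lambda>_ \<omega>. (\<Sum>j=1..n. eps j \<omega>) / real n) n \<omega>)\<^sup>2) \<and>
    expectation (\<lambda>\<omega>. (W (\<lambda>_ \<omega>. (\<Sum>j=1..n. eps j \<omega>) / real n) n \<omega>)\<^sup>2) \<le> b n) sequentially"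
proof -
  obtain C where C: "eventually (\<lambda>n. \<forall>U. (\<forall>i. U i \<in> borel_measurable (Pi\<^sub>M UNIV (\<lambda>_. borel))) \<longrightarrow>
    (\<forall>i. integrable M (\<lambda>\<omega>. (U i (\<lambda>j. \<eta> j \<omega>))\<^sup>2)) \<longrightarrow>
    integrable M (\<lambda>\<omega>. (W (\<lambda>i \<omega>. U i (\<lambda>j. \<eta> j \<omega>)) n \<omega>)\<^sup>2) \<and>
    expectation (\<lambda>\<omega>. (W (\<lambda>i \<omega>. U i (\<lambda>j. \<eta> j \<omega>)) n \<omega>)\<^sup>2) \<le> C * ((\<Sum>i=1..n. expectation (\<lambda>\<omega>. (U i (\<lambda>j. \<eta> j \<omega>))\<^sup>2)) / real n)) sequentially"
    using W_square by blast
  let ?b = "\<lambda>n. C * expectation (\<lambda>\<omega>. ((\<Sum>i=1..n. eps i \<omega>) / real n)\<^sup>2)"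
  have "?b \<longlonglongrightarrow> 0" using tendsto_mult_right_zero[OF eps_average] .
  moreover have "eventually (\<lambda>n. integrable M (\<lambda>\<omega>. (W (\<lambda>_ \<omega>. (\<Sum>j=1..n. eps j \<omega>) / real n) n \<omega>)\<^sup>2) \<and>
    expectation (\<lambda>\<omega>. (W (\<lambda>_ \<omega>. (\<Sum>j=1..n. eps j \<omega>) / real n) n \<omega>)\<^sup>2) \<le> ?b n) sequentially"
    using C eventually_ge_at_top[of 1]
  proof eventually_elim
    case (elim n)
    have m: "(\<lambda>p. (\<Sum>j=1..n. GP j p) / real n) \<in> borel_measurable (Pi\<^sub>M UNIV (\<lambda>_. borel))" by measurable
    have i: "integrable M (\<lambda>\<omega>. ((\<Sum>j=1..n. GP j (\<lambda>j. \<eta> j \<omega>)) / real n)\<^sup>2)"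
      using integrable_sum_square[of "{1..n}" eps M] eps_square_integrable by (simp add: power_divide eps_GP)
    from elim(1)[rule_format, of "\<lambda>_ p. (\<Sum>j=1..n. GP j p) / real n", OF m i] elim(2)
    show ?case by (simp add: eps_GP)
  qed
  ultimately show ?thesis by blast
qed

lemma char_W_eps:
  "(\<lambda>n. expectation (\<lambda>\<omega>. iexp (t * W eps n \<omega>))) \<longlonglongrightarrow> complex_of_real (exp (- (t\<^sup>2 * (kappa1 K * std_normal_density x) / 2)))"
proof -
  define \<kappa> where "\<kappa> = kappa1 K * std_normal_density x"
  have \<kappa>0: "0 \<le> \<kappa>" by (simp add: \<kappa>_def kappa1_def)
  obtain C where C0: "0 \<le> C" and C: "eventually (\<lambda>n. \<forall>U. (\<forall>i. U i \<in> borel_measurable (Pi\<^sub>M UNIV (\<lambda>_. borel))) \<longrightarrow>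
    (\<forall>i. integrable M (\<lambda>\<omega>. (U i (\<lambda>j. \<eta> j \<omega>))\<^sup>2)) \<longrightarrow>
    integrable M (\<lambda>\<omega>. (W (\<lambda>i \<omega>. U i (\<lambda>j. \<eta> j \<omega>)) n \<omega>)\<^sup>2) \<and>
    expectation (\<lambda>\<omega>. (W (\<lambda>i \<omega>. U i (\<lambda>j. \<eta> j \<omega>)) n \<omega>)\<^sup>2) \<le> C * ((\<Sum>i=1..n. expectation (\<lambda>\<omega>. (U i (\<lambda>j. \<eta> j \<omega>))\<^sup>2)) / real n)) sequentially"
    using W_square by blast
  \<comment> \<open>The cost of the level \<open>L\<close>: the first term for replacing the errors
    in the sum, the second for the limiting variance being \<open>vtrunc\<close> instead of
    1.\<close>
  define r where "r = (\<lambda>L. \<bar>t\<bar> * sqrt (C * (1 - vtrunc (real L))) + t\<^sup>2 * \<kappa> / 2 * (1 - vtrunc (real L)))"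
  have "r \<longlonglongrightarrow> \<bar>t\<bar> * sqrt (C * (1 - 1)) + t\<^sup>2 * \<kappa> / 2 * (1 - 1)"
    unfolding r_def by (intro tendsto_intros vtrunc_limit)
  then have r0: "r \<longlonglongrightarrow> 0" by simp
  let ?\<Phi> = "\<lambda>n. expectation (\<lambda>\<omega>. iexp (t * W eps n \<omega>))" and ?g = "\<lambda>u. exp (- (t\<^sup>2 * (u * \<kappa>) / 2))"
  show ?thesis
    unfolding tendsto_iff dist_norm \<kappa>_def[symmetric]
  proof (intro allI impI)
    fix \<eta>0 :: real assume \<eta>0: "0 < \<eta>0"
    have "eventually (\<lambda>L. r L < \<eta>0 / 2) sequentially" using r0 \<eta>0 by (intro order_tendstoD(2)[OF r0]) simp
    then obtain L where rL: "r L < \<eta>0 / 2" by (auto simp: eventually_sequentially)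
    define T where "T = (\<lambda>i \<omega>. trunc (real L) (eps i \<omega>))"
    have T[measurable]: "T i \<in> borel_measurable M" for i unfolding T_def by measurable
    let ?A = "\<lambda>n \<omega>. (\<Sum>i=1..n. (T i \<omega>)\<^sup>2) / real n"
    define \<delta>1 where "\<delta>1 = (\<lambda>n. cmod (expectation (\<lambda>\<omega>. iexp (t * W T n \<omega>)) - expectation (\<lambda>\<omega>. complex_of_real (?g (?A n \<omega>)))))"
    define \<delta>2 where "\<delta>2 = (\<lambda>n. t\<^sup>2 * \<kappa> / 2 * sqrt (expectation (\<lambda>\<omega>. (?A n \<omega> - vtrunc (real L))\<^sup>2)))"
    have "(\<lambda>n. expectation (\<lambda>\<omega>. iexp (t * W T n \<omega>)) - expectation (\<lambda>\<omega>. complex_of_real (?g (?A n \<omega>)))) \<longlonglongrightarrow> 0"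
    proof -
      have m: "(\<lambda>p. trunc (real L) (GP i p)) \<in> borel_measurable (Pi\<^sub>M UNIV (\<lambda>_. borel))" for i by measurable
      from random_weighted_char[OF h_pos h_lim nh_lim h_memory, of "\<lambda>i p. trunc (real L) (GP i p)" "real L" t, OF _ m trunc_bound]
      show ?thesis by (simp only: W_def T_def eps_GP \<kappa>_def of_nat_0_le_iff)
    qed
    then have d1: "\<delta>1 \<longlonglongrightarrow> 0" unfolding \<delta>1_def by (rule tendsto_norm_zero)
    have "\<delta>2 \<longlonglongrightarrow> t\<^sup>2 * \<kappa> / 2 * sqrt 0" unfolding \<delta>2_def T_def by (intro tendsto_intros trunc_average)
    then have d2: "\<delta>2 \<longlonglongrightarrow> 0" by simp
    have "(\<lambda>n. \<delta>1 n + \<delta>2 n) \<longlonglongrightarrow> 0" using tendsto_add[OF d1 d2] by simp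
    then have "eventually (\<lambda>n. \<delta>1 n + \<delta>2 n < \<eta>0 / 2) sequentially" using \<eta>0 by (intro order_tendstoD(2)) auto
    with C eventually_ge_at_top[of 1]
    show "eventually (\<lambda>n. cmod (?\<Phi> n - complex_of_real (exp (- (t\<^sup>2 * \<kappa> / 2)))) < \<eta>0) sequentially"
    proof eventually_elim
      case (elim n)
      have diff: "W eps n \<omega> - W T n \<omega> = W (\<lambda>i \<omega>. eps i \<omega> - T i \<omega>) n \<omega>" for \<omega>
        by (simp add: W_def left_diff_distrib sum_subtractf diff_divide_distrib)
      have m: "(\<lambda>p. GP i p - trunc (real L) (GP i p)) \<in> borel_measurable (Pi\<^sub>M UNIV (\<lambda>_. borel))" for i by measurable
      have i: "integrable M (\<lambda>\<omega>. (GP i (\<lambda>j. \<eta> j \<omega>) - trunc (real L) (GP i (\<lambda>j. \<eta> j \<omega>)))\<^sup>2)" for i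
        using expectation_trunc_error(1)[of i "real L"] by (simp add: eps_GP)
      from elim(1)[rule_format, of "\<lambda>i p. GP i p - trunc (real L) (GP i p)", OF m i]
      have D: "integrable M (\<lambda>\<omega>. (W eps n \<omega> - W T n \<omega>)\<^sup>2)"
        "expectation (\<lambda>\<omega>. (W eps n \<omega> - W T n \<omega>)\<^sup>2) \<le> C * ((\<Sum>i=1..n. expectation (\<lambda>\<omega>. (eps i \<omega> - trunc (real L) (eps i \<omega>))\<^sup>2)) / real n)"
        unfolding diff unfolding T_def eps_GP by blast+
      have "expectation (\<lambda>\<omega>. (W eps n \<omega> - W T n \<omega>)\<^sup>2) \<le> C * (1 - vtrunc (real L))"
        using D(2) elim(2) unfolding expectation_trunc_error(2) by simp
      then have 1: "cmod (?\<Phi> n - expectation (\<lambda>\<omega>. iexp (t * W T n \<omega>))) \<le> \<bar>t\<bar> * sqrt (C * (1 - vtrunc (real L)))"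
        by (intro norm_char_diff_le W_measurable D(1) T eps_measurable)
      have A0: "0 \<le> ?A n \<omega>" for \<omega> by (intro divide_nonneg_nonneg sum_nonneg) auto
      have Am: "?A n \<in> borel_measurable M" by measurable
      have TL: "(T i \<omega>)\<^sup>2 \<le> (real L)\<^sup>2" for i \<omega>
        using trunc_bound[of "real L" "eps i \<omega>"] by (simp add: T_def abs_le_square_iff[symmetric])
      have Ai: "integrable M (\<lambda>\<omega>. (?A n \<omega> - vtrunc (real L))\<^sup>2)"
      proof (intro integrable_diff_square)
        show "integrable M (\<lambda>\<omega>. (?A n \<omega>)\<^sup>2)"
        proof (intro integrable_const_bound[where B="((real L)\<^sup>2)\<^sup>2"] AE_I2)
          fix \<omega>
          have "(\<Sum>i=1..n. (T i \<omega>)\<^sup>2) \<le> (\<Sum>i=1..n. (real L)\<^sup>2)" by (intro sum_mono TL)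
          then have "?A n \<omega> \<le> (real L)\<^sup>2" using elim(2) by (simp add: divide_le_eq mult.commute)
          then show "norm ((?A n \<omega>)\<^sup>2) \<le> ((real L)\<^sup>2)\<^sup>2" using A0[of \<omega>] power_mono[of "?A n \<omega>" "(real L)\<^sup>2" 2] by simp
        qed measurable
      qed auto
      have g_lip: "\<bar>?g u - ?g w\<bar> \<le> t\<^sup>2 * \<kappa> / 2 * \<bar>u - w\<bar>" if "0 \<le> u" "0 \<le> w" for u w
      proof -
        have "\<bar>?g u - ?g w\<bar> \<le> exp 0 * \<bar>- (t\<^sup>2 * (u * \<kappa>) / 2) - - (t\<^sup>2 * (w * \<kappa>) / 2)\<bar>"
          using that \<kappa>0 by (intro abs_exp_diff_le) auto
        also have "- (t\<^sup>2 * (u * \<kappa>) / 2) - - (t\<^sup>2 * (w * \<kappa>) / 2) = - (t\<^sup>2 * \<kappa> / 2 * (u - w))" by (simp add: field_simps)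
        also have "exp 0 * \<bar>- (t\<^sup>2 * \<kappa> / 2 * (u - w))\<bar> = t\<^sup>2 * \<kappa> / 2 * \<bar>u - w\<bar>" using \<kappa>0 by (simp add: abs_mult)
        finally show ?thesis .
      qed
      have gi: "integrable M (\<lambda>\<omega>. complex_of_real (?g (?A n \<omega>)))"
      proof (intro integrable_const_bound[where B=1] AE_I2)
        fix \<omega>
        have "0 \<le> t\<^sup>2 * (?A n \<omega> * \<kappa>) / 2"
          by (rule divide_nonneg_nonneg[OF mult_nonneg_nonneg[OF zero_le_power2 mult_nonneg_nonneg[OF A0[of \<omega>] \<kappa>0]]]) simp
        then show "cmod (complex_of_real (?g (?A n \<omega>))) \<le> 1" by (simp only: norm_of_real) simp
      qed measurable
      have 2: "cmod (expectation (\<lambda>\<omega>. complex_of_real (?g (?A n \<omega>))) - complex_of_real (?g (vtrunc (real L)))) \<le> \<delta>2 n"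
      proof -
        have "expectation (\<lambda>\<omega>. complex_of_real (?g (?A n \<omega>)) - complex_of_real (?g (vtrunc (real L))))
          = expectation (\<lambda>\<omega>. complex_of_real (?g (?A n \<omega>))) - complex_of_real (?g (vtrunc (real L)))"
          by (subst Bochner_Integration.integral_diff[OF gi integrable_const]) (simp add: prob_space)
        then have "cmod (expectation (\<lambda>\<omega>. complex_of_real (?g (?A n \<omega>))) - complex_of_real (?g (vtrunc (real L))))
          \<le> expectation (\<lambda>\<omega>. cmod (complex_of_real (?g (?A n \<omega>)) - complex_of_real (?g (vtrunc (real L)))))"
          using integral_norm_bound[of M "\<lambda>\<omega>. complex_of_real (?g (?A n \<omega>)) - complex_of_real (?g (vtrunc (real L)))"] by (simp only:)
        also have "\<dots> \<le> expectation (\<lambda>\<omega>. t\<^sup>2 * \<kappa> / 2 * \<bar>?A n \<omega> - vtrunc (real L)\<bar>)"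
        proof (rule integral_mono)
          show "integrable M (\<lambda>\<omega>. cmod (complex_of_real (?g (?A n \<omega>)) - complex_of_real (?g (vtrunc (real L)))))"
            by (intro integrable_norm Bochner_Integration.integrable_diff gi integrable_const)
          show "integrable M (\<lambda>\<omega>. t\<^sup>2 * \<kappa> / 2 * \<bar>?A n \<omega> - vtrunc (real L)\<bar>)"
            by (intro integrable_mult_right integrable_abs expectation_abs_le_sqrt(1)[OF _ Ai]) measurable
          show "cmod (complex_of_real (?g (?A n \<omega>)) - complex_of_real (?g (vtrunc (real L)))) \<le> t\<^sup>2 * \<kappa> / 2 * \<bar>?A n \<omega> - vtrunc (real L)\<bar>" for \<omega>
            unfolding of_real_diff[symmetric] norm_of_real by (rule g_lip[OF A0 vtrunc_bounds(1)])
        qed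
        also have "\<dots> = t\<^sup>2 * \<kappa> / 2 * expectation (\<lambda>\<omega>. \<bar>?A n \<omega> - vtrunc (real L)\<bar>)" by (rule integral_mult_right_zero)
        also have "\<dots> \<le> \<delta>2 n"
          unfolding \<delta>2_def using \<kappa>0 by (intro mult_left_mono expectation_abs_le_sqrt(2)[OF _ Ai]) simp_all
        finally show ?thesis .
      qed
      have "\<bar>?g (vtrunc (real L)) - ?g 1\<bar> \<le> t\<^sup>2 * \<kappa> / 2 * (1 - vtrunc (real L))"
        using g_lip[OF vtrunc_bounds(1), of 1 "real L"] vtrunc_bounds(2)[of "real L"] by simp
      then have 3: "cmod (complex_of_real (?g (vtrunc (real L))) - complex_of_real (exp (- (t\<^sup>2 * \<kappa> / 2)))) \<le> t\<^sup>2 * \<kappa> / 2 * (1 - vtrunc (real L))"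
        unfolding of_real_diff[symmetric] norm_of_real by simp
      have tri: "cmod (a - e) \<le> x1 + (x2 + (x3 + x4))" if "cmod (a - b) \<le> x1" "cmod (b - c) = x2" "cmod (c - d) \<le> x3" "cmod (d - e) \<le> x4"
        for a b c d e :: complex and x1 x2 x3 x4
      proof -
        have "a - e = (a - b) + ((b - c) + ((c - d) + (d - e)))" by simp
        also have "cmod \<dots> \<le> x1 + (x2 + (x3 + x4))"
          using that by (intro norm_triangle_le add_mono) (auto intro!: norm_triangle_le add_mono)
        finally show ?thesis .
      qed
      from tri[OF 1 \<delta>1_def[THEN fun_cong, symmetric] 2 3]
      show "cmod (?\<Phi> n - complex_of_real (exp (- (t\<^sup>2 * \<kappa> / 2)))) < \<eta>0"
        using rL elim(3) unfolding r_def by linarith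
    qed
  qed
qed

end

subsection \<open>Estimation of the shape function\<close>

text \<open>The bounded first derivative gives a global Lipschitz constant. As \<open>m\<close> may
  be unbounded, this is its growth control: it makes \<open>m (X i)\<close> square integrable and
  bounds the local bias.\<close>

lemma twice_diff_lipschitz:
  assumes "twice_diff_bounded_derivs g"
  shows "\<exists>D\<ge>0. \<forall>u v. \<bar>g u - g v\<bar> \<le> D * \<bar>u - v\<bar>"
proof -
  from assms obtain g' where g': "\<And>u. (g has_real_derivative g' u) (at u)" "bounded (range g')"
    unfolding twice_diff_bounded_derivs_def by blast
  from g'(2) obtain D where D: "0 < D" "\<And>u. \<bar>g' u\<bar> \<le> D" unfolding bounded_pos by auto
  have "\<bar>g u - g v\<bar> \<le> D * \<bar>u - v\<bar>" for u v
    using field_differentiable_bound[of UNIV g g' D u v] g'(1) D by simp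
  then show ?thesis using D(1) by (intro exI[of _ D]) auto
qed

lemma twice_diff_measurable:
  assumes "twice_diff_bounded_derivs g"
  shows "g \<in> borel_measurable borel"
proof -
  from assms obtain g' where g': "\<And>u. (g has_real_derivative g' u) (at u)"
    unfolding twice_diff_bounded_derivs_def by blast
  have "continuous_on UNIV g"
    using g' by (intro continuous_at_imp_continuous_on) (auto intro: DERIV_isCont)
  then show ?thesis by (rule borel_measurable_continuous_onI)
qed

section \<open>Consistency of the density estimate and the negligible terms\<close>

locale shape_estimation = shape_regression M \<zeta> \<sigma> a \<alpha> A X K x \<eta> G h
  for M :: "'a measure" and \<zeta> \<sigma> a \<alpha> A X K x \<eta> G h +
  fixes m :: "real \<Rightarrow> real"
  assumes m_smooth: "twice_diff_bounded_derivs m"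
begin

lemma m_measurable[measurable]: "m \<in> borel_measurable borel"
  by (rule twice_diff_measurable[OF m_smooth])

definition fhat :: "nat \<Rightarrow> 'a \<Rightarrow> real" where
  "fhat n \<omega> = density_est K (h n) n (\<lambda>i. X i \<omega>) x"

lemma fhat_eq: "fhat n \<omega> = 1 / (real n * h n) * (\<Sum>i=1..n. kern (h n) (X i \<omega>))"
  by (simp add: fhat_def density_est_def kern_def)

lemma fhat_measurable[measurable]: "fhat n \<in> borel_measurable M"
  unfolding fhat_eq[abs_def]
  by (intro borel_measurable_times borel_measurable_const borel_measurable_sum measurable_compose[OF X_measurable kern_measurable]) simp

text \<open>The stochastic part is \<open>W\<close> with unit weights divided by the root of n h, of
  second moment at most C / (n h); the deterministic part converges by
  \<open>EK_limit\<close>.\<close>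

lemma fhat_consistent: "little_o_P_one M (\<lambda>n \<omega>. fhat n \<omega> - std_normal_density x)"
proof -
  obtain C where C: "eventually (\<lambda>n. \<forall>U. (\<forall>i. U i \<in> borel_measurable (Pi\<^sub>M UNIV (\<lambda>_. borel))) \<longrightarrow>
    (\<forall>i. integrable M (\<lambda>\<omega>. (U i (\<lambda>j. \<eta> j \<omega>))\<^sup>2)) \<longrightarrow>
    integrable M (\<lambda>\<omega>. (W (\<lambda>i \<omega>. U i (\<lambda>j. \<eta> j \<omega>)) n \<omega>)\<^sup>2) \<and>
    expectation (\<lambda>\<omega>. (W (\<lambda>i \<omega>. U i (\<lambda>j. \<eta> j \<omega>)) n \<omega>)\<^sup>2) \<le> C * ((\<Sum>i=1..n. expectation (\<lambda>\<omega>. (U i (\<lambda>j. \<eta> j \<omega>))\<^sup>2)) / real n)) sequentially"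
    using W_square by blast
  let ?B = "\<lambda>n. EK (h n) / h n - std_normal_density x"
  let ?b = "\<lambda>n. 2 * (C / (real n * h n)) + 2 * (?B n)\<^sup>2"
  have "?b \<longlonglongrightarrow> 2 * 0 + 2 * (std_normal_density x - std_normal_density x)\<^sup>2"
    by (intro tendsto_intros EK_limit h_pos h_lim real_tendsto_divide_at_top[OF tendsto_const nh_lim])
  then have b0: "?b \<longlonglongrightarrow> 0" by simp
  show ?thesis
  proof (rule little_o_P_of_square[OF _ _ b0])
    show "(\<lambda>\<omega>. fhat n \<omega> - std_normal_density x) \<in> borel_measurable M" for n by measurable
    show "eventually (\<lambda>n. integrable M (\<lambda>\<omega>. (fhat n \<omega> - std_normal_density x)\<^sup>2) \<and>
      expectation (\<lambda>\<omega>. (fhat n \<omega> - std_normal_density x)\<^sup>2) \<le> ?b n) sequentially"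
      using C eventually_ge_at_top[of 1]
    proof eventually_elim
      case (elim n)
      have hp: "0 < h n" using h_pos elim by simp
      have nh: "0 < real n * h n" using hp elim by simp
      let ?W = "W (\<lambda>_ _. 1) n"
      have Wm: "?W \<in> borel_measurable M" by (rule W_measurable) simp
      have W2: "integrable M (\<lambda>\<omega>. (?W \<omega>)\<^sup>2)" "expectation (\<lambda>\<omega>. (?W \<omega>)\<^sup>2) \<le> C"
        using elim(1)[rule_format, of "\<lambda>_ _. 1"] elim(2) prob_space by simp_all
      have eq: "fhat n \<omega> - std_normal_density x = ?W \<omega> / sqrt (real n * h n) + ?B n" for \<omega>
      proof -
        have "?W \<omega> / sqrt (real n * h n) = (\<Sum>i=1..n. kern (h n) (X i \<omega>) - EK (h n)) / (real n * h n)"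
          using nh by (simp add: W_def)
        also have "\<dots> = fhat n \<omega> - EK (h n) / h n"
          using nh elim(2) by (simp add: fhat_eq sum_subtractf diff_divide_distrib)
        finally show ?thesis by simp
      qed
      have i: "integrable M (\<lambda>\<omega>. (?W \<omega> / sqrt (real n * h n))\<^sup>2)" using W2(1) by (simp add: power_divide)
      have "integrable M (\<lambda>\<omega>. (?W \<omega> / sqrt (real n * h n) + ?B n)\<^sup>2)"
        by (rule integrable_add_square[OF _ _ i]) (use Wm in auto)
      moreover have "expectation (\<lambda>\<omega>. (?W \<omega> / sqrt (real n * h n) + ?B n)\<^sup>2) \<le> 2 * expectation (\<lambda>\<omega>. (?W \<omega> / sqrt (real n * h n))\<^sup>2) + 2 * expectation (\<lambda>_. (?B n)\<^sup>2)"
        by (rule integral_add_square_le[OF _ _ i]) (use Wm in auto)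
      moreover have "expectation (\<lambda>\<omega>. (?W \<omega> / sqrt (real n * h n))\<^sup>2) \<le> C / (real n * h n)"
        using W2(2) nh by (simp add: power_divide divide_right_mono)
      moreover have "expectation (\<lambda>_. (?B n)\<^sup>2) = (?B n)\<^sup>2" using prob_space by simp
      ultimately show ?case unfolding eq by linarith
    qed
  qed
qed

lemma m_X_square_integrable: assumes i: "1 \<le> i" shows "integrable M (\<lambda>\<omega>. (m (X i \<omega>) - c)\<^sup>2)"
proof -
  have [measurable]: "X i \<in> borel_measurable M" by (rule X_measurable[OF i])
  obtain D where D: "0 \<le> D" "\<And>u v. \<bar>m u - m v\<bar> \<le> D * \<bar>u - v\<bar>"
    using twice_diff_lipschitz[OF m_smooth] by auto
  have "integrable lborel (\<lambda>u. u\<^sup>2 * std_normal_density u)"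
    using integrable_std_normal_moment[of 2] by (simp add: mult.commute)
  then have X2: "integrable M (\<lambda>\<omega>. (X i \<omega>)\<^sup>2)" using expectation_X(2)[OF i, of "\<lambda>u. u\<^sup>2"] by simp
  have i0: "integrable M (\<lambda>\<omega>. (m (X i \<omega>) - m 0)\<^sup>2)"
  proof (rule Bochner_Integration.integrable_bound[OF integrable_mult_right[OF X2, of "D\<^sup>2"]])
    show "AE \<omega> in M. norm ((m (X i \<omega>) - m 0)\<^sup>2) \<le> norm (D\<^sup>2 * (X i \<omega>)\<^sup>2)"
    proof (rule AE_I2)
      fix \<omega>
      have "\<bar>m (X i \<omega>) - m 0\<bar> \<le> \<bar>D * X i \<omega>\<bar>" using D(2)[of "X i \<omega>" 0] D(1) by (simp add: abs_mult)
      then show "norm ((m (X i \<omega>) - m 0)\<^sup>2) \<le> norm (D\<^sup>2 * (X i \<omega>)\<^sup>2)"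
        by (simp add: abs_le_square_iff power_mult_distrib)
    qed
  qed measurable
  have "integrable M (\<lambda>\<omega>. ((m (X i \<omega>) - m 0) - (c - m 0))\<^sup>2)"
    by (rule integrable_diff_square[OF _ _ i0]) auto
  then show ?thesis by simp
qed

lemma X_sum_square:
  "\<exists>C\<ge>0. \<forall>n\<ge>1. \<forall>g. g \<in> borel_measurable borel \<longrightarrow> integrable M (\<lambda>\<omega>. (g (X 1 \<omega>))\<^sup>2) \<longrightarrow> expectation (\<lambda>\<omega>. g (X 1 \<omega>)) = 0 \<longrightarrow>
    integrable M (\<lambda>\<omega>. (\<Sum>i=1..n. g (X i \<omega>))\<^sup>2) \<and>
    expectation (\<lambda>\<omega>. (\<Sum>i=1..n. g (X i \<omega>))\<^sup>2) \<le> C * real n powr (1 - \<alpha>) * real n * expectation (\<lambda>\<omega>. (g (X 1 \<omega>))\<^sup>2 :: real)"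
proof -
  obtain C where C0: "0 \<le> C" and C: "\<forall>n\<ge>1. \<forall>e g. g \<in> borel_measurable borel \<longrightarrow> integrable M (\<lambda>\<omega>. (g (X 1 \<omega>))\<^sup>2) \<longrightarrow>
      expectation (\<lambda>\<omega>. g (X 1 \<omega>)) = 0 \<longrightarrow>
      expectation (\<lambda>\<omega>. (\<Sum>i=1..n. e i * g (X i \<omega>))\<^sup>2)
        \<le> C * real n powr (1 - \<alpha>) * (\<Sum>i=1..n. (e i)\<^sup>2) * expectation (\<lambda>\<omega>. (g (X 1 \<omega>))\<^sup>2 :: real)"
    using X_weighted_sum by blast
  show ?thesis
  proof (intro exI[of _ C] conjI C0 allI impI)
    fix n :: nat and g :: "real \<Rightarrow> real"
    assume n: "1 \<le> n" and g: "g \<in> borel_measurable borel" and g2: "integrable M (\<lambda>\<omega>. (g (X 1 \<omega>))\<^sup>2)"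
      and g0: "expectation (\<lambda>\<omega>. g (X 1 \<omega>)) = 0"
    have gm: "(\<lambda>u. (g u)\<^sup>2) \<in> borel_measurable borel" using g by measurable
    show "integrable M (\<lambda>\<omega>. (\<Sum>i=1..n. g (X i \<omega>))\<^sup>2)"
    proof (rule integrable_sum_square)
      fix i assume i: "i \<in> {1..n}"
      then show "(\<lambda>\<omega>. g (X i \<omega>)) \<in> borel_measurable M" by (intro measurable_compose[OF X_measurable g]) simp
      show "integrable M (\<lambda>\<omega>. (g (X i \<omega>))\<^sup>2)"
        using g2 expectation_X(2)[OF _ gm, of i] expectation_X(2)[OF _ gm, of 1] i by simp
    qed
    show "expectation (\<lambda>\<omega>. (\<Sum>i=1..n. g (X i \<omega>))\<^sup>2) \<le> C * real n powr (1 - \<alpha>) * real n * expectation (\<lambda>\<omega>. (g (X 1 \<omega>))\<^sup>2)"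
      using C[rule_format, OF n g g2 g0, of "\<lambda>_. 1"] by simp
  qed
qed

definition m_mean :: real where "m_mean = (\<integral>u. m u * std_normal_density u \<partial>lborel)"

definition err_mean :: "nat \<Rightarrow> 'a \<Rightarrow> real" where
  "err_mean n \<omega> = sqrt (real n * h n) / real n * (\<Sum>i=1..n. m (X i \<omega>) - m_mean)"

lemma err_mean_measurable: "err_mean n \<in> borel_measurable M"
  unfolding err_mean_def[abs_def]
  by (intro borel_measurable_times borel_measurable_const borel_measurable_sum borel_measurable_diff measurable_compose[OF X_measurable m_measurable]) simp

text \<open>The sum of \<open>n\<close> centred values has second moment of order n^(2-\<alpha>),
  and the squared normalisation is h / n; the product is of order h n^(1-\<alpha>).\<close>

lemma err_mean_square:
  "\<exists>b. b \<longlonglongrightarrow> 0 \<and> eventually (\<lambda>n. integrable M (\<lambda>\<omega>. (err_mean n \<omega>)\<^sup>2) \<and> expectation (\<lambda>\<omega>. (err_mean n \<omega>)\<^sup>2) \<le> b n) sequentially"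
proof -
  obtain C where C0: "0 \<le> C" and C: "\<forall>n\<ge>1. \<forall>g. g \<in> borel_measurable borel \<longrightarrow> integrable M (\<lambda>\<omega>. (g (X 1 \<omega>))\<^sup>2) \<longrightarrow> expectation (\<lambda>\<omega>. g (X 1 \<omega>)) = 0 \<longrightarrow>
    integrable M (\<lambda>\<omega>. (\<Sum>i=1..n. g (X i \<omega>))\<^sup>2) \<and>
    expectation (\<lambda>\<omega>. (\<Sum>i=1..n. g (X i \<omega>))\<^sup>2) \<le> C * real n powr (1 - \<alpha>) * real n * expectation (\<lambda>\<omega>. (g (X 1 \<omega>))\<^sup>2 :: real)"
    using X_sum_square by blast
  let ?v = "expectation (\<lambda>\<omega>. (m (X 1 \<omega>) - m_mean)\<^sup>2)"
  let ?b = "\<lambda>n. C * ?v * (h n * real n powr (1 - \<alpha>))"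
  have "?b \<longlonglongrightarrow> 0" by (rule tendsto_mult_right_zero[OF h_memory])
  moreover have "eventually (\<lambda>n. integrable M (\<lambda>\<omega>. (err_mean n \<omega>)\<^sup>2) \<and> expectation (\<lambda>\<omega>. (err_mean n \<omega>)\<^sup>2) \<le> ?b n) sequentially"
    using eventually_ge_at_top[of 1]
  proof eventually_elim
    case (elim n)
    have hp: "0 < h n" using h_pos elim by simp
    have X1: "X 1 \<in> borel_measurable M" by (rule X_measurable) simp
    have mi: "integrable M (\<lambda>\<omega>. m (X 1 \<omega>))"
      using expectation_abs_le_sqrt(1)[of "\<lambda>\<omega>. m (X 1 \<omega>)"] m_X_square_integrable[of 1 0] measurable_compose[OF X1 m_measurable] by simp
    have "expectation (\<lambda>\<omega>. m (X 1 \<omega>) - m_mean) = 0"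
      using mi prob_space expectation_X(1)[of 1 m] by (simp add: m_mean_def)
    with C[rule_format, OF elim, of "\<lambda>u. m u - m_mean"] m_X_square_integrable[of 1 m_mean]
    have S: "integrable M (\<lambda>\<omega>. (\<Sum>i=1..n. m (X i \<omega>) - m_mean)\<^sup>2)"
      "expectation (\<lambda>\<omega>. (\<Sum>i=1..n. m (X i \<omega>) - m_mean)\<^sup>2) \<le> C * real n powr (1 - \<alpha>) * real n * ?v" by auto
    have eq: "(err_mean n \<omega>)\<^sup>2 = h n / real n * (\<Sum>i=1..n. m (X i \<omega>) - m_mean)\<^sup>2" for \<omega>
      using hp elim by (simp add: err_mean_def power_mult_distrib power_divide power2_eq_square[of "real n"])
    have "expectation (\<lambda>\<omega>. (err_mean n \<omega>)\<^sup>2) = h n / real n * expectation (\<lambda>\<omega>. (\<Sum>i=1..n. m (X i \<omega>) - m_mean)\<^sup>2)"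
      unfolding eq by (rule integral_mult_right_zero)
    also have "\<dots> \<le> h n / real n * (C * real n powr (1 - \<alpha>) * real n * ?v)"
      using S(2) hp by (intro mult_left_mono) auto
    also have "\<dots> = ?b n" using elim by (simp add: mult_ac)
    finally show ?case unfolding eq using S(1) by (auto intro!: integrable_mult_right)
  qed
  ultimately show ?thesis by blast
qed

definition mn :: "nat \<Rightarrow> real" where "mn n = regression_centering M K (h n) m (X 1) x"

lemma mn_eq: "mn n = expectation (\<lambda>\<omega>. kern (h n) (X 1 \<omega>) * m (X 1 \<omega>)) / EK (h n)"
  by (simp add: mn_def regression_centering_def kern_def EK_def)

definition err_bias :: "nat \<Rightarrow> 'a \<Rightarrow> real" where
  "err_bias n \<omega> = (\<Sum>i=1..n. kern (h n) (X i \<omega>) * (m (X i \<omega>) - mn n)) / sqrt (real n * h n)"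

lemma err_bias_measurable: "err_bias n \<in> borel_measurable M"
  unfolding err_bias_def[abs_def]
  by (intro borel_measurable_divide borel_measurable_times borel_measurable_const borel_measurable_sum borel_measurable_diff
      measurable_compose[OF X_measurable m_measurable] measurable_compose[OF X_measurable kern_measurable]) simp_all

text \<open>Of the three powers of \<open>b\<close>, two come from writing the squared distance in
  units of the bandwidth and one from the width of the kernel.\<close>

lemma kernel_second_moment:
  assumes hp: "0 < b"
  shows "integrable M (\<lambda>\<omega>. kern b (X 1 \<omega>) * (X 1 \<omega> - x)\<^sup>2)"
    and "expectation (\<lambda>\<omega>. kern b (X 1 \<omega>) * (X 1 \<omega> - x)\<^sup>2) \<le> 1 / sqrt (2 * pi) * (\<integral>s. s\<^sup>2 * K s \<partial>lborel) * b ^ 3"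
proof -
  have K2: "integrable lborel (\<lambda>s. s\<^sup>2 * K s)" using kernel by (simp add: smoothing_kernel_def)
  note k = integral_kernel_density_le[OF K2 _ borel_measurable_normal_density _ _ hp, of 0 1 "1 / sqrt (2 * pi)" x]
  have eq: "(kern b u * (u - x)\<^sup>2) * std_normal_density u = b\<^sup>2 * ((((x - u) / b)\<^sup>2 * K ((x - u) / b)) * std_normal_density u)" for u
    using hp by (simp add: kern_def power_divide power2_commute)
  have bd: "std_normal_density u \<le> 1 / sqrt (2 * pi)" for u using std_normal_density_bounded[of u] by linarith
  have m: "(\<lambda>u. kern b u * (u - x)\<^sup>2) \<in> borel_measurable borel" by measurable
  show "integrable M (\<lambda>\<omega>. kern b (X 1 \<omega>) * (X 1 \<omega> - x)\<^sup>2)"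
    unfolding expectation_X(2)[OF order_refl m] eq by (intro integrable_mult_right k(1) bd) (auto simp: K_nonneg)
  have "expectation (\<lambda>\<omega>. kern b (X 1 \<omega>) * (X 1 \<omega> - x)\<^sup>2) = b\<^sup>2 * (\<integral>u. (((x - u) / b)\<^sup>2 * K ((x - u) / b)) * std_normal_density u \<partial>lborel)"
    unfolding expectation_X(1)[OF order_refl m] eq by (rule integral_mult_right_zero)
  also have "\<dots> \<le> b\<^sup>2 * (1 / sqrt (2 * pi) * (\<integral>s. s\<^sup>2 * K s \<partial>lborel) * b)"
    by (intro mult_left_mono k(2) bd) (auto simp: K_nonneg)
  also have "\<dots> = 1 / sqrt (2 * pi) * (\<integral>s. s\<^sup>2 * K s \<partial>lborel) * b ^ 3"
    by (simp add: power2_eq_square power3_eq_cube)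
  finally show "expectation (\<lambda>\<omega>. kern b (X 1 \<omega>) * (X 1 \<omega> - x)\<^sup>2) \<le> 1 / sqrt (2 * pi) * (\<integral>s. s\<^sup>2 * K s \<partial>lborel) * b ^ 3" .
qed

text \<open>As the ratio of the two expectations, \<open>mn\<close> makes the summand exactly
  centred. The second moment is of order h^3 because \<open>m\<close> is Lipschitz and the kernel
  concentrates at distance h. In the constant the factor 4 collects two equal contributions, one
  from \<open>m (X 1 \<omega>) - m x\<close> and one from \<open>mn n - m x\<close>.\<close>

lemma local_bias:
  "\<exists>B\<ge>0. \<forall>n\<ge>1. integrable M (\<lambda>\<omega>. (kern (h n) (X 1 \<omega>) * (m (X 1 \<omega>) - mn n))\<^sup>2) \<and>
    expectation (\<lambda>\<omega>. kern (h n) (X 1 \<omega>) * (m (X 1 \<omega>) - mn n)) = 0 \<and>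
    expectation (\<lambda>\<omega>. (kern (h n) (X 1 \<omega>) * (m (X 1 \<omega>) - mn n))\<^sup>2) \<le> B * h n ^ 3"
proof -
  obtain D where D: "0 \<le> D" "\<And>u v. \<bar>m u - m v\<bar> \<le> D * \<bar>u - v\<bar>"
    using twice_diff_lipschitz[OF m_smooth] by auto
  have X1[measurable]: "X 1 \<in> borel_measurable M" by (rule X_measurable) simp
  define c2 where "c2 = 1 / sqrt (2 * pi) * (\<integral>s. s\<^sup>2 * K s \<partial>lborel)"
  have c20: "0 \<le> c2" unfolding c2_def by (intro mult_nonneg_nonneg integral_nonneg_AE AE_I2) (auto simp: K_nonneg)
  show ?thesis
  proof (intro exI[of _ "4 * K_sup * D\<^sup>2 * c2"] conjI allI impI)
    show "0 \<le> 4 * K_sup * D\<^sup>2 * c2" using K_sup_nonneg c20 by simp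
    fix n :: nat assume n: "1 \<le> n"
    note hp = h_pos[OF n]
    let ?k = "\<lambda>\<omega>. kern (h n) (X 1 \<omega>)"
    have km: "?k \<in> borel_measurable M" by measurable
    have ki: "integrable M ?k" by (rule kern_X_integrable) simp
    have bounded_mult: "integrable M (\<lambda>\<omega>. ?k \<omega> * f \<omega>)" if f: "integrable M f" for f
    proof (rule Bochner_Integration.integrable_bound[OF integrable_mult_right[OF f, of K_sup]])
      show "AE \<omega> in M. norm (?k \<omega> * f \<omega>) \<le> norm (K_sup * f \<omega>)"
        using kern_nonneg kern_le K_sup_nonneg by (intro AE_I2) (simp add: abs_mult mult_right_mono)
    qed (use f km in measurable)
    have msq: "integrable M (\<lambda>\<omega>. (m (X 1 \<omega>) - c)\<^sup>2)" for c by (rule m_X_square_integrable) simp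
    have mi: "integrable M (\<lambda>\<omega>. m (X 1 \<omega>) - c)" for c
      by (rule expectation_abs_le_sqrt(1)[OF _ msq]) measurable
    have kmi: "integrable M (\<lambda>\<omega>. ?k \<omega> * (m (X 1 \<omega>) - c))" for c by (rule bounded_mult[OF mi])
    have km0: "integrable M (\<lambda>\<omega>. ?k \<omega> * m (X 1 \<omega>))" using kmi[of 0] by simp
    have Ekm: "expectation (\<lambda>\<omega>. ?k \<omega> * (m (X 1 \<omega>) - c)) = (mn n - c) * EK (h n)" for c
    proof -
      have "expectation (\<lambda>\<omega>. ?k \<omega> * (m (X 1 \<omega>) - c)) = expectation (\<lambda>\<omega>. ?k \<omega> * m (X 1 \<omega>)) - c * EK (h n)"
        using km0 ki by (simp add: right_diff_distrib EK_def mult.commute[of _ c])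
      also have "expectation (\<lambda>\<omega>. ?k \<omega> * m (X 1 \<omega>)) = mn n * EK (h n)"
        using EK_pos[OF hp] by (simp add: mn_eq)
      finally show ?thesis by (simp add: left_diff_distrib)
    qed
    show "expectation (\<lambda>\<omega>. ?k \<omega> * (m (X 1 \<omega>) - mn n)) = 0" by (simp only: Ekm) simp
    let ?q = "expectation (\<lambda>\<omega>. ?k \<omega> * (X 1 \<omega> - x)\<^sup>2)"
    note q = kernel_second_moment[OF hp]
    have kms: "integrable M (\<lambda>\<omega>. ?k \<omega> * (m (X 1 \<omega>) - c)\<^sup>2)" for c by (rule bounded_mult[OF msq])
    have Eq: "expectation (\<lambda>\<omega>. ?k \<omega> * (m (X 1 \<omega>) - m x)\<^sup>2) \<le> D\<^sup>2 * ?q"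
    proof -
      have "expectation (\<lambda>\<omega>. ?k \<omega> * (m (X 1 \<omega>) - m x)\<^sup>2) \<le> expectation (\<lambda>\<omega>. D\<^sup>2 * (?k \<omega> * (X 1 \<omega> - x)\<^sup>2))"
      proof (rule integral_mono[OF kms integrable_mult_right[OF q(1)]])
        fix \<omega>
        have "\<bar>m (X 1 \<omega>) - m x\<bar> \<le> \<bar>D * (X 1 \<omega> - x)\<bar>" using D(2)[of "X 1 \<omega>" x] D(1) by (simp add: abs_mult)
        then have "(m (X 1 \<omega>) - m x)\<^sup>2 \<le> D\<^sup>2 * (X 1 \<omega> - x)\<^sup>2" by (simp add: abs_le_square_iff power_mult_distrib)
        then have "?k \<omega> * (m (X 1 \<omega>) - m x)\<^sup>2 \<le> ?k \<omega> * (D\<^sup>2 * (X 1 \<omega> - x)\<^sup>2)" by (intro mult_left_mono kern_nonneg)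
        then show "?k \<omega> * (m (X 1 \<omega>) - m x)\<^sup>2 \<le> D\<^sup>2 * (?k \<omega> * (X 1 \<omega> - x)\<^sup>2)" by (simp only: mult.left_commute)
      qed
      then show ?thesis by simp
    qed
    \<comment> \<open>\<open>mn n\<close> is the mean of \<open>m\<close> under the kernel-weighted
      law, so its squared distance from \<open>m x\<close> is at most the mean of the squared
      distance: Cauchy-Schwarz with the weight split into two square roots.\<close>
    have shift: "(mn n - m x)\<^sup>2 * EK (h n) \<le> D\<^sup>2 * ?q"
    proof -
      let ?r = "\<lambda>\<omega>. sqrt (?k \<omega>)"
      have rr: "?r \<omega> * ?r \<omega> = ?k \<omega>" "(?r \<omega>)\<^sup>2 = ?k \<omega>" for \<omega> using kern_nonneg by simp_all
      have rm: "?r \<in> borel_measurable M" using km by measurable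
      have "(expectation (\<lambda>\<omega>. ?r \<omega> * (?r \<omega> * (m (X 1 \<omega>) - m x))))\<^sup>2
        \<le> expectation (\<lambda>\<omega>. (?r \<omega>)\<^sup>2) * expectation (\<lambda>\<omega>. (?r \<omega> * (m (X 1 \<omega>) - m x))\<^sup>2)"
      proof (rule Cauchy_Schwarz_integral)
        show "(\<lambda>\<omega>. ?r \<omega> * (m (X 1 \<omega>) - m x)) \<in> borel_measurable M" using rm by measurable
        show "integrable M (\<lambda>\<omega>. (?r \<omega>)\<^sup>2)" unfolding rr by (rule ki)
        show "integrable M (\<lambda>\<omega>. (?r \<omega> * (m (X 1 \<omega>) - m x))\<^sup>2)" unfolding power_mult_distrib rr by (rule kms)
      qed (rule rm)
      then have "((mn n - m x) * EK (h n))\<^sup>2 \<le> EK (h n) * expectation (\<lambda>\<omega>. ?k \<omega> * (m (X 1 \<omega>) - m x)\<^sup>2)"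
        unfolding mult.assoc[symmetric] rr power_mult_distrib[of "sqrt _"] Ekm EK_def[symmetric] .
      also have "\<dots> \<le> EK (h n) * (D\<^sup>2 * ?q)" using EK_pos[OF hp] by (intro mult_left_mono Eq) simp
      finally have "EK (h n) * ((mn n - m x)\<^sup>2 * EK (h n)) \<le> EK (h n) * (D\<^sup>2 * ?q)"
        by (simp only: power_mult_distrib power2_eq_square[of "EK _"] mult_ac)
      then show ?thesis using EK_pos[OF hp] by (simp only: mult_le_cancel_left_pos)
    qed
    have pw: "(?k \<omega> * (m (X 1 \<omega>) - mn n))\<^sup>2 \<le> 2 * K_sup * (?k \<omega> * (m (X 1 \<omega>) - m x)\<^sup>2) + 2 * K_sup * (mn n - m x)\<^sup>2 * ?k \<omega>" for \<omega>
    proof -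
      let ?u = "m (X 1 \<omega>) - m x" and ?v = "mn n - m x"
      have "0 \<le> (?u + ?v)\<^sup>2" by simp
      then have "(m (X 1 \<omega>) - mn n)\<^sup>2 \<le> 2 * ?u\<^sup>2 + 2 * ?v\<^sup>2" by (simp add: power2_eq_square algebra_simps)
      then have *: "?k \<omega> * (m (X 1 \<omega>) - mn n)\<^sup>2 \<le> ?k \<omega> * (2 * ?u\<^sup>2 + 2 * ?v\<^sup>2)" by (intro mult_left_mono kern_nonneg)
      have "?k \<omega> * (?k \<omega> * (m (X 1 \<omega>) - mn n)\<^sup>2) \<le> K_sup * (?k \<omega> * (2 * ?u\<^sup>2 + 2 * ?v\<^sup>2))"
        by (rule mult_mono[OF kern_le * K_sup_nonneg]) (intro mult_nonneg_nonneg kern_nonneg zero_le_power2)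
      moreover have "(k * u)\<^sup>2 = k * (k * u\<^sup>2)" for k u :: real
        by (simp only: power_mult_distrib power2_eq_square mult_ac)
      moreover have "c * (k * (2 * u + 2 * w)) = 2 * c * (k * u) + 2 * c * w * k" for c k u w :: real
        by (simp only: distrib_left mult_ac)
      ultimately show ?thesis by (simp only:)
    qed
    have int_rhs: "integrable M (\<lambda>\<omega>. 2 * K_sup * (?k \<omega> * (m (X 1 \<omega>) - m x)\<^sup>2) + 2 * K_sup * (mn n - m x)\<^sup>2 * ?k \<omega>)"
      by (intro Bochner_Integration.integrable_add integrable_mult_right kms ki)
    show int: "integrable M (\<lambda>\<omega>. (?k \<omega> * (m (X 1 \<omega>) - mn n))\<^sup>2)"
    proof (rule Bochner_Integration.integrable_bound[OF int_rhs])
      show "AE \<omega> in M. norm ((?k \<omega> * (m (X 1 \<omega>) - mn n))\<^sup>2) \<le> norm (2 * K_sup * (?k \<omega> * (m (X 1 \<omega>) - m x)\<^sup>2) + 2 * K_sup * (mn n - m x)\<^sup>2 * ?k \<omega>)"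
      proof (rule AE_I2)
        fix \<omega> show "norm ((?k \<omega> * (m (X 1 \<omega>) - mn n))\<^sup>2) \<le> norm (2 * K_sup * (?k \<omega> * (m (X 1 \<omega>) - m x)\<^sup>2) + 2 * K_sup * (mn n - m x)\<^sup>2 * ?k \<omega>)"
          unfolding real_norm_def abs_power2[of "?k \<omega> * (m (X 1 \<omega>) - mn n)"] by (rule order_trans[OF pw abs_ge_self])
      qed
    qed measurable
    have "expectation (\<lambda>\<omega>. (?k \<omega> * (m (X 1 \<omega>) - mn n))\<^sup>2) \<le> expectation (\<lambda>\<omega>. 2 * K_sup * (?k \<omega> * (m (X 1 \<omega>) - m x)\<^sup>2) + 2 * K_sup * (mn n - m x)\<^sup>2 * ?k \<omega>)"
      by (rule integral_mono[OF int int_rhs pw])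
    also have "\<dots> = 2 * K_sup * expectation (\<lambda>\<omega>. ?k \<omega> * (m (X 1 \<omega>) - m x)\<^sup>2) + 2 * K_sup * (mn n - m x)\<^sup>2 * EK (h n)"
      unfolding EK_def by (subst Bochner_Integration.integral_add[OF integrable_mult_right[OF kms] integrable_mult_right[OF ki]]) (simp only: integral_mult_right_zero)
    also have "\<dots> \<le> 2 * K_sup * (D\<^sup>2 * ?q) + 2 * K_sup * (D\<^sup>2 * ?q)"
      unfolding mult.assoc using Eq shift K_sup_nonneg by (intro add_mono mult_left_mono) auto
    also have "\<dots> = 4 * K_sup * D\<^sup>2 * ?q" by simp
    also have "\<dots> \<le> 4 * K_sup * D\<^sup>2 * (c2 * h n ^ 3)"
      using q(2) K_sup_nonneg unfolding c2_def by (intro mult_left_mono) auto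
    finally show "expectation (\<lambda>\<omega>. (?k \<omega> * (m (X 1 \<omega>) - mn n))\<^sup>2) \<le> 4 * K_sup * D\<^sup>2 * c2 * h n ^ 3"
      by (simp only: mult.assoc)
  qed
qed

text \<open>The sum has second moment of order n^(2-\<alpha>) h^3; division by n h leaves h times h
  n^(1-\<alpha>).\<close>

lemma err_bias_square:
  "\<exists>b. b \<longlonglongrightarrow> 0 \<and> eventually (\<lambda>n. integrable M (\<lambda>\<omega>. (err_bias n \<omega>)\<^sup>2) \<and> expectation (\<lambda>\<omega>. (err_bias n \<omega>)\<^sup>2) \<le> b n) sequentially"
proof -
  obtain C where C0: "0 \<le> C" and C: "\<forall>n\<ge>1. \<forall>g. g \<in> borel_measurable borel \<longrightarrow> integrable M (\<lambda>\<omega>. (g (X 1 \<omega>))\<^sup>2) \<longrightarrow> expectation (\<lambda>\<omega>. g (X 1 \<omega>)) = 0 \<longrightarrow>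
    integrable M (\<lambda>\<omega>. (\<Sum>i=1..n. g (X i \<omega>))\<^sup>2) \<and>
    expectation (\<lambda>\<omega>. (\<Sum>i=1..n. g (X i \<omega>))\<^sup>2) \<le> C * real n powr (1 - \<alpha>) * real n * expectation (\<lambda>\<omega>. (g (X 1 \<omega>))\<^sup>2 :: real)"
    using X_sum_square by blast
  obtain B where B0: "0 \<le> B" and B: "\<forall>n\<ge>1. integrable M (\<lambda>\<omega>. (kern (h n) (X 1 \<omega>) * (m (X 1 \<omega>) - mn n))\<^sup>2) \<and>
    expectation (\<lambda>\<omega>. kern (h n) (X 1 \<omega>) * (m (X 1 \<omega>) - mn n)) = 0 \<and>
    expectation (\<lambda>\<omega>. (kern (h n) (X 1 \<omega>) * (m (X 1 \<omega>) - mn n))\<^sup>2) \<le> B * h n ^ 3"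
    using local_bias by blast
  let ?b = "\<lambda>n. C * B * h n * (h n * real n powr (1 - \<alpha>))"
  have "?b \<longlonglongrightarrow> C * B * 0 * 0" by (intro tendsto_intros h_lim h_memory)
  then have "?b \<longlonglongrightarrow> 0" by simp
  moreover have "eventually (\<lambda>n. integrable M (\<lambda>\<omega>. (err_bias n \<omega>)\<^sup>2) \<and> expectation (\<lambda>\<omega>. (err_bias n \<omega>)\<^sup>2) \<le> ?b n) sequentially"
    using eventually_ge_at_top[of 1]
  proof eventually_elim
    case (elim n)
    have hp: "0 < h n" using h_pos elim by simp
    have nh: "0 < real n * h n" using hp elim by simp
    let ?S = "\<lambda>\<omega>. \<Sum>i=1..n. kern (h n) (X i \<omega>) * (m (X i \<omega>) - mn n)"
    have gm: "(\<lambda>u. kern (h n) u * (m u - mn n)) \<in> borel_measurable borel" by measurable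
    from C[rule_format, OF elim gm] B[rule_format, OF elim]
    have S: "integrable M (\<lambda>\<omega>. (?S \<omega>)\<^sup>2)"
      "expectation (\<lambda>\<omega>. (?S \<omega>)\<^sup>2) \<le> C * real n powr (1 - \<alpha>) * real n * expectation (\<lambda>\<omega>. (kern (h n) (X 1 \<omega>) * (m (X 1 \<omega>) - mn n))\<^sup>2)"
      by auto
    have eq: "(err_bias n \<omega>)\<^sup>2 = 1 / (real n * h n) * (?S \<omega>)\<^sup>2" for \<omega>
      using nh by (simp add: err_bias_def power_divide)
    have "expectation (\<lambda>\<omega>. (err_bias n \<omega>)\<^sup>2) = 1 / (real n * h n) * expectation (\<lambda>\<omega>. (?S \<omega>)\<^sup>2)"
      unfolding eq by (rule integral_mult_right_zero)
    also have "\<dots> \<le> 1 / (real n * h n) * (C * real n powr (1 - \<alpha>) * real n * (B * h n ^ 3))"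
    proof (rule mult_left_mono[OF order_trans[OF S(2)]])
      show "C * real n powr (1 - \<alpha>) * real n * expectation (\<lambda>\<omega>. (kern (h n) (X 1 \<omega>) * (m (X 1 \<omega>) - mn n))\<^sup>2) \<le> C * real n powr (1 - \<alpha>) * real n * (B * h n ^ 3)"
        using B[rule_format, OF elim] C0 by (intro mult_left_mono) auto
    qed (use nh in simp)
    also have "\<dots> = ?b n" using hp elim by (simp add: power3_eq_cube)
    finally show ?case unfolding eq using S(1) by (auto intro!: integrable_mult_right)
  qed
  ultimately show ?thesis by blast
qed

end

section \<open>The limit of the studentised statistic\<close>

context shape_estimation
begin

definition Q1 :: "nat \<Rightarrow> 'a \<Rightarrow> real" where "Q1 n \<omega> = 1 / sqrt (kappa1 K * fhat n \<omega>)"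

definition Q2 :: "nat \<Rightarrow> 'a \<Rightarrow> real" where "Q2 n \<omega> = sqrt (fhat n \<omega> / kappa1 K)"

definition W_avg :: "nat \<Rightarrow> 'a \<Rightarrow> real" where
  "W_avg n \<omega> = W (\<lambda>_ \<omega>. (\<Sum>j=1..n. eps j \<omega>) / real n) n \<omega>"

text \<open>The right-hand side of \<open>studentized_identity\<close> with
  \<open>c = EK (h n)\<close>. The first term carries the limit, the other three vanish in
  probability.\<close>

definition S :: "nat \<Rightarrow> 'a \<Rightarrow> real" where
  "S n \<omega> = Q1 n \<omega> * W eps n \<omega> + - (Q1 n \<omega> * W_avg n \<omega>) + Q1 n \<omega> * err_bias n \<omega> + - (Q2 n \<omega> * err_mean n \<omega>)"

lemma kappa1_pos: "0 < kappa1 K"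
  using kernel by (auto simp: kappa1_def smoothing_kernel_def order_less_le)

lemma kappa_density_pos: "0 < kappa1 K * std_normal_density x"
  by (intro mult_pos_pos kappa1_pos normal_density_pos) simp

lemma Q_measurable[measurable]: "Q1 n \<in> borel_measurable M" "Q2 n \<in> borel_measurable M"
  unfolding Q1_def[abs_def] Q2_def[abs_def] by measurable

lemma W_avg_measurable[measurable]: "W_avg n \<in> borel_measurable M"
  unfolding W_avg_def[abs_def] by (rule W_measurable) measurable

lemma W_eps_measurable[measurable]: "W eps n \<in> borel_measurable M"
  by (rule W_measurable) measurable

lemmas [measurable] = err_mean_measurable err_bias_measurable

lemma S_measurable[measurable]: "S n \<in> borel_measurable M"
  unfolding S_def[abs_def] by measurable

lemma S_eq:
  assumes Y: "\<And>i. 1 \<le> i \<Longrightarrow> Y i = m (X i \<omega>) + eps i \<omega>"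
  shows "sqrt (real n * h n / kappa1 K) * sqrt (density_est K (h n) n (\<lambda>i. X i \<omega>) x) *
      (shape_est K (h n) n (\<lambda>i. X i \<omega>) Y x - shape_centering M K (h n) m std_normal_density (X 1) x) = S n \<omega>"
proof (cases "n = 0")
  case True
  \<comment> \<open>With no observations the factor \<open>sqrt (real n * h n / kappa1 K)\<close> is
    0, and all sums on the right are empty.\<close>
  then show ?thesis by (simp add: S_def W_def W_avg_def err_bias_def err_mean_def)
next
  case False
  then have n: "1 \<le> n" by simp
  have Ysum: "(\<Sum>i=1..n. Y i) = (\<Sum>i=1..n. m (X i \<omega>) + eps i \<omega>)"
    "(\<Sum>i=1..n. Y i * kern (h n) (X i \<omega>)) = (\<Sum>i=1..n. (m (X i \<omega>) + eps i \<omega>) * kern (h n) (X i \<omega>))"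
    using Y by (auto intro!: sum.cong)
  have shape: "shape_est K (h n) n (\<lambda>i. X i \<omega>) Y x
    = 1 / (real n * h n * fhat n \<omega>) * (\<Sum>i=1..n. (m (X i \<omega>) + eps i \<omega>) * kern (h n) (X i \<omega>)) - 1 / real n * (\<Sum>i=1..n. m (X i \<omega>) + eps i \<omega>)"
    unfolding shape_est_def nadaraya_watson_def fhat_def[symmetric] kern_def[symmetric] Ysum ..
  have centering: "shape_centering M K (h n) m std_normal_density (X 1) x = mn n - m_mean"
    by (simp add: shape_centering_def mn_def m_mean_def)
  show ?thesis
    unfolding shape centering fhat_def[symmetric] S_def Q1_def Q2_def W_def W_avg_def err_bias_def err_mean_def
    by (rule studentized_identity[OF n h_pos[OF n] kappa1_pos kern_nonneg fhat_eq])
qed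

lemma Q_consistent:
  "little_o_P_one M (\<lambda>n \<omega>. Q1 n \<omega> - 1 / sqrt (kappa1 K * std_normal_density x))"
  "little_o_P_one M (\<lambda>n \<omega>. Q2 n \<omega> - sqrt (std_normal_density x / kappa1 K))"
proof -
  have "isCont (\<lambda>f. 1 / sqrt (kappa1 K * f)) (std_normal_density x)"
    using kappa_density_pos by (intro continuous_intros) auto
  from little_o_P_continuous[OF fhat_measurable fhat_consistent this]
  show "little_o_P_one M (\<lambda>n \<omega>. Q1 n \<omega> - 1 / sqrt (kappa1 K * std_normal_density x))"
    by (simp add: Q1_def)
  have "isCont (\<lambda>f. sqrt (f / kappa1 K)) (std_normal_density x)"
    using kappa1_pos by (intro continuous_intros) auto
  from little_o_P_continuous[OF fhat_measurable fhat_consistent this]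
  show "little_o_P_one M (\<lambda>n \<omega>. Q2 n \<omega> - sqrt (std_normal_density x / kappa1 K))"
    by (simp add: Q2_def)
qed

text \<open>Replacing \<open>Q1\<close> by its limit in front of \<open>W eps\<close> uses only that
  \<open>W eps\<close> is bounded in mean square; the remaining terms pair a convergent factor with
  one that tends to zero in mean square.\<close>

lemma S_approx:
  "little_o_P_one M (\<lambda>n \<omega>. S n \<omega> - 1 / sqrt (kappa1 K * std_normal_density x) * W eps n \<omega>)"
proof -
  let ?q = "1 / sqrt (kappa1 K * std_normal_density x)"
  have Qm: "Q1 n \<in> borel_measurable M" "Q2 n \<in> borel_measurable M" for n by (rule Q_measurable)+
  have Wm: "W eps n \<in> borel_measurable M" and Am: "W_avg n \<in> borel_measurable M" for n
    by (rule W_eps_measurable W_avg_measurable)+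
  obtain C where C: "eventually (\<lambda>n. integrable M (\<lambda>\<omega>. (W eps n \<omega>)\<^sup>2) \<and> expectation (\<lambda>\<omega>. (W eps n \<omega>)\<^sup>2) \<le> C) sequentially"
    using W_eps_bounded by blast
  have Qd: "(\<lambda>\<omega>. Q1 n \<omega> - ?q) \<in> borel_measurable M" for n by measurable
  have 1: "little_o_P_one M (\<lambda>n \<omega>. (Q1 n \<omega> - ?q) * W eps n \<omega>)"
    by (rule little_o_P_mult_square_bounded[OF Qd Wm Q_consistent(1) C])
  obtain b where b: "b \<longlonglongrightarrow> 0" "eventually (\<lambda>n. integrable M (\<lambda>\<omega>. (W_avg n \<omega>)\<^sup>2) \<and> expectation (\<lambda>\<omega>. (W_avg n \<omega>)\<^sup>2) \<le> b n) sequentially"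
    using W_average unfolding W_avg_def[symmetric] by blast
  have 2: "little_o_P_one M (\<lambda>n \<omega>. Q1 n \<omega> * W_avg n \<omega>)"
    by (rule little_o_P_mult_convergent[OF Qm(1) Am Q_consistent(1) b(2,1)])
  obtain b where b: "b \<longlonglongrightarrow> 0" "eventually (\<lambda>n. integrable M (\<lambda>\<omega>. (err_bias n \<omega>)\<^sup>2) \<and> expectation (\<lambda>\<omega>. (err_bias n \<omega>)\<^sup>2) \<le> b n) sequentially"
    using err_bias_square by blast
  have 3: "little_o_P_one M (\<lambda>n \<omega>. Q1 n \<omega> * err_bias n \<omega>)"
    by (rule little_o_P_mult_convergent[OF Qm(1) err_bias_measurable Q_consistent(1) b(2,1)])
  obtain b where b: "b \<longlonglongrightarrow> 0" "eventually (\<lambda>n. integrable M (\<lambda>\<omega>. (err_mean n \<omega>)\<^sup>2) \<and> expectation (\<lambda>\<omega>. (err_mean n \<omega>)\<^sup>2) \<le> b n) sequentially"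
    using err_mean_square by blast
  have 4: "little_o_P_one M (\<lambda>n \<omega>. Q2 n \<omega> * err_mean n \<omega>)"
    by (rule little_o_P_mult_convergent[OF Qm(2) err_mean_measurable Q_consistent(2) b(2,1)])
  have neg: "little_o_P_one M (\<lambda>n \<omega>. - Z n \<omega>)" if "little_o_P_one M Z" for Z
    using that by (simp add: little_o_P_one_def)
  have "little_o_P_one M (\<lambda>n \<omega>. (Q1 n \<omega> - ?q) * W eps n \<omega> + - (Q1 n \<omega> * W_avg n \<omega>) + Q1 n \<omega> * err_bias n \<omega> + - (Q2 n \<omega> * err_mean n \<omega>))"
    by (rule little_o_P_add[OF _ _ little_o_P_add[OF _ _ little_o_P_add[OF _ _ 1 neg[OF 2]] 3] neg[OF 4]]) measurable
  then show ?thesis by (simp add: S_def algebra_simps)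
qed

lemma S_weak_limit: "conv_in_distr M S std_normal_distribution"
  unfolding conv_in_distr_def
proof (rule levy_continuity)
  show "real_distribution (distr M borel (S n))" for n by (rule real_distribution_distr) measurable
  show "real_distribution std_normal_distribution" by (rule real_dist_normal_dist)
  fix t
  let ?\<kappa> = "kappa1 K * std_normal_density x"
  let ?A = "\<lambda>n \<omega>. 1 / sqrt ?\<kappa> * W eps n \<omega>"
  have A: "?A n \<in> borel_measurable M" for n by measurable
  show "(\<lambda>n. char (distr M borel (S n)) t) \<longlonglongrightarrow> char std_normal_distribution t"
  proof (rule char_tendsto_little_o_P[OF S_measurable A S_approx])
    have "char (distr M borel (?A n)) t = expectation (\<lambda>\<omega>. iexp ((t / sqrt ?\<kappa>) * W eps n \<omega>))" for n
      unfolding char_def by (subst integral_distr) (simp_all add: A)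
    \<comment> \<open>Studentisation: evaluating the limit of \<open>char_W_eps\<close> at the
      rescaled argument cancels the variance \<open>?\<kappa>\<close>.\<close>
    moreover have "(t / sqrt ?\<kappa>)\<^sup>2 * ?\<kappa> = t\<^sup>2"
      using kappa_density_pos by (auto simp: power_divide)
    then have "complex_of_real (exp (- ((t / sqrt ?\<kappa>)\<^sup>2 * ?\<kappa> / 2))) = char std_normal_distribution t"
      by (simp only: char_std_normal_distribution minus_divide_left)
    ultimately show "(\<lambda>n. char (distr M borel (?A n)) t) \<longlonglongrightarrow> char std_normal_distribution t"
      using char_W_eps[of "t / sqrt ?\<kappa>"] by (simp only:)
  qed
qed

end

theorem proposition2p3:
  fixes M :: "'a measure"
    and X \<epsilon> Y :: "nat \<Rightarrow> 'a \<Rightarrow> real"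
    and \<zeta> \<eta> :: "int \<Rightarrow> 'a \<Rightarrow> real"
    and a h :: "nat \<Rightarrow> real"
    and G :: "(nat \<Rightarrow> real) \<Rightarrow> real"
    and K m :: "real \<Rightarrow> real"
    and A\<^sub>0 \<alpha>\<^sub>X \<sigma> x :: real
  assumes M: "prob_space M"
    and kernel: "smoothing_kernel K"
    and bandwidth: "bandwidth h"
    and m: "twice_diff_bounded_derivs m"
    and model: "\<And>i \<omega>. 1 \<le> i \<Longrightarrow> \<omega> \<in> space M \<Longrightarrow> Y i \<omega> = m (X i \<omega>) + \<epsilon> i \<omega>"
    and indep_X_eps: "indep_sequences M X {1..} \<epsilon> {1..}"
    and alpha: "0 < \<alpha>\<^sub>X" "\<alpha>\<^sub>X < 1"
    and a_0: "a 0 = 1"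
    and a_k: "\<And>k. 1 \<le> k \<Longrightarrow> a k = A\<^sub>0 * real k powr (- (\<alpha>\<^sub>X + 1) / 2)"
    and zeta_iid: "iid M \<zeta>"
    and zeta_gaussian: "0 < \<sigma>" "\<And>i. distributed M lborel (\<zeta> i) (normal_density 0 \<sigma>)"
    and X_measurable: "\<And>i. 1 \<le> i \<Longrightarrow> X i \<in> borel_measurable M"
    and X_linear: "\<And>i. 1 \<le> i \<Longrightarrow> AE \<omega> in M. (\<lambda>k. a k * \<zeta> (int i - int k) \<omega>) sums X i \<omega>"
    and X_variance: "prob_space.variance M (X 1) = 1"
    and eta_iid: "iid M \<eta>"
    and indep_X_eta: "indep_sequences M X {1..} \<eta> UNIV"
    and G: "G \<in> borel_measurable (\<Pi>\<^sub>M k\<in>(UNIV :: nat set). borel)"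
    and eps: "\<And>i \<omega>. 1 \<le> i \<Longrightarrow> \<omega> \<in> space M \<Longrightarrow> \<epsilon> i \<omega> = G (\<lambda>k. \<eta> (int i - int k) \<omega>)"
    and eps_mean: "(LINT \<omega>|M. \<epsilon> 1 \<omega>) = 0"
    and eps_second_moment: "(LINT \<omega>|M. (\<epsilon> 1 \<omega>)\<^sup>2) = 1"
    and martingale_part: "little_o_P_one M (\<lambda>n \<omega>. sqrt (real n * h n) / real n *
          (\<Sum>i=1..n. (real_cond_exp M (past_sigma M \<eta> (int i - 1)) (\<epsilon> i) \<omega> - \<epsilon> i \<omega>)))"
    and predictable_part: "little_o_P_one M (\<lambda>n \<omega>. sqrt (real n * h n) * (h n)\<^sup>2 / real n *
          (\<Sum>i=1..n. real_cond_exp M (past_sigma M \<eta> (int i - 1)) (\<epsilon> i) \<omega>))"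
    and bandwidth_memory: "(\<lambda>n. h n * real n powr (1 - \<alpha>\<^sub>X)) \<longlonglongrightarrow> 0"
  shows "conv_in_distr M
      (\<lambda>n \<omega>. sqrt (real n * h n / kappa1 K) *
         sqrt (density_est K (h n) n (\<lambda>i. X i \<omega>) x) *
         (shape_est K (h n) n (\<lambda>i. X i \<omega>) (\<lambda>i. Y i \<omega>) x
            - shape_centering M K (h n) m std_normal_density (X 1) x))
      std_normal_distribution"
proof -
  interpret P: prob_space M by (rule M)
  have \<zeta>: "P.indep_vars (\<lambda>_. borel) \<zeta> UNIV" using zeta_iid by (simp add: iid_def)
  have \<eta>: "P.indep_vars (\<lambda>_. borel) \<eta> UNIV" "\<And>i j. distr M borel (\<eta> i) = distr M borel (\<eta> j)"
    using eta_iid unfolding iid_def by blast+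
  have \<eta>_meas: "\<eta> j \<in> borel_measurable M" for j using \<eta>(1) by (auto simp: P.indep_vars_def)
  \<comment> \<open>The constant \<open>A\<^sub>0\<close> may be negative, so the decay bound is
    instantiated with its absolute value.\<close>
  have a_le: "\<bar>a k\<bar> \<le> \<bar>A\<^sub>0\<bar> * real k powr (- (\<alpha>\<^sub>X + 1) / 2)" if "1 \<le> k" for k
    unfolding a_k[OF that] by (simp add: abs_mult)
  have G_eps: "G (\<lambda>k. \<eta> (1 - int k) \<omega>) = \<epsilon> 1 \<omega>" if "\<omega> \<in> space M" for \<omega>
    using eps[OF order_refl that] by simp
  have G_mean: "(\<integral>\<omega>. G (\<lambda>k. \<eta> (1 - int k) \<omega>) \<partial>M) = 0"
    using eps_mean G_eps by (simp cong: Bochner_Integration.integral_cong)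
  have G_square: "(\<integral>\<omega>. (G (\<lambda>k. \<eta> (1 - int k) \<omega>))\<^sup>2 \<partial>M) = 1"
    using eps_second_moment G_eps by (simp cong: Bochner_Integration.integral_cong)
  interpret shape_estimation M \<zeta> \<sigma> a \<alpha>\<^sub>X "\<bar>A\<^sub>0\<bar>" X K x \<eta> G h m
    by unfold_locales
      (use \<zeta> zeta_gaussian alpha a_0 a_le X_measurable X_linear X_variance kernel \<eta>_meas indep_X_eta \<eta> G G_mean G_square
        bandwidth bandwidth_memory m in \<open>auto simp: bandwidth_def\<close>)
  have "distr M borel (\<lambda>\<omega>. sqrt (real n * h n / kappa1 K) *
         sqrt (density_est K (h n) n (\<lambda>i. X i \<omega>) x) *
         (shape_est K (h n) n (\<lambda>i. X i \<omega>) (\<lambda>i. Y i \<omega>) x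
            - shape_centering M K (h n) m std_normal_density (X 1) x)) = distr M borel (S n)" for n
  \<comment> \<open>The given errors agree with those built from \<open>G\<close> only on the space
    of \<open>M\<close> and from index 1 on, which is enough for equality of the laws.\<close>
  proof (intro distr_cong refl S_eq)
    fix \<omega> i assume "\<omega> \<in> space M" "1 \<le> (i::nat)"
    then show "Y i \<omega> = m (X i \<omega>) + eps i \<omega>"
      using model[of i \<omega>] local.eps[of i \<omega>] by (simp add: eps_def lagged_def[abs_def])
  qed
  with S_weak_limit show ?thesis unfolding conv_in_distr_def by (simp only:)
qed

end
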